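(* Let $T>0$, $\frac13\le\alpha<1$, $\frac1\alpha<p\le\infty$, and $0<q\le\infty$ if $\alpha>\frac13$, while $0<q\le3$ if $\alpha=\frac13$. Let $\mathbf X=(\delta X,\mathbb X)$ be a level-$2$ Besov rough path, $\mathbf X\in\mathbf B^\alpha_{pq}([0,T];\mathbb R^n)$, and let $f:\mathbb R^m\to\mathbb R^m\otimes\mathbb R^n$ satisfy: if $\alpha>\frac13$, $f\in C^{2,\delta}$ for some $\delta\in(0,1]$ with $(2+\delta)\alpha>1$ and $\delta\alpha>\frac1p$; if $\alpha=\frac13$, $f\in C^3$. Then for every $y\in\mathbb R^m$ there exists a unique solution $(Y,Y')\in\mathscr B^\alpha_{pq,\mathbf X}([0,T];\mathbb R^m)$ of $$dY_t=f(Y_t)\cdot d\mathbf X_t\ \text{ in }[0,T],\qquad Y_0=y .$$ Moreover, there exists a constant $M$ depending only on $\alpha$, $p$, $q$, $T$, $\|f\|_{C^2}$ and $|||\mathbf X|||_{\mathbf B^\alpha_{pq}}$ such that $[(Y,Y')]_{\mathscr B^\alpha_{pq,\mathbf X}}\le M$.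
   Context: Notation: $\Delta_2(0,T)=\{(s,t)\in[0,T]^2:s\le t\}$, $\delta f_{st}=f_t-f_s$. Exponents $\infty$ are read as suprema. Besov spaces: $[f]_{B^\alpha_{pq}([0,T])}=\big[\int_0^T(\tau^{-\alpha}\sup_{0\le h\le\tau}\|f_{\cdot+h}-f_\cdot\|_{L^p([0,T-h])})^q\frac{d\tau}\tau\big]^{1/q}$; $f\in B^\alpha_{pq}$ iff $f\in L^p$ and this is finite. For measurable $A$ on $\Delta_2(0,T)$, $\|A\|_{\mathbb B^\alpha_{pq}([0,T])}=\big[\int_0^T(\tau^{-\alpha}\sup_{0\le h\le\tau}\|A_{\cdot,\cdot+h}\|_{L^p([0,T-h])})^q\frac{d\tau}\tau\big]^{1/q}$. Rough paths: $\mathbf X=(\mathbf X^{(1)},\mathbf X^{(2)})=(\delta X,\mathbb X):\Delta_2(0,T)\to\mathbb R^n\oplus(\mathbb R^n)^{\otimes2}$ ($X:[0,T]\to\mathbb R^n$, $X_0=0$) is in $\mathbf B^\alpha_{pq}([0,T];\mathbb R^n)$ if Chen's relation $\mathbb X_{su}=\mathbb X_{st}+\mathbb X_{tu}+\delta X_{st}\otimes\delta X_{tu}$ holds for all $s\le t\le u$ and $|||\mathbf X|||_{\mathbf B^\alpha_{pq}}=\|\delta X\|_{\mathbb B^\alpha_{p,q}}+\|\mathbb X\|^{1/2}_{\mathbb B^{2\alpha}_{p/2,q/2}}<\infty$. Continuous versions are used throughout. Controlled paths: $(Y,Y')\in\mathscr B^\alpha_{pq,\mathbf X}([0,T];V)$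 ($V$ finite dimensional) if $Y\in B^\alpha_{pq}([0,T];V)$, $Y'\in B^\alpha_{pq}([0,T];\mathcal L(\mathbb R^n;V))$ and $R^Y:=\delta Y-Y'\delta X\in\mathbb B^{2\alpha}_{p/2,q/2}$, where $(Y'\delta X)_{st}=Y'_s(X_t-X_s)$; $[(Y,Y')]_{\mathscr B^\alpha_{pq,\mathbf X}}=[Y']_{B^\alpha_{pq}}+\|R^Y\|_{\mathbb B^{2\alpha}_{p/2,q/2}}$. Rough integral: if $(W,W')\in\mathscr B^\alpha_{pq,\mathbf X}([0,T];\mathbb R^m\otimes\mathbb R^n)$, then $\int_0^\cdot W\cdot d\mathbf X$ is the unique continuous path $Z$, $Z_0=0$, such that $\delta Z$ is the limit in $\mathbb B^{3\alpha}_{p/3,\infty}$, as the mesh of partitions $\{0=\tau_0<\dots<\tau_N=1\}$ of $[0,1]$ tends to $0$, of $\sum_i\big(W_{u_{i-1}}\delta X_{u_{i-1}u_i}+W'_{u_{i-1}}\mathbb X_{u_{i-1}u_i}\big)$ with $u_i=s+\tau_i(t-s)$; it is regarded as the controlled path $(Z,Z')$ with $Z'=W$. Composition: for $(Y,Y')$ controlled, $f(Y)$ is the controlled path $(f(Y),Df(Y)Y')$. Solution: $(Y,Y')\in\mathscr B^\alpha_{pq,\mathbf X}([0,T];\mathbb R^m)$ solves the equation if $Y_t=y+\int_0^tf(Y_s)\cdot d\mathbf X_s$ for all $t$, as an identity of controlled paths (so $Y'=f(Y)$). $C^{k}$, $C^{k,\delta}$: bounded functions with bounded continuous derivatives up to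 order $k$ (and $\delta$-Hölder $k$-th derivative), with usual norms. *)

theory Defs
  imports "HOL-Analysis.Analysis"
begin

section \<open>Lebesgue and Besov (quasi-)norms\<close>

text \<open>The power \<open>x\<^sup>r\<close> on \<open>[0, \<infinity>]\<close>, used only for exponents \<open>r > 0\<close>.\<close>

definition epowr :: "ennreal \<Rightarrow> real \<Rightarrow> ennreal" where
  "epowr x r = (if x = \<infinity> then \<infinity> else ennreal (enn2real x powr r))"

text \<open>The exponent \<open>\<infinity>\<close> is read as a supremum. All paths and two-parameter functions
  below are required to be continuous, so this is also the essential supremum for the
  measures that occur. Exponents below \<open>1\<close> are allowed.\<close>

definition lp_norm :: "ennreal \<Rightarrow> 'a measure \<Rightarrow> ('a \<Rightarrow> ennreal) \<Rightarrow> ennreal" where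
  "lp_norm p M g =
     (if p = \<infinity> then (SUP x\<in>space M. g x)
      else epowr (\<integral>\<^sup>+x. epowr (g x) (enn2real p) \<partial>M) (1 / enn2real p))"

definition simplex2 :: "real \<Rightarrow> (real \<times> real) set" where
  "simplex2 T = {(s, t). 0 \<le> s \<and> s \<le> t \<and> t \<le> T}"

definition incr :: "(real \<Rightarrow> 'v::real_normed_vector) \<Rightarrow> real \<Rightarrow> real \<Rightarrow> 'v" where
  "incr f s t = f t - f s"

text \<open>The norm \<open>\<parallel>A\<parallel>\<close> of \<open>\<bbbB>\<^sup>\<alpha>\<^sub>p\<^sub>q([0,T])\<close>; the outer norm is taken with respect to
  the measure \<open>d\<tau>/\<tau>\<close> on \<open>(0,T]\<close>.\<close>

definition besov2_norm ::
  "real \<Rightarrow> ennreal \<Rightarrow> ennreal \<Rightarrow> real \<Rightarrow> (real \<Rightarrow> real \<Rightarrow> 'v::real_normed_vector) \<Rightarrow> ennreal" where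
  "besov2_norm \<alpha> p q T A =
     lp_norm q (density (restrict_space lborel {0<..T}) (\<lambda>\<tau>. ennreal (1 / \<tau>)))
       (\<lambda>\<tau>. ennreal (\<tau> powr (- \<alpha>)) *
          (SUP h\<in>{0..\<tau>}. lp_norm p (restrict_space lborel {0..T - h})
                            (\<lambda>s. ennreal (norm (A s (s + h))))))"

definition in_besov2 ::
  "real \<Rightarrow> ennreal \<Rightarrow> ennreal \<Rightarrow> real \<Rightarrow> (real \<Rightarrow> real \<Rightarrow> 'v::real_normed_vector) \<Rightarrow> bool" where
  "in_besov2 \<alpha> p q T A \<longleftrightarrow>
     (\<lambda>(s, t). A s t) \<in> borel_measurable (restrict_space borel (simplex2 T)) \<and>
     besov2_norm \<alpha> p q T A < \<infinity>"

definition besov_seminorm ::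
  "real \<Rightarrow> ennreal \<Rightarrow> ennreal \<Rightarrow> real \<Rightarrow> (real \<Rightarrow> 'v::real_normed_vector) \<Rightarrow> ennreal" where
  "besov_seminorm \<alpha> p q T f = besov2_norm \<alpha> p q T (incr f)"

definition in_besov ::
  "real \<Rightarrow> ennreal \<Rightarrow> ennreal \<Rightarrow> real \<Rightarrow> (real \<Rightarrow> 'v::real_normed_vector) \<Rightarrow> bool" where
  "in_besov \<alpha> p q T f \<longleftrightarrow>
     f \<in> borel_measurable (restrict_space lborel {0..T}) \<and>
     lp_norm p (restrict_space lborel {0..T}) (\<lambda>t. ennreal (norm (f t))) < \<infinity> \<and>
     besov_seminorm \<alpha> p q T f < \<infinity>"


section \<open>Besov rough paths\<close>

text \<open>Tensors in \<open>\<real>\<^sup>n \<otimes> \<real>\<^sup>n\<close> and \<open>\<real>\<^sup>m \<otimes> \<real>\<^sup>n\<close> are matrices; the first tensor factor is the row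
  index. Their norm is the Euclidean (Frobenius) norm.\<close>

definition tensor :: "real ^ 'm \<Rightarrow> real ^ 'n \<Rightarrow> real ^ 'n ^ 'm" where
  "tensor a b = (\<chi> i j. a $ i * b $ j)"

definition rough_norm ::
  "real \<Rightarrow> ennreal \<Rightarrow> ennreal \<Rightarrow> real \<Rightarrow>
   (real \<Rightarrow> real ^ 'n) \<Rightarrow> (real \<Rightarrow> real \<Rightarrow> real ^ 'n ^ 'n) \<Rightarrow> ennreal" where
  "rough_norm \<alpha> p q T X XX =
     besov2_norm \<alpha> p q T (incr X) + epowr (besov2_norm (2 * \<alpha>) (p / 2) (q / 2) T XX) (1 / 2)"

text \<open>The rough path is \<open>(\<delta>X, XX)\<close>. The continuity clauses here, in \<open>controlled\<close> and in
  \<open>has_rough_integral\<close> select the continuous versions. Functions are total, but only their values on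
  \<open>[0,T]\<close>, respectively on the simplex, matter.\<close>

definition rough_path ::
  "real \<Rightarrow> ennreal \<Rightarrow> ennreal \<Rightarrow> real \<Rightarrow>
   (real \<Rightarrow> real ^ 'n) \<Rightarrow> (real \<Rightarrow> real \<Rightarrow> real ^ 'n ^ 'n) \<Rightarrow> bool" where
  "rough_path \<alpha> p q T X XX \<longleftrightarrow>
     X 0 = 0 \<and>
     continuous_on {0..T} X \<and>
     continuous_on (simplex2 T) (\<lambda>(s, t). XX s t) \<and>
     (\<forall>s t u. 0 \<le> s \<and> s \<le> t \<and> t \<le> u \<and> u \<le> T \<longrightarrow>
        XX s u = XX s t + XX t u + tensor (incr X s t) (incr X t u)) \<and>
     rough_norm \<alpha> p q T X XX < \<infinity>"


section \<open>Controlled paths and the rough integral\<close>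

definition remainder ::
  "(real \<Rightarrow> real ^ 'n) \<Rightarrow> (real \<Rightarrow> 'v::euclidean_space) \<Rightarrow> (real \<Rightarrow> (real ^ 'n) \<Rightarrow>\<^sub>L 'v) \<Rightarrow>
   real \<Rightarrow> real \<Rightarrow> 'v" where
  "remainder X Y Y' s t = incr Y s t - blinfun_apply (Y' s) (incr X s t)"

definition controlled ::
  "real \<Rightarrow> ennreal \<Rightarrow> ennreal \<Rightarrow> real \<Rightarrow> (real \<Rightarrow> real ^ 'n) \<Rightarrow>
   (real \<Rightarrow> 'v::euclidean_space) \<Rightarrow> (real \<Rightarrow> (real ^ 'n) \<Rightarrow>\<^sub>L 'v) \<Rightarrow> bool" where
  "controlled \<alpha> p q T X Y Y' \<longleftrightarrow>
     continuous_on {0..T} Y \<and> continuous_on {0..T} Y' \<and>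
     in_besov \<alpha> p q T Y \<and> in_besov \<alpha> p q T Y' \<and>
     in_besov2 (2 * \<alpha>) (p / 2) (q / 2) T (remainder X Y Y')"

definition controlled_seminorm ::
  "real \<Rightarrow> ennreal \<Rightarrow> ennreal \<Rightarrow> real \<Rightarrow> (real \<Rightarrow> real ^ 'n) \<Rightarrow>
   (real \<Rightarrow> 'v::euclidean_space) \<Rightarrow> (real \<Rightarrow> (real ^ 'n) \<Rightarrow>\<^sub>L 'v) \<Rightarrow> ennreal" where
  "controlled_seminorm \<alpha> p q T X Y Y' =
     besov_seminorm \<alpha> p q T Y' + besov2_norm (2 * \<alpha>) (p / 2) (q / 2) T (remainder X Y Y')"

text \<open>The pairing of \<open>W' \<in> L(\<real>\<^sup>n; \<real>\<^sup>m \<otimes> \<real>\<^sup>n)\<close> with a 2-tensor \<open>B\<close>: the unique linear map in \<open>B\<close> with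
  \<open>contract W' (tensor a b) = W' a *v b\<close>. So the first index of the second level is fed to \<open>W'\<close>,
  consistently with \<open>XX s t = \<integral>\<^sub>s\<^sup>t \<delta>X\<^sub>s\<^sub>r \<otimes> dX\<^sub>r\<close> and Chen's relation.\<close>

definition contract ::
  "((real ^ 'n) \<Rightarrow>\<^sub>L (real ^ 'n ^ 'm)) \<Rightarrow> real ^ 'n ^ 'n \<Rightarrow> real ^ 'm" where
  "contract W' B = (\<Sum>i\<in>UNIV. blinfun_apply W' (axis i 1) *v (B $ i))"

lemma contract_tensor: "contract W' (tensor a b) = blinfun_apply W' a *v b"
proof -
  have a: "a = (\<Sum>i\<in>UNIV. (a $ i) *\<^sub>R axis i 1)"
    by (simp add: vec_eq_iff axis_def if_distrib cong: if_cong)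
  have t: "tensor a b $ i = a $ i *\<^sub>R b" for i
    by (simp add: tensor_def vec_eq_iff)
  have "blinfun_apply W' a = (\<Sum>i\<in>UNIV. (a $ i) *\<^sub>R blinfun_apply W' (axis i 1))"
    by (subst a) (simp add: blinfun.sum_right blinfun.scaleR_right)
  moreover have "(\<Sum>i\<in>S. (a $ i) *\<^sub>R blinfun_apply W' (axis i 1)) *v b
      = (\<Sum>i\<in>S. blinfun_apply W' (axis i 1) *v (a $ i *\<^sub>R b))" if "finite S" for S
    using that
    by (induction S rule: finite_induct)
       (simp_all add: matrix_vector_mult_add_rdistrib scaleR_matrix_vector_assoc
         matrix_vector_mult_scaleR)
  ultimately show ?thesis
    by (simp add: contract_def t)
qed

text \<open>Partitions \<open>0 = \<tau>\<^sub>0 < \<dots> < \<tau>\<^sub>N = 1\<close>; values of \<open>\<tau>\<close> beyond \<open>N\<close> are irrelevant.\<close>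

definition unit_partition :: "nat \<Rightarrow> (nat \<Rightarrow> real) \<Rightarrow> bool" where
  "unit_partition N \<tau> \<longleftrightarrow> \<tau> 0 = 0 \<and> \<tau> N = 1 \<and> (\<forall>i<N. \<tau> i < \<tau> (Suc i))"

definition mesh :: "nat \<Rightarrow> (nat \<Rightarrow> real) \<Rightarrow> real" where
  "mesh N \<tau> = Max ((\<lambda>i. \<tau> (Suc i) - \<tau> i) ` {..<N})"

definition rough_sum ::
  "(real \<Rightarrow> real ^ 'n) \<Rightarrow> (real \<Rightarrow> real \<Rightarrow> real ^ 'n ^ 'n) \<Rightarrow>
   (real \<Rightarrow> real ^ 'n ^ 'm) \<Rightarrow> (real \<Rightarrow> (real ^ 'n) \<Rightarrow>\<^sub>L (real ^ 'n ^ 'm)) \<Rightarrow>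
   nat \<Rightarrow> (nat \<Rightarrow> real) \<Rightarrow> real \<Rightarrow> real \<Rightarrow> real ^ 'm" where
  "rough_sum X XX W W' N \<tau> s t =
     (let u = (\<lambda>i. s + \<tau> i * (t - s)) in
        \<Sum>i<N. W (u i) *v incr X (u i) (u (Suc i)) + contract (W' (u i)) (XX (u i) (u (Suc i))))"

text \<open>\<open>Z\<close> is the rough integral of the controlled path \<open>(W, W')\<close>. A relation is used because \<open>Z\<close> is
  determined on \<open>[0,T]\<close> only.\<close>

definition has_rough_integral ::
  "real \<Rightarrow> ennreal \<Rightarrow> ennreal \<Rightarrow> real \<Rightarrow>
   (real \<Rightarrow> real ^ 'n) \<Rightarrow> (real \<Rightarrow> real \<Rightarrow> real ^ 'n ^ 'n) \<Rightarrow>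
   (real \<Rightarrow> real ^ 'n ^ 'm) \<Rightarrow> (real \<Rightarrow> (real ^ 'n) \<Rightarrow>\<^sub>L (real ^ 'n ^ 'm)) \<Rightarrow>
   (real \<Rightarrow> real ^ 'm) \<Rightarrow> bool" where
  "has_rough_integral \<alpha> p q T X XX W W' Z \<longleftrightarrow>
     controlled \<alpha> p q T X W W' \<and>
     continuous_on {0..T} Z \<and> Z 0 = 0 \<and>
     (\<forall>\<epsilon>>0. \<exists>\<eta>>0. \<forall>N \<tau>. unit_partition N \<tau> \<and> mesh N \<tau> < \<eta> \<longrightarrow>
        besov2_norm (3 * \<alpha>) (p / 3) \<infinity> T
          (\<lambda>s t. rough_sum X XX W W' N \<tau> s t - incr Z s t) < ennreal \<epsilon>)"


section \<open>Function spaces for the vector field\<close>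

text \<open>The derivative as an operator-valued map, so that it can be iterated. It is meaningful at points
  of differentiability.\<close>

definition fderiv ::
  "('a::euclidean_space \<Rightarrow> 'b::real_normed_vector) \<Rightarrow> 'a \<Rightarrow> 'a \<Rightarrow>\<^sub>L 'b" where
  "fderiv f x = Blinfun (frechet_derivative f (at x))"

definition Cb0 :: "('a::euclidean_space \<Rightarrow> 'b::real_normed_vector) \<Rightarrow> bool" where
  "Cb0 f \<longleftrightarrow> continuous_on UNIV f \<and> bounded (range f)"

definition Cb1 :: "('a::euclidean_space \<Rightarrow> 'b::real_normed_vector) \<Rightarrow> bool" where
  "Cb1 f \<longleftrightarrow> Cb0 f \<and> (\<forall>x. f differentiable (at x)) \<and> Cb0 (fderiv f)"

definition Cb2 :: "('a::euclidean_space \<Rightarrow> 'b::real_normed_vector) \<Rightarrow> bool" where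
  "Cb2 f \<longleftrightarrow> Cb0 f \<and> (\<forall>x. f differentiable (at x)) \<and> Cb1 (fderiv f)"

definition Cb3 :: "('a::euclidean_space \<Rightarrow> 'b::real_normed_vector) \<Rightarrow> bool" where
  "Cb3 f \<longleftrightarrow> Cb0 f \<and> (\<forall>x. f differentiable (at x)) \<and> Cb2 (fderiv f)"

definition Cb2_holder ::
  "real \<Rightarrow> ('a::euclidean_space \<Rightarrow> 'b::real_normed_vector) \<Rightarrow> bool" where
  "Cb2_holder \<delta> f \<longleftrightarrow> Cb2 f \<and>
     (\<exists>L. \<forall>x y. norm (fderiv (fderiv f) x - fderiv (fderiv f) y) \<le> L * norm (x - y) powr \<delta>)"

definition C2_norm :: "('a::euclidean_space \<Rightarrow> 'b::real_normed_vector) \<Rightarrow> real" where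
  "C2_norm f = (SUP x. norm (f x)) + (SUP x. norm (fderiv f x)) + (SUP x. norm (fderiv (fderiv f) x))"


section \<open>Rough differential equations\<close>

text \<open>The identification \<open>\<real>\<^sup>m \<otimes> \<real>\<^sup>n = L(\<real>\<^sup>n; \<real>\<^sup>m)\<close>.\<close>

lift_definition tensor_map :: "real ^ 'n ^ 'm \<Rightarrow> (real ^ 'n) \<Rightarrow>\<^sub>L (real ^ 'm)" is "(*v)"
  by (rule matrix_vector_mul_bounded_linear)

text \<open>\<open>(Y, Y')\<close> solves \<open>Y = y + \<integral> f(Y) \<cdot> dX\<close> as an identity of controlled paths: the integrand is
  \<open>(f(Y), Df(Y) Y')\<close>, and the integral has Gubinelli derivative \<open>f(Y)\<close>.\<close>

definition rde_solution ::
  "real \<Rightarrow> ennreal \<Rightarrow> ennreal \<Rightarrow> real \<Rightarrow>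
   (real \<Rightarrow> real ^ 'n) \<Rightarrow> (real \<Rightarrow> real \<Rightarrow> real ^ 'n ^ 'n) \<Rightarrow>
   (real ^ 'm \<Rightarrow> real ^ 'n ^ 'm) \<Rightarrow> real ^ 'm \<Rightarrow>
   (real \<Rightarrow> real ^ 'm) \<Rightarrow> (real \<Rightarrow> (real ^ 'n) \<Rightarrow>\<^sub>L (real ^ 'm)) \<Rightarrow> bool" where
  "rde_solution \<alpha> p q T X XX f y Y Y' \<longleftrightarrow>
     controlled \<alpha> p q T X Y Y' \<and>
     (\<exists>Z. has_rough_integral \<alpha> p q T X XX
            (\<lambda>t. f (Y t)) (\<lambda>t. fderiv f (Y t) o\<^sub>L Y' t) Z \<and>
          (\<forall>t\<in>{0..T}. Y t = y + Z t)) \<and>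
     (\<forall>t\<in>{0..T}. Y' t = tensor_map (f (Y t)))"

end

theory Submission
 imports Defs "HOL-Complex_Analysis.Great_Picard"
begin

text \<open>The argument is Davie's, on dyadic grids. Integrating the increments of the rough path over dyadic cells
 (a Garsia-Rodemich-Rumsey type chaining) turns the Besov norms into arrays \<open>U n i\<close> that bound the oscillation of the
 first level and the square root of the second level on the \<open>i\<close>-th cell of generation \<open>n\<close>, with
 \<open>l\<^sup>p\<close>-control over each generation; at \<open>\<alpha> = 1/3\<close> the assumption \<open>q \<le> 3\<close> still makes the cubes \<open>U n i ^ 3\<close>
 summable over the tree of all cells. Let \<open>W n i\<close> be the sum of these cubes below a cell. By Chen's relation the
 Davie remainder of the Euler schemes is dominated by \<open>W\<close>, so the schemes converge along a subsequence to a path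
 with the same bound. The \<open>l\<^bsup>p/3\<^esup>\<close>-control of \<open>W\<close> gives back all Besov norms and the convergence
 of the compensated Riemann sums. Conversely the remainder of any solution is dominated by such a tree sum, since its
 partition sums vanish in the limit; the difference of two remainders then satisfies a discrete Gronwall estimate
 with the summable weights \<open>U n i powr (2 + \<delta>)\<close>, which forces uniqueness.\<close>

section \<open>The vector field\<close>

text \<open>The rough path is controlled only in averages over a generation, and
  \<open>p / 3\<close> may be below 1, so neither a pointwise control function nor Minkowski's
  inequality is available. The tree sum takes over the first role because it is superadditive under
  bisection; Jensen's inequality or subadditivity of powers, according to the side of 1 on which the
  exponent lies, takes over the second. The condition \<alpha> > 1/p yields pointwise decay of the
  arrays at the rate \<open>2 powr (- (\<alpha> - 1 / p) * n)\<close>: it makes the multiplicative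
  errors of the bisection summable and supplies the surplus by which the remainders beat the Besov
  order in which they are tested. At \<alpha> = 1/3 the third-order defect has order exactly 1 and
  no power of the mesh is gained; convergence of the partition sums then rests on the vanishing tail
  of a convergent series. The constants of the existence part are fixed from the two norms before
  the rough path, the vector field and the initial value, which gives the dependence of
  \<open>M\<close>. The bound is proved for the constructed solution, and uniqueness makes that
  enough.\<close>

lemma norm_matrix_vector_mult_le:
 fixes M :: "real ^ 'n ^ 'm"
 shows "norm (M *v x) <= norm M * norm x"
proof -
 have "norm (M *v x) = L2_set (%i. norm ((M *v x) $ i)) UNIV"
  by (simp add: norm_vec_def)
 also have "\<dots> <= L2_set (%i. norm (M $ i) * norm x) UNIV"
  by (intro L2_set_mono) (auto simp: matrix_vector_mul_component Cauchy_Schwarz_ineq2)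
 also have "\<dots> = norm M * norm x"
  by (simp add: norm_vec_def L2_set_left_distrib)
 finally show ?thesis .
qed

text \<open>Each of the \<open>CARD('n)\<close> rows of \<open>B\<close> is bounded by
  \<open>norm B\<close>; this crude dimensional factor is the origin of the parameter
  \<open>d\<close> in the later constants.\<close>

lemma norm_contract_le:
 fixes W :: "(real ^ 'n) \<Rightarrow>\<^sub>L (real ^ 'n ^ 'm)"
 shows "norm (contract W B) <= CARD('n) * norm W * norm B"
proof -
 have "norm (contract W B) <= (\<Sum>i\<in>UNIV. norm (blinfun_apply W (axis i 1) *v (B $ i)))"
  unfolding contract_def by (rule norm_sum)
 also have "\<dots> <= (\<Sum>i\<in>(UNIV::'n set). norm W * norm B)"
 proof (rule sum_mono)
  fix i :: 'n
  have "norm (blinfun_apply W (axis i 1) *v (B $ i)) <= norm (blinfun_apply W (axis i 1)) * norm (B $ i)"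
   by (rule norm_matrix_vector_mult_le)
  also have "\<dots> <= norm W * norm B"
  proof (rule mult_mono)
   have "norm (blinfun_apply W (axis i 1)) <= norm W * norm (axis i (1::real))"
    by (rule norm_blinfun)
   then show "norm (blinfun_apply W (axis i 1)) <= norm W" by simp
  qed (auto simp: Finite_Cartesian_Product.norm_nth_le)
  finally show "norm (blinfun_apply W (axis i 1) *v (B $ i)) <= norm W * norm B" .
 qed
 also have "\<dots> = CARD('n) * norm W * norm B" by simp
 finally show ?thesis .
qed

lemma contract_diff_left: "contract (V - W) B = contract V B - contract W B"
 by (simp add: contract_def blinfun.diff_left matrix_vector_mult_diff_rdistrib sum_subtractf)

lemma contract_add_right: "contract W (B + B') = contract W B + contract W B'"
 by (simp add: contract_def matrix_vector_right_distrib sum.distrib)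

lemma norm_tensor_map_le: "norm (tensor_map M) <= norm M"
 by (rule norm_blinfun_bound) (auto simp: tensor_map.rep_eq norm_matrix_vector_mult_le)

lemma tensor_map_diff: "tensor_map (M - N) = tensor_map M - tensor_map N"
 by (rule blinfun_eqI) (simp add: tensor_map.rep_eq blinfun.diff_left matrix_vector_mult_diff_rdistrib)

section \<open>The Davie expansion and its defect under subdivision\<close>

text \<open>The Gubinelli derivative of \<open>f(Y)\<close> at a solution, where the derivative of
  \<open>Y\<close> is \<open>f(Y)\<close> itself.\<close>

definition step_op :: "(real ^ 'm => real ^ 'n ^ 'm) => real ^ 'm => (real ^ 'n) \<Rightarrow>\<^sub>L (real ^ 'n ^ 'm)" where
 "step_op f y = fderiv f y o\<^sub>L tensor_map (f y)"

text \<open>The local error of a second-order Euler step started at \<open>s\<close>. Its sums over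
  a partition are exactly the gap between compensated Riemann sums and increments
  (\<open>rough_sum_remainder\<close>), so existence and uniqueness both reduce to estimating
  it.\<close>

definition davie_remainder ::
 "(real ^ 'm => real ^ 'n ^ 'm) => (real => real ^ 'n) => (real => real => real ^ 'n ^ 'n) =>
  (real => real ^ 'm) => real => real => real ^ 'm" where
 "davie_remainder f X XX Y s t =
   Y t - Y s - f (Y s) *v (X t - X s) - contract (step_op f (Y s)) (XX s t)"

text \<open>The cross term of Chen's relation, contracted with \<open>step_op f (Y s)\<close>, is
  the linear part of \<open>f (Y u) - f (Y s)\<close>. What is left is a first-order remainder times
  an increment, and an increment times the second level: both are of third order.\<close>

lemma davie_remainder_defect:
 assumes "XX s t = XX s u + XX u t + tensor (X u - X s) (X t - X u)"
 shows "davie_remainder f X XX Y s t = davie_remainder f X XX Y s u + davie_remainder f X XX Y u t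
  + ((f (Y u) - f (Y s) - step_op f (Y s) (X u - X s)) *v (X t - X u)
    + contract (step_op f (Y u) - step_op f (Y s)) (XX u t))"
proof -
 have "f (Y s) *v (X t - X s) = f (Y s) *v (X u - X s) + f (Y s) *v (X t - X u)"
  by (simp flip: matrix_vector_right_distrib)
 then show ?thesis
  unfolding davie_remainder_def assms contract_add_right contract_tensor contract_diff_left
   matrix_vector_mult_diff_rdistrib
  by (simp add: algebra_simps)
qed

section \<open>Lipschitz and Taylor estimates for the vector field\<close>

lemma has_derivative_fderiv:
 assumes "f differentiable (at x)"
 shows "(f has_derivative blinfun_apply (fderiv f x)) (at x)"
proof -
 have "(f has_derivative frechet_derivative f (at x)) (at x)"
  using assms frechet_derivative_works by blast
 moreover from this have "blinfun_apply (fderiv f x) = frechet_derivative f (at x)"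
  unfolding fderiv_def by (intro bounded_linear_Blinfun_apply has_derivative_bounded_linear)
 ultimately show ?thesis by simp
qed

lemma norm_le_SUP:
 assumes "Cb0 f"
 shows "norm (f x) <= (SUP x. norm (f x))"
proof (rule cSUP_upper)
 show "bdd_above (range (%x. norm (f x)))"
  using assms unfolding Cb0_def bounded_iff bdd_above_def by auto
qed simp

lemma Cb2_has_derivative:
 assumes "Cb2 f"
 shows "(f has_derivative blinfun_apply (fderiv f x)) (at x)"
  "(fderiv f has_derivative blinfun_apply (fderiv (fderiv f) x)) (at x)"
 using assms unfolding Cb2_def Cb1_def by (auto intro: has_derivative_fderiv)

lemma Cb2_norm_le:
 assumes "Cb2 f"
 shows "norm (f x) <= C2_norm f" "norm (fderiv f x) <= C2_norm f"
  "norm (fderiv (fderiv f) x) <= C2_norm f" "0 <= C2_norm f"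
proof -
 have b: "Cb0 f" "Cb0 (fderiv f)" "Cb0 (fderiv (fderiv f))"
  using assms unfolding Cb2_def Cb1_def by auto
 note u = b[THEN norm_le_SUP, of x]
 have "0 <= (SUP x. norm (f x))" "0 <= (SUP x. norm (fderiv f x))" "0 <= (SUP x. norm (fderiv (fderiv f) x))"
  using u norm_ge_zero order_trans by blast+
 with u show "norm (f x) <= C2_norm f" "norm (fderiv f x) <= C2_norm f"
  "norm (fderiv (fderiv f) x) <= C2_norm f" "0 <= C2_norm f"
  unfolding C2_norm_def by linarith+
qed

lemma lipschitz_if_fderiv_bounded:
 fixes f :: "'a::euclidean_space => 'b::real_normed_vector"
 assumes "\<And>x. (f has_derivative blinfun_apply (f' x)) (at x)" "\<And>x. norm (f' x) <= c"
 shows "norm (f b - f a) <= c * norm (b - a)"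
proof (rule differentiable_bound[of UNIV f "%x. blinfun_apply (f' x)"])
 show "onorm (blinfun_apply (f' x)) <= c" for x
  using assms(2)[of x] by (simp add: norm_blinfun.rep_eq)
qed (use assms(1) in auto)

lemma Cb2_lipschitz:
 assumes "Cb2 f"
 shows "norm (f b - f a) <= C2_norm f * norm (b - a)"
  "norm (fderiv f b - fderiv f a) <= C2_norm f * norm (b - a)"
 using lipschitz_if_fderiv_bounded Cb2_has_derivative[OF assms] Cb2_norm_le[OF assms] by blast+

text \<open>Mean value inequality in one real parameter. The Taylor and four-point estimates below
  are all obtained by choosing a curve \<open>\<phi>\<close> whose end points differ by the quantity
  in question.\<close>

lemma segment_bound:
 fixes \<phi> :: "real => 'b::real_normed_vector"
 assumes "\<And>l. (\<phi> has_vector_derivative \<phi>' l) (at l)" "\<And>l. 0 <= l ==> l <= 1 ==> norm (\<phi>' l) <= B"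
 shows "norm (\<phi> 1 - \<phi> 0) <= B"
proof -
 have "norm (\<phi> 1 - \<phi> 0) <= B * norm (1 - 0 :: real)"
 proof (rule differentiable_bound[of "{0..1}" \<phi> "%l h. h *\<^sub>R \<phi>' l"])
  show "(\<phi> has_derivative (%h. h *\<^sub>R \<phi>' l)) (at l within {0..1})" for l
   using assms(1)[of l] unfolding has_vector_derivative_def by (rule has_derivative_at_withinI)
  show "onorm (%h::real. h *\<^sub>R \<phi>' l) <= B" if "l \<in> {0..1}" for l
   using assms(2)[of l] that by (intro onorm_bound) (auto intro: order_trans[OF norm_ge_zero] simp: mult.commute[of B] mult_left_mono)
 qed auto
 then show ?thesis by simp
qed

lemma has_vector_derivative_along:
 fixes f :: "'a::euclidean_space => 'b::real_normed_vector"
 assumes "\<And>x. (f has_derivative blinfun_apply (f' x)) (at x)"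
 shows "((%l. f (a + l *\<^sub>R h)) has_vector_derivative blinfun_apply (f' (a + l *\<^sub>R h)) h) (at l)"
proof -
 have "((%l. a + l *\<^sub>R h) has_vector_derivative h) (at l)"
  by (auto intro!: derivative_eq_intros)
 from vector_derivative_diff_chain_within[OF this has_derivative_at_withinI[OF assms]] show ?thesis
  by (simp add: o_def)
qed

definition taylor1 :: "('a::euclidean_space => 'b::real_normed_vector) => 'a => 'a => 'b" where
 "taylor1 f a b = f b - f a - fderiv f a (b - a)"

lemma norm_blinfun_le:
 "norm A <= c ==> norm (blinfun_apply A x) <= c * norm x"
 using norm_blinfun[of A x] mult_right_mono[of "norm A" c "norm x"] by simp

lemma taylor1_bound:
 assumes "Cb2 f"
 shows "norm (taylor1 f a b) <= C2_norm f * norm (b - a) ^ 2"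
proof -
 \<comment> \<open>Subtracting the linear part along the segment makes the derivative of the curve a
   difference of two values of \<open>fderiv f\<close>, small by the Lipschitz bound.\<close>
 define \<phi> where "\<phi> l = f (a + l *\<^sub>R (b - a)) - l *\<^sub>R fderiv f a (b - a)" for l
 have "norm (\<phi> 1 - \<phi> 0) <= C2_norm f * norm (b - a) ^ 2"
 proof (rule segment_bound)
  show "(\<phi> has_vector_derivative (fderiv f (a + l *\<^sub>R (b - a)) - fderiv f a) (b - a)) (at l)" for l
   unfolding \<phi>_def blinfun.diff_left
   by (rule has_vector_derivative_diff[OF has_vector_derivative_along[OF Cb2_has_derivative(1)[OF assms]]])
    (auto intro!: derivative_eq_intros)
  fix l :: real assume l: "0 <= l" "l <= 1"
  have "norm (fderiv f (a + l *\<^sub>R (b - a)) - fderiv f a) <= C2_norm f * norm (l *\<^sub>R (b - a))"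
   using Cb2_lipschitz(2)[OF assms, where b = "a + l *\<^sub>R (b - a)" and a = a] by simp
  also have "\<dots> <= C2_norm f * norm (b - a)"
   using l Cb2_norm_le(4)[OF assms] by (auto intro!: mult_left_mono mult_left_le_one_le)
  finally show "norm ((fderiv f (a + l *\<^sub>R (b - a)) - fderiv f a) (b - a)) <= C2_norm f * norm (b - a) ^ 2"
   by (auto dest: norm_blinfun_le[of _ _ "b - a"] simp: power2_eq_square mult_ac)
 qed
 then show ?thesis by (simp add: \<phi>_def taylor1_def algebra_simps)
qed

lemma norm_step_op_le:
 assumes "Cb2 f"
 shows "norm (step_op f a) <= C2_norm f ^ 2"
proof -
 have "norm (step_op f a) <= norm (fderiv f a) * norm (tensor_map (f a))"
  unfolding step_op_def by (rule norm_blinfun_compose)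
 also have "\<dots> <= C2_norm f * C2_norm f"
  using Cb2_norm_le[OF assms] order_trans[OF norm_tensor_map_le[of "f a"]] by (intro mult_mono) auto
 finally show ?thesis by (simp add: power2_eq_square)
qed

lemma step_op_lipschitz:
 assumes "Cb2 f"
 shows "norm (step_op f b - step_op f a) <= 2 * C2_norm f ^ 2 * norm (b - a)"
proof -
 have e: "step_op f b - step_op f a = ((fderiv f b - fderiv f a) o\<^sub>L tensor_map (f b))
   + (fderiv f a o\<^sub>L tensor_map (f b - f a))"
  unfolding step_op_def tensor_map_diff
  by (rule blinfun_eqI) (simp add: blinfun.diff_left blinfun.diff_right blinfun.add_left)
 have "norm ((fderiv f b - fderiv f a) o\<^sub>L tensor_map (f b)) <= (C2_norm f * norm (b - a)) * C2_norm f"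
  using Cb2_lipschitz(2)[OF assms, of b a] order_trans[OF norm_tensor_map_le[of "f b"]] Cb2_norm_le[OF assms]
  by (intro order_trans[OF norm_blinfun_compose] mult_mono) auto
 moreover have "norm (fderiv f a o\<^sub>L tensor_map (f b - f a)) <= C2_norm f * (C2_norm f * norm (b - a))"
  using Cb2_lipschitz(1)[OF assms, of b a] order_trans[OF norm_tensor_map_le[of "f b - f a"]] Cb2_norm_le[OF assms]
  by (intro order_trans[OF norm_blinfun_compose] mult_mono) auto
 ultimately show ?thesis unfolding e by (intro norm_triangle_le) (simp add: power2_eq_square algebra_simps)
qed


section \<open>Four-point estimates for comparing two paths\<close>

text \<open>Move \<open>a'\<close> to \<open>a\<close> and \<open>a' + k'\<close> to
  \<open>a + k\<close> simultaneously along segments. The derivative of the difference splits into a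
  part along \<open>k - k'\<close> and a part comparing \<open>F'\<close> at two points whose
  distance is at most \<open>m\<close> by convexity of the ball. The bound is linear in the
  differences of the data, as a Gronwall argument requires.\<close>

lemma four_point_bound:
 fixes F :: "'a::euclidean_space => 'b::real_normed_vector"
 assumes F: "\<And>x. (F has_derivative blinfun_apply (F' x)) (at x)" and c: "\<And>x. norm (F' x) <= c"
  and eta: "\<And>x k. norm k <= m ==> norm (F' (x + k) - F' x) <= \<eta>"
  and k: "norm k <= m" and k': "norm k' <= m"
 shows "norm ((F (a + k) - F a) - (F (a' + k') - F a')) <= c * norm (k - k') + \<eta> * norm (a - a')"
proof -
 define p where "p l = (a' + k') + l *\<^sub>R (a + k - (a' + k'))" for l
 define q where "q l = a' + l *\<^sub>R (a - a')" for l
 define \<phi> where "\<phi> l = F (p l) - F (q l)" for l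
 have "norm (\<phi> 1 - \<phi> 0) <= c * norm (k - k') + \<eta> * norm (a - a')"
 proof (rule segment_bound)
  show "(\<phi> has_vector_derivative F' (p l) (a + k - (a' + k')) - F' (q l) (a - a')) (at l)" for l
   unfolding \<phi>_def p_def q_def by (intro has_vector_derivative_diff has_vector_derivative_along F)
  fix l :: real assume l: "0 <= l" "l <= 1"
  have pq: "p l = q l + ((1 - l) *\<^sub>R k' + l *\<^sub>R k)"
   by (simp add: p_def q_def algebra_simps)
  have "norm ((1 - l) *\<^sub>R k' + l *\<^sub>R k) <= (1 - l) * norm k' + l * norm k"
   using l by (intro norm_triangle_le) auto
  also have "\<dots> <= m" using l k k' by (intro convex_bound_le) auto
  finally have "norm (F' (p l) - F' (q l)) <= \<eta>"
   unfolding pq by (rule eta)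
  then have "norm ((F' (p l) - F' (q l)) (a - a')) <= \<eta> * norm (a - a')"
   by (rule norm_blinfun_le)
  moreover have "norm (F' (p l) (k - k')) <= c * norm (k - k')"
   using c by (rule norm_blinfun_le)
  moreover have "F' (p l) (a + k - (a' + k')) - F' (q l) (a - a')
    = F' (p l) (k - k') + (F' (p l) - F' (q l)) (a - a')"
   by (simp add: blinfun.diff_left blinfun.diff_right blinfun.add_right)
  ultimately show "norm (F' (p l) (a + k - (a' + k')) - F' (q l) (a - a')) <= c * norm (k - k') + \<eta> * norm (a - a')"
   by (simp only:) (rule norm_triangle_le, simp)
 qed
 then show ?thesis by (simp add: \<phi>_def p_def q_def algebra_simps)
qed

text \<open>Common form of the two regularity assumptions on the vector field; at \<alpha> = 1/3 it
  is used with \<open>\<delta> = 1\<close>.\<close>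

definition fderiv2_holder :: "real => real => ('a::euclidean_space => 'b::real_normed_vector) => bool" where
 "fderiv2_holder L \<delta> f \<longleftrightarrow> Cb2 f \<and> 0 <= L \<and> 0 < \<delta> \<and>
   (\<forall>x y. norm (fderiv (fderiv f) x - fderiv (fderiv f) y) <= L * norm (x - y) powr \<delta>)"

lemma four_point_vector_field:
 assumes "Cb2 f" "norm k <= m" "norm k' <= m"
 shows "norm ((f (a + k) - f a) - (f (a' + k') - f a'))
  <= C2_norm f * norm (k - k') + C2_norm f * m * norm (a - a')"
proof (rule four_point_bound[OF Cb2_has_derivative(1)[OF assms(1)] Cb2_norm_le(2)[OF assms(1)] _ assms(2,3)])
 fix x j :: 'a assume "norm j <= m"
 then show "norm (fderiv f (x + j) - fderiv f x) <= C2_norm f * m"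
  using Cb2_lipschitz(2)[OF assms(1), of "x + j" x] Cb2_norm_le(4)[OF assms(1)]
  by (auto elim!: order_trans intro: mult_left_mono)
qed

lemma four_point_fderiv:
 assumes "fderiv2_holder L \<delta> f" "norm k <= m" "norm k' <= m"
 shows "norm ((fderiv f (a + k) - fderiv f a) - (fderiv f (a' + k') - fderiv f a'))
  <= C2_norm f * norm (k - k') + L * m powr \<delta> * norm (a - a')"
proof -
 have f: "Cb2 f" "0 <= L" "0 < \<delta>"
  "norm (fderiv (fderiv f) x - fderiv (fderiv f) y) <= L * norm (x - y) powr \<delta>" for x y
  using assms(1) unfolding fderiv2_holder_def by auto
 show ?thesis
 proof (rule four_point_bound[OF Cb2_has_derivative(2)[OF f(1)] Cb2_norm_le(3)[OF f(1)] _ assms(2,3)])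
  fix x j :: 'a assume "norm j <= m"
  then have "norm j powr \<delta> <= m powr \<delta>" using f(3) by (intro powr_mono2) auto
  then show "norm (fderiv (fderiv f) (x + j) - fderiv (fderiv f) x) <= L * m powr \<delta>"
   using f(4)[of "x + j" x] mult_left_mono[of _ _ L] f(2) by force
 qed
qed

text \<open>Along scaled increments, the derivative of the difference of the two remainders consists
  of increments of \<open>fderiv f\<close> applied to \<open>h\<close> and \<open>h'\<close>. The
  four-point estimate for \<open>fderiv f\<close> supplies the factor \<open>m powr \<delta>\<close>
  next to \<open>norm (a - a')\<close>, which separate bounds on the two remainders could not
  give.\<close>

lemma taylor1_difference:
 assumes f: "fderiv2_holder L \<delta> f" and m: "norm (b - a) <= m" "norm (b' - a') <= m"
 shows "norm (taylor1 f a b - taylor1 f a' b')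
  <= 2 * C2_norm f * m * norm ((b - a) - (b' - a')) + L * m powr \<delta> * m * norm (a - a')"
proof -
 have C: "Cb2 f" "0 <= L" using f unfolding fderiv2_holder_def by auto
 have m0: "0 <= m" using m(1) norm_ge_zero order_trans by blast
 define h where "h = b - a"
 define h' where "h' = b' - a'"
 have hm: "norm h <= m" "norm h' <= m" using m by (auto simp: h_def h'_def)
 define \<phi> where "\<phi> l = (f (a + l *\<^sub>R h) - l *\<^sub>R fderiv f a h) - (f (a' + l *\<^sub>R h') - l *\<^sub>R fderiv f a' h')" for l
 have "norm (\<phi> 1 - \<phi> 0) <= 2 * C2_norm f * m * norm (h - h') + L * m powr \<delta> * m * norm (a - a')"
 proof (rule segment_bound)
  show "(\<phi> has_vector_derivative (fderiv f (a + l *\<^sub>R h) h - fderiv f a h) - (fderiv f (a' + l *\<^sub>R h') h' - fderiv f a' h')) (at l)" for l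
   unfolding \<phi>_def
   by (intro has_vector_derivative_diff has_vector_derivative_along Cb2_has_derivative(1) C)
    (auto intro!: derivative_eq_intros)
  fix l :: real assume l: "0 <= l" "l <= 1"
  have lm: "norm (l *\<^sub>R h) <= m" "norm (l *\<^sub>R h') <= m"
   using l hm m0 by (auto intro!: mult_le_one order_trans[OF mult_left_le_one_le])
  have 1: "norm (fderiv f (a + l *\<^sub>R h) - fderiv f a) <= C2_norm f * m"
   using Cb2_lipschitz(2)[OF C(1), of "a + l *\<^sub>R h" a] lm(1) Cb2_norm_le(4)[OF C(1)]
   by (auto elim!: order_trans intro: mult_left_mono)
  have "norm ((fderiv f (a + l *\<^sub>R h) - fderiv f a) - (fderiv f (a' + l *\<^sub>R h') - fderiv f a'))
   <= C2_norm f * norm (l *\<^sub>R h - l *\<^sub>R h') + L * m powr \<delta> * norm (a - a')"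
   by (rule four_point_fderiv[OF f lm])
  also have "norm (l *\<^sub>R h - l *\<^sub>R h') <= norm (h - h')"
   unfolding scaleR_diff_right[symmetric] using l by (auto intro: mult_left_le_one_le)
  finally have 2: "norm ((fderiv f (a + l *\<^sub>R h) - fderiv f a) - (fderiv f (a' + l *\<^sub>R h') - fderiv f a'))
   <= C2_norm f * norm (h - h') + L * m powr \<delta> * norm (a - a')"
   using Cb2_norm_le(4)[OF C(1)] by (simp add: mult_left_mono)
  have e: "(fderiv f (a + l *\<^sub>R h) h - fderiv f a h) - (fderiv f (a' + l *\<^sub>R h') h' - fderiv f a' h')
   = (fderiv f (a + l *\<^sub>R h) - fderiv f a) (h - h')
    + ((fderiv f (a + l *\<^sub>R h) - fderiv f a) - (fderiv f (a' + l *\<^sub>R h') - fderiv f a')) h'"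
   by (simp add: blinfun.diff_left blinfun.diff_right)
  have "norm (((fderiv f (a + l *\<^sub>R h) - fderiv f a) - (fderiv f (a' + l *\<^sub>R h') - fderiv f a')) h')
   <= (C2_norm f * norm (h - h') + L * m powr \<delta> * norm (a - a')) * m"
   by (rule order_trans[OF norm_blinfun_le[OF 2] mult_left_mono[OF hm(2)]])
    (use Cb2_norm_le(4)[OF C(1)] C(2) in auto)
  with norm_blinfun_le[OF 1, of "h - h'"]
  show "norm ((fderiv f (a + l *\<^sub>R h) h - fderiv f a h) - (fderiv f (a' + l *\<^sub>R h') h' - fderiv f a' h'))
   <= 2 * C2_norm f * m * norm (h - h') + L * m powr \<delta> * m * norm (a - a')"
   unfolding e by (intro norm_triangle_le) (simp add: algebra_simps)
 qed
 then show ?thesis by (simp add: \<phi>_def taylor1_def h_def h'_def algebra_simps)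
qed

lemma step_op_four_point:
 assumes f: "fderiv2_holder L \<delta> f" "\<delta> <= 1" and m: "norm (b - a) <= m" "norm (b' - a') <= m" "m <= 1"
  and mu: "norm (a - a') <= \<mu>" "norm (b - b') <= \<mu>"
 shows "norm ((step_op f b - step_op f a) - (step_op f b' - step_op f a'))
  <= 2 * C2_norm f ^ 2 * norm ((b - a) - (b' - a')) + (C2_norm f * L + 3 * C2_norm f ^ 2) * m powr \<delta> * \<mu>"
proof -
 have C: "Cb2 f" "0 <= L" "0 < \<delta>" using f unfolding fderiv2_holder_def by auto
 define c where "c = C2_norm f"
 note c0 = Cb2_norm_le(4)[OF C(1), folded c_def]
 have m0: "0 <= m" using m(1) norm_ge_zero order_trans by blast
 have mu0: "0 <= \<mu>" using mu(1) norm_ge_zero order_trans by blast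
 \<comment> \<open>With \<open>m <= 1\<close> and \<open>\<delta> <= 1\<close>, Lipschitz terms of
   order \<open>m\<close> are absorbed in the Hoelder term of order
   \<open>m powr \<delta>\<close>.\<close>
 have md: "m <= m powr \<delta>" using m0 m(3) f(2) C(3)
  by (cases "m = 0") (auto intro: order_trans[OF _ powr_mono'[of \<delta> 1 m]])
 define P where "P = fderiv f"
 define Q where "Q x = tensor_map (f x)" for x
 define d where "d = norm ((b - a) - (b' - a'))"
 have Pn: "norm (P x) <= c" for x unfolding P_def c_def by (rule Cb2_norm_le(2)[OF C(1)])
 have Qn: "norm (Q x) <= c" for x unfolding Q_def c_def
  using norm_tensor_map_le[of "f x"] Cb2_norm_le(1)[OF C(1), of x] by simp
 have Pl: "norm (P y - P x) <= c * norm (y - x)" for x y unfolding P_def c_def by (rule Cb2_lipschitz(2)[OF C(1)])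
 have Ql: "norm (Q y - Q x) <= c * norm (y - x)" for x y unfolding Q_def c_def tensor_map_diff[symmetric]
  by (rule order_trans[OF norm_tensor_map_le Cb2_lipschitz(1)[OF C(1)]])
 have P4: "norm ((P b - P a) - (P b' - P a')) <= c * d + L * m powr \<delta> * \<mu>"
 proof -
  have "L * m powr \<delta> * norm (a - a') <= L * m powr \<delta> * \<mu>"
   using mu(1) C(2) by (intro mult_left_mono) auto
  then show ?thesis
   using four_point_fderiv[OF f(1) m(1,2), of a a'] by (simp add: P_def c_def d_def)
 qed
 have Q4: "norm ((Q b - Q a) - (Q b' - Q a')) <= c * d + c * m * \<mu>"
 proof -
  have "norm ((Q b - Q a) - (Q b' - Q a')) <= norm ((f b - f a) - (f b' - f a'))"
   unfolding Q_def tensor_map_diff[symmetric] by (rule norm_tensor_map_le)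
  also have "\<dots> <= c * d + c * m * norm (a - a')"
   using four_point_vector_field[OF C(1) m(1,2), of a a'] by (simp add: c_def d_def)
  also have "\<dots> <= c * d + c * m * \<mu>" using mu(1) c0 m0 by (auto intro!: mult_left_mono)
  finally show ?thesis .
 qed
 \<comment> \<open>Product rule for the four-point difference of \<open>P\<close> composed with
   \<open>Q\<close>: every summand contains either a four-point difference or an increment in time
   paired with a difference of the two paths.\<close>
 have e: "(step_op f b - step_op f a) - (step_op f b' - step_op f a')
  = ((((P b - P a) - (P b' - P a')) o\<^sub>L Q b) + ((P b' - P a') o\<^sub>L (Q b - Q b')))
   + (((P a - P a') o\<^sub>L (Q b - Q a)) + (P a' o\<^sub>L ((Q b - Q a) - (Q b' - Q a'))))"
  unfolding step_op_def P_def[symmetric] Q_def[symmetric]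
  by (rule blinfun_eqI) (simp add: blinfun.diff_left blinfun.diff_right blinfun.add_left)
 have cc: "norm (A o\<^sub>L B) <= s * r" if "norm A <= s" "norm B <= r" for A :: "(real^'a) \<Rightarrow>\<^sub>L (real^'b^'a)" and B :: "(real^'b) \<Rightarrow>\<^sub>L (real^'a)" and s r
 proof -
  have "0 <= s" using that(1) norm_ge_zero order_trans by blast
  then show ?thesis using that by (intro order_trans[OF norm_blinfun_compose] mult_mono) auto
 qed
 have 1: "norm (((P b - P a) - (P b' - P a')) o\<^sub>L Q b) <= (c * d + L * m powr \<delta> * \<mu>) * c"
  by (rule cc[OF P4 Qn])
 have "norm (P b' - P a') <= c * m" "norm (Q b - Q a) <= c * m"
  using Pl[of b' a'] Ql[of b a] m c0 by (auto elim!: order_trans intro!: mult_left_mono)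
 moreover have "norm (Q b - Q b') <= c * \<mu>" "norm (P a - P a') <= c * \<mu>"
  using Pl[of a a'] Ql[of b b'] mu c0 by (auto elim!: order_trans intro!: mult_left_mono)
 ultimately have 2: "norm ((P b' - P a') o\<^sub>L (Q b - Q b')) <= (c * m) * (c * \<mu>)"
  "norm ((P a - P a') o\<^sub>L (Q b - Q a)) <= (c * \<mu>) * (c * m)"
  by (auto intro!: cc)
 have 3: "norm (P a' o\<^sub>L ((Q b - Q a) - (Q b' - Q a'))) <= c * (c * d + c * m * \<mu>)"
  by (rule cc[OF Pn Q4])
 have "norm ((step_op f b - step_op f a) - (step_op f b' - step_op f a'))
  <= ((c * d + L * m powr \<delta> * \<mu>) * c + (c * m) * (c * \<mu>)) + ((c * \<mu>) * (c * m) + c * (c * d + c * m * \<mu>))"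
  unfolding e by (intro norm_triangle_mono 1 2 3)
 also have "\<dots> = 2 * c^2 * d + c * L * m powr \<delta> * \<mu> + 3 * c^2 * \<mu> * m"
  by (simp add: algebra_simps power2_eq_square)
 also have "\<dots> <= 2 * c^2 * d + c * L * m powr \<delta> * \<mu> + 3 * c^2 * \<mu> * m powr \<delta>"
  using md mu0 by (intro add_left_mono mult_left_mono) auto
 finally show ?thesis by (simp add: c_def d_def algebra_simps)
qed

section \<open>One bisection step, for one path and for the difference of two\<close>

text \<open>If \<open>x\<close> is the size of the remainder on the left half, the increment of
  \<open>Y\<close> over it is of size \<open>a * (u + x)\<close>. The assumptions
  \<open>u <= 1\<close> and \<open>x <= 1\<close> linearise all squares, which leaves the additive
  error \<open>u ^ 3\<close> and the multiplicative error \<open>u * x\<close>. Only the left half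
  enters, since the defect involves \<open>Y\<close> at \<open>s\<close> and \<open>r\<close>
  alone.\<close>

lemma davie_remainder_step:
 fixes X :: "real => real ^ 'n" and Y :: "real => real ^ 'm" and a c u :: real
 assumes f: "Cb2 f"
  and chen: "XX s t = XX s r + XX r t + tensor (X r - X s) (X t - X r)"
  and u: "0 <= u" "u <= 1" "norm (X r - X s) <= u" "norm (X t - X r) <= u"
   "norm (XX s r) <= u\<^sup>2" "norm (XX r t) <= u\<^sup>2"
  and xi: "norm (davie_remainder f X XX Y s r) <= 1"
  and c: "c = C2_norm f" and a: "a = c + CARD('n) * c\<^sup>2 + 1"
 shows "norm (davie_remainder f X XX Y s t - davie_remainder f X XX Y s r - davie_remainder f X XX Y r t)
  <= (2 * c * a\<^sup>2 + c * a + 2 * CARD('n) * c\<^sup>2 * a) * (u ^ 3 + u * norm (davie_remainder f X XX Y s r))"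
proof -
 let ?D = "davie_remainder f X XX Y"
 define N where "N = real CARD('n)"
 define x where "x = norm (?D s r)"
 have x: "0 <= x" "x <= 1" using xi by (auto simp: x_def)
 have N: "1 <= N" unfolding N_def by (simp add: Suc_leI)
 have c0: "0 <= c" using Cb2_norm_le(4)[OF f] c by simp
 have a1: "a = c + N * c\<^sup>2 + 1" using a by (simp add: N_def)
 have a0: "1 <= a" "c <= a" "N * c\<^sup>2 <= a" using a1 c0 N by auto
 have u2: "u\<^sup>2 <= u" using u(1,2) by (simp add: power2_eq_square mult_left_le_one_le)
 have F: "norm (f (Y s) *v (X r - X s)) <= c * u"
  using Cb2_norm_le(1)[OF f, of "Y s"] c0 u(1,3) unfolding c
  by (intro order_trans[OF norm_matrix_vector_mult_le] mult_mono) auto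
 have K: "norm (contract W B) <= N * w * b" if "norm W <= w" "norm B <= b" for W :: "(real^'n) \<Rightarrow>\<^sub>L (real^'n^'m)" and B w b
 proof -
  have "norm (contract W B) <= N * norm W * norm B" using norm_contract_le[of W B] by (simp add: N_def)
  also have "\<dots> <= N * w * b"
   using that N norm_ge_zero[of W] norm_ge_zero[of B]
   by (intro mult_mono mult_nonneg_nonneg) (auto simp del: norm_ge_zero)
  finally show ?thesis .
 qed
 have G: "norm (contract (step_op f (Y s)) (XX s r)) <= N * c\<^sup>2 * u\<^sup>2"
  by (rule K) (use norm_step_op_le[OF f] u(5) c in auto)
 have Y: "Y r - Y s = f (Y s) *v (X r - X s) + (contract (step_op f (Y s)) (XX s r) + ?D s r)"
  by (simp add: davie_remainder_def)
 have "norm (Y r - Y s) <= c * u + (N * c\<^sup>2 * u\<^sup>2 + x)"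
  unfolding Y using x_def by (intro norm_triangle_mono F G) auto
 also have "\<dots> <= c * u + (N * c\<^sup>2 * u + x)"
  using u2 N c0 by (intro add_mono mult_left_mono) auto
 also have "\<dots> <= a * (u + x)"
  using u(1) x(1) a0 c0 N by (simp add: a1 algebra_simps)
 finally have Yb: "norm (Y r - Y s) <= a * (u + x)" .
 have "norm (Y r - Y s) ^ 2 <= (a * (u + x))\<^sup>2"
  using Yb by (intro power_mono) auto
 also have "\<dots> <= a\<^sup>2 * (2 * (u\<^sup>2 + x))"
 proof -
  have "x\<^sup>2 <= x" using x by (simp add: power2_eq_square mult_left_le_one_le)
  moreover have "0 <= (u - x)\<^sup>2" by simp
  ultimately have "(u + x)\<^sup>2 <= 2 * (u\<^sup>2 + x)" by (simp add: power2_eq_square algebra_simps)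
  then show ?thesis by (simp add: power_mult_distrib mult_left_mono)
 qed
 finally have Y2: "norm (Y r - Y s) ^ 2 <= a\<^sup>2 * (2 * (u\<^sup>2 + x))" .
 have T: "norm (taylor1 f (Y s) (Y r)) <= c * (a\<^sup>2 * (2 * (u\<^sup>2 + x)))"
  using taylor1_bound[OF f, of "Y s" "Y r"] mult_left_mono[OF Y2 c0] c by simp
 have R: "norm (contract (step_op f (Y s)) (XX s r) + ?D s r) <= a * (u\<^sup>2 + x)"
 proof -
  have "norm (contract (step_op f (Y s)) (XX s r) + ?D s r) <= N * c\<^sup>2 * u\<^sup>2 + x"
   using x_def by (intro norm_triangle_mono G) auto
  also have "\<dots> <= a * u\<^sup>2 + a * x"
   using a0 x(1) by (intro add_mono mult_right_mono) (auto simp: mult_right_mono[of 1 a x, simplified])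
  finally show ?thesis by (simp add: algebra_simps)
 qed
 \<comment> \<open>The increment of \<open>Y\<close> minus its first-order part is second level plus
   remainder, so what \<open>fderiv f\<close> is applied to is already of second order.\<close>
 have split: "f (Y r) - f (Y s) - step_op f (Y s) (X r - X s)
   = taylor1 f (Y s) (Y r) + fderiv f (Y s) (contract (step_op f (Y s)) (XX s r) + ?D s r)"
 proof -
  have "contract (step_op f (Y s)) (XX s r) + ?D s r = (Y r - Y s) - tensor_map (f (Y s)) (X r - X s)"
   by (simp add: davie_remainder_def tensor_map.rep_eq)
  then show ?thesis by (simp add: taylor1_def step_op_def blinfun.diff_right)
 qed
 have "norm (fderiv f (Y s) (contract (step_op f (Y s)) (XX s r) + ?D s r)) <= c * (a * (u\<^sup>2 + x))"
  using norm_blinfun_le[OF Cb2_norm_le(2)[OF f]] mult_left_mono[OF R c0] unfolding c by (rule order_trans)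
 with T have "norm (f (Y r) - f (Y s) - step_op f (Y s) (X r - X s)) <= (2 * c * a\<^sup>2 + c * a) * (u\<^sup>2 + x)"
  unfolding split by (intro norm_triangle_le) (simp add: algebra_simps)
 then have 1: "norm ((f (Y r) - f (Y s) - step_op f (Y s) (X r - X s)) *v (X t - X r)) <= ((2 * c * a\<^sup>2 + c * a) * (u\<^sup>2 + x)) * u"
  using u(1,4) x(1) a0 c0 by (intro order_trans[OF norm_matrix_vector_mult_le] mult_mono) auto
 have "norm (step_op f (Y r) - step_op f (Y s)) <= 2 * c\<^sup>2 * (a * (u + x))"
  using order_trans[OF step_op_lipschitz[OF f] mult_left_mono[OF Yb]] c by simp
 then have "norm (contract (step_op f (Y r) - step_op f (Y s)) (XX r t)) <= N * (2 * c\<^sup>2 * (a * (u + x))) * u\<^sup>2"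
  using u(6) by (rule K)
 also have "\<dots> = (2 * N * c\<^sup>2 * a) * (u ^ 3 + x * u\<^sup>2)"
  by (simp add: algebra_simps power2_eq_square power3_eq_cube)
 also have "\<dots> <= (2 * N * c\<^sup>2 * a) * (u ^ 3 + u * x)"
  using mult_right_mono[OF u2 x(1)] N a0 by (intro mult_left_mono) (auto simp: mult.commute[of x])
 finally have 2: "norm (contract (step_op f (Y r) - step_op f (Y s)) (XX r t)) <= (2 * N * c\<^sup>2 * a) * (u ^ 3 + u * x)" .
 have "norm (?D s t - ?D s r - ?D r t) <= ((2 * c * a\<^sup>2 + c * a) * (u\<^sup>2 + x)) * u + (2 * N * c\<^sup>2 * a) * (u ^ 3 + u * x)"
  unfolding davie_remainder_defect[where f = f and Y = Y, OF chen]
  using norm_triangle_mono[OF 1 2] by simp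
 then show ?thesis unfolding x_def[symmetric]
  by (simp add: N_def algebra_simps power2_eq_square power3_eq_cube)
qed

text \<open>The computation of \<open>davie_remainder_step\<close> for the difference of two paths
  whose distance at \<open>s\<close> and \<open>r\<close> is at most \<open>\<mu>\<close>. Every
  error is linear in \<open>\<mu>\<close> and \<open>D s r\<close>; Hoelder continuity of the second
  derivative gives \<open>u powr (2 + \<delta>)\<close> in place of \<open>u ^ 3\<close>, and this
  is the weight whose tree sum has to converge.\<close>

lemma davie_difference_step:
 fixes X :: "real => real ^ 'n" and Y Z :: "real => real ^ 'm" and a c u \<mu> L \<delta> :: real
 assumes f: "fderiv2_holder L \<delta> f" "\<delta> <= 1"
  and chen: "XX s t = XX s r + XX r t + tensor (X r - X s) (X t - X r)"
  and u: "0 <= u" "u <= 1" "norm (X r - X s) <= u" "norm (X t - X r) <= u"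
   "norm (XX s r) <= u\<^sup>2" "norm (XX r t) <= u\<^sup>2" "norm (Y r - Y s) <= u" "norm (Z r - Z s) <= u"
   "norm (Y r - Y s - f (Y s) *v (X r - X s)) <= u\<^sup>2"
  and mu: "norm (Y s - Z s) <= \<mu>" "norm (Y r - Z r) <= \<mu>"
  and c: "c = C2_norm f" and a: "a = c + 2 * CARD('n) * c\<^sup>2 + 1"
  and D: "D = (%s t. davie_remainder f X XX Y s t - davie_remainder f X XX Z s t)"
 shows "norm (D s t) <= norm (D s r) + norm (D r t)
  + (3 * c * a + c + L + CARD('n) * (2 * c\<^sup>2 * a + c * L + 3 * c\<^sup>2)) * (\<mu> * u powr (2 + \<delta>) + u * norm (D s r))"
proof -
 define N where "N = real CARD('n)"
 define x where "x = norm (D s r)"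
 have C: "Cb2 f" "0 <= L" "0 < \<delta>" using f unfolding fderiv2_holder_def by auto
 have x: "0 <= x" by (auto simp: x_def)
 have mu0: "0 <= \<mu>" using mu(1) norm_ge_zero order_trans by blast
 have N: "1 <= N" unfolding N_def by (simp add: Suc_leI)
 have c0: "0 <= c" using Cb2_norm_le(4)[OF C(1)] c by simp
 have a1: "a = c + 2 * N * c\<^sup>2 + 1" using a by (simp add: N_def)
 have a0: "1 <= a" "c <= a" "2 * N * c\<^sup>2 <= a" using a1 c0 N by auto
 have u2: "u\<^sup>2 <= u" using u(1,2) by (simp add: power2_eq_square mult_left_le_one_le)
 have ud: "u <= u powr \<delta>" using u(1,2) f(2) C(3)
  by (cases "u = 0") (auto intro: order_trans[OF _ powr_mono'[of \<delta> 1 u]])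
 have upow: "u powr (2 + \<delta>) = u * (u * u powr \<delta>)"
  using u(1) C(3) by (cases "u = 0") (auto simp: powr_add power2_eq_square)
 have K: "norm (contract W B) <= N * w * b" if "norm W <= w" "norm B <= b" for W :: "(real^'n) \<Rightarrow>\<^sub>L (real^'n^'m)" and B w b
 proof -
  have "norm (contract W B) <= N * norm W * norm B" using norm_contract_le[of W B] by (simp add: N_def)
  also have "\<dots> <= N * w * b"
   using that N norm_ge_zero[of W] norm_ge_zero[of B]
   by (intro mult_mono mult_nonneg_nonneg) (auto simp del: norm_ge_zero)
  finally show ?thesis .
 qed
 define g where "g = contract (step_op f (Y s)) (XX s r) - contract (step_op f (Z s)) (XX s r)"
 have gb: "norm g <= 2 * N * c\<^sup>2 * \<mu> * u\<^sup>2"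
 proof -
  have "norm (step_op f (Y s) - step_op f (Z s)) <= 2 * c\<^sup>2 * \<mu>"
   using order_trans[OF step_op_lipschitz[OF C(1)] mult_left_mono[OF mu(1)]] c by simp
  from K[OF this u(5)] show ?thesis by (simp add: g_def contract_diff_left mult_ac)
 qed
 define h where "h = (f (Y s) - f (Z s)) *v (X r - X s)"
 have hb: "norm h <= c * \<mu> * u"
 proof -
  have "norm (f (Y s) - f (Z s)) <= c * \<mu>"
   using order_trans[OF Cb2_lipschitz(1)[OF C(1)] mult_left_mono[OF mu(1)]] c c0 by simp
  then show ?thesis unfolding h_def using u(1,3) c0 mu0
   by (intro order_trans[OF norm_matrix_vector_mult_le] mult_mono) auto
 qed
 have dY: "(Y r - Y s) - (Z r - Z s) = h + (g + D s r)"
  by (simp add: h_def g_def D davie_remainder_def matrix_vector_mult_diff_rdistrib)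
 have "norm ((Y r - Y s) - (Z r - Z s)) <= c * \<mu> * u + (2 * N * c\<^sup>2 * \<mu> * u\<^sup>2 + x)"
  unfolding dY by (intro norm_triangle_mono hb gb) (simp add: x_def)
 also have "\<dots> <= c * \<mu> * u + (2 * N * c\<^sup>2 * \<mu> * u + x)"
  using u2 N mu0 c0 by (intro add_mono mult_left_mono) auto
 also have "\<dots> <= a * (\<mu> * u + x)"
  using u(1) x(1) a0 c0 N mu0 by (simp add: a1 algebra_simps)
 finally have db: "norm ((Y r - Y s) - (Z r - Z s)) <= a * (\<mu> * u + x)" .
 have gx: "norm (g + D s r) <= a * (\<mu> * u\<^sup>2 + x)"
 proof -
  have "norm (g + D s r) <= 2 * N * c\<^sup>2 * \<mu> * u\<^sup>2 + x"
   by (intro norm_triangle_mono gb) (simp add: x_def)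
  also have "\<dots> <= a * \<mu> * u\<^sup>2 + a * x"
   using a0 x(1) mu0 by (intro add_mono mult_right_mono) (auto simp: mult_right_mono[of 1 a x, simplified])
  finally show ?thesis by (simp add: algebra_simps)
 qed
 define R where "R = Y r - Y s - f (Y s) *v (X r - X s)"
 define S where "S V = f (V r) - f (V s) - step_op f (V s) (X r - X s)" for V :: "real => real ^ 'm"
 have S: "S V = taylor1 f (V s) (V r) + fderiv f (V s) ((V r - V s) - f (V s) *v (X r - X s))" for V
 proof -
  have "step_op f (V s) (X r - X s) = fderiv f (V s) (f (V s) *v (X r - X s))"
   by (simp add: step_op_def tensor_map.rep_eq)
  then show ?thesis by (simp only: S_def taylor1_def blinfun.diff_right) simp
 qed
 \<comment> \<open>The first-order remainders of \<open>Y\<close> and \<open>Z\<close> differ by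
   \<open>g + D s r\<close>, so only the one of \<open>Y\<close> has to be bounded by
   itself.\<close>
 have SYZ: "S Y - S Z = (taylor1 f (Y s) (Y r) - taylor1 f (Z s) (Z r))
   + ((fderiv f (Y s) - fderiv f (Z s)) R + fderiv f (Z s) (g + D s r))"
 proof -
  have "g + D s r = R - ((Z r - Z s) - f (Z s) *v (X r - X s))"
   by (simp add: g_def D R_def davie_remainder_def)
  then show ?thesis unfolding S by (simp add: R_def blinfun.diff_left blinfun.diff_right)
 qed
 have T: "norm (taylor1 f (Y s) (Y r) - taylor1 f (Z s) (Z r))
   <= 2 * c * u * (a * (\<mu> * u + x)) + L * u powr \<delta> * u * \<mu>"
 proof -
  have "norm (taylor1 f (Y s) (Y r) - taylor1 f (Z s) (Z r))
    <= 2 * c * u * norm ((Y r - Y s) - (Z r - Z s)) + L * u powr \<delta> * u * norm (Y s - Z s)"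
   using taylor1_difference[OF f(1) u(7,8)] c by simp
  also have "\<dots> <= 2 * c * u * (a * (\<mu> * u + x)) + L * u powr \<delta> * u * \<mu>"
   using db mu(1) c0 u(1) C(2) by (intro add_mono mult_left_mono) auto
  finally show ?thesis .
 qed
 have "norm (fderiv f (Y s) - fderiv f (Z s)) <= c * \<mu>"
  using order_trans[OF Cb2_lipschitz(2)[OF C(1)] mult_left_mono[OF mu(1)]] c c0 by simp
 from norm_blinfun_le[OF this, of R] have T2: "norm ((fderiv f (Y s) - fderiv f (Z s)) R) <= c * \<mu> * u\<^sup>2"
  using u(9) c0 mu0 by (elim order_trans) (auto simp: R_def intro!: mult_left_mono)
 have T3: "norm (fderiv f (Z s) (g + D s r)) <= c * (a * (\<mu> * u\<^sup>2 + x))"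
  using norm_blinfun_le[OF Cb2_norm_le(2)[OF C(1)]] mult_left_mono[OF gx c0] unfolding c by (rule order_trans)
 have uu: "u\<^sup>2 <= u * u powr \<delta>" using ud u(1) by (simp add: power2_eq_square mult_left_mono)
 have ux: "u * x <= x" using u(1,2) x by (simp add: mult_left_le_one_le)
 define v where "v = u * u powr \<delta>"
 have v: "0 <= v" "u\<^sup>2 <= v" using u(1) uu by (auto simp: v_def)
 have "norm (S Y - S Z) <= (2 * c * u * (a * (\<mu> * u + x)) + L * u powr \<delta> * u * \<mu>) + (c * \<mu> * u\<^sup>2 + c * (a * (\<mu> * u\<^sup>2 + x)))"
  unfolding SYZ by (intro norm_triangle_mono T T2 T3)
 also have "\<dots> = (2 * c * a + c + c * a) * (\<mu> * u\<^sup>2) + 2 * c * a * (u * x) + L * (\<mu> * v) + c * a * x"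
  by (simp add: algebra_simps power2_eq_square v_def)
 also have "\<dots> <= (2 * c * a + c + c * a) * (\<mu> * v) + 2 * c * a * x + L * (\<mu> * v) + c * a * x"
  using ux v mu0 c0 a0 C(2) by (intro add_mono mult_left_mono) auto
 also have "\<dots> <= (3 * c * a + c + L) * (\<mu> * v + x)"
  using v(1) mu0 x c0 C(2) a0 by (simp add: algebra_simps)
 finally have SS: "norm (S Y - S Z) <= (3 * c * a + c + L) * (\<mu> * v + x)" .
 then have 1: "norm ((S Y - S Z) *v (X t - X r)) <= ((3 * c * a + c + L) * (\<mu> * v + x)) * u"
  using u(1,4) x(1) a0 c0 v mu0 C(2) by (intro order_trans[OF norm_matrix_vector_mult_le] mult_mono) auto
 define E where "E = (step_op f (Y r) - step_op f (Y s)) - (step_op f (Z r) - step_op f (Z s))"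
 have "norm E <= 2 * c\<^sup>2 * norm ((Y r - Y s) - (Z r - Z s)) + (c * L + 3 * c\<^sup>2) * u powr \<delta> * \<mu>"
  unfolding E_def c by (rule step_op_four_point[OF f u(7,8,2) mu])
 also have "\<dots> <= 2 * c\<^sup>2 * (a * (\<mu> * u + x)) + (c * L + 3 * c\<^sup>2) * u powr \<delta> * \<mu>"
  using mult_left_mono[OF db, of "2 * c\<^sup>2"] by simp
 finally have "norm (contract E (XX r t)) <= N * (2 * c\<^sup>2 * (a * (\<mu> * u + x)) + (c * L + 3 * c\<^sup>2) * u powr \<delta> * \<mu>) * u\<^sup>2"
  using u(6) by (rule K)
 also have "\<dots> = N * (2 * c\<^sup>2 * a) * (\<mu> * (u * u\<^sup>2)) + N * (2 * c\<^sup>2 * a) * (u * (u * x)) + N * (c * L + 3 * c\<^sup>2) * (\<mu> * (u * v))"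
  by (simp add: algebra_simps power2_eq_square v_def)
 also have "\<dots> <= N * (2 * c\<^sup>2 * a) * (\<mu> * (u * v)) + N * (2 * c\<^sup>2 * a) * (u * x) + N * (c * L + 3 * c\<^sup>2) * (\<mu> * (u * v))"
  using ux v mu0 c0 a0 N u(1) C(2) by (intro add_mono mult_left_mono) auto
 also have "\<dots> <= N * (2 * c\<^sup>2 * a + c * L + 3 * c\<^sup>2) * (\<mu> * (u * v) + u * x)"
 proof -
  have "0 <= N * (c * L + 3 * c\<^sup>2) * (u * x)" using u(1) x N c0 C(2) by simp
  then show ?thesis by (simp add: algebra_simps)
 qed
 finally have 2: "norm (contract E (XX r t)) <= N * (2 * c\<^sup>2 * a + c * L + 3 * c\<^sup>2) * (\<mu> * (u * v) + u * x)" .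
 have e: "D s t = (D s r + D r t) + ((S Y - S Z) *v (X t - X r) + contract E (XX r t))"
  unfolding D E_def S_def davie_remainder_defect[OF chen] contract_diff_left matrix_vector_mult_diff_rdistrib
  by (simp add: algebra_simps)
 have "norm (D s t) <= (x + norm (D r t)) + (((3 * c * a + c + L) * (\<mu> * v + x)) * u + N * (2 * c\<^sup>2 * a + c * L + 3 * c\<^sup>2) * (\<mu> * (u * v) + u * x))"
  unfolding e by (intro norm_triangle_mono 1 2) (auto simp: x_def)
 then show ?thesis unfolding x_def[symmetric] N_def[symmetric] upow v_def[symmetric]
  by (simp add: algebra_simps)
qed

section \<open>Dyadic cells and tree sums\<close>

definition dpt :: "real => nat => nat => real" where
 "dpt T n i = T * real i / 2 ^ n"

lemma dpt_0 [simp]: "dpt T n 0 = 0"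
 by (simp add: dpt_def)

lemma dpt_end [simp]: "dpt T n (2 ^ n) = T"
 by (simp add: dpt_def)

lemma dpt_double: "dpt T (Suc n) (2 * i) = dpt T n i"
 by (simp add: dpt_def)

lemma dpt_refine: "dpt T (n + k) (i * 2 ^ k) = dpt T n i"
 by (simp add: dpt_def power_add)

lemma dpt_Suc: "dpt T n (Suc i) = dpt T n i + T / 2 ^ n"
 by (simp add: dpt_def field_simps)

lemma dpt_mono: "0 < T ==> i <= j ==> dpt T n i <= dpt T n j"
 by (simp add: dpt_def divide_right_mono)

lemma dpt_less_iff: "0 < T ==> dpt T n i < dpt T n j \<longleftrightarrow> i < j"
 by (simp add: dpt_def divide_less_cancel)

lemma dpt_le_iff: "0 < T ==> dpt T n i <= dpt T n j \<longleftrightarrow> i <= j"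
 by (simp add: dpt_def divide_le_cancel)

lemma dpt_bounds: "0 < T ==> i <= 2 ^ n ==> 0 <= dpt T n i \<and> dpt T n i <= T"
 using dpt_mono[of T 0 i n] dpt_mono[of T i "2 ^ n" n] by simp

lemma dyadic_floor:
 assumes "0 < T" "0 <= s" "s < T"
 obtains i where "i < 2 ^ n" "dpt T n i <= s" "s < dpt T n (Suc i)" "i = nat \<lfloor>s * 2 ^ n / T\<rfloor>"
proof -
 define i where "i = nat \<lfloor>s * 2 ^ n / T\<rfloor>"
 have 0: "0 <= s * 2 ^ n / T" using assms by simp
 have i: "real i <= s * 2 ^ n / T" "s * 2 ^ n / T < real i + 1"
  using 0 by (simp_all add: i_def of_nat_nat)
 have "s * 2 ^ n / T < 2 ^ n" using assms by (simp add: field_simps)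
 with i(1) have "real i < 2 ^ n" by linarith
 then have "i < 2 ^ n" by simp
 moreover have "dpt T n i <= s" "s < dpt T n (Suc i)"
  using i assms(1) by (simp_all add: dpt_def field_simps)
 ultimately show thesis using that i_def by blast
qed

text \<open>The end point \<open>T\<close> belongs to no half-open cell and is assigned to the last
  one.\<close>

lemma in_dyadic_cell:
 assumes "0 < T" "0 <= s" "s <= T"
 obtains i where "i < 2 ^ n" "dpt T n i <= s" "s <= dpt T n (Suc i)"
proof (cases "s = T")
 case True
 have "(2::nat) ^ n - 1 < 2 ^ n" "Suc (2 ^ n - 1) = (2::nat) ^ n" by simp_all
 then show ?thesis using that[of "2 ^ n - 1"] True assms(1) dpt_bounds[of T "2 ^ n - 1" n] by simp
next
 case False
 with assms show ?thesis using dyadic_floor[of T s n] that by (metis less_eq_real_def)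
qed

text \<open>A lag of at most one cell length crosses at most one grid point; hence bounds on single
  cells and a defect at one grid point will suffice for all short lags.\<close>

lemma adjacent_cells:
 assumes "0 < T" "0 <= s" "s <= t" "t <= T" "t - s <= T / 2 ^ n"
 obtains i j where "i < 2 ^ n" "j < 2 ^ n" "j = i \<or> j = Suc i" "dpt T n i <= s" "s <= dpt T n (Suc i)"
  "dpt T n j <= t" "t <= dpt T n (Suc j)"
proof (cases "s = T")
 case True
 then show ?thesis using that in_dyadic_cell[of T s n] assms by (metis order_antisym)
next
 case False
 with assms have sT: "s < T" by simp
 obtain i where i: "i < 2 ^ n" "dpt T n i <= s" "s < dpt T n (Suc i)"
  using dyadic_floor[OF assms(1,2) sT, of n] by metis
 show ?thesis
 proof (cases "t <= dpt T n (Suc i)")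
  case True
  then show ?thesis using that[of i i] i assms by auto
 next
  case False
  then have "Suc i \<noteq> 2 ^ n" using assms(4) by auto
  with i have "Suc i < 2 ^ n" by simp
  moreover have "t <= dpt T n (Suc (Suc i))" using i assms by (simp add: dpt_Suc)
  ultimately show ?thesis using that[of i "Suc i"] i False by auto
 qed
qed

section \<open>Sums over the dyadic tree of descendants\<close>

definition level_sum :: "(nat => nat => real) => nat => real" where
 "level_sum a n = (\<Sum>i<2 ^ n. a n i)"

text \<open>The interval \<open>{i * 2 ^ k..<Suc i * 2 ^ k}\<close> lists the cells of generation
  \<open>n + k\<close> inside cell \<open>i\<close> of generation \<open>n\<close>; the cell itself
  is counted as \<open>k = 0\<close>.\<close>

definition tree_sum :: "(nat => nat => real) => nat => nat => real" where
 "tree_sum a n i = (\<Sum>k. \<Sum>j\<in>{i * 2 ^ k..<Suc i * 2 ^ k}. a (n + k) j)"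

definition tree_summable :: "(nat => nat => real) => bool" where
 "tree_summable a \<longleftrightarrow> (\<forall>n. \<forall>i<2 ^ n. 0 <= a n i) \<and> summable (level_sum a)"

lemma descendant_less:
 assumes "i < 2 ^ n" "j < Suc i * 2 ^ k"
 shows "j < 2 ^ (n + k)"
proof -
 have "Suc i * 2 ^ k <= 2 ^ n * 2 ^ k" using assms(1) by (intro mult_right_mono) auto
 then show ?thesis using assms(2) by (simp add: power_add)
qed

lemma sum_descendants_children:
 fixes g :: "nat => 'a::comm_monoid_add"
 shows "sum g {i * 2 ^ Suc k..<Suc i * 2 ^ Suc k}
  = sum g {2 * i * 2 ^ k..<Suc (2 * i) * 2 ^ k} + sum g {Suc (2 * i) * 2 ^ k..<Suc (Suc (2 * i)) * 2 ^ k}"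
proof -
 have "i * 2 ^ Suc k = 2 * i * 2 ^ k"
  by (simp only: power_Suc mult_ac)
 moreover have "Suc (Suc (2 * i)) = 2 * Suc i" by simp
 then have "Suc i * 2 ^ Suc k = Suc (Suc (2 * i)) * (2::nat) ^ k"
  by (simp only: power_Suc mult_ac)
 moreover have "2 * i * 2 ^ k <= Suc (2 * i) * (2::nat) ^ k" "Suc (2 * i) * 2 ^ k <= Suc (Suc (2 * i)) * (2::nat) ^ k"
  by (intro mult_right_mono; simp)+
 ultimately show ?thesis by (simp only: sum.atLeastLessThan_concat)
qed

lemma sum_over_descendants:
 fixes g :: "nat => 'a::comm_monoid_add"
 shows "(\<Sum>i<m. \<Sum>j\<in>{i * 2 ^ k..<Suc i * 2 ^ k}. g j) = (\<Sum>j<m * 2 ^ k. g j)"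
proof (induction m)
 case (Suc m)
 have "m * 2 ^ k <= Suc m * (2::nat) ^ k" by (intro mult_right_mono) auto
 from sum.atLeastLessThan_concat[OF le0 this, of g]
 show ?case unfolding sum.lessThan_Suc Suc.IH by (simp only: lessThan_atLeast0)
qed simp

context
 fixes a :: "nat => nat => real"
 assumes a: "tree_summable a"
begin

lemma descendants_sum_bounds:
 assumes "i < 2 ^ n"
 shows "0 <= (\<Sum>j\<in>{i * 2 ^ k..<Suc i * 2 ^ k}. a (n + k) j)"
  "(\<Sum>j\<in>{i * 2 ^ k..<Suc i * 2 ^ k}. a (n + k) j) <= level_sum a (n + k)"
proof -
 have nn: "j < 2 ^ m ==> 0 <= a m j" for m j using a by (simp add: tree_summable_def)
 show "0 <= (\<Sum>j\<in>{i * 2 ^ k..<Suc i * 2 ^ k}. a (n + k) j)"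
  by (intro sum_nonneg nn) (use descendant_less[OF assms] in auto)
 show "(\<Sum>j\<in>{i * 2 ^ k..<Suc i * 2 ^ k}. a (n + k) j) <= level_sum a (n + k)"
  unfolding level_sum_def using nn descendant_less[OF assms] by (intro sum_mono2) auto
qed

lemma summable_level_tail: "summable (%k. level_sum a (n + k))"
 using a summable_ignore_initial_segment[of "level_sum a" n] by (simp add: tree_summable_def add.commute)

lemma summable_descendants:
 assumes "i < 2 ^ n"
 shows "summable (%k. \<Sum>j\<in>{i * 2 ^ k..<Suc i * 2 ^ k}. a (n + k) j)"
 using descendants_sum_bounds[OF assms] by (intro summable_comparison_test'[OF summable_level_tail[of n], of 0]) auto

lemma tree_sum_nonneg: "i < 2 ^ n ==> 0 <= tree_sum a n i"
 unfolding tree_sum_def by (intro suminf_nonneg summable_descendants descendants_sum_bounds)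

text \<open>This recursion makes the tree sum a control function on dyadic cells: it is
  superadditive over the two children, and the surplus \<open>a n i\<close> pays for the defect at
  the midpoint.\<close>

lemma tree_sum_rec:
 assumes "i < 2 ^ n"
 shows "tree_sum a n i = a n i + tree_sum a (Suc n) (2 * i) + tree_sum a (Suc n) (Suc (2 * i))"
proof -
 have i2: "2 * i < 2 ^ Suc n" "Suc (2 * i) < 2 ^ Suc n" using assms by auto
 have "tree_sum a n i = (\<Sum>k. \<Sum>j\<in>{i * 2 ^ Suc k..<Suc i * 2 ^ Suc k}. a (n + Suc k) j) + a n i"
  unfolding tree_sum_def using suminf_split_head[OF summable_descendants[OF assms]] by simp
 also have "(\<Sum>k. \<Sum>j\<in>{i * 2 ^ Suc k..<Suc i * 2 ^ Suc k}. a (n + Suc k) j)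
   = tree_sum a (Suc n) (2 * i) + tree_sum a (Suc n) (Suc (2 * i))"
  unfolding tree_sum_def sum_descendants_children
  using suminf_add[OF summable_descendants[OF i2(1)] summable_descendants[OF i2(2)]] by simp
 finally show ?thesis by simp
qed

lemma tree_sum_ge: "i < 2 ^ n ==> a n i <= tree_sum a n i"
 using tree_sum_rec[of i n] tree_sum_nonneg[of "2 * i" "Suc n"] tree_sum_nonneg[of "Suc (2 * i)" "Suc n"] by simp

lemma tree_sum_le_tail: "i < 2 ^ n ==> tree_sum a n i <= (\<Sum>k. level_sum a (n + k))"
 unfolding tree_sum_def
 by (intro suminf_le summable_descendants summable_level_tail descendants_sum_bounds)

lemma level_sum_tree_sum: "(\<Sum>i<2 ^ n. tree_sum a n i) = (\<Sum>k. level_sum a (n + k))"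
proof -
 have "(\<Sum>i<2 ^ n. tree_sum a n i) = (\<Sum>k. \<Sum>i<2 ^ n. \<Sum>j\<in>{i * 2 ^ k..<Suc i * 2 ^ k}. a (n + k) j)"
  unfolding tree_sum_def by (rule suminf_sum[symmetric], rule summable_descendants) simp
 also have "\<dots> = (\<Sum>k. level_sum a (n + k))"
  unfolding sum_over_descendants by (simp only: level_sum_def power_add)
 finally show ?thesis .
qed

lemma level_tail_tendsto_0: "(%n. \<Sum>k. level_sum a (n + k)) \<longlonglongrightarrow> 0"
 using suminf_exist_split2[of "level_sum a"] a by (simp add: tree_summable_def add.commute)

end

text \<open>A discrete sewing lemma: the weights \<open>B\<close> absorb the multiplicative errors \<open>1 + C u\<close> that accumulate
 along the bisection tree.\<close>

lemma tree_induction: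
 fixes \<Theta> :: "real => real => real" and B u :: "nat => real" and a w :: "nat => nat => real"
 assumes T: "0 < T" and N: "n0 <= N"
  and base: "\<And>i s t. i < 2 ^ N ==> s \<in> G ==> t \<in> G ==> dpt T N i <= s ==> s <= t ==> t <= dpt T N (Suc i) ==>
   \<Theta> s t <= B N * w N i"
  and step: "\<And>n i s r t. n0 <= n ==> n < N ==> i < 2 ^ n ==> s \<in> G ==> r \<in> G ==> t \<in> G ==>
   dpt T n i <= s ==> s <= r ==> r <= t ==> t <= dpt T n (Suc i) ==>
   \<Theta> s r <= B (Suc n) * w (Suc n) (2 * i) ==>
   \<Theta> s t <= \<Theta> s r + \<Theta> r t + C * u n * \<Theta> s r + C * a n i"
  and G: "\<And>n i s t. n < N ==> i < 2 ^ n ==> s \<in> G ==> t \<in> G ==> s <= dpt T (Suc n) (Suc (2 * i)) ==>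
   dpt T (Suc n) (Suc (2 * i)) <= t ==> dpt T (Suc n) (Suc (2 * i)) \<in> G"
  and w: "\<And>n i. n0 <= n ==> n < N ==> i < 2 ^ n ==> w (Suc n) (2 * i) + w (Suc n) (Suc (2 * i)) + a n i <= w n i"
  and nonneg: "\<And>n i. n0 <= n ==> n <= N ==> i < 2 ^ n ==> 0 <= w n i" "\<And>n i. n0 <= n ==> n < N ==> i < 2 ^ n ==> 0 <= a n i"
   "\<And>n. 0 <= u n" "0 <= C"
  and B: "\<And>n. (1 + C * u n) * B (Suc n) <= B n" "\<And>n. C <= B n"
  and n: "n0 <= n" "n <= N" and i: "i < 2 ^ n" and st: "s \<in> G" "t \<in> G" "dpt T n i <= s" "s <= t" "t <= dpt T n (Suc i)"
 shows "\<Theta> s t <= B n * w n i"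
 using n(2,1) i st
proof (induction n arbitrary: i s t rule: inc_induct)
 case base
 then show ?case using assms(3) by blast
next
 case (step n)
 let ?r = "dpt T (Suc n) (Suc (2 * i))"
 have i2: "2 * i < 2 ^ Suc n" "Suc (2 * i) < 2 ^ Suc n" using step.prems by auto
 have ends: "dpt T (Suc n) (2 * i) = dpt T n i" "dpt T (Suc n) (Suc (Suc (2 * i))) = dpt T n (Suc i)"
  using dpt_double[of T n "Suc i"] by (simp_all add: dpt_double)
 have n0: "n0 <= Suc n" using step.prems by simp
 note IH1 = step.IH[OF n0 i2(1)] and IH2 = step.IH[OF n0 i2(2)]
 have B0: "0 <= B m" for m using B(2)[of m] nonneg(4) by simp
 have Bs: "B (Suc n) <= B n"
 proof -
  have "1 * B (Suc n) <= (1 + C * u n) * B (Suc n)"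
   using B0 nonneg(3)[of n] nonneg(4) by (intro mult_right_mono) auto
  with B(1)[of n] show ?thesis by simp
 qed
 have sN: "Suc n <= N" using step.hyps by simp
 note wn = nonneg(1)[OF n0 sN i2(1)] nonneg(1)[OF n0 sN i2(2)] nonneg(2)[OF step.prems(1) step.hyps(2) step.prems(2)]
 note wr = w[OF step.prems(1) step.hyps(2) step.prems(2)]
 have sub: "B (Suc n) * w (Suc n) (2 * i) <= B n * w n i" "B (Suc n) * w (Suc n) (Suc (2 * i)) <= B n * w n i"
  using wn wr Bs B0 by (auto intro!: mult_mono)
 \<comment> \<open>Either the interval lies in one child, or it contains the midpoint, which then
   belongs to \<open>G\<close> and splits it.\<close>
 consider "t <= ?r" | "?r <= s" | "s <= ?r" "?r <= t" by linarith
 then show ?case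
 proof cases
  case 1
  then show ?thesis using IH1[of s t] step.prems sub ends by auto
 next
  case 2
  then show ?thesis using IH2[of s t] step.prems sub ends by auto
 next
  case 3
  then have r: "?r \<in> G" using G step.prems step.hyps by blast
  have 31: "\<Theta> s ?r <= B (Suc n) * w (Suc n) (2 * i)" using IH1[of s ?r] r step.prems 3 ends by auto
  have 32: "\<Theta> ?r t <= B (Suc n) * w (Suc n) (Suc (2 * i))" using IH2[of ?r t] r step.prems 3 ends by auto
  have "\<Theta> s t <= \<Theta> s ?r + \<Theta> ?r t + C * u n * \<Theta> s ?r + C * a n i"
   using assms(4)[OF step.prems(1) step.hyps(2) step.prems(2)] step.prems r 3 31 by blast
  also have "\<dots> = (1 + C * u n) * \<Theta> s ?r + \<Theta> ?r t + C * a n i" by (simp add: algebra_simps)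
  also have "\<dots> <= (1 + C * u n) * (B (Suc n) * w (Suc n) (2 * i)) + (1 + C * u n) * (B (Suc n) * w (Suc n) (Suc (2 * i))) + B n * a n i"
  proof (intro add_mono mult_left_mono mult_right_mono 31 B(2) wn)
   have "0 <= B (Suc n) * w (Suc n) (Suc (2 * i))" using B0 wn by simp
   from mult_right_mono[OF _ this, of 1 "1 + C * u n"]
   have "B (Suc n) * w (Suc n) (Suc (2 * i)) <= (1 + C * u n) * (B (Suc n) * w (Suc n) (Suc (2 * i)))"
    using nonneg(3)[of n] nonneg(4) by simp
   with 32 show "\<Theta> ?r t <= (1 + C * u n) * (B (Suc n) * w (Suc n) (Suc (2 * i)))" by linarith
  qed (use nonneg(3)[of n] nonneg(4) in auto)
  also have "\<dots> = ((1 + C * u n) * B (Suc n)) * (w (Suc n) (2 * i) + w (Suc n) (Suc (2 * i))) + B n * a n i"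
   by (simp add: algebra_simps)
  also have "\<dots> <= B n * (w (Suc n) (2 * i) + w (Suc n) (Suc (2 * i))) + B n * a n i"
   using B(1)[of n] wn by (intro add_mono mult_right_mono) auto
  also have "\<dots> = B n * (w (Suc n) (2 * i) + w (Suc n) (Suc (2 * i)) + a n i)"
   by (simp add: algebra_simps)
  also have "\<dots> <= B n * w n i" using wr B0 by (intro mult_left_mono) auto
  finally show ?thesis .
 qed
qed

text \<open>An upper bound for the product of the factors \<open>1 + C * u k\<close> over
  \<open>k >= n\<close>; the prefactor \<open>C\<close> lets it dominate the additive constant as
  well.\<close>

definition tree_weight :: "real => (nat => real) => nat => real" where
 "tree_weight C u n = C * exp (C * (\<Sum>k. u (n + k)))"

lemma tree_weight:
 assumes "summable u" "\<And>n. 0 <= u n" "0 <= C"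
 shows "(1 + C * u n) * tree_weight C u (Suc n) <= tree_weight C u n" "C <= tree_weight C u n"
  "tree_weight C u n <= tree_weight C u 0"
proof -
 have s: "summable (%k. u (n + k))" for n
  using summable_ignore_initial_segment[OF assms(1), of n] by (simp add: add.commute)
 have "(\<Sum>k. u (n + k)) = (\<Sum>k. u (Suc n + k)) + u n"
  using suminf_split_head[OF s[of n]] by simp
 then have e: "tree_weight C u n = exp (C * u n) * tree_weight C u (Suc n)"
  by (simp add: tree_weight_def algebra_simps exp_add)
 have nn: "0 <= tree_weight C u n" for n using assms(3) by (simp add: tree_weight_def)
 show "(1 + C * u n) * tree_weight C u (Suc n) <= tree_weight C u n"
  unfolding e by (intro mult_right_mono nn exp_ge_add_one_self)
 have "0 <= C * (\<Sum>k. u (n + k))" using assms s by (intro mult_nonneg_nonneg suminf_nonneg) auto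
 then show "C <= tree_weight C u n"
  using mult_left_mono[of 1 "exp (C * (\<Sum>k. u (n + k)))" C] assms(3) by (simp add: tree_weight_def)
 have "(\<Sum>k. u (k + n)) <= (\<Sum>k. u k)"
  unfolding suminf_minus_initial_segment[OF assms(1), of n] using assms(2) by (simp add: sum_nonneg)
 then show "tree_weight C u n <= tree_weight C u 0"
  using assms(3) by (auto simp: tree_weight_def add.commute intro!: mult_left_mono)
qed

section \<open>Existence\<close>

definition chen :: "real => (real => real ^ 'n) => (real => real => real ^ 'n ^ 'n) => bool" where
 "chen T X XX \<longleftrightarrow> (\<forall>s r t. 0 <= s \<and> s <= r \<and> r <= t \<and> t <= T -->
   XX s t = XX s r + XX r t + tensor (X r - X s) (X t - X r))"

definition dominated ::
 "real => (real => real ^ 'n) => (real => real => real ^ 'n ^ 'n) => (nat => nat => real) => bool" where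
 "dominated T X XX U \<longleftrightarrow> (\<forall>n\<ge>1. \<forall>i<2 ^ n. \<forall>s t. dpt T n i <= s \<and> s <= t \<and> t <= dpt T n (Suc i) -->
   norm (X t - X s) <= U n i \<and> norm (XX s t) <= (U n i)\<^sup>2)"

lemma tensor_0 [simp]: "tensor 0 b = 0"
 by (simp add: tensor_def vec_eq_iff)

lemma chen_diag: "chen T X XX ==> 0 <= s ==> s <= T ==> XX s s = 0"
proof -
 assume "chen T X XX" "0 <= s" "s <= T"
 then have "XX s s = XX s s + XX s s + tensor (X s - X s) (X s - X s)"
  unfolding chen_def by blast
 then show ?thesis by simp
qed

lemma davie_remainder_diag: "chen T X XX ==> 0 <= s ==> s <= T ==> davie_remainder f X XX Y s s = 0"
 by (simp add: davie_remainder_def chen_diag contract_def)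

text \<open>The recursion fixes the grid values, and each cell is filled by one second-order step
  from its left end. At a right end the floor already selects the next cell; the two prescriptions
  agree there because a step of length zero is trivial by Chen's relation.\<close>

lemma euler_scheme:
 fixes X :: "real => real ^ 'n" and y :: "real ^ 'm"
 assumes T: "0 < T" and chen: "chen T X XX"
 obtains Y where "Y 0 = y"
  "\<And>k t. k < 2 ^ N ==> dpt T N k <= t ==> t <= dpt T N (Suc k) ==> davie_remainder f X XX Y (dpt T N k) t = 0"
proof -
 define e where "e z s t = z + f z *v (X t - X s) + contract (step_op f z) (XX s t)" for z s t
 define g where "g = rec_nat y (%k z. e z (dpt T N k) (dpt T N (Suc k)))"
 have g: "g 0 = y" "g (Suc k) = e (g k) (dpt T N k) (dpt T N (Suc k))" for k
  by (simp_all add: g_def)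
 define Y where "Y t = (let k = nat \<lfloor>t * 2 ^ N / T\<rfloor> in e (g k) (dpt T N k) t)" for t
 have e_diag: "e z s s = z" if "0 <= s" "s <= T" for z s
  using chen_diag[OF chen that] by (simp add: e_def contract_def)
 have Yg: "Y (dpt T N k) = g k" if "k <= 2 ^ N" for k
 proof -
  have "dpt T N k * 2 ^ N / T = real k" using T by (simp add: dpt_def)
  then show ?thesis using e_diag dpt_bounds[OF T that] by (simp add: Y_def Let_def)
 qed
 have Ye: "Y t = e (g k) (dpt T N k) t" if k: "k < 2 ^ N" and t: "dpt T N k <= t" "t <= dpt T N (Suc k)" for k t
 proof (cases "t = dpt T N (Suc k)")
  case True
  then show ?thesis using Yg[of "Suc k"] k g(2) by simp
 next
  case False
  with t have "dpt T N k <= t" "t < dpt T N (Suc k)" by simp_all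
  then have "real k <= t * 2 ^ N / T" "t * 2 ^ N / T < real k + 1"
   using T by (simp_all add: dpt_def field_simps)
  then have "\<lfloor>t * 2 ^ N / T\<rfloor> = int k" by (intro floor_unique) auto
  then show ?thesis by (simp add: Y_def Let_def)
 qed
 have "Y 0 = y" using Yg[of 0] g(1) by simp
 moreover have "davie_remainder f X XX Y (dpt T N k) t = 0"
  if "k < 2 ^ N" "dpt T N k <= t" "t <= dpt T N (Suc k)" for k t
  using Ye[OF that] Yg[of k] that by (simp add: davie_remainder_def e_def)
 ultimately show thesis using that by blast
qed

text \<open>The constant of \<open>davie_remainder_step\<close> in terms of the dimension
  \<open>d\<close> and of \<open>c = C2_norm f\<close>.\<close>

definition davie_const :: "real => real => real" where
 "davie_const d c = (let a = c + d * c\<^sup>2 + 1 in 2 * c * a\<^sup>2 + c * a + 2 * d * c\<^sup>2 * a)"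

lemma davie_const_nonneg: "0 <= d ==> 0 <= c ==> 0 <= davie_const d c"
 by (simp add: davie_const_def Let_def)

lemma increment_le_davie_remainder:
 fixes X :: "real => real ^ 'n" and Y :: "real => real ^ 'm"
 assumes "Cb2 f"
 shows "norm (Y t - Y s) <= C2_norm f * norm (X t - X s) + CARD('n) * (C2_norm f)\<^sup>2 * norm (XX s t)
  + norm (davie_remainder f X XX Y s t)"
proof -
 have e: "Y t - Y s = f (Y s) *v (X t - X s) + contract (step_op f (Y s)) (XX s t) + davie_remainder f X XX Y s t"
  by (simp add: davie_remainder_def)
 have 1: "norm (f (Y s) *v (X t - X s)) <= C2_norm f * norm (X t - X s)"
  using Cb2_norm_le(1)[OF assms, of "Y s"] by (intro order_trans[OF norm_matrix_vector_mult_le] mult_right_mono) auto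
 have 2: "norm (contract (step_op f (Y s)) (XX s t)) <= CARD('n) * (C2_norm f)\<^sup>2 * norm (XX s t)"
  using norm_step_op_le[OF assms, of "Y s"] by (intro order_trans[OF norm_contract_le] mult_right_mono mult_left_mono) auto
 show ?thesis unfolding e by (intro norm_triangle_mono 1 2) simp
qed

lemma norm_le_defect: "norm a <= norm b + norm c + norm (a - b - c)"
 by norm

text \<open>Induction from the mesh generation \<open>N\<close> to coarser cells. The defect
  estimate needs a remainder of size at most 1 on the left half; the induction hypothesis itself
  provides this, since \<open>small\<close> keeps the right-hand side below 1 from generation
  \<open>n0\<close> on. The resulting bound does not depend on \<open>N\<close>.\<close>

lemma euler_davie_bound:
 fixes X :: "real => real ^ 'n" and Y :: "real => real ^ 'm"
 assumes T: "0 < T" and chen: "chen T X XX" and dom: "dominated T X XX U" and f: "Cb2 f"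
  and U: "tree_summable (%n i. U n i ^ 3)" "\<And>n i. 1 <= n ==> i < 2 ^ n ==> U n i <= u n"
  and u: "summable u" "\<And>n. 0 <= u n"
  and n0: "1 <= n0" "n0 <= N" "\<And>n. n0 <= n ==> u n <= 1"
  and small: "\<And>n i. n0 <= n ==> i < 2 ^ n ==>
   tree_weight (davie_const CARD('n) (C2_norm f)) u 0 * tree_sum (%n i. U n i ^ 3) n i <= 1"
  and Y: "\<And>k t. k < 2 ^ N ==> dpt T N k <= t ==> t <= dpt T N (Suc k) ==> davie_remainder f X XX Y (dpt T N k) t = 0"
  and n: "n0 <= n" "n <= N" and i: "i < 2 ^ n" and st: "dpt T n i <= s" "s <= t" "t <= dpt T n (Suc i)"
 shows "norm (davie_remainder f X XX Y s t)
  <= tree_weight (davie_const CARD('n) (C2_norm f)) u 0 * tree_sum (%n i. U n i ^ 3) n i"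
proof -
 define C where "C = davie_const CARD('n) (C2_norm f)"
 let ?W = "tree_sum (%n i. U n i ^ 3)"
 have C0: "0 <= C" unfolding C_def using davie_const_nonneg Cb2_norm_le(4)[OF f] by simp
 note B = tree_weight[OF u C0]
 have U3: "0 <= U n i ^ 3" if "i < 2 ^ n" for n i using U(1) that by (simp add: tree_summable_def)
 then have U0: "0 <= U n i" if "i < 2 ^ n" for n i
  using zero_le_odd_power[of 3 "U n i"] that by simp
 have Wle: "0 <= ?W n i" "U n i ^ 3 <= ?W n i" if "i < 2 ^ n" for n i
  using that tree_sum_nonneg[OF U(1)] tree_sum_ge[OF U(1)] by auto
 have bd: "0 <= s \<and> t <= T" if "dpt T n i <= s" "t <= dpt T n (Suc i)" "i < 2 ^ n" for n i s t
  using dpt_bounds[OF T, of i n] dpt_bounds[OF T, of "Suc i" n] that by auto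
 have defect: "norm (davie_remainder f X XX Y s t - davie_remainder f X XX Y s r - davie_remainder f X XX Y r t)
   <= C * (U n i ^ 3 + U n i * norm (davie_remainder f X XX Y s r))"
  if "n0 <= n" "i < 2 ^ n" "dpt T n i <= s" "s <= r" "r <= t" "t <= dpt T n (Suc i)"
   "norm (davie_remainder f X XX Y s r) <= 1" for n i s r t
 proof -
  have n1: "1 <= n" using that n0 by simp
  have d: "norm (X t' - X s') <= U n i \<and> norm (XX s' t') <= (U n i)\<^sup>2" if "dpt T n i <= s'" "s' <= t'" "t' <= dpt T n (Suc i)" for s' t'
   using dom n1 \<open>i < 2 ^ n\<close> that by (simp add: dominated_def)
  have chen': "XX s t = XX s r + XX r t + tensor (X r - X s) (X t - X r)"
   using chen that bd[OF that(3,6,2)] by (simp add: chen_def)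
  have "norm (davie_remainder f X XX Y s t - davie_remainder f X XX Y s r - davie_remainder f X XX Y r t)
   <= (2 * C2_norm f * (C2_norm f + CARD('n) * (C2_norm f)\<^sup>2 + 1)\<^sup>2 + C2_norm f * (C2_norm f + CARD('n) * (C2_norm f)\<^sup>2 + 1)
    + 2 * CARD('n) * (C2_norm f)\<^sup>2 * (C2_norm f + CARD('n) * (C2_norm f)\<^sup>2 + 1))
    * (U n i ^ 3 + U n i * norm (davie_remainder f X XX Y s r))"
   using d[of s r] d[of r t] that U0 order_trans[OF U(2)[OF n1] n0(3)]
   by (intro davie_remainder_step[OF f chen']) auto
  then show ?thesis by (simp add: C_def davie_const_def Let_def)
 qed
 have "norm (davie_remainder f X XX Y s t) <= tree_weight C u n * ?W n i"
 proof (rule tree_induction[where \<Theta> = "%s t. norm (davie_remainder f X XX Y s t)" and B = "tree_weight C u" and w = "?W"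
   and C = C and u = u and a = "%n i. U n i ^ 3" and N = N and G = UNIV and n = n and i = i and s = s and t = t, of T n0])
  fix i s t assume i: "i < 2 ^ N" and st: "dpt T N i <= s" "s <= t" "t <= dpt T N (Suc i)"
  \<comment> \<open>Inside a mesh cell both remainders from the left end vanish, so the remainder
    from \<open>s\<close> to \<open>t\<close> is the negative of a single defect.\<close>
  have "davie_remainder f X XX Y (dpt T N i) s = 0" "davie_remainder f X XX Y (dpt T N i) t = 0"
   using Y[OF i, of s] Y[OF i, of t] st by auto
  then have "norm (davie_remainder f X XX Y s t) <= C * U N i ^ 3"
   using defect[OF n0(2) i, of "dpt T N i" s t] st by simp
  also have "\<dots> <= tree_weight C u N * ?W N i"
   using B(2)[of N] C0 Wle[OF i] U3[OF i] by (intro mult_mono) auto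
  finally show "norm (davie_remainder f X XX Y s t) <= tree_weight C u N * ?W N i" .
 next
  fix n i s r t
  assume n: "n0 <= n" "n < N" and i: "i < 2 ^ n"
   and st: "dpt T n i <= s" "s <= r" "r <= t" "t <= dpt T n (Suc i)"
   and IH: "norm (davie_remainder f X XX Y s r) <= tree_weight C u (Suc n) * ?W (Suc n) (2 * i)"
  have i2: "2 * i < 2 ^ Suc n" using i by simp
  have "tree_weight C u (Suc n) * ?W (Suc n) (2 * i) <= tree_weight C u 0 * ?W (Suc n) (2 * i)"
   using B(3) Wle[OF i2] by (intro mult_right_mono) auto
  also have "\<dots> <= 1" using small[of "Suc n" "2 * i"] n i2 by (simp add: C_def)
  finally have "norm (davie_remainder f X XX Y s r) <= 1" using IH by simp
  from defect[OF n(1) i st this]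
  have "norm (davie_remainder f X XX Y s t) <= norm (davie_remainder f X XX Y s r) + norm (davie_remainder f X XX Y r t)
    + C * (U n i ^ 3 + U n i * norm (davie_remainder f X XX Y s r))"
   using norm_le_defect[of "davie_remainder f X XX Y s t" "davie_remainder f X XX Y s r" "davie_remainder f X XX Y r t"]
   by linarith
  also have "C * (U n i ^ 3 + U n i * norm (davie_remainder f X XX Y s r))
    <= C * (U n i ^ 3 + u n * norm (davie_remainder f X XX Y s r))"
   using U(2)[of n i] n n0(1) i C0 by (intro mult_left_mono add_left_mono mult_right_mono) auto
  finally show "norm (davie_remainder f X XX Y s t) <= norm (davie_remainder f X XX Y s r) + norm (davie_remainder f X XX Y r t)
    + C * u n * norm (davie_remainder f X XX Y s r) + C * U n i ^ 3"
   by (simp add: algebra_simps)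
 next
  show "?W (Suc n) (2 * i) + ?W (Suc n) (Suc (2 * i)) + U n i ^ 3 <= ?W n i" if "i < 2 ^ n" for n i
   using tree_sum_rec[OF U(1) that] by simp
 qed ((rule T n0(2) UNIV_I Wle(1) U3 u(2) C0 B(1) B(2) n i st; (assumption)?)+)
 also have "\<dots> <= tree_weight C u 0 * ?W n i" using B(3) Wle[OF i] by (intro mult_right_mono) auto
 finally show ?thesis by (simp add: C_def)
qed

lemma bounded_linear_contract: "bounded_linear (contract W)"
proof (rule bounded_linear_intro)
 show "contract W (B + B') = contract W B + contract W B'" for B B' by (rule contract_add_right)
 show "contract W (r *\<^sub>R B) = r *\<^sub>R contract W B" for r B
  by (simp add: contract_def matrix_vector_mult_scaleR scaleR_sum_right)
 show "norm (contract W B) <= norm B * (CARD('a) * norm W)" for B :: "real^'a^'a"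
  using norm_contract_le[of W B] by (simp add: mult_ac)
qed

lemma continuous_on_dyadic_cells:
 fixes Y :: "real => 'a::topological_space"
 assumes T: "0 < T" and c: "\<And>k. k < 2 ^ N ==> continuous_on {dpt T N k..dpt T N (Suc k)} Y"
 shows "continuous_on {0..T} Y"
proof -
 have "continuous_on {0..dpt T N k} Y" if "k <= 2 ^ N" for k
  using that
 proof (induction k)
  case (Suc k)
  have "{0..dpt T N (Suc k)} = {0..dpt T N k} \<union> {dpt T N k..dpt T N (Suc k)}"
   using dpt_mono[OF T, of 0 k N] dpt_mono[OF T, of k "Suc k" N] by auto
  then show ?case using Suc c[of k] by (auto intro!: continuous_on_closed_Un)
 qed simp
 from this[of "2 ^ N"] show ?thesis by simp
qed

lemma euler_continuous:
 fixes X :: "real => real ^ 'n" and Y :: "real => real ^ 'm"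
 assumes T: "0 < T" and X: "continuous_on {0..T} X" and XX: "\<And>s. 0 <= s ==> continuous_on {s..T} (XX s)"
  and Y: "\<And>k t. k < 2 ^ N ==> dpt T N k <= t ==> t <= dpt T N (Suc k) ==> davie_remainder f X XX Y (dpt T N k) t = 0"
 shows "continuous_on {0..T} Y"
proof (rule continuous_on_dyadic_cells[OF T])
 fix k :: nat assume k: "k < 2 ^ N"
 let ?l = "dpt T N k"
 have b: "0 <= ?l" "dpt T N (Suc k) <= T" using dpt_bounds[OF T, of k N] dpt_bounds[OF T, of "Suc k" N] k by auto
 have cX: "continuous_on {?l..dpt T N (Suc k)} X" "continuous_on {?l..dpt T N (Suc k)} (XX ?l)"
  by (rule continuous_on_subset[OF X], use b in auto) (rule continuous_on_subset[OF XX[OF b(1)]], use b in auto)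
 have "continuous_on {?l..dpt T N (Suc k)} (%t. Y ?l + f (Y ?l) *v (X t - X ?l) + contract (step_op f (Y ?l)) (XX ?l t))"
  by (intro continuous_intros bounded_linear.continuous_on[OF matrix_vector_mul_bounded_linear]
    bounded_linear.continuous_on[OF bounded_linear_contract] cX)
 then show "continuous_on {?l..dpt T N (Suc k)} Y"
 proof (rule continuous_on_eq)
  show "Y ?l + f (Y ?l) *v (X t - X ?l) + contract (step_op f (Y ?l)) (XX ?l t) = Y t"
   if "t \<in> {?l..dpt T N (Suc k)}" for t
   using Y[OF k, of t] that by (simp add: davie_remainder_def algebra_simps)
 qed
qed

lemma davie_remainder_tendsto:
 fixes X :: "real => real ^ 'n" and Y :: "real => real ^ 'm"
 assumes f: "Cb2 f" and "(%k. Z k s) \<longlonglongrightarrow> Y s" "(%k. Z k t) \<longlonglongrightarrow> Y t"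
 shows "(%k. davie_remainder f X XX (Z k) s t) \<longlonglongrightarrow> davie_remainder f X XX Y s t"
proof -
 have lip: "(%k. g (Z k s)) \<longlonglongrightarrow> g (Y s)"
  if g: "\<And>a b. norm (g b - g a) <= K * norm (b - a)" for g :: "real ^ 'm => 'z::real_normed_vector" and K
 proof (rule LIM_zero_cancel, rule Lim_null_comparison)
  show "\<forall>\<^sub>F k in sequentially. norm (g (Z k s) - g (Y s)) <= K * norm (Z k s - Y s)"
   by (rule always_eventually, rule allI, rule g)
  have "(%k. K * norm (Z k s - Y s)) \<longlonglongrightarrow> K * norm (Y s - Y s)"
   by (intro tendsto_intros assms)
  then show "(%k. K * norm (Z k s - Y s)) \<longlonglongrightarrow> 0" by simp
 qed
 have 1: "(%k. f (Z k s) *v (X t - X s)) \<longlonglongrightarrow> f (Y s) *v (X t - X s)"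
 proof (rule lip)
  fix a b
  have "norm (f b *v (X t - X s) - f a *v (X t - X s)) <= (C2_norm f * norm (b - a)) * norm (X t - X s)"
   unfolding matrix_vector_mult_diff_rdistrib[symmetric]
   using Cb2_lipschitz(1)[OF f, of b a] by (intro order_trans[OF norm_matrix_vector_mult_le] mult_right_mono) auto
  then show "norm (f b *v (X t - X s) - f a *v (X t - X s)) <= (C2_norm f * norm (X t - X s)) * norm (b - a)"
   by (simp add: mult_ac)
 qed
 have 2: "(%k. contract (step_op f (Z k s)) (XX s t)) \<longlonglongrightarrow> contract (step_op f (Y s)) (XX s t)"
 proof (rule lip)
  fix a b
  have "norm (contract (step_op f b) (XX s t) - contract (step_op f a) (XX s t))
    <= CARD('n) * (2 * (C2_norm f)\<^sup>2 * norm (b - a)) * norm (XX s t)"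
   unfolding contract_diff_left[symmetric]
   using step_op_lipschitz[OF f, of b a] by (intro order_trans[OF norm_contract_le] mult_right_mono mult_left_mono) auto
  then show "norm (contract (step_op f b) (XX s t) - contract (step_op f a) (XX s t))
    <= (CARD('n) * (2 * (C2_norm f)\<^sup>2) * norm (XX s t)) * norm (b - a)"
   by (simp add: mult_ac)
 qed
 show ?thesis unfolding davie_remainder_def by (intro tendsto_intros assms 1 2)
qed

text \<open>Arzela-Ascoli for the Euler schemes. The uniform bound controls increments over cells of
  generation \<open>n\<close> for schemes of mesh generation at least \<open>n\<close>; this
  suffices for equicontinuity because only finitely many schemes are left over. The bound survives
  pointwise convergence, as the remainder depends on two values of the path.\<close>

theorem davie_existence:
 fixes X :: "real => real ^ 'n" and y :: "real ^ 'm"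
 assumes T: "0 < T" and chen: "chen T X XX" and dom: "dominated T X XX U" and f: "Cb2 f"
  and U: "tree_summable (%n i. U n i ^ 3)" "\<And>n i. 1 <= n ==> i < 2 ^ n ==> U n i <= u n"
  and u: "summable u" "\<And>n. 0 <= u n"
  and W: "\<And>n i. 1 <= n ==> i < 2 ^ n ==> tree_sum (%n i. U n i ^ 3) n i <= w n" and w: "w \<longlonglongrightarrow> 0"
  and cont: "continuous_on {0..T} X" "\<And>s. 0 <= s ==> continuous_on {s..T} (XX s)"
  and n0: "1 <= n0" "\<And>n. n0 <= n ==> u n <= 1"
   "\<And>n. n0 <= n ==> tree_weight (davie_const CARD('n) (C2_norm f)) u 0 * w n <= 1"
 obtains Y where "continuous_on {0..T} Y" "Y 0 = y"
  "\<And>n i s t. n0 <= n ==> i < 2 ^ n ==> dpt T n i <= s ==> s <= t ==> t <= dpt T n (Suc i) ==>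
   norm (davie_remainder f X XX Y s t)
   <= tree_weight (davie_const CARD('n) (C2_norm f)) u 0 * tree_sum (%n i. U n i ^ 3) n i"
proof -
 define c where "c = C2_norm f"
 define B where "B = tree_weight (davie_const CARD('n) c) u 0"
 let ?W = "tree_sum (%n i. U n i ^ 3)"
 have c0: "0 <= c" unfolding c_def using Cb2_norm_le(4)[OF f] by simp
 have B0: "0 <= B" unfolding B_def
  using tree_weight(2)[OF u davie_const_nonneg, of "CARD('n)" c 0] davie_const_nonneg[of "CARD('n)" c] c0 by simp
 have small: "B * ?W n i <= 1" if "n0 <= n" "i < 2 ^ n" for n i
  using n0(3)[OF that(1)] mult_left_mono[OF W[of n i] B0] that n0(1) by (simp add: B_def c_def)
 define P where "P N Z \<longleftrightarrow> Z 0 = y \<and> continuous_on {0..T} Z \<and> (\<forall>n i s t. n0 <= n --> n <= N --> i < 2 ^ n -->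
   dpt T n i <= s --> s <= t --> t <= dpt T n (Suc i) --> norm (davie_remainder f X XX Z s t) <= B * ?W n i)" for N Z
 have "\<exists>Z. P N Z" if N: "n0 <= N" for N
 proof -
  obtain Z where Z: "Z 0 = y"
   "\<And>k t. k < 2 ^ N ==> dpt T N k <= t ==> t <= dpt T N (Suc k) ==> davie_remainder f X XX Z (dpt T N k) t = 0"
   using euler_scheme[OF T chen, of y N f] by blast
  have "norm (davie_remainder f X XX Z s t) <= B * ?W n i"
   if "n0 <= n" "n <= N" "i < 2 ^ n" "dpt T n i <= s" "s <= t" "t <= dpt T n (Suc i)" for n i s t
   unfolding B_def c_def
   by (rule euler_davie_bound[OF T chen dom f U u n0(1) N n0(2) small[unfolded B_def c_def] Z(2) that]; assumption)
  moreover have "continuous_on {0..T} Z" by (rule euler_continuous[OF T cont Z(2)]; assumption)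
  ultimately show ?thesis using Z(1) unfolding P_def by blast
 qed
 then obtain Z where ZP: "\<And>N. n0 <= N ==> P N (Z N)" by metis
 then have Zc: "\<And>N. n0 <= N ==> continuous_on {0..T} (Z N)"
  and Z: "\<And>N. n0 <= N ==> Z N 0 = y"
  "\<And>N n i s t. n0 <= n ==> n <= N ==> i < 2 ^ n ==> dpt T n i <= s ==> s <= t ==> t <= dpt T n (Suc i) ==>
   norm (davie_remainder f X XX (Z N) s t) <= B * ?W n i"
 proof -
  show "n0 <= N ==> continuous_on {0..T} (Z N)" "n0 <= N ==> Z N 0 = y" for N
   using ZP[of N] unfolding P_def by blast+
  show "norm (davie_remainder f X XX (Z N) s t) <= B * ?W n i"
   if "n0 <= n" "n <= N" "i < 2 ^ n" "dpt T n i <= s" "s <= t" "t <= dpt T n (Suc i)" for N n i s t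
   using ZP[of N] that order_trans[OF that(1,2)] unfolding P_def by blast
 qed
 \<comment> \<open>A common modulus of continuity over one cell of generation \<open>n\<close>, for
   all schemes of mesh generation at least \<open>n\<close>.\<close>
 define e where "e n = c * u n + CARD('n) * c\<^sup>2 * u n + B * w n" for n
 have w0: "0 <= w n" if "1 <= n" for n
  using W[of n 0] tree_sum_nonneg[OF U(1), of 0 n] that by simp
 have Zinc: "norm (Z N t - Z N s) <= e n"
  if "n0 <= n" "n <= N" "i < 2 ^ n" "dpt T n i <= s" "s <= t" "t <= dpt T n (Suc i)" for N n i s t
 proof -
  have n1: "1 <= n" using that n0 by simp
  have d: "norm (X t - X s) <= u n" "norm (XX s t) <= u n"
  proof -
   have a: "norm (X t - X s) <= U n i" "norm (XX s t) <= (U n i)\<^sup>2"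
    using dom n1 that by (auto simp: dominated_def)
   have "U n i <= u n" "0 <= U n i" using U(2)[of n i] n1 that a(1) norm_ge_zero order_trans by blast+
   moreover from this have "(U n i)\<^sup>2 <= u n"
    using n0(2)[OF that(1)] mult_mono[of "U n i" "u n" "U n i" 1] u(2)[of n] by (simp add: power2_eq_square)
   ultimately show "norm (X t - X s) <= u n" "norm (XX s t) <= u n" using a by auto
  qed
  have "norm (Z N t - Z N s) <= c * norm (X t - X s) + CARD('n) * c\<^sup>2 * norm (XX s t) + norm (davie_remainder f X XX (Z N) s t)"
   unfolding c_def by (rule increment_le_davie_remainder[OF f])
  also have "\<dots> <= c * u n + CARD('n) * c\<^sup>2 * u n + B * ?W n i"
   using d c0 Z(2)[OF that] by (intro add_mono mult_left_mono) auto
  also have "\<dots> <= e n" unfolding e_def using W[OF n1 that(3)] B0 by (intro add_left_mono mult_left_mono) auto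
  finally show ?thesis .
 qed
 have e_nn: "0 <= e n" if "n0 <= n" for n
  unfolding e_def using c0 u(2) B0 w0[of n] that n0(1) by simp
 have e0: "e \<longlonglongrightarrow> 0"
 proof -
  have "e \<longlonglongrightarrow> c * 0 + CARD('n) * c\<^sup>2 * 0 + B * 0"
   unfolding e_def by (intro tendsto_intros summable_LIMSEQ_zero[OF u(1)] w)
  then show ?thesis by simp
 qed
 \<comment> \<open>Uniform boundedness: at most \<open>2 ^ n0\<close> cells of generation
   \<open>n0\<close> are crossed, each with an increment of at most \<open>e n0\<close>.\<close>
 have Zend: "norm (Z N (dpt T n0 i) - y) <= real i * e n0" if "n0 <= N" "i <= 2 ^ n0" for N i
  using that(2)
 proof (induction i)
  case (Suc i)
  have "norm (Z N (dpt T n0 (Suc i)) - Z N (dpt T n0 i)) <= e n0"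
   using Zinc[of n0 N i "dpt T n0 i" "dpt T n0 (Suc i)"] that Suc.prems T by (simp add: dpt_mono)
  moreover have "norm (Z N (dpt T n0 i) - y) <= real i * e n0" using Suc by simp
  ultimately show ?case
   using norm_triangle_ineq[of "Z N (dpt T n0 (Suc i)) - Z N (dpt T n0 i)" "Z N (dpt T n0 i) - y"]
   by (simp add: algebra_simps)
 qed (use Z(1)[OF that(1)] in simp)
 have Zbd: "norm (Z N t) <= norm y + (2 ^ n0 + 1) * e n0" if "n0 <= N" "t \<in> {0..T}" for N t
 proof -
  have t01: "0 <= t" "t <= T" using that by auto
  obtain i where i: "i < 2 ^ n0" "dpt T n0 i <= t" "t <= dpt T n0 (Suc i)"
   by (rule in_dyadic_cell[OF T t01, of n0])
  have "real i * e n0 <= 2 ^ n0 * e n0"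
  proof (rule mult_right_mono)
   have "real i < real (2 ^ n0)" using i(1) by (simp only: of_nat_less_iff)
   then show "real i <= 2 ^ n0" by simp
  qed (use e_nn in auto)
  moreover have "norm (Z N t - Z N (dpt T n0 i)) <= e n0" using Zinc[of n0 N i] that i by simp
  moreover have "norm (Z N (dpt T n0 i) - y) <= real i * e n0" using Zend[OF that(1), of i] i by simp
  ultimately show ?thesis
   using norm_triangle_ineq[of "Z N t - Z N (dpt T n0 i)" "Z N (dpt T n0 i) - y"]
    norm_triangle_ineq[of "Z N t - y" y]
   by (simp add: algebra_simps)
 qed
 obtain g k where g: "continuous_on {0..T} g" "strict_mono (k :: nat => nat)"
  "\<And>\<epsilon>. 0 < \<epsilon> ==> \<exists>M. \<forall>n x. n \<ge> M \<and> x \<in> {0..T} --> norm (Z (n0 + k n) x - g x) < \<epsilon>"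
 proof (rule Arzela_Ascoli[of "{0..T}" "%N. Z (n0 + N)" "norm y + (2 ^ n0 + 1) * e n0"])
  show "norm (Z (n0 + n) x) <= norm y + (2 ^ n0 + 1) * e n0" if "x \<in> {0..T}" for n x
   using Zbd[of "n0 + n"] that by simp
  fix x \<epsilon> :: real assume x: "x \<in> {0..T}" and \<epsilon>: "0 < \<epsilon>"
  obtain n1 where n1: "\<And>n. n1 <= n ==> e n < \<epsilon> / 2"
   using order_tendstoD(2)[OF e0, of "\<epsilon> / 2"] \<epsilon> by (auto simp: eventually_sequentially)
  define n where "n = max n0 n1"
  have n: "n0 <= n" "e n < \<epsilon> / 2" using n1 by (auto simp: n_def)
  have far: "norm (Z N t - Z N s) < \<epsilon>" if N: "n <= N" and st: "s \<in> {0..T}" "t \<in> {0..T}" "s <= t" "t - s <= T / 2 ^ n" for N s t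
  proof -
   obtain i j where ij: "i < 2 ^ n" "j < 2 ^ n" "j = i \<or> j = Suc i" "dpt T n i <= s" "s <= dpt T n (Suc i)"
    "dpt T n j <= t" "t <= dpt T n (Suc j)"
    using adjacent_cells[OF T, of s t n] st by auto
   from ij(3) show ?thesis
   proof
    assume "j = i"
    then show ?thesis using Zinc[OF n(1) N ij(1,4) st(3)] ij n(2) e_nn[OF n(1)] by simp
   next
    assume j: "j = Suc i"
    then have "norm (Z N t - Z N (dpt T n j)) <= e n" "norm (Z N (dpt T n j) - Z N s) <= e n"
     using Zinc[OF n(1) N ij(2) order_refl ij(6,7)] Zinc[OF n(1) N ij(1,4,5)] by simp_all
    then show ?thesis using n(2) by norm
   qed
  qed
  have "\<exists>d>0. \<forall>z\<in>{0..T}. norm (x - z) < d --> norm (Z (n0 + N) x - Z (n0 + N) z) < \<epsilon>" for N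
  proof -
   have "\<exists>d>0. \<forall>z\<in>{0..T}. norm (z - x) < d --> norm (Z (n0 + N) z - Z (n0 + N) x) < \<epsilon>"
    using Zc[of "n0 + N"] x \<epsilon> unfolding continuous_on_iff dist_norm by simp
   then show ?thesis
    by (simp only: norm_minus_commute[of x] norm_minus_commute[of "Z (n0 + N) x"])
  qed
  then obtain d where d: "\<And>N. 0 < d N" "\<And>N z. z \<in> {0..T} ==> norm (x - z) < d N ==> norm (Z (n0 + N) x - Z (n0 + N) z) < \<epsilon>"
   by metis
  \<comment> \<open>The schemes with \<open>N < n\<close> are continuous one by one; all others
    share the scale \<open>T / 2 ^ n\<close>.\<close>
  define d' where "d' = Min (insert (T / 2 ^ n) (d ` {..<n}))"
  have d': "0 < d'" "d' <= T / 2 ^ n" "\<And>N. N < n ==> d' <= d N"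
   using d(1) T by (auto simp: d'_def)
  show "\<exists>d>0. \<forall>N z. z \<in> {0..T} \<and> norm (x - z) < d --> norm (Z (n0 + N) x - Z (n0 + N) z) < \<epsilon>"
  proof (intro exI[of _ d'] conjI d' allI impI)
   fix N z assume z: "z \<in> {0..T} \<and> norm (x - z) < d'"
   show "norm (Z (n0 + N) x - Z (n0 + N) z) < \<epsilon>"
   proof (cases "N < n")
    case True
    then show ?thesis using d(2)[of z N] d'(3)[of N] z by simp
   next
    case False
    show ?thesis
    proof (cases "x <= z")
     case True
     then show ?thesis using far[of "n0 + N" x z] False z x d'(2) by (auto simp: norm_minus_commute)
    next
     case xz: False
     then show ?thesis using far[of "n0 + N" z x] False z x d'(2) by auto
    qed
   qed
  qed
 qed auto
 have lim: "(%N. Z (n0 + k N) x) \<longlonglongrightarrow> g x" if "x \<in> {0..T}" for x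
  using g(3) that by (force simp: LIMSEQ_iff)
 show thesis
 proof (rule that[OF g(1)])
  have "(%N. Z (n0 + k N) 0) \<longlonglongrightarrow> g 0" using lim T by simp
  then show "g 0 = y" using Z(1) by (simp add: LIMSEQ_const_iff)
  fix n i s t assume n: "n0 <= n" "i < 2 ^ n" and st: "dpt T n i <= s" "s <= t" "t <= dpt T n (Suc i)"
  have st': "s \<in> {0..T}" "t \<in> {0..T}"
   using dpt_bounds[OF T, of i n] dpt_bounds[OF T, of "Suc i" n] n st by auto
  have "(%N. norm (davie_remainder f X XX (Z (n0 + k N)) s t)) \<longlonglongrightarrow> norm (davie_remainder f X XX g s t)"
   by (intro tendsto_norm davie_remainder_tendsto[OF f] lim st')
  moreover have "\<forall>\<^sub>F N in sequentially. norm (davie_remainder f X XX (Z (n0 + k N)) s t) <= B * ?W n i"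
   using eventually_ge_at_top[of n]
  proof eventually_elim
   fix N assume "n <= N"
   then have "n <= n0 + k N" using seq_suble[OF g(2), of N] by simp
   then show "norm (davie_remainder f X XX (Z (n0 + k N)) s t) <= B * ?W n i"
    using Z(2)[OF n(1) _ n(2) st] by blast
  qed
  ultimately show "norm (davie_remainder f X XX g s t)
    <= tree_weight (davie_const CARD('n) (C2_norm f)) u 0 * ?W n i"
   unfolding B_def[unfolded c_def, symmetric] by (rule tendsto_upperbound) simp
 qed
qed

section \<open>Uniqueness\<close>

text \<open>The constant of \<open>davie_difference_step\<close>, increased by 1 so that all tree
  weights built from it are at least 1.\<close>

definition difference_const :: "real => real => real => real" where
 "difference_const d c L = (let a = c + 2 * d * c\<^sup>2 + 1 in
   3 * c * a + c + L + d * (2 * c\<^sup>2 * a + c * L + 3 * c\<^sup>2) + 1)"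

text \<open>On a cell of generation \<open>n0\<close> at whose left end the paths agree, let
  \<open>\<mu>\<close> be the maximum of their distance. The tree bound for the difference of the
  remainders is \<open>\<mu>\<close> times a weighted tail of at most 1/2, plus an error of the
  finest generation that vanishes in the limit. Hence \<open>\<mu> = 0\<close>, and the cells are
  treated from left to right.\<close>

theorem davie_uniqueness:
 fixes X :: "real => real ^ 'n" and Y Z :: "real => real ^ 'm"
 assumes T: "0 < T" and chen: "chen T X XX" and dom: "dominated T X XX U"
  and f: "fderiv2_holder L \<delta> f" "\<delta> <= 1"
  and U: "tree_summable (%n i. U n i powr (2 + \<delta>))" "\<And>n i. 1 <= n ==> i < 2 ^ n ==> U n i <= u n"
  and u: "summable u" "\<And>n. 0 <= u n"
  and inc: "\<And>n i s t. 1 <= n ==> i < 2 ^ n ==> dpt T n i <= s ==> s <= t ==> t <= dpt T n (Suc i) ==>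
   norm (Y t - Y s) <= U n i \<and> norm (Z t - Z s) <= U n i \<and> norm (Y t - Y s - f (Y s) *v (X t - X s)) <= (U n i)\<^sup>2"
  and e: "\<And>n i. 1 <= n ==> i < 2 ^ n ==> norm (davie_remainder f X XX Y (dpt T n i) (dpt T n (Suc i))) <= e n i"
   "\<And>n i. 1 <= n ==> i < 2 ^ n ==> norm (davie_remainder f X XX Z (dpt T n i) (dpt T n (Suc i))) <= e n i"
   "(%n. \<Sum>i<2 ^ n. e n i) \<longlonglongrightarrow> 0"
  and cont: "continuous_on {0..T} Y" "continuous_on {0..T} Z" and init: "Y 0 = Z 0"
  and t: "t \<in> {0..T}"
 shows "Y t = Z t"
proof -
 have C2: "Cb2 f" "0 <= L" "0 < \<delta>" using f unfolding fderiv2_holder_def by auto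
 define C where "C = difference_const CARD('n) (C2_norm f) L"
 define B where "B = tree_weight C u"
 let ?a = "%n i. U n i powr (2 + \<delta>)"
 let ?tail = "%n. \<Sum>k. level_sum ?a (n + k)"
 define D where "D = (%s t. davie_remainder f X XX Y s t - davie_remainder f X XX Z s t)"
 have C1: "1 <= C" using Cb2_norm_le(4)[OF C2(1)] C2(2) by (simp add: C_def difference_const_def Let_def)
 then have C0: "0 <= C" by simp
 note B = tree_weight[OF u C0, folded B_def]
 have B1: "1 <= B n" for n using B(2)[of n] C1 by simp
 have U0: "0 <= U n i" if "1 <= n" "i < 2 ^ n" for n i
 proof -
  have "dpt T n i <= dpt T n (Suc i)" by (rule dpt_mono[OF T]) simp
  from inc[OF that order_refl this order_refl] show ?thesis using norm_ge_zero order_trans by blast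
 qed
 obtain n1 where n1: "\<And>n. n1 <= n ==> u n < 1"
  using order_tendstoD(2)[OF summable_LIMSEQ_zero[OF u(1)], of 1] by (auto simp: eventually_sequentially)
 obtain n2 where n2: "\<And>n. n2 <= n ==> B 0 * ?tail n < 1 / 2"
  using order_tendstoD(2)[OF tendsto_mult_right_zero[OF level_tail_tendsto_0[OF U(1)], of "B 0"], of "1 / 2"]
  by (auto simp: eventually_sequentially)
 \<comment> \<open>From this generation on the increments are at most 1, and the weighted tail of
   the tree is at most 1/2.\<close>
 define n0 where "n0 = max 1 (max n1 n2)"
 have n0: "1 <= n0" "\<And>n. n0 <= n ==> u n <= 1" "B 0 * ?tail n0 <= 1 / 2"
  using n1 n2[of n0] by (force simp: n0_def less_imp_le)+
 have bd: "0 <= s \<and> t <= T" if "dpt T n i <= s" "t <= dpt T n (Suc i)" "i < 2 ^ n" for n i s t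
  using dpt_bounds[OF T, of i n] dpt_bounds[OF T, of "Suc i" n] that by auto
 have e0: "0 <= e n i" if "1 <= n" "i < 2 ^ n" for n i
  using e(1)[OF that] norm_ge_zero order_trans by blast
 have cell: "\<forall>t\<in>{dpt T n0 i..dpt T n0 (Suc i)}. Y t = Z t" if i: "i < 2 ^ n0" and l: "Y (dpt T n0 i) = Z (dpt T n0 i)" for i
 proof -
  let ?l = "dpt T n0 i" and ?r = "dpt T n0 (Suc i)"
  have lr: "?l <= ?r" "{?l..?r} \<subseteq> {0..T}" using dpt_mono[OF T, of i "Suc i" n0] bd[OF order_refl order_refl i] by auto
  have cD: "continuous_on {?l..?r} (%t. norm (Y t - Z t))"
   by (intro continuous_intros continuous_on_subset[OF cont(1) lr(2)] continuous_on_subset[OF cont(2) lr(2)])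
  obtain x where x: "x \<in> {?l..?r}" "\<And>z. z \<in> {?l..?r} ==> norm (Y z - Z z) <= norm (Y x - Z x)"
   using continuous_attains_sup[OF compact_Icc _ cD] lr(1) by (metis atLeastAtMost_iff empty_iff order_refl)
  define \<mu> where "\<mu> = norm (Y x - Z x)"
  have grid: "norm (Y t - Z t) <= B 0 * (\<mu> * ?tail n0 + 2 * (\<Sum>j<2 ^ N. e N j))"
   if N: "n0 <= N" and t: "t = dpt T N m" "m <= 2 ^ N" "?l <= t" "t <= ?r" for N t m
  proof -
   \<comment> \<open>The error \<open>e\<close> controls remainders between consecutive grid points
     only, so the induction runs over the grid of generation \<open>N\<close> inside the
     cell.\<close>
   define G where "G = {dpt T N k |k. k <= 2 ^ N} \<inter> {?l..?r}"
   \<comment> \<open>The full tree sum of the source terms plus the mesh errors of all descendants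
     of generation \<open>N\<close>; both parts add up over children. The factor 2 is for the two
     paths.\<close>
   define w where "w n j = \<mu> * tree_sum ?a n j + (\<Sum>j\<in>{j * 2 ^ (N - n)..<Suc j * 2 ^ (N - n)}. 2 * e N j)" for n j
   have N1: "1 <= N" using N n0(1) by simp
   have dpt_N: "dpt T n j = dpt T N (j * 2 ^ (N - n))" if "n <= N" for n j
    using dpt_refine[of T n "N - n" j] that by simp
   have G: "dpt T n j \<in> G" if "n <= N" "j <= 2 ^ n" "s \<in> G" "t \<in> G" "s <= dpt T n j" "dpt T n j <= t" for n j s t
   proof -
    have "j * 2 ^ (N - n) <= 2 ^ n * 2 ^ (N - n)" using that(2) by (rule mult_right_mono) simp
    also have "\<dots> = 2 ^ N" using that(1) by (simp flip: power_add)
    finally show ?thesis using that dpt_N[OF that(1), of j] unfolding G_def by auto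
   qed
   have \<mu>: "norm (Y s - Z s) <= \<mu>" if "s \<in> G" for s using x(2)[of s] that by (auto simp: G_def \<mu>_def)
   have diag: "D s s = 0" if "s \<in> G" for s
    using that lr(2) by (auto simp: D_def G_def davie_remainder_diag[OF chen])
   have "norm (D ?l t) <= B n0 * w n0 i"
   proof (rule tree_induction[where \<Theta> = "%s t. norm (D s t)" and B = B and w = w
      and C = C and u = u and a = "%n i. \<mu> * ?a n i" and N = N and G = G and n = n0 and i = i and s = ?l and t = t, of T n0])
    fix j s t assume j: "j < 2 ^ N" and st: "s \<in> G" "t \<in> G" "dpt T N j <= s" "s <= t" "t <= dpt T N (Suc j)"
    have w0: "0 <= \<mu> * tree_sum ?a N j" using tree_sum_nonneg[OF U(1) j] by (simp add: \<mu>_def)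
    have wN: "w N j = \<mu> * tree_sum ?a N j + 2 * e N j" by (simp add: w_def)
    have "norm (D s t) <= w N j"
    proof (cases "s = t")
     case True
     then show ?thesis using diag st(1) w0 e0[OF N1 j] wN by simp
    next
     case False
     obtain a b where ab: "s = dpt T N a" "t = dpt T N b" using st by (auto simp: G_def)
     then have "j <= a" "a < b" "b <= Suc j" using st False by (auto simp: dpt_le_iff[OF T] dpt_less_iff[OF T] less_le)
     then have "a = j" "b = Suc j" by auto
     then show ?thesis
      using norm_triangle_ineq4[of "davie_remainder f X XX Y s t" "davie_remainder f X XX Z s t"]
       e(1,2)[OF N1 j] w0 wN ab by (simp add: D_def)
    qed
    also have "\<dots> <= B N * w N j" using mult_right_mono[OF B1[of N], of "w N j"] w0 wN e0[OF N1 j] by simp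
    finally show "norm (D s t) <= B N * w N j" .
   next
    fix n j :: nat and s r t
    assume n: "n0 <= n" "n < N" and j: "j < 2 ^ n" and G3: "s \<in> G" "r \<in> G" "t \<in> G"
     and st: "dpt T n j <= s" "s <= r" "r <= t" "t <= dpt T n (Suc j)"
    have n1: "1 <= n" using n n0(1) by simp
    have d: "norm (X t' - X s') <= U n j \<and> norm (XX s' t') <= (U n j)\<^sup>2" if "dpt T n j <= s'" "s' <= t'" "t' <= dpt T n (Suc j)" for s' t'
     using dom n1 j that by (simp add: dominated_def)
    have chen': "XX s t = XX s r + XX r t + tensor (X r - X s) (X t - X r)"
     using chen st bd[OF st(1,4) j] by (simp add: chen_def)
    let ?c = "C2_norm f" and ?K = "CARD('n)"
    let ?aa = "?c + real (2 * ?K) * ?c\<^sup>2 + 1"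
    have "norm (D s t) <= norm (D s r) + norm (D r t)
      + (3 * ?c * ?aa + ?c + L + ?K * (2 * ?c\<^sup>2 * ?aa + ?c * L + 3 * ?c\<^sup>2)) * (\<mu> * U n j powr (2 + \<delta>) + U n j * norm (D s r))"
     by (rule davie_difference_step[OF f chen' U0[OF n1 j] _ _ _ _ _ _ _ _ \<mu>[OF G3(1)] \<mu>[OF G3(2)] refl refl D_def])
      (use d[of s r] d[of r t] st inc[OF n1 j, of s r] order_trans[OF U(2)[OF n1 j] n0(2)[OF n(1)]] in auto)
    also have "\<dots> <= norm (D s r) + norm (D r t) + C * (\<mu> * U n j powr (2 + \<delta>) + u n * norm (D s r))"
    proof (intro add_left_mono mult_mono)
     show "U n j <= u n" by (rule U(2)[OF n1 j])
    qed (use u(2)[of n] U0[OF n1 j] C0 in \<open>auto simp: \<mu>_def C_def difference_const_def Let_def\<close>)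
    finally show "norm (D s t) <= norm (D s r) + norm (D r t) + C * u n * norm (D s r) + C * (\<mu> * U n j powr (2 + \<delta>))"
     by (simp add: algebra_simps)
   next
    fix n j s t assume "n < N" "j < 2 ^ n" "s \<in> G" "t \<in> G" "s <= dpt T (Suc n) (Suc (2 * j))"
     "dpt T (Suc n) (Suc (2 * j)) <= t"
    then show "dpt T (Suc n) (Suc (2 * j)) \<in> G" by (intro G[of "Suc n"]) auto
   next
    fix n j :: nat assume n: "n0 <= n" "n < N" and j: "j < 2 ^ n"
    have Nn: "N - n = Suc (N - Suc n)" using n by simp
    show "w (Suc n) (2 * j) + w (Suc n) (Suc (2 * j)) + \<mu> * U n j powr (2 + \<delta>) <= w n j"
     unfolding w_def Nn sum_descendants_children tree_sum_rec[OF U(1) j] by (simp only: distrib_left)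
   next
    fix n j :: nat assume n: "n0 <= n" "n <= N" and j: "j < (2::nat) ^ n"
    have "0 <= 2 * e N k" if "k \<in> {j * 2 ^ (N - n)..<Suc j * 2 ^ (N - n)}" for k
    proof -
     have "k < 2 ^ (n + (N - n))" by (rule descendant_less[OF j]) (use that in auto)
     then show ?thesis using e0[OF N1, of k] n by simp
    qed
    then show "0 <= w n j" unfolding w_def
     by (intro add_nonneg_nonneg sum_nonneg mult_nonneg_nonneg tree_sum_nonneg[OF U(1) j]) (auto simp: \<mu>_def)
   next
    show "?l \<in> G" "t \<in> G"
    proof -
     have "i * 2 ^ (N - n0) <= 2 ^ n0 * 2 ^ (N - n0)" using i by (intro mult_right_mono) auto
     also have "\<dots> = (2::nat) ^ N" using N by (simp flip: power_add)
     finally show "?l \<in> G" using dpt_N[OF N, of i] lr(1) by (auto simp: G_def)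
     show "t \<in> G" using t by (auto simp: G_def)
    qed
   qed (use t N i T B(1,2) u(2) C0 in \<open>auto simp: \<mu>_def\<close>)
   \<comment> \<open>Since the paths agree at the left end, all terms of the two remainders cancel
     except the values at \<open>t\<close>.\<close>
   also have "D ?l t = Y t - Z t"
    by (simp add: D_def davie_remainder_def l)
   finally have "norm (Y t - Z t) <= B n0 * w n0 i" .
   also have "\<dots> <= B 0 * (\<mu> * ?tail n0 + 2 * (\<Sum>j<2 ^ N. e N j))"
   proof (intro mult_mono)
    have sub: "{i * 2 ^ (N - n0)..<Suc i * 2 ^ (N - n0)} \<subseteq> {..<2 ^ N}"
     using descendant_less[OF i, of _ "N - n0"] N by auto
    have "(\<Sum>j\<in>{i * 2 ^ (N - n0)..<Suc i * 2 ^ (N - n0)}. 2 * e N j) <= (\<Sum>j<2 ^ N. 2 * e N j)"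
     using e0[OF N1] by (intro sum_mono2 sub) auto
    moreover have "\<mu> * tree_sum ?a n0 i <= \<mu> * ?tail n0"
     by (intro mult_left_mono tree_sum_le_tail[OF U(1) i]) (simp add: \<mu>_def)
    ultimately show "w n0 i <= \<mu> * ?tail n0 + 2 * (\<Sum>j<2 ^ N. e N j)"
     unfolding w_def sum_distrib_left by simp
    show "0 <= w n0 i" unfolding w_def using e0[OF N1] sub tree_sum_nonneg[OF U(1) i]
     by (intro add_nonneg_nonneg sum_nonneg mult_nonneg_nonneg) (auto simp: \<mu>_def)
   qed (use B(3)[of n0] B1[of 0] in auto)
   finally show ?thesis .
  qed
  have "norm (Y t - Z t) <= \<mu> / 2" if t: "t \<in> {?l..?r}" for t
  proof (cases "t = ?l")
   case True
   then show ?thesis using l by (simp add: \<mu>_def)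
  next
   case False
   have t0: "0 <= t" "t <= T" using t lr by auto
   have "\<exists>m<2 ^ N. dpt T N m <= t \<and> t <= dpt T N (Suc m)" for N
    by (rule in_dyadic_cell[OF T t0, of N]) blast
   then obtain m where m: "\<And>N. m N < 2 ^ N" "\<And>N. dpt T N (m N) <= t" "\<And>N. t <= dpt T N (Suc (m N))"
    by metis
   \<comment> \<open>Grid points just below \<open>t\<close>, which stay in the cell from generation
     \<open>n0\<close> on and converge to \<open>t\<close>.\<close>
   define z where "z N = dpt T N (m N)" for N
   have z: "?l <= z N" if "n0 <= N" for N
   proof (rule ccontr)
    have e: "?l = dpt T N (i * 2 ^ (N - n0))" using dpt_refine[of T n0 "N - n0" i] that by simp
    assume "\<not> ?l <= z N"
    then have "m N < i * 2 ^ (N - n0)" unfolding z_def e not_le dpt_less_iff[OF T] .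
    then have "dpt T N (Suc (m N)) <= ?l" unfolding e by (intro dpt_mono T) simp
    then show False using m(3)[of N] t False by simp
   qed
   have zr: "z N <= ?r" for N using m(2)[of N] t by (simp add: z_def)
   have zt: "z \<longlonglongrightarrow> t"
   proof (rule LIM_zero_cancel, rule Lim_null_comparison)
    show "\<forall>\<^sub>F N in sequentially. norm (z N - t) <= T * (1 / 2) ^ N"
     using m(2,3) by (intro always_eventually allI) (auto simp: z_def dpt_Suc power_divide algebra_simps)
    show "(%N. T * (1 / 2) ^ N) \<longlonglongrightarrow> 0" by (intro tendsto_mult_right_zero LIMSEQ_power_zero) simp
   qed
   have "(%N. norm (Y (z (N + n0)) - Z (z (N + n0)))) \<longlonglongrightarrow> norm (Y t - Z t)"
   proof (rule continuous_on_tendsto_compose[OF cD])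
    show "(%N. z (N + n0)) \<longlonglongrightarrow> t" by (rule LIMSEQ_ignore_initial_segment[OF zt])
    show "t \<in> {?l..?r}" by (rule t)
    show "\<forall>\<^sub>F N in sequentially. z (N + n0) \<in> {?l..?r}" using z zr by (intro always_eventually allI) auto
   qed
   moreover have "(%N. B 0 * (\<mu> * ?tail n0 + 2 * (\<Sum>j<2 ^ (N + n0). e (N + n0) j)))
     \<longlonglongrightarrow> B 0 * (\<mu> * ?tail n0 + 2 * 0)"
    by (intro tendsto_intros LIMSEQ_ignore_initial_segment[OF e(3)])
   moreover have "norm (Y (z (N + n0)) - Z (z (N + n0))) <= B 0 * (\<mu> * ?tail n0 + 2 * (\<Sum>j<2 ^ (N + n0). e (N + n0) j))" for N
    by (rule grid[of "N + n0" "z (N + n0)" "m (N + n0)"]) (use m(1)[of "N + n0"] z zr in \<open>auto simp: z_def less_imp_le\<close>)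
   ultimately have "norm (Y t - Z t) <= B 0 * (\<mu> * ?tail n0 + 2 * 0)"
    by (intro LIMSEQ_le) auto
   also have "\<dots> = \<mu> * (B 0 * ?tail n0)" by simp
   also have "\<dots> <= \<mu> * (1 / 2)" using n0(3) by (intro mult_left_mono) (auto simp: \<mu>_def)
   finally show ?thesis by simp
  qed
  from this[OF x(1)] have "\<mu> = 0" by (simp add: \<mu>_def)
  then show ?thesis using x(2) by (simp add: \<mu>_def)
 qed
 have "\<forall>t\<in>{0..dpt T n0 i}. Y t = Z t" if "i <= 2 ^ n0" for i
  using that
 proof (induction i)
  case (Suc i)
  then have *: "\<forall>t\<in>{0..dpt T n0 i}. Y t = Z t" "i < 2 ^ n0" by auto
  then have "Y (dpt T n0 i) = Z (dpt T n0 i)" using dpt_bounds[OF T, of i n0] by simp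
  from cell[OF *(2) this] *(1) show ?case by (metis atLeastAtMost_iff linorder_le_cases)
 qed (use init in simp)
 from this[of "2 ^ n0"] t show ?thesis by simp
qed

section \<open>Power means and normalised cell norms\<close>

lemma sum_powr_le_powr_sum:
 fixes x :: "'a => real"
 assumes "\<And>i. i \<in> S ==> 0 <= x i" "1 <= r"
 shows "(\<Sum>i\<in>S. x i powr r) <= (\<Sum>i\<in>S. x i) powr r"
proof (cases "finite S")
 case True
 let ?s = "\<Sum>i\<in>S. x i"
 have s0: "0 <= ?s" using assms(1) by (rule sum_nonneg)
 have split: "y powr r = y * y powr (r - 1)" if "0 <= y" for y :: real
  using that assms(2) powr_mult_base[of y "r - 1"] by simp
 have "(\<Sum>i\<in>S. x i powr r) <= (\<Sum>i\<in>S. x i * ?s powr (r - 1))"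
 proof (rule sum_mono)
  fix i assume i: "i \<in> S"
  have "x i <= ?s" using member_le_sum[of i S x] i assms(1) True by auto
  then show "x i powr r <= x i * ?s powr (r - 1)"
   using split[of "x i"] assms(1)[OF i] assms(2) by (auto intro!: mult_left_mono powr_mono2)
 qed
 also have "\<dots> = ?s powr r" using split[OF s0] by (simp add: sum_distrib_right)
 finally show ?thesis .
qed simp

lemma powr_sum_le_sum_powr:
 fixes x :: "'a => real"
 assumes "\<And>i. i \<in> S ==> 0 <= x i" "0 < r" "r <= 1"
 shows "(\<Sum>i\<in>S. x i) powr r <= (\<Sum>i\<in>S. x i powr r)"
proof -
 have "(\<Sum>i\<in>S. (x i powr r) powr (1 / r)) <= (\<Sum>i\<in>S. x i powr r) powr (1 / r)"
  using assms by (intro sum_powr_le_powr_sum) auto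
 then have "(\<Sum>i\<in>S. x i) <= (\<Sum>i\<in>S. x i powr r) powr (1 / r)"
  using assms by (simp add: powr_powr)
 then have "(\<Sum>i\<in>S. x i) powr r <= ((\<Sum>i\<in>S. x i powr r) powr (1 / r)) powr r"
  using assms by (intro powr_mono2 sum_nonneg) auto
 then show ?thesis using assms by (simp add: powr_powr sum_nonneg)
qed

text \<open>Jensen's inequality for \<open>y powr r\<close> with weights \<open>l i\<close>. Indices
  with \<open>x i = 0\<close> are discarded first, because \<open>powr_convex\<close> lives on
  positive numbers; a zero weight occurs only together with \<open>x i = 0\<close>.\<close>

lemma powr_sum_weighted:
 fixes x l :: "'a => real"
 assumes "finite S" "\<And>i. i \<in> S ==> 0 <= x i" "\<And>i. i \<in> S ==> 0 <= l i" "\<And>i. i \<in> S ==> l i = 0 ==> x i = 0" "1 <= r"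
 shows "(\<Sum>i\<in>S. x i) powr r <= (\<Sum>i\<in>S. l i) powr (r - 1) * (\<Sum>i\<in>S. l i * (x i / l i) powr r)"
proof -
 define S' where "S' = {i\<in>S. 0 < x i}"
 have S': "finite S'" "S' \<subseteq> S" using assms(1) by (auto simp: S'_def)
 have pos: "0 < l i" "0 < x i" if "i \<in> S'" for i using that assms(3,4)[of i] by (force simp: S'_def)+
 have sx: "(\<Sum>i\<in>S. x i) = (\<Sum>i\<in>S'. x i)"
  using assms(1,2) by (intro sum.mono_neutral_right) (force simp: S'_def)+
 have nn: "0 <= (\<Sum>i\<in>S. l i * (x i / l i) powr r)" using assms(3) by (intro sum_nonneg) auto
 show ?thesis
 proof (cases "S' = {}")
  case True
  then show ?thesis using nn assms(5) sx by simp
 next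
  case False
  let ?L = "\<Sum>i\<in>S'. l i"
  have L: "0 < ?L" using False S'(1) pos by (intro sum_pos) auto
  have "(\<Sum>i\<in>S'. (l i / ?L) *\<^sub>R (x i / l i)) powr r <= (\<Sum>i\<in>S'. (l i / ?L) * (x i / l i) powr r)"
  proof (rule convex_on_sum[OF S'(1) False powr_convex[OF assms(5)]])
   show "(\<Sum>i\<in>S'. l i / ?L) = 1" using L by (simp flip: sum_divide_distrib)
   show "0 <= l i / ?L" if "i \<in> S'" for i using pos[OF that] L by simp
   show "x i / l i \<in> {0<..}" if "i \<in> S'" for i using pos[OF that] by simp
  qed
  moreover have "(\<Sum>i\<in>S'. (l i / ?L) *\<^sub>R (x i / l i)) = (\<Sum>i\<in>S'. x i) / ?L"
   unfolding sum_divide_distrib by (intro sum.cong) (use pos in \<open>force simp: field_simps\<close>)+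
  moreover have "(\<Sum>i\<in>S'. (l i / ?L) * (x i / l i) powr r) = (\<Sum>i\<in>S'. l i * (x i / l i) powr r) / ?L"
   by (simp add: sum_divide_distrib)
  ultimately have "((\<Sum>i\<in>S'. x i) / ?L) powr r <= (\<Sum>i\<in>S'. l i * (x i / l i) powr r) / ?L" by simp
  then have "(\<Sum>i\<in>S'. x i) powr r / ?L powr r <= (\<Sum>i\<in>S'. l i * (x i / l i) powr r) / ?L"
   using L pos by (simp add: powr_divide sum_nonneg less_imp_le)
  then have "(\<Sum>i\<in>S'. x i) powr r <= ?L powr (r - 1) * (\<Sum>i\<in>S'. l i * (x i / l i) powr r)"
   using L by (simp add: field_simps powr_diff)
  also have "\<dots> <= (\<Sum>i\<in>S. l i) powr (r - 1) * (\<Sum>i\<in>S. l i * (x i / l i) powr r)"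
   using assms L S' by (intro mult_mono powr_mono2 sum_mono2 sum_nonneg) (auto intro!: sum_nonneg mult_nonneg_nonneg simp: less_imp_le[OF pos(1)])
  finally show ?thesis by (simp add: sx)
 qed
qed

lemma powr_sum_le_card:
 fixes x :: "'a => real"
 assumes "finite S" "\<And>i. i \<in> S ==> 0 <= x i" "1 <= r"
 shows "(\<Sum>i\<in>S. x i) powr r <= real (card S) powr (r - 1) * (\<Sum>i\<in>S. x i powr r)"
 using powr_sum_weighted[of S x "%_. 1" r] assms by simp

text \<open>One constant for all \<open>r > 0\<close>, at the price of optimality, because exponents
  on both sides of 1 occur.\<close>

lemma powr_add_le:
 fixes a b r :: real
 assumes "0 <= a" "0 <= b" "0 < r"
 shows "(a + b) powr r <= 2 powr r * (a powr r + b powr r)"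
proof -
 have "(a + b) powr r <= (2 * max a b) powr r" using assms by (intro powr_mono2) auto
 also have "\<dots> = 2 powr r * max (a powr r) (b powr r)"
  using assms by (auto simp: powr_mult max_def powr_mono2 intro: antisym)
 also have "\<dots> <= 2 powr r * (a powr r + b powr r)" by (intro mult_left_mono) auto
 finally show ?thesis .
qed

text \<open>The normalised mean of order \<open>p\<close> over generation \<open>n\<close> is at
  most \<open>v n\<close>, written without roots so that \<open>p < 1\<close> needs no separate
  treatment. The normalisation by the number of cells makes \<open>v n\<close> comparable with an
  \<open>L^p\<close> norm in time.\<close>

definition cell_bound :: "ennreal => (nat => nat => real) => (nat => real) => bool" where
 "cell_bound p V v \<longleftrightarrow> (\<forall>n\<ge>1. 0 <= v n \<and> (\<forall>i<2 ^ n. 0 <= V n i) \<and>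
   (if p = \<infinity> then \<forall>i<2 ^ n. V n i <= v n
   else (\<Sum>i<2 ^ n. V n i powr enn2real p) <= 2 ^ n * v n powr enn2real p))"

text \<open>Above \<alpha> = 1/3 the geometric decay, the case of an infinite third index, is all
  that is kept of the Besov norm. At 1/3 the second clause says in addition that
  \<open>2 powr (n / 3) * v n\<close> is cubically summable, which is the trace of
  \<open>q <= 3\<close>.\<close>

definition admissible :: "real => real => (nat => real) => bool" where
 "admissible \<alpha> K v \<longleftrightarrow> (\<forall>n\<ge>1. 0 <= v n \<and> v n <= K * 2 powr (- \<alpha> * n)) \<and>
   (\<alpha> = 1 / 3 --> (\<forall>N. (\<Sum>n=1..N. 2 ^ n * v n ^ 3) <= K))"

lemma admissible_nonneg: "admissible \<alpha> K v ==> 0 <= K"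
proof -
 assume "admissible \<alpha> K v"
 then have "0 <= v 1" "v 1 <= K * 2 powr (- \<alpha> * real 1)" unfolding admissible_def by blast+
 then have "0 <= K * 2 powr (- \<alpha> * real 1)" by linarith
 then show ?thesis by (simp add: zero_le_mult_iff)
qed

text \<open>\<open>c\<close> serves the decay clause and \<open>c ^ 3\<close> the cubic sum; adding
  them keeps a single constant.\<close>

lemma admissible_scale:
 assumes "admissible \<alpha> K v" "0 <= c"
 shows "admissible \<alpha> ((c + c ^ 3) * K) (%n. c * v n)"
proof -
 note K = admissible_nonneg[OF assms(1)]
 have "c * v n <= ((c + c ^ 3) * K) * 2 powr (- \<alpha> * n)" if "1 <= n" for n
 proof -
  have "c * v n <= c * (K * 2 powr (- \<alpha> * n))"
   using assms that by (intro mult_left_mono) (auto simp: admissible_def)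
  also have "\<dots> <= (c + c ^ 3) * (K * 2 powr (- \<alpha> * n))"
   using assms(2) K by (intro mult_right_mono) auto
  finally show ?thesis by (simp add: mult_ac)
 qed
 moreover have "(\<Sum>n=1..N. 2 ^ n * (c * v n) ^ 3) <= (c + c ^ 3) * K" if "\<alpha> = 1 / 3" for N
 proof -
  have "(\<Sum>n=1..N. 2 ^ n * (c * v n) ^ 3) = c ^ 3 * (\<Sum>n=1..N. 2 ^ n * v n ^ 3)"
   by (simp add: sum_distrib_left power_mult_distrib mult_ac)
  also have "\<dots> <= c ^ 3 * K" using assms that by (intro mult_left_mono) (auto simp: admissible_def)
  also have "\<dots> <= (c + c ^ 3) * K" using assms(2) K by (intro mult_right_mono) auto
  finally show ?thesis .
 qed
 ultimately show ?thesis using assms by (auto simp: admissible_def)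
qed

lemma admissible_add:
 assumes "admissible \<alpha> K v" "admissible \<alpha> L w"
 shows "admissible \<alpha> (8 * (K + L)) (%n. v n + w n)"
proof -
 note K = admissible_nonneg[OF assms(1)] admissible_nonneg[OF assms(2)]
 have "v n + w n <= (8 * (K + L)) * 2 powr (- \<alpha> * n)" if "1 <= n" for n
 proof -
  have "v n + w n <= (K + L) * 2 powr (- \<alpha> * n)"
   using assms that by (auto simp: admissible_def algebra_simps intro!: add_mono)
  also have "\<dots> <= (8 * (K + L)) * 2 powr (- \<alpha> * n)" using K by (intro mult_right_mono) auto
  finally show ?thesis .
 qed
 moreover have "(\<Sum>n=1..N. 2 ^ n * (v n + w n) ^ 3) <= 8 * (K + L)" if "\<alpha> = 1 / 3" for N
 proof -
  have "(\<Sum>n=1..N. 2 ^ n * (v n + w n) ^ 3) <= (\<Sum>n=1..N. 8 * (2 ^ n * v n ^ 3) + 8 * (2 ^ n * w n ^ 3))"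
  proof (rule sum_mono)
   fix n assume "n \<in> {1..N}"
   then have 0: "0 <= v n" "0 <= w n" using assms by (auto simp: admissible_def)
   have "(v n + w n) ^ 3 <= 8 * (v n ^ 3 + w n ^ 3)"
    using powr_add_le[OF 0, of 3] 0 by simp
   from mult_left_mono[OF this, of "2 ^ n"]
   show "2 ^ n * (v n + w n) ^ 3 <= 8 * (2 ^ n * v n ^ 3) + 8 * (2 ^ n * w n ^ 3)"
    by (simp add: algebra_simps)
  qed
  also have "\<dots> <= 8 * (K + L)"
   unfolding sum.distrib sum_distrib_left[symmetric] using assms that
   by (auto simp: admissible_def algebra_simps intro!: add_mono)
  finally show ?thesis .
 qed
 ultimately show ?thesis using assms by (auto simp: admissible_def)
qed

lemma cell_bound_nonneg:
 assumes "cell_bound p V v" "1 <= n"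
 shows "0 <= v n" "i < 2 ^ n ==> 0 <= V n i"
 using assms by (auto simp: cell_bound_def)

lemma cell_bound_finiteD:
 assumes "cell_bound p V v" "p \<noteq> \<infinity>" "1 <= n"
 shows "(\<Sum>i<2 ^ n. V n i powr enn2real p) <= 2 ^ n * v n powr enn2real p"
 using assms by (auto simp: cell_bound_def)

lemma cell_bound_infD:
 assumes "cell_bound \<infinity> V v" "1 <= n" "i < 2 ^ n"
 shows "V n i <= v n"
 using assms by (auto simp: cell_bound_def)

definition inv_exp :: "ennreal => real" where
 "inv_exp p = (if p = \<infinity> then 0 else 1 / enn2real p)"

text \<open>One term of the sum against the whole sum: the discrete form of the embedding that costs
  \<open>1 / p\<close> in the order.\<close>

lemma cell_bound_pointwise:
 assumes "cell_bound p V v" "0 < p" "1 <= n" "i < 2 ^ n"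
 shows "V n i <= 2 powr (n * inv_exp p) * v n"
proof (cases "p = \<infinity>")
 case True
 then show ?thesis using cell_bound_infD[of V v n i] assms by (simp add: inv_exp_def)
next
 case False
 let ?P = "enn2real p"
 have P: "0 < ?P" using assms(2) False by (simp add: enn2real_positive_iff top.not_eq_extremum)
 note V0 = cell_bound_nonneg[OF assms(1,3)]
 have "V n i powr ?P <= (\<Sum>i<2 ^ n. V n i powr ?P)"
  using assms(4) by (intro member_le_sum) auto
 also have "\<dots> <= 2 ^ n * v n powr ?P" by (rule cell_bound_finiteD[OF assms(1) False assms(3)])
 finally have "(V n i powr ?P) powr (1 / ?P) <= (2 ^ n * v n powr ?P) powr (1 / ?P)"
  using P by (intro powr_mono2) auto
 then show ?thesis using P V0(1) V0(2)[OF assms(4)] False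
  by (simp add: powr_powr powr_mult inv_exp_def powr_realpow[symmetric])
qed

text \<open>A power \<open>a\<close> of an \<open>l^p\<close> array is an \<open>l^(p/a)\<close>
  array. The factor \<open>s n\<close> may vary with the generation, so that a pointwise bound can
  be spent on part of the exponent.\<close>

lemma cell_bound_rescale:
 assumes V: "cell_bound p V v" and a: "0 < a" and p: "0 < p" and q: "q = p / ennreal a"
  and V': "\<And>n i. 1 <= n ==> i < 2 ^ n ==> 0 <= V' n i \<and> V' n i <= V n i powr a * s n" and s: "\<And>n. 1 <= n ==> 0 <= s n"
 shows "cell_bound q V' (%n. v n powr a * s n)"
proof (cases "p = \<infinity>")
 case True
 then have "q = \<infinity>" using a q by (simp add: ennreal_top_divide)
 show ?thesis unfolding cell_bound_def
 proof (intro allI impI conjI)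
  fix n :: nat assume n: "1 <= n"
  show "0 <= v n powr a * s n" using s[OF n] by simp
  show "0 <= V' n i" if "i < 2 ^ n" for i using V'[OF n that] by simp
  have "V' n i <= v n powr a * s n" if "i < 2 ^ n" for i
  proof -
   have "V n i powr a * s n <= v n powr a * s n"
    using cell_bound_infD[of V v n i] V True n that cell_bound_nonneg[OF V n] s[OF n] a
    by (intro mult_right_mono powr_mono2) auto
   then show ?thesis using V'[OF n that] by simp
  qed
  then show "if q = \<infinity> then \<forall>i<2 ^ n. V' n i <= v n powr a * s n
   else (\<Sum>i<2 ^ n. V' n i powr enn2real q) <= 2 ^ n * (v n powr a * s n) powr enn2real q"
   using \<open>q = \<infinity>\<close> by simp
 qed
next
 case False
 let ?P = "enn2real p"
 have P: "0 < ?P" "p = ennreal ?P" using p False by (auto simp: enn2real_positive_iff top.not_eq_extremum)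
 have q': "q = ennreal (?P / a)" using q P a by (metis divide_ennreal less_imp_le)
 then have Q: "q \<noteq> \<infinity>" "enn2real q = ?P / a" using P a by simp_all
 show ?thesis unfolding cell_bound_def
 proof (intro allI impI conjI)
  fix n :: nat assume n: "1 <= n"
  note nn = cell_bound_nonneg[OF V n] s[OF n]
  show "0 <= v n powr a * s n" using s[OF n] by simp
  show "0 <= V' n i" if "i < 2 ^ n" for i using V'[OF n that] by simp
  have "(\<Sum>i<2 ^ n. V' n i powr (?P / a)) <= (\<Sum>i<2 ^ n. V n i powr ?P * s n powr (?P / a))"
  proof (rule sum_mono)
   fix i :: nat assume i: "i \<in> {..<2 ^ n}"
   have "V' n i powr (?P / a) <= (V n i powr a * s n) powr (?P / a)"
    using V'[OF n, of i] i P a by (intro powr_mono2) auto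
   also have "\<dots> = V n i powr ?P * s n powr (?P / a)"
    using nn i a by (simp add: powr_mult powr_powr)
   finally show "V' n i powr (?P / a) <= V n i powr ?P * s n powr (?P / a)" .
  qed
  also have "\<dots> <= (2 ^ n * v n powr ?P) * s n powr (?P / a)"
   using cell_bound_finiteD[OF V False n] by (simp add: sum_distrib_right[symmetric] mult_right_mono)
  also have "\<dots> = 2 ^ n * (v n powr a * s n) powr (?P / a)"
   using nn a by (simp add: powr_mult powr_powr)
  finally show "if q = \<infinity> then \<forall>i<2 ^ n. V' n i <= v n powr a * s n
   else (\<Sum>i<2 ^ n. V' n i powr enn2real q) <= 2 ^ n * (v n powr a * s n) powr enn2real q"
   using Q by simp
 qed
qed

lemma cell_bound_mono:
 assumes "cell_bound p V v" "0 < p" "\<And>n i. 1 <= n ==> i < 2 ^ n ==> 0 <= V' n i \<and> V' n i <= c * V n i"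
  "\<And>n. 1 <= n ==> c * v n <= v' n" "0 <= c"
 shows "cell_bound p V' v'"
proof -
 have "cell_bound p V' (%n. v n powr 1 * c)"
  using cell_bound_nonneg[OF assms(1)] assms(3,5)
  by (intro cell_bound_rescale[OF assms(1) zero_less_one assms(2)]) (auto simp: mult_ac divide_ennreal_def)
 note b = this
 have v: "0 <= c * v n \<and> c * v n <= v' n" if "1 <= n" for n
  using cell_bound_nonneg(1)[OF assms(1) that] assms(4)[OF that] assms(5) by simp
 show ?thesis unfolding cell_bound_def
 proof (intro allI impI conjI)
  fix n :: nat assume n: "1 <= n"
  show "0 <= v' n" using v[OF n] by linarith
  show "0 <= V' n i" if "i < 2 ^ n" for i using cell_bound_nonneg(2)[OF b n that] .
  have "(v n powr 1 * c) powr enn2real p <= v' n powr enn2real p"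
   using v[OF n] cell_bound_nonneg(1)[OF assms(1) n] by (intro powr_mono2) (auto simp: mult_ac)
  then have fin: "2 ^ n * (v n powr 1 * c) powr enn2real p <= 2 ^ n * v' n powr enn2real p"
   by (rule mult_left_mono) simp
  have vc: "v n powr 1 * c <= v' n" using v[OF n] cell_bound_nonneg(1)[OF assms(1) n] by (simp add: mult_ac)
  show "if p = \<infinity> then \<forall>i<2 ^ n. V' n i <= v' n else (\<Sum>i<2 ^ n. V' n i powr enn2real p) <= 2 ^ n * v' n powr enn2real p"
  proof (cases "p = \<infinity>")
   case True
   then have "cell_bound \<infinity> V' (%n. v n powr 1 * c)" using b by simp
   from cell_bound_infD[OF this n] vc True show ?thesis by (auto intro: order_trans)
  next
   case False
   from order_trans[OF cell_bound_finiteD[OF b False n] fin] False show ?thesis by simp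
  qed
 qed
qed

text \<open>Quasi-triangle inequality for all \<open>p > 0\<close>: a factor 2 comes from
  \<open>powr_add_le\<close>, and \<open>2 powr inv_exp p\<close> from adding two sums before the
  root is taken.\<close>

lemma cell_bound_add:
 assumes V: "cell_bound p V v" "cell_bound p V' v'" and p: "0 < p"
 shows "cell_bound p (%n i. V n i + V' n i) (%n. 2 powr (1 + inv_exp p) * (v n + v' n))"
proof (cases "p = \<infinity>")
 case True
 show ?thesis unfolding cell_bound_def
 proof (intro allI impI conjI)
  fix n :: nat assume n: "1 <= n"
  note nn = cell_bound_nonneg[OF V(1) n] cell_bound_nonneg[OF V(2) n]
  show "0 <= 2 powr (1 + inv_exp p) * (v n + v' n)" using nn by simp
  show "0 <= V n i + V' n i" if "i < 2 ^ n" for i using nn that by simp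
  have "V n i + V' n i <= 2 * (v n + v' n)" if "i < 2 ^ n" for i
   using cell_bound_infD[of V v n i] cell_bound_infD[of V' v' n i] True V n that nn by simp
  then show "if p = \<infinity> then \<forall>i<2 ^ n. V n i + V' n i <= 2 powr (1 + inv_exp p) * (v n + v' n)
    else (\<Sum>i<2 ^ n. (V n i + V' n i) powr enn2real p) <= 2 ^ n * (2 powr (1 + inv_exp p) * (v n + v' n)) powr enn2real p"
   using True by (simp add: inv_exp_def)
 qed
next
 case False
 let ?P = "enn2real p"
 have P: "0 < ?P" using p False by (auto simp: enn2real_positive_iff top.not_eq_extremum)
 show ?thesis unfolding cell_bound_def
 proof (intro allI impI conjI)
  fix n :: nat assume n: "1 <= n"
  note nn = cell_bound_nonneg[OF V(1) n] cell_bound_nonneg[OF V(2) n]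
  show "0 <= 2 powr (1 + inv_exp p) * (v n + v' n)" using nn by simp
  show "0 <= V n i + V' n i" if "i < 2 ^ n" for i using nn that by simp
  have "(\<Sum>i<2 ^ n. (V n i + V' n i) powr ?P) <= (\<Sum>i<2 ^ n. 2 powr ?P * (V n i powr ?P + V' n i powr ?P))"
   using nn P by (intro sum_mono powr_add_le) auto
  also have "\<dots> = 2 powr ?P * ((\<Sum>i<2 ^ n. V n i powr ?P) + (\<Sum>i<2 ^ n. V' n i powr ?P))"
   by (simp only: sum_distrib_left[symmetric] sum.distrib)
  also have "\<dots> <= 2 powr ?P * (2 ^ n * v n powr ?P + 2 ^ n * v' n powr ?P)"
   using cell_bound_finiteD[OF V(1) False n] cell_bound_finiteD[OF V(2) False n] by (intro mult_left_mono add_mono) auto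
  also have "\<dots> <= 2 powr ?P * (2 ^ n * (v n + v' n) powr ?P + 2 ^ n * (v n + v' n) powr ?P)"
   using nn P by (intro mult_left_mono add_mono powr_mono2) auto
  also have "\<dots> = 2 ^ n * (2 powr (1 + inv_exp p) * (v n + v' n)) powr ?P"
   using nn P False by (simp add: inv_exp_def powr_mult powr_powr powr_add)
  finally show "if p = \<infinity> then \<forall>i<2 ^ n. V n i + V' n i <= 2 powr (1 + inv_exp p) * (v n + v' n)
    else (\<Sum>i<2 ^ n. (V n i + V' n i) powr ?P) <= 2 ^ n * (2 powr (1 + inv_exp p) * (v n + v' n)) powr ?P"
   using False by simp
 qed
qed

section \<open>Tree sums of Besov-bounded cell arrays\<close>

lemma powr_geometric_sums:
 assumes "\<beta> < 0"
 shows "(%k. 2 powr (\<beta> * real (n + k))) sums (2 powr (\<beta> * n) / (1 - 2 powr \<beta>))"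
proof -
 have "2 powr \<beta> < 1" using assms powr_less_mono[of \<beta> 0 2] by simp
 then have "(%k. (2 powr \<beta>) ^ k) sums (1 / (1 - 2 powr \<beta>))" by (intro geometric_sums) simp
 then have "(%k. 2 powr (\<beta> * n) * (2 powr \<beta>) ^ k) sums (2 powr (\<beta> * n) * (1 / (1 - 2 powr \<beta>)))"
  by (rule sums_mult)
 moreover have "2 powr (\<beta> * n) * (2 powr \<beta>) ^ k = 2 powr (\<beta> * real (n + k))" for k
  by (simp add: powr_realpow[symmetric] powr_powr powr_add[symmetric] algebra_simps)
 ultimately show ?thesis by simp
qed

text \<open>For \<open>\<theta> <= p\<close> means are compared by Jensen and the
  \<open>2 ^ n\<close> cells are counted; for \<open>\<theta> > p\<close> the embedding of
  \<open>l^p\<close> in the summation space of order \<open>\<theta>\<close> costs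
  \<open>2 powr (n * \<theta> / p)\<close>.\<close>

lemma level_sum_powr_le:
 assumes U: "cell_bound p U u" and p: "0 < p" and th: "0 < \<theta>" and n: "1 <= n"
 shows "level_sum (%n i. U n i powr \<theta>) n <= 2 powr (n * max 1 (\<theta> * inv_exp p)) * u n powr \<theta>"
proof (cases "p = \<infinity>")
 case True
 have "level_sum (%n i. U n i powr \<theta>) n <= (\<Sum>i<(2::nat) ^ n. u n powr \<theta>)"
  unfolding level_sum_def using cell_bound_infD[of U u n] U True n cell_bound_nonneg[OF U n] th
  by (intro sum_mono powr_mono2) auto
 then show ?thesis using True by (simp add: inv_exp_def powr_realpow)
next
 case False
 define P where "P = enn2real p"
 have P: "0 < P" using p False by (auto simp: P_def enn2real_positive_iff top.not_eq_extremum)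
 note nn = cell_bound_nonneg[OF U n]
 note b = cell_bound_finiteD[OF U False n, folded P_def]
 have ip: "inv_exp p = 1 / P" using False by (simp add: inv_exp_def P_def)
 have s0: "0 <= (\<Sum>i<(2::nat) ^ n. U n i powr \<theta>)" by (rule sum_nonneg) simp
 show ?thesis
 proof (cases "\<theta> <= P")
  case True
  define r where "r = P / \<theta>"
  have r: "1 <= r" using True th by (simp add: r_def)
  have "(\<Sum>i<(2::nat) ^ n. U n i powr \<theta>) powr r <= (2 ^ n) powr (r - 1) * (\<Sum>i<(2::nat) ^ n. (U n i powr \<theta>) powr r)"
   using powr_sum_le_card[of "{..<2 ^ n}" "%i. U n i powr \<theta>" r] r by simp
  also have "(\<Sum>i<(2::nat) ^ n. (U n i powr \<theta>) powr r) <= 2 ^ n * u n powr P"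
   using b th by (simp add: powr_powr r_def)
  finally have "(\<Sum>i<(2::nat) ^ n. U n i powr \<theta>) powr r <= (2 ^ n) powr (r - 1) * (2 ^ n * u n powr P)"
   by (simp add: mult_left_mono)
  also have "\<dots> = (2 ^ n * u n powr \<theta>) powr r"
   using th nn by (simp add: powr_mult powr_powr r_def powr_diff)
  finally have "((\<Sum>i<(2::nat) ^ n. U n i powr \<theta>) powr r) powr (1 / r) <= ((2 ^ n * u n powr \<theta>) powr r) powr (1 / r)"
   using r by (intro powr_mono2[where a = "1 / r"]) auto
  then have "(\<Sum>i<(2::nat) ^ n. U n i powr \<theta>) <= 2 ^ n * u n powr \<theta>"
   using r s0 nn by (simp add: powr_powr)
  moreover have "max 1 (\<theta> * inv_exp p) = 1" using True P by (simp add: ip)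
  ultimately show ?thesis by (simp add: level_sum_def powr_realpow)
 next
  case False
  have "(\<Sum>i<(2::nat) ^ n. U n i powr \<theta>) = (\<Sum>i<(2::nat) ^ n. (U n i powr P) powr (\<theta> / P))"
   using P by (simp add: powr_powr)
  also have "\<dots> <= (\<Sum>i<(2::nat) ^ n. U n i powr P) powr (\<theta> / P)"
   using False P by (intro sum_powr_le_powr_sum) auto
  also have "\<dots> <= (2 ^ n * u n powr P) powr (\<theta> / P)"
   using b P th by (intro powr_mono2 sum_nonneg) auto
  also have "\<dots> = 2 powr (n * (\<theta> / P)) * u n powr \<theta>"
   using P by (simp add: powr_mult powr_powr powr_realpow[symmetric])
  also have "\<theta> / P = max 1 (\<theta> * inv_exp p)" using False P by (simp add: ip)
  finally show ?thesis by (simp add: level_sum_def)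
 qed
qed

text \<open>If \<open>\<theta> * \<alpha> > 1\<close> the sums over generations decay geometrically.
  At \<alpha> = 1/3 and \<open>\<theta> = 3\<close> the decay clause gives mere boundedness, and
  summability comes from the cubic clause of \<open>admissible\<close>.\<close>

lemma tree_summable_cells:
 assumes U: "cell_bound p U u" and adm: "admissible \<alpha> K u" and p: "0 < p" "inv_exp p < \<alpha>"
  and th: "0 < \<theta>" "\<theta> * \<alpha> > 1 \<or> \<alpha> = 1 / 3 \<and> \<theta> = 3" and U0: "\<And>n i. i < 2 ^ n ==> 0 <= U n i"
 shows "tree_summable (%n i. U n i powr \<theta>)"
proof -
 let ?a = "%n i. U n i powr \<theta>"
 have a0: "0 <= level_sum ?a n" for n unfolding level_sum_def by (intro sum_nonneg) auto
 have u: "0 <= u n" "u n <= K * 2 powr (- \<alpha> * n)" if "1 <= n" for n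
  using adm that by (auto simp: admissible_def)
 have "summable (level_sum ?a)"
 proof (cases "\<theta> * \<alpha> > 1")
  case True
  \<comment> \<open>Negative because \<open>\<theta> * \<alpha>\<close> exceeds both 1 and
    \<open>\<theta> * inv_exp p\<close>.\<close>
  define \<beta> where "\<beta> = max 1 (\<theta> * inv_exp p) - \<theta> * \<alpha>"
  have \<beta>: "\<beta> < 0" using True p th by (auto simp: \<beta>_def max_def)
  have le: "level_sum ?a n <= K powr \<theta> * 2 powr (\<beta> * n)" if n: "1 <= n" for n
  proof -
   have "level_sum ?a n <= 2 powr (n * max 1 (\<theta> * inv_exp p)) * u n powr \<theta>"
    by (rule level_sum_powr_le[OF U p(1) th(1) n])
   also have "\<dots> <= 2 powr (n * max 1 (\<theta> * inv_exp p)) * (K * 2 powr (- \<alpha> * n)) powr \<theta>"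
    using u[OF n] th by (intro mult_left_mono powr_mono2) auto
   also have "\<dots> = K powr \<theta> * 2 powr (\<beta> * n)"
    using admissible_nonneg[OF adm]
    by (simp add: powr_mult powr_powr \<beta>_def powr_add[symmetric] algebra_simps)
   finally show ?thesis .
  qed
  have "summable (%n. K powr \<theta> * 2 powr (\<beta> * n))"
   using powr_geometric_sums[OF \<beta>, of 0] by (intro summable_mult) (auto simp: sums_iff)
  then show ?thesis
   by (rule summable_comparison_test'[where N = 1]) (use le a0 in auto)
 next
  case False
  then have th3: "\<alpha> = 1 / 3" "\<theta> = 3" using th(2) by auto
  then have m: "max 1 (\<theta> * inv_exp p) = 1" using p(2) by simp
  have le: "level_sum ?a n <= 2 ^ n * u n ^ 3" if n: "1 <= n" for n
   using level_sum_powr_le[OF U p(1) th(1) n, unfolded m] u(1)[OF n] th3 by (simp add: powr_realpow)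
  have "(\<Sum>n<N. level_sum ?a (Suc n)) <= K" for N
  proof -
   have "(\<Sum>n<N. level_sum ?a (Suc n)) <= (\<Sum>n<N. 2 ^ Suc n * u (Suc n) ^ 3)"
    by (intro sum_mono le) simp
   also have "\<dots> = (\<Sum>n=1..N. 2 ^ n * u n ^ 3)"
    by (rule sum.reindex_bij_witness[of _ "%n. n - 1" Suc]) auto
   also have "\<dots> <= K" using adm th3 by (simp add: admissible_def)
   finally show ?thesis .
  qed
  then have "summable (%n. level_sum ?a (Suc n))"
   by (intro bounded_imp_summable[where B = K] a0) (simp add: lessThan_Suc_atMost[symmetric] del: sum.lessThan_Suc)
  then show ?thesis by (simp add: summable_Suc_iff)
 qed
 then show ?thesis by (auto simp: tree_summable_def)
qed

text \<open>The cubes of generation \<open>m\<close> sum to at most \<open>2 ^ m * u m ^ 3\<close>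
  once \<open>p >= 3\<close>, so \<open>scale_tail u n / 2 ^ n\<close> is the natural mean size of a
  tree sum of cubes over generation \<open>n\<close>.\<close>

definition scale_tail :: "(nat => real) => nat => real" where
 "scale_tail u n = (\<Sum>k. 2 ^ (n + k) * u (n + k) ^ 3)"

text \<open>At \<alpha> = 1/3 the factor \<open>2 powr ((1 - 3 * \<alpha>) * n)\<close> equals 1 and
  only boundedness is left; the separate convergence to 0 later replaces a gain of a power of the
  mesh.\<close>

lemma admissible_scale_tail:
 assumes adm: "admissible \<alpha> K u" and al: "1 / 3 <= \<alpha>" and n: "1 <= n"
 shows "summable (%k. 2 ^ (n + k) * u (n + k) ^ 3)"
  "scale_tail u n <= (K + (if \<alpha> = 1 / 3 then 0 else K ^ 3 / (1 - 2 powr (1 - 3 * \<alpha>)))) * 2 powr ((1 - 3 * \<alpha>) * n)"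
  "\<alpha> = 1 / 3 ==> scale_tail u \<longlonglongrightarrow> 0"
proof -
 have u: "0 <= u n" "u n <= K * 2 powr (- \<alpha> * n)" if "1 <= n" for n
  using adm that by (auto simp: admissible_def)
 note K = admissible_nonneg[OF adm]
 have crit: "summable (%k. 2 ^ k * u k ^ 3)" "(\<Sum>k. 2 ^ (n + k) * u (n + k) ^ 3) <= K" if al: "\<alpha> = 1 / 3" "1 <= n" for n
 proof -
  have b: "(\<Sum>k<N. 2 ^ (n + k) * u (n + k) ^ 3) <= K" if n: "1 <= n" for N n
  proof -
   have "(\<Sum>k<N. 2 ^ (n + k) * u (n + k) ^ 3) = (\<Sum>k=n..<n + N. 2 ^ k * u k ^ 3)"
    by (rule sum.reindex_bij_witness[of _ "%k. k - n" "%k. n + k"]) auto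
   also have "\<dots> <= (\<Sum>k=1..n + N. 2 ^ k * u k ^ 3)"
    using n u(1) by (intro sum_mono2) auto
   also have "\<dots> <= K" using adm al by (simp add: admissible_def)
   finally show ?thesis .
  qed
  have s: "summable (%k. 2 ^ (n + k) * u (n + k) ^ 3)" if n: "1 <= n" for n
   using b[OF n] u(1) n by (intro bounded_imp_summable[where B = K]) (auto simp: lessThan_Suc_atMost[symmetric] simp del: sum.lessThan_Suc)
  show "summable (%k. 2 ^ k * u k ^ 3)" using s[of 1] summable_Suc_iff[of "%k. 2 ^ k * u k ^ 3"] by simp
  show "(\<Sum>k. 2 ^ (n + k) * u (n + k) ^ 3) <= K" by (rule suminf_le_const[OF s[OF that(2)] b[OF that(2)]])
 qed
 have gen: "summable (%k. 2 ^ (n + k) * u (n + k) ^ 3) \<and>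
   (\<Sum>k. 2 ^ (n + k) * u (n + k) ^ 3) <= K ^ 3 / (1 - 2 powr (1 - 3 * \<alpha>)) * 2 powr ((1 - 3 * \<alpha>) * n)" if "\<alpha> \<noteq> 1 / 3"
 proof -
  have \<beta>: "1 - 3 * \<alpha> < 0" using that al by simp
  have le: "2 ^ m * u m ^ 3 <= K ^ 3 * 2 powr ((1 - 3 * \<alpha>) * m)" if m: "1 <= m" for m
  proof -
   have "2 ^ m * u m ^ 3 <= 2 ^ m * (K * 2 powr (- \<alpha> * m)) ^ 3"
    using u[OF m] by (intro mult_left_mono power_mono) auto
   also have "\<dots> = K ^ 3 * 2 powr ((1 - 3 * \<alpha>) * m)"
    by (simp add: power_mult_distrib powr_realpow[symmetric] powr_powr powr_add[symmetric] algebra_simps)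
   finally show ?thesis .
  qed
  have g: "(%k. K ^ 3 * 2 powr ((1 - 3 * \<alpha>) * real (n + k))) sums (K ^ 3 * (2 powr ((1 - 3 * \<alpha>) * n) / (1 - 2 powr (1 - 3 * \<alpha>))))"
   by (intro sums_mult powr_geometric_sums \<beta>)
  have s: "summable (%k. 2 ^ (n + k) * u (n + k) ^ 3)"
   by (rule summable_comparison_test'[OF sums_summable[OF g], of 0]) (use le[of "n + _"] u(1)[of "n + _"] n in auto)
  moreover have "(\<Sum>k. 2 ^ (n + k) * u (n + k) ^ 3) <= K ^ 3 * (2 powr ((1 - 3 * \<alpha>) * n) / (1 - 2 powr (1 - 3 * \<alpha>)))"
   unfolding sums_unique[OF g] by (intro suminf_le s sums_summable[OF g] le) (use n in auto)
  ultimately show ?thesis by simp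
 qed
 show "summable (%k. 2 ^ (n + k) * u (n + k) ^ 3)"
 proof (cases "\<alpha> = 1 / 3")
  case True
  from summable_ignore_initial_segment[OF crit(1)[OF True n], of n] show ?thesis by (simp add: add.commute)
 qed (use gen in blast)
 show "scale_tail u n <= (K + (if \<alpha> = 1 / 3 then 0 else K ^ 3 / (1 - 2 powr (1 - 3 * \<alpha>)))) * 2 powr ((1 - 3 * \<alpha>) * n)"
 proof (cases "\<alpha> = 1 / 3")
  case True
  then have "1 - 3 * \<alpha> = 0" by simp
  then have e: "2 powr ((1 - 3 * \<alpha>) * real n) = 1" by (simp only: mult_zero_left) simp
  show ?thesis using crit(2)[OF True n] unfolding scale_tail_def e if_P[OF True] by simp
 next
  case False
  have "0 <= K * 2 powr ((1 - 3 * \<alpha>) * n)" using K by simp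
  with gen[OF False] False show ?thesis by (simp add: scale_tail_def distrib_right)
 qed
 show "scale_tail u \<longlonglongrightarrow> 0" if "\<alpha> = 1 / 3"
  unfolding scale_tail_def using suminf_exist_split2[OF crit(1)[OF that order_refl]] by (simp add: add.commute)
qed

lemma tree_sum_partial_tendsto:
 assumes "tree_summable a" "i < 2 ^ n"
 shows "(%M. \<Sum>k<M. \<Sum>j\<in>{i * 2 ^ k..<Suc i * 2 ^ k}. a (n + k) j) \<longlonglongrightarrow> tree_sum a n i"
 unfolding tree_sum_def using summable_descendants[OF assms] by (rule summable_LIMSEQ)

text \<open>A Fatou-type step: power sums of infinite tree sums are limits of those over finitely
  many generations, to which inequalities for finite sums apply.\<close>

lemma sum_tree_sum_powr_le:
 assumes a: "tree_summable a" and r: "0 < r"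
  and b: "\<And>M. (\<Sum>i<2 ^ n. (\<Sum>k<M. \<Sum>j\<in>{i * 2 ^ k..<Suc i * 2 ^ k}. a (n + k) j) powr r) <= S"
 shows "(\<Sum>i<2 ^ n. tree_sum a n i powr r) <= S"
proof -
 have nn: "0 <= (\<Sum>k<M. \<Sum>j\<in>{i * 2 ^ k..<Suc i * 2 ^ k}. a (n + k) j)" if "i < 2 ^ n" for i M
  by (rule sum_nonneg) (rule descendants_sum_bounds(1)[OF a that])
 have "(%M. \<Sum>i<2 ^ n. (\<Sum>k<M. \<Sum>j\<in>{i * 2 ^ k..<Suc i * 2 ^ k}. a (n + k) j) powr r)
   \<longlonglongrightarrow> (\<Sum>i<2 ^ n. tree_sum a n i powr r)"
 proof (rule tendsto_sum)
  fix i :: nat assume "i \<in> {..<2 ^ n}"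
  then have i: "i < 2 ^ n" by simp
  show "(%M. (\<Sum>k<M. \<Sum>j\<in>{i * 2 ^ k..<Suc i * 2 ^ k}. a (n + k) j) powr r) \<longlonglongrightarrow> tree_sum a n i powr r"
   by (rule tendsto_powr'[OF tree_sum_partial_tendsto[OF a i] tendsto_const])
    (intro disjI2 conjI r always_eventually allI nn i)
 qed
 then show ?thesis by (rule LIMSEQ_le_const2) (use b in auto)
qed

lemma sum_descendants_card: "card {i * 2 ^ k..<Suc i * (2::nat) ^ k} = 2 ^ k"
proof -
 have "Suc i * (2::nat) ^ k = i * 2 ^ k + 2 ^ k" by (simp only: mult_Suc add.commute)
 then show ?thesis by (simp only: card_atLeastLessThan add_diff_cancel_left')
qed

text \<open>The case \<open>p >= 3\<close>, where \<open>r = p / 3\<close> is at least 1.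
  Minkowski's inequality over the generations is replaced by Jensen with the weights
  \<open>l k = 2 ^ (n + k) * u (n + k) ^ 3\<close>, the expected size of generation
  \<open>n + k\<close>; after division by its weight every generation contributes the same amount.
  Inside one generation, Jensen is applied to the \<open>2 ^ k\<close> descendants of a
  cell.\<close>

lemma cell_bound_tree_sum:
 assumes U: "cell_bound p U u" and adm: "admissible \<alpha> K u" and p: "0 < p" "inv_exp p < \<alpha>"
  and al: "1 / 3 <= \<alpha>" and U0: "\<And>n i. i < 2 ^ n ==> 0 <= U n i"
  and big: "inv_exp p <= 1 / 3"
 shows "cell_bound (p / 3) (tree_sum (%n i. U n i ^ 3)) (%n. scale_tail u n / 2 ^ n)"
proof -
 let ?a = "%n i. U n i ^ 3"
 have "tree_summable (%n i. U n i powr 3)"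
  using al by (intro tree_summable_cells[OF U adm p]) (auto intro: U0)
 then have ts: "tree_summable ?a" using U0 unfolding tree_summable_def level_sum_def by simp
 have u0: "0 <= u n" if "1 <= n" for n using adm that by (auto simp: admissible_def)
 have s: "summable (%k. 2 ^ (n + k) * u (n + k) ^ 3)" if "1 <= n" for n
  by (rule admissible_scale_tail(1)[OF adm al that])
 have L0: "0 <= scale_tail u n" if "1 <= n" for n
  unfolding scale_tail_def using u0 that by (intro suminf_nonneg s) auto
 have part: "(\<Sum>k<M. 2 ^ (n + k) * u (n + k) ^ 3) <= scale_tail u n" if "1 <= n" for n M
  unfolding scale_tail_def using u0 that by (intro sum_le_suminf s) auto
 show ?thesis unfolding cell_bound_def
 proof (intro allI impI conjI)
  fix n :: nat assume n: "1 <= n"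
  show "0 <= scale_tail u n / 2 ^ n" using L0[OF n] by simp
  show "0 <= tree_sum ?a n i" if "i < 2 ^ n" for i by (rule tree_sum_nonneg[OF ts that])
  show "if p / 3 = \<infinity> then \<forall>i<2 ^ n. tree_sum ?a n i <= scale_tail u n / 2 ^ n
   else (\<Sum>i<2 ^ n. tree_sum ?a n i powr enn2real (p / 3)) <= 2 ^ n * (scale_tail u n / 2 ^ n) powr enn2real (p / 3)"
  proof (cases "p = \<infinity>")
   case True
   have "tree_sum ?a n i <= scale_tail u n / 2 ^ n" if i: "i < 2 ^ n" for i
   proof (rule LIMSEQ_le_const2[OF tree_sum_partial_tendsto[OF ts i]], intro exI allI impI)
    fix M :: nat
    have "(\<Sum>k<M. \<Sum>j\<in>{i * 2 ^ k..<Suc i * 2 ^ k}. ?a (n + k) j) <= (\<Sum>k<M. 2 ^ k * u (n + k) ^ 3)"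
    proof (rule sum_mono)
     fix k
     have "(\<Sum>j\<in>{i * 2 ^ k..<Suc i * 2 ^ k}. ?a (n + k) j) <= (\<Sum>j\<in>{i * 2 ^ k..<Suc i * 2 ^ k}. u (n + k) ^ 3)"
     proof (intro sum_mono power_mono)
      fix j assume "j \<in> {i * 2 ^ k..<Suc i * 2 ^ k}"
      then have j: "j < 2 ^ (n + k)" using descendant_less[OF i] by auto
      show "U (n + k) j <= u (n + k)" using cell_bound_infD[of U u "n + k" j] U True n j by simp
      show "0 <= U (n + k) j" by (rule U0[OF j])
     qed
     also have "\<dots> = 2 ^ k * u (n + k) ^ 3" by (simp only: sum_constant sum_descendants_card) simp
     finally show "(\<Sum>j\<in>{i * 2 ^ k..<Suc i * 2 ^ k}. ?a (n + k) j) <= 2 ^ k * u (n + k) ^ 3" .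
    qed
    also have "\<dots> = (\<Sum>k<M. 2 ^ (n + k) * u (n + k) ^ 3) / 2 ^ n"
     by (simp add: sum_divide_distrib power_add)
    also have "\<dots> <= scale_tail u n / 2 ^ n" by (intro divide_right_mono part n) simp
    finally show "(\<Sum>k<M. \<Sum>j\<in>{i * 2 ^ k..<Suc i * 2 ^ k}. ?a (n + k) j) <= scale_tail u n / 2 ^ n" .
   qed
   then show ?thesis using True by (simp add: ennreal_top_divide)
  next
   case False
   define P where "P = enn2real p"
   define r where "r = P / 3"
   have P: "0 < P" "p = ennreal P" using p(1) False by (auto simp: P_def enn2real_positive_iff top.not_eq_extremum)
   have p3: "p / 3 = ennreal r" using P divide_ennreal[of P 3] by (simp add: r_def)
   have ip: "inv_exp p = 1 / P" using False by (simp add: inv_exp_def P_def)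
   have r: "1 <= r" using big P(1) unfolding ip r_def by (simp add: field_simps)
   let ?S = "%i k. \<Sum>j\<in>{i * 2 ^ k..<Suc i * 2 ^ k}. ?a (n + k) j"
   define l where "l k = 2 ^ (n + k) * u (n + k) ^ 3" for k
   have l0: "0 <= l k" for k using u0[of "n + k"] n by (simp add: l_def)
   have S0: "0 <= ?S i k" if "i < 2 ^ n" for i k by (rule descendants_sum_bounds(1)[OF ts that])
   have Sr: "(\<Sum>i<2 ^ n. ?S i k powr r) <= (2 ^ k) powr (r - 1) * (2 ^ (n + k) * u (n + k) powr P)" for k
   proof -
    have U3: "?a (n + k) j powr r = U (n + k) j powr P" if "j < 2 ^ (n + k)" for j
     using U0[OF that] P by (simp add: r_def powr_powr flip: powr_numeral)
    have "(\<Sum>i<2 ^ n. ?S i k powr r) <= (\<Sum>i<2 ^ n. (2 ^ k) powr (r - 1) * (\<Sum>j\<in>{i * 2 ^ k..<Suc i * 2 ^ k}. U (n + k) j powr P))"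
    proof (rule sum_mono)
     fix i :: nat assume "i \<in> {..<2 ^ n}"
     then have j: "j < 2 ^ (n + k)" if "j \<in> {i * 2 ^ k..<Suc i * 2 ^ k}" for j
      using that descendant_less[of i n j k] by auto
     have "?S i k powr r <= real (card {i * 2 ^ k..<Suc i * 2 ^ k}) powr (r - 1)
       * (\<Sum>j\<in>{i * 2 ^ k..<Suc i * 2 ^ k}. ?a (n + k) j powr r)"
      using U0[OF j] r by (intro powr_sum_le_card) auto
     also have "\<dots> = (2 ^ k) powr (r - 1) * (\<Sum>j\<in>{i * 2 ^ k..<Suc i * 2 ^ k}. U (n + k) j powr P)"
      using U3[OF j] by (simp only: sum_descendants_card of_nat_power of_nat_numeral cong: sum.cong)
     finally show "?S i k powr r <= (2 ^ k) powr (r - 1) * (\<Sum>j\<in>{i * 2 ^ k..<Suc i * 2 ^ k}. U (n + k) j powr P)" .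
    qed
    also have "\<dots> = (2 ^ k) powr (r - 1) * (\<Sum>j<2 ^ (n + k). U (n + k) j powr P)"
     unfolding sum_distrib_left[symmetric] sum_over_descendants by (simp only: power_add)
    also have "\<dots> <= (2 ^ k) powr (r - 1) * (2 ^ (n + k) * u (n + k) powr P)"
     using cell_bound_finiteD[OF U False, of "n + k"] n by (intro mult_left_mono) (auto simp: P_def)
    finally show ?thesis .
   qed
   have "(\<Sum>i<2 ^ n. tree_sum ?a n i powr r) <= 2 ^ n * (scale_tail u n / 2 ^ n) powr r"
   proof (rule sum_tree_sum_powr_le[OF ts])
    fix M :: nat
    \<comment> \<open>A vanishing weight forces its whole generation to vanish, as the weighted
      Jensen inequality demands.\<close>
    have lz: "?S i k = 0" if "i < 2 ^ n" "l k = 0" for i k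
    proof -
     have "u (n + k) = 0" using that(2) by (simp add: l_def)
     then have "(\<Sum>j<2 ^ (n + k). U (n + k) j powr P) <= 0"
      using cell_bound_finiteD[OF U False, of "n + k"] n by (simp add: P_def)
     then have "(\<Sum>j<2 ^ (n + k). U (n + k) j powr P) = 0"
      by (intro antisym sum_nonneg) auto
     then have z: "U (n + k) j = 0" if "j < 2 ^ (n + k)" for j
      using that by (simp add: sum_nonneg_eq_0_iff)
     have "U (n + k) j = 0" if "j \<in> {i * 2 ^ k..<Suc i * 2 ^ k}" for j
      using z[of j] descendant_less[OF \<open>i < 2 ^ n\<close>, of j k] that by auto
     then show ?thesis by (intro sum.neutral) simp
    qed
    have "(\<Sum>i<2 ^ n. (\<Sum>k<M. ?S i k) powr r)
      <= (\<Sum>i<2 ^ n. (\<Sum>k<M. l k) powr (r - 1) * (\<Sum>k<M. l k * (?S i k / l k) powr r))"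
     by (intro sum_mono powr_sum_weighted) (use S0 l0 lz r in auto)
    also have "\<dots> = (\<Sum>k<M. l k) powr (r - 1) * (\<Sum>k<M. l k * (\<Sum>i<2 ^ n. (?S i k / l k) powr r))"
    proof -
     have "(\<Sum>i<2 ^ n. \<Sum>k<M. l k * (?S i k / l k) powr r) = (\<Sum>k<M. \<Sum>i<2 ^ n. l k * (?S i k / l k) powr r)"
      by (rule sum.swap)
     then show ?thesis by (simp only: sum_distrib_left[symmetric])
    qed
    also have "\<dots> <= (\<Sum>k<M. l k) powr (r - 1) * (\<Sum>k<M. l k * 2 powr (n * (1 - r)))"
    proof (rule mult_left_mono, rule sum_mono)
     fix k
     show "l k * (\<Sum>i<2 ^ n. (?S i k / l k) powr r) <= l k * 2 powr (n * (1 - r))"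
     proof (cases "l k = 0")
      case False
      then have lk: "0 < l k" "0 < u (n + k)" using l0[of k] u0[of "n + k"] n by (auto simp: l_def less_le)
      have "(\<Sum>i<2 ^ n. (?S i k / l k) powr r) = (\<Sum>i<2 ^ n. ?S i k powr r) / l k powr r"
      proof -
       have "(?S i k / l k) powr r = ?S i k powr r / l k powr r" if "i < 2 ^ n" for i
        by (rule powr_divide)
       then have "(\<Sum>i<2 ^ n. (?S i k / l k) powr r) = (\<Sum>i<2 ^ n. ?S i k powr r / l k powr r)"
        by (intro sum.cong refl) (simp only: lessThan_iff)
       then show ?thesis by (simp only: sum_divide_distrib[symmetric])
      qed
      also have "\<dots> <= (2 ^ k) powr (r - 1) * (2 ^ (n + k) * u (n + k) powr P) / l k powr r"
       by (intro divide_right_mono Sr) simp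
      also have "\<dots> = 2 powr (n * (1 - r))"
      proof -
       have "l k powr r = 2 powr ((n + k) * r) * u (n + k) powr P"
       proof -
        have "l k = 2 powr (n + k) * u (n + k) powr 3"
         using lk by (simp add: l_def powr_realpow del: of_nat_add)
        then show ?thesis by (simp only: powr_mult powr_powr r_def) simp
       qed
       moreover have "(2 ^ k) powr (r - 1) * (2 ^ (n + k) * u (n + k) powr P)
         = 2 powr (n * (1 - r)) * (2 powr ((n + k) * r) * u (n + k) powr P)"
       proof -
        have a: "(2::real) ^ m = 2 powr m" for m by (simp add: powr_realpow)
        have e: "real k * (r - 1) + real (n + k) = n * (1 - r) + real (n + k) * r"
         by (simp add: algebra_simps)
        show ?thesis
         unfolding a powr_powr mult.assoc[symmetric] powr_add[symmetric] e by simp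
       qed
       ultimately show ?thesis using lk by simp
      qed
      finally show ?thesis using lk by (intro mult_left_mono) auto
     qed simp
    qed (use l0 in auto)
    also have "\<dots> = (\<Sum>k<M. l k) powr r * 2 powr (n * (1 - r))"
     using powr_mult_base[OF sum_nonneg[of "{..<M}" l], of "r - 1"] l0
     by (simp add: sum_distrib_right[symmetric] mult_ac)
    also have "\<dots> <= scale_tail u n powr r * 2 powr (n * (1 - r))"
     using part[OF n, of M] l0 r by (intro mult_right_mono powr_mono2 sum_nonneg) (auto simp: l_def)
    also have "\<dots> = 2 ^ n * (scale_tail u n / 2 ^ n) powr r"
     using L0[OF n] by (simp add: powr_divide powr_powr powr_realpow[symmetric] powr_diff algebra_simps)
    finally show "(\<Sum>i<2 ^ n. (\<Sum>k<M. ?S i k) powr r) <= 2 ^ n * (scale_tail u n / 2 ^ n) powr r" .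
   qed (use r in simp)
   then show ?thesis using r by (simp add: p3)
  qed
 qed
qed

text \<open>The case \<open>p < 3\<close>. Powers of order \<open>p / 3\<close> are subadditive, so
  everything reduces to the sum of \<open>U powr p\<close> over all descendants, dominated by a
  geometric series of ratio \<open>2 powr (1 - \<alpha> * p)\<close>. Here
  \<open>1 / p < \<alpha>\<close> forces \<alpha> > 1/3.\<close>

lemma cell_bound_tree_sum_small:
 assumes U: "cell_bound p U u" and adm: "admissible \<alpha> K u" and p: "0 < p" "inv_exp p < \<alpha>"
  and al: "1 / 3 <= \<alpha>" and U0: "\<And>n i. i < 2 ^ n ==> 0 <= U n i"
  and big: "1 / 3 < inv_exp p"
 shows "cell_bound (p / 3) (tree_sum (%n i. U n i ^ 3))
  (%n. (K powr enn2real p / (1 - 2 powr (1 - \<alpha> * enn2real p))) powr (3 / enn2real p) * 2 powr (- 3 * \<alpha> * n))"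
proof -
 let ?a = "%n i. U n i ^ 3"
 have al3: "1 / 3 < \<alpha>" using p(2) big by simp
 have "tree_summable (%n i. U n i powr 3)"
  using al3 by (intro tree_summable_cells[OF U adm p]) (auto intro: U0)
 then have ts: "tree_summable ?a" using U0 unfolding tree_summable_def level_sum_def by simp
 have pinf: "p \<noteq> \<infinity>" using big by (auto simp: inv_exp_def)
 define P where "P = enn2real p"
 define r where "r = P / 3"
 have P: "0 < P" "p = ennreal P" using p(1) pinf by (auto simp: P_def enn2real_positive_iff top.not_eq_extremum)
 have p3: "p / 3 = ennreal r" using P divide_ennreal[of P 3] by (simp add: r_def)
 have ip: "inv_exp p = 1 / P" using pinf by (simp add: inv_exp_def P_def)
 have r: "0 < r" "r <= 1" using big P(1) unfolding ip r_def by (simp_all add: field_simps)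
 have aP: "1 - \<alpha> * P < 0" using p(2) P(1) unfolding ip by (simp add: field_simps)
 define C where "C = K powr P / (1 - 2 powr (1 - \<alpha> * P))"
 have u: "0 <= u n" "u n <= K * 2 powr (- \<alpha> * n)" if "1 <= n" for n
  using adm that by (auto simp: admissible_def)
 note K = admissible_nonneg[OF adm]
 have "2 powr (1 - \<alpha> * P) < 1" using aP powr_less_mono[of "1 - \<alpha> * P" 0 2] by simp
 then have C0: "0 <= C" by (simp add: C_def)
 show ?thesis unfolding cell_bound_def P_def[symmetric] C_def[symmetric]
 proof (intro allI impI conjI)
  fix n :: nat assume n: "1 <= n"
  show "0 <= C powr (3 / P) * 2 powr (- 3 * \<alpha> * n)" by simp
  show "0 <= tree_sum ?a n i" if "i < 2 ^ n" for i by (rule tree_sum_nonneg[OF ts that])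
  have "(\<Sum>i<2 ^ n. tree_sum ?a n i powr r) <= C * 2 powr ((1 - \<alpha> * P) * n)"
  proof (rule sum_tree_sum_powr_le[OF ts r(1)])
   fix M :: nat
   have g: "(%k. K powr P * 2 powr ((1 - \<alpha> * P) * real (n + k))) sums (K powr P * (2 powr ((1 - \<alpha> * P) * n) / (1 - 2 powr (1 - \<alpha> * P))))"
    by (intro sums_mult powr_geometric_sums aP)
   have "(\<Sum>i<2 ^ n. (\<Sum>k<M. \<Sum>j\<in>{i * 2 ^ k..<Suc i * 2 ^ k}. ?a (n + k) j) powr r)
     <= (\<Sum>i<2 ^ n. \<Sum>k<M. \<Sum>j\<in>{i * 2 ^ k..<Suc i * 2 ^ k}. U (n + k) j powr P)"
   proof (rule sum_mono)
    fix i :: nat assume "i \<in> {..<2 ^ n}"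
    then have i: "i < 2 ^ n" by simp
    have j: "0 <= U (n + k) j" if "j \<in> {i * 2 ^ k..<Suc i * 2 ^ k}" for j k
     using that descendant_less[OF i, of j k] U0 by auto
    have "(\<Sum>k<M. \<Sum>j\<in>{i * 2 ^ k..<Suc i * 2 ^ k}. ?a (n + k) j) powr r
      <= (\<Sum>k<M. (\<Sum>j\<in>{i * 2 ^ k..<Suc i * 2 ^ k}. ?a (n + k) j) powr r)"
     using r by (intro powr_sum_le_sum_powr descendants_sum_bounds(1)[OF ts i])
    also have "\<dots> <= (\<Sum>k<M. \<Sum>j\<in>{i * 2 ^ k..<Suc i * 2 ^ k}. ?a (n + k) j powr r)"
     using r j by (intro sum_mono powr_sum_le_sum_powr) auto
    also have "\<dots> = (\<Sum>k<M. \<Sum>j\<in>{i * 2 ^ k..<Suc i * 2 ^ k}. U (n + k) j powr P)"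
    proof (intro sum.cong refl)
     fix k j assume "j \<in> {i * 2 ^ k..<Suc i * 2 ^ k}"
     from j[OF this] show "?a (n + k) j powr r = U (n + k) j powr P"
      using P by (simp add: r_def powr_powr flip: powr_numeral)
    qed
    finally show "(\<Sum>k<M. \<Sum>j\<in>{i * 2 ^ k..<Suc i * 2 ^ k}. ?a (n + k) j) powr r
      <= (\<Sum>k<M. \<Sum>j\<in>{i * 2 ^ k..<Suc i * 2 ^ k}. U (n + k) j powr P)" .
   qed
   also have "\<dots> = (\<Sum>k<M. \<Sum>j<2 ^ (n + k). U (n + k) j powr P)"
   proof -
    have "(\<Sum>i<2 ^ n. \<Sum>k<M. \<Sum>j\<in>{i * 2 ^ k..<Suc i * 2 ^ k}. U (n + k) j powr P)
      = (\<Sum>k<M. \<Sum>i<2 ^ n. \<Sum>j\<in>{i * 2 ^ k..<Suc i * 2 ^ k}. U (n + k) j powr P)"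
     by (rule sum.swap)
    then show ?thesis by (simp only: sum_over_descendants power_add)
   qed
   also have "\<dots> <= (\<Sum>k<M. K powr P * 2 powr ((1 - \<alpha> * P) * real (n + k)))"
   proof (rule sum_mono)
    fix k
    have n1: "1 <= n + k" using n by simp
    have "(\<Sum>j<2 ^ (n + k). U (n + k) j powr P) <= 2 ^ (n + k) * u (n + k) powr P"
     using cell_bound_finiteD[OF U pinf n1] by (simp add: P_def)
    also have "\<dots> <= 2 ^ (n + k) * (K * 2 powr (- \<alpha> * real (n + k))) powr P"
     using u[OF n1] P by (intro mult_left_mono powr_mono2) auto
    also have "\<dots> = K powr P * 2 powr ((1 - \<alpha> * P) * real (n + k))"
     using K by (simp add: powr_mult powr_powr powr_add[symmetric] algebra_simps flip: powr_realpow)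
    finally show "(\<Sum>j<2 ^ (n + k). U (n + k) j powr P) <= K powr P * 2 powr ((1 - \<alpha> * P) * real (n + k))" .
   qed
   also have "\<dots> <= K powr P * (2 powr ((1 - \<alpha> * P) * n) / (1 - 2 powr (1 - \<alpha> * P)))"
    unfolding sums_unique[OF g] using K by (intro sum_le_suminf sums_summable[OF g]) auto
   finally show "(\<Sum>i<2 ^ n. (\<Sum>k<M. \<Sum>j\<in>{i * 2 ^ k..<Suc i * 2 ^ k}. ?a (n + k) j) powr r) <= C * 2 powr ((1 - \<alpha> * P) * n)"
    by (simp add: C_def)
  qed
  also have "\<dots> = 2 ^ n * (C powr (3 / P) * 2 powr (- 3 * \<alpha> * n)) powr r"
   using C0 P by (simp add: powr_mult powr_powr r_def powr_add[symmetric] algebra_simps flip: powr_realpow)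
  finally show "if p / 3 = \<infinity> then \<forall>i<2 ^ n. tree_sum ?a n i <= C powr (3 / P) * 2 powr (- 3 * \<alpha> * n)
   else (\<Sum>i<2 ^ n. tree_sum ?a n i powr enn2real (p / 3)) <= 2 ^ n * (C powr (3 / P) * 2 powr (- 3 * \<alpha> * n)) powr enn2real (p / 3)"
   using r by (simp add: p3)
 qed
qed

section \<open>Lebesgue and Besov norms of continuous functions\<close>

lemma epowr_ennreal: "0 <= x ==> epowr (ennreal x) r = ennreal (x powr r)"
 by (simp add: epowr_def)

lemma epowr_top [simp]: "epowr top r = top"
 by (simp add: epowr_def)

lemma epowr_mono: "x <= y ==> 0 <= r ==> epowr x r <= epowr y r"
 by (cases x rule: ennreal_cases; cases y rule: ennreal_cases)
  (auto simp: epowr_ennreal intro!: ennreal_leI powr_mono2 simp: top_unique)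

lemma epowr_epowr: "epowr (epowr x r) s = epowr x (r * s)"
 by (cases x rule: ennreal_cases) (simp_all add: epowr_ennreal powr_powr)

lemma epowr_le_iff:
 assumes "0 <= c" "0 < r"
 shows "epowr x (1 / r) <= ennreal c \<longleftrightarrow> x <= ennreal (c powr r)"
proof
 assume "epowr x (1 / r) <= ennreal c"
 from epowr_mono[OF this, of r] show "x <= ennreal (c powr r)"
  using assms by (cases x rule: ennreal_cases) (simp_all add: epowr_epowr epowr_ennreal powr_powr top_unique)
next
 assume "x <= ennreal (c powr r)"
 from epowr_mono[OF this, of "1 / r"] show "epowr x (1 / r) <= ennreal c"
  using assms by (simp add: epowr_ennreal powr_powr)
qed

lemma epowr_cmult:
 assumes "0 < c"
 shows "epowr (ennreal c * x) r = ennreal (c powr r) * epowr x r"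
 using assms by (cases x rule: ennreal_cases)
  (simp_all add: epowr_ennreal ennreal_mult[symmetric] powr_mult ennreal_mult_eq_top_iff ennreal_mult_top)

lemma epowr_add_le:
 assumes "0 < r"
 shows "epowr (x + y) r <= ennreal (2 powr r) * (epowr x r + epowr y r)"
proof (cases "x = top \<or> y = top")
 case True
 then show ?thesis by (auto simp: ennreal_mult_top)
next
 case False
 then obtain a b where ab: "x = ennreal a" "y = ennreal b" "0 <= a" "0 <= b"
  by (metis ennreal_cases)
 have "epowr (x + y) r = ennreal ((a + b) powr r)"
  using ab by (simp add: epowr_ennreal flip: ennreal_plus)
 also have "\<dots> <= ennreal (2 powr r * (a powr r + b powr r))"
  by (intro ennreal_leI powr_add_le ab assms)
 also have "\<dots> = ennreal (2 powr r) * (epowr x r + epowr y r)"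
  using ab by (simp add: epowr_ennreal ennreal_mult)
 finally show ?thesis .
qed

lemma epowr_measurable [measurable]:
 assumes "g \<in> borel_measurable M"
 shows "(%x. epowr (g x) r) \<in> borel_measurable M"
proof -
 have "(%x. if g x = \<infinity> then (\<infinity>::ennreal) else ennreal (enn2real (g x) powr r)) \<in> borel_measurable M"
  using assms by measurable
 then show ?thesis by (simp add: epowr_def)
qed

lemma enn2real_pos: "0 < p ==> p \<noteq> \<infinity> ==> 0 < enn2real p"
 by (simp add: enn2real_positive_iff top.not_eq_extremum)

lemma lp_norm_mono:
 assumes "\<And>x. x \<in> space M ==> f x <= g x"
 shows "lp_norm p M f <= lp_norm p M g"
 using assms unfolding lp_norm_def
 by (auto intro!: SUP_mono epowr_mono nn_integral_mono)

lemma lp_norm_le_finite_iff: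
 assumes "0 <= c" "0 < p" "p \<noteq> \<infinity>"
 shows "lp_norm p M g <= ennreal c \<longleftrightarrow> (\<integral>\<^sup>+x. epowr (g x) (enn2real p) \<partial>M) <= ennreal (c powr enn2real p)"
 using epowr_le_iff[OF assms(1) enn2real_pos[OF assms(2,3)]] assms(3) by (simp add: lp_norm_def)

text \<open>One explicit constant for all exponents in \<open>(0, \<infinity>]\<close>, because
  \<open>p / 2\<close> and \<open>q / 2\<close> may be below 1, where Minkowski's inequality
  fails.\<close>

lemma lp_norm_quasi_triangle:
 assumes p: "0 < p" and c: "0 < c" and m: "g \<in> borel_measurable M" "h \<in> borel_measurable M"
  and le: "\<And>x. x \<in> space M ==> f x <= ennreal c * (g x + h x)"
 shows "lp_norm p M f <= ennreal (c * 2 * 2 powr inv_exp p) * (lp_norm p M g + lp_norm p M h)"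
proof (cases "p = \<infinity>")
 case True
 have "f x <= ennreal (c * 2 * 2 powr inv_exp p) * ((SUP x\<in>space M. g x) + (SUP x\<in>space M. h x))" if "x \<in> space M" for x
 proof -
  have "f x <= ennreal c * ((SUP x\<in>space M. g x) + (SUP x\<in>space M. h x))"
   using le[OF that] that by (elim order_trans) (intro mult_left_mono add_mono SUP_upper; simp)
  also have "\<dots> <= ennreal (c * 2 * 2 powr inv_exp p) * ((SUP x\<in>space M. g x) + (SUP x\<in>space M. h x))"
   using c True by (intro mult_right_mono ennreal_leI) (auto simp: inv_exp_def)
  finally show ?thesis .
 qed
 then show ?thesis using True by (auto simp: lp_norm_def intro!: SUP_least)
next
 case False
 define P where "P = enn2real p"
 have P: "0 < P" unfolding P_def by (rule enn2real_pos[OF p False])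
 define k where "k = c powr P * 2 powr P"
 have k: "0 < k" using c by (simp add: k_def)
 have "(\<integral>\<^sup>+x. epowr (f x) P \<partial>M) <= (\<integral>\<^sup>+x. ennreal k * (epowr (g x) P + epowr (h x) P) \<partial>M)"
 proof (rule nn_integral_mono)
  fix x assume "x \<in> space M"
  then have "epowr (f x) P <= epowr (ennreal c * (g x + h x)) P" using P by (intro epowr_mono le) auto
  also have "\<dots> = ennreal (c powr P) * epowr (g x + h x) P" by (rule epowr_cmult[OF c])
  also have "\<dots> <= ennreal (c powr P) * (ennreal (2 powr P) * (epowr (g x) P + epowr (h x) P))"
   by (intro mult_left_mono epowr_add_le P) simp
  finally show "epowr (f x) P <= ennreal k * (epowr (g x) P + epowr (h x) P)"
   by (simp add: k_def ennreal_mult mult.assoc)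
 qed
 also have "\<dots> = ennreal k * ((\<integral>\<^sup>+x. epowr (g x) P \<partial>M) + (\<integral>\<^sup>+x. epowr (h x) P \<partial>M))"
  using m by (simp add: nn_integral_cmult nn_integral_add)
 finally have "epowr (\<integral>\<^sup>+x. epowr (f x) P \<partial>M) (1 / P)
   <= epowr (ennreal k * ((\<integral>\<^sup>+x. epowr (g x) P \<partial>M) + (\<integral>\<^sup>+x. epowr (h x) P \<partial>M))) (1 / P)"
  using P by (intro epowr_mono) auto
 also have "\<dots> <= ennreal (k powr (1 / P)) * (ennreal (2 powr (1 / P))
   * (epowr (\<integral>\<^sup>+x. epowr (g x) P \<partial>M) (1 / P) + epowr (\<integral>\<^sup>+x. epowr (h x) P \<partial>M) (1 / P)))"
  unfolding epowr_cmult[OF k] using P by (intro mult_left_mono epowr_add_le) auto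
 also have "k powr (1 / P) = c * 2" using c P by (simp add: k_def powr_mult powr_powr)
 finally show ?thesis using False c
  by (simp add: lp_norm_def P_def[symmetric] inv_exp_def ennreal_mult mult.assoc)
qed

lemma lp_norm_square_le:
 assumes "0 < p"
 shows "lp_norm (p / 2) M (%x. (g x)\<^sup>2) <= (lp_norm p M g)\<^sup>2"
proof (cases "p = \<infinity>")
 case True
 then show ?thesis by (auto simp: lp_norm_def ennreal_top_divide intro!: SUP_least power_mono SUP_upper)
next
 case False
 define P where "P = enn2real p"
 have P: "0 < P" "p = ennreal P" unfolding P_def using enn2real_pos[OF assms False] False
  by (auto simp: top.not_eq_extremum)
 have p2: "p / 2 = ennreal (P / 2)" using P divide_ennreal[of P 2] by simp
 have sq: "epowr (x\<^sup>2) (P / 2) = epowr x P" for x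
  by (cases x rule: ennreal_cases) (auto simp: epowr_ennreal ennreal_power powr_powr P power2_eq_square[of "top::ennreal"] simp flip: powr_numeral)
 have rt: "epowr x (2 / P) = (epowr x (1 / P))\<^sup>2" for x
 proof (cases x rule: ennreal_cases)
  case (real a)
  have "a powr (2 / P) = (a powr (1 / P))\<^sup>2" by (simp add: powr_powr flip: powr_numeral)
  then show ?thesis using real by (simp add: epowr_ennreal ennreal_power)
 qed (simp add: power2_eq_square[of "top::ennreal"])
 have "lp_norm (p / 2) M (%x. (g x)\<^sup>2) = epowr (\<integral>\<^sup>+x. epowr ((g x)\<^sup>2) (P / 2) \<partial>M) (1 / (P / 2))"
  using P(1) by (simp add: lp_norm_def p2)
 also have "\<dots> = (epowr (\<integral>\<^sup>+x. epowr (g x) P \<partial>M) (1 / P))\<^sup>2"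
  by (simp add: sq rt)
 also have "\<dots> = (lp_norm p M g)\<^sup>2" using False by (simp add: lp_norm_def P_def)
 finally show ?thesis by simp
qed

lemma nn_integral_Icc:
 fixes a b :: real and g :: "real => real"
 assumes "continuous_on {a..b} g" "\<And>s. s \<in> {a..b} ==> 0 <= g s"
 shows "(\<integral>\<^sup>+s. ennreal (g s) \<partial>restrict_space lborel {a..b}) = ennreal (integral {a..b} g)"
proof -
 have "(g has_integral integral {a..b} g) {a..b}"
  using integrable_continuous_interval[OF assms(1)] by (simp add: integrable_integral)
 from nn_integral_has_integral_lebesgue'[OF assms(2) this] show ?thesis
  by (simp add: nn_integral_restrict_space)
qed

section \<open>Slices at a fixed lag, moduli and the Besov scale\<close>

definition Lp :: "ennreal => real => (real => real => 'v::real_normed_vector) => real => ennreal" where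
 "Lp p T A h = lp_norm p (restrict_space lborel {0..T - h}) (%s. ennreal (norm (A s (s + h))))"

definition modulus :: "ennreal => real => (real => real => 'v::real_normed_vector) => real => ennreal" where
 "modulus p T A \<tau> = (SUP h\<in>{0..\<tau>}. Lp p T A h)"

definition scale_measure_on :: "real => real measure" where
 "scale_measure_on T = density (restrict_space lborel {0<..T}) (%\<tau>. ennreal (1 / \<tau>))"

lemma besov2_norm_eq:
 "besov2_norm \<alpha> p q T A = lp_norm q (scale_measure_on T) (%\<tau>. ennreal (\<tau> powr - \<alpha>) * modulus p T A \<tau>)"
 by (simp add: besov2_norm_def scale_measure_on_def modulus_def Lp_def)

lemma space_scale_measure [simp]: "space (scale_measure_on T) = {0<..T}"
 by (simp add: scale_measure_on_def space_restrict_space)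

lemma sets_scale_measure: "sets (scale_measure_on T) = sets (restrict_space borel {0<..T})"
 by (simp add: scale_measure_on_def sets_restrict_space)

abbreviation cont2 :: "real => (real => real => 'v::real_normed_vector) => bool" where
 "cont2 T A \<equiv> continuous_on (simplex2 T) (%(s, t). A s t)"

lemma cont2_slice:
 assumes "cont2 T A" "0 <= h"
 shows "continuous_on {0..T - h} (%s. A s (s + h))"
proof -
 have "continuous_on {0..T - h} (%s. (%(s, t). A s t) (s, s + h))"
  by (rule continuous_on_compose2[OF assms(1)]) (use assms(2) in \<open>auto intro!: continuous_intros simp: simplex2_def\<close>)
 then show ?thesis by simp
qed

lemma compact_simplex2: "compact (simplex2 T)"
proof -
 have "simplex2 T = ({0..T} \<times> {0..T}) \<inter> {z. fst z <= snd z}"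
  by (auto simp: simplex2_def)
 moreover have "closed {z::real \<times> real. fst z <= snd z}"
  by (intro closed_Collect_le continuous_intros)
 ultimately show ?thesis by (simp add: compact_Int_closed compact_Times)
qed

lemma cont2_bounded:
 assumes "cont2 T A"
 obtains M where "0 <= M" "\<And>s t. 0 <= s ==> s <= t ==> t <= T ==> norm (A s t) <= M"
proof -
 have "bounded ((%(s, t). A s t) ` simplex2 T)"
  using compact_continuous_image[OF assms compact_simplex2] compact_imp_bounded by blast
 then obtain M where M: "0 < M" "\<And>x. x \<in> (%(s, t). A s t) ` simplex2 T ==> norm x <= M"
  unfolding bounded_pos by blast
 show ?thesis
 proof (rule that[of M])
  show "0 <= M" using M by simp
  show "norm (A s t) <= M" if "0 <= s" "s <= t" "t <= T" for s t
   using that by (intro M(2)) (auto simp: simplex2_def image_iff intro!: bexI[of _ "(s, t)"])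
 qed
qed

lemma continuous_norm_powr_slice:
 assumes "cont2 T A" "0 <= h" "0 < r"
 shows "continuous_on {0..T - h} (%s. norm (A s (s + h)) powr r)"
 using assms by (intro continuous_on_powr' continuous_intros cont2_slice) auto

text \<open>Continuity turns slice norms into ordinary integrals of continuous functions on an
  interval, for which splitting into cells and translation are available.\<close>

lemma Lp_le_iff:
 assumes A: "cont2 T A" and h: "0 <= h" and p: "0 < p" and c: "0 <= c"
 shows "Lp p T A h <= ennreal c \<longleftrightarrow>
  (if p = \<infinity> then \<forall>s\<in>{0..T - h}. norm (A s (s + h)) <= c
   else integral {0..T - h} (%s. norm (A s (s + h)) powr enn2real p) <= c powr enn2real p)"
proof (cases "p = \<infinity>")
 case True
 then show ?thesis using c by (simp add: Lp_def lp_norm_def space_restrict_space SUP_le_iff)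
next
 case False
 have i0: "0 <= integral {0..T - h} (%s. norm (A s (s + h)) powr enn2real p)"
  by (intro integral_nonneg integrable_continuous_interval continuous_norm_powr_slice A h enn2real_pos p False) auto
 have "(\<integral>\<^sup>+s. epowr (ennreal (norm (A s (s + h)))) (enn2real p) \<partial>restrict_space lborel {0..T - h})
   = ennreal (integral {0..T - h} (%s. norm (A s (s + h)) powr enn2real p))"
  unfolding epowr_ennreal[OF norm_ge_zero]
  by (intro nn_integral_Icc continuous_norm_powr_slice A h enn2real_pos p False) auto
 then show ?thesis using False i0
  by (simp add: Lp_def lp_norm_le_finite_iff[OF c p False] ennreal_le_iff)
qed

lemma Lp_le_bound:
 assumes T: "0 < T" and A: "cont2 T A" and h: "0 <= h" "h <= T" and p: "0 < p"
  and M: "0 <= M" "\<And>s t. 0 <= s ==> s <= t ==> t <= T ==> norm (A s t) <= M"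
 shows "Lp p T A h <= ennreal (M * T powr inv_exp p)"
proof -
 have c: "0 <= M * T powr inv_exp p" using M by simp
 show ?thesis unfolding Lp_le_iff[OF A h(1) p c]
 proof (cases "p = \<infinity>")
  case True
  have "norm (A s (s + h)) <= M" if "s \<in> {0..T - h}" for s using that h by (intro M(2)) auto
  then show "if p = \<infinity> then \<forall>s\<in>{0..T - h}. norm (A s (s + h)) <= M * T powr inv_exp p
   else integral {0..T - h} (%s. norm (A s (s + h)) powr enn2real p) <= (M * T powr inv_exp p) powr enn2real p"
   using True T by (auto simp: inv_exp_def)
 next
  case False
  note P = enn2real_pos[OF p False]
  have "integral {0..T - h} (%s. norm (A s (s + h)) powr enn2real p) <= integral {0..T - h} (%s. M powr enn2real p)"
  proof (rule integral_le)
   show "norm (A s (s + h)) powr enn2real p <= M powr enn2real p" if "s \<in> {0..T - h}" for s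
    using that h P by (intro powr_mono2 M(2)) auto
  qed (auto intro!: integrable_continuous_interval continuous_norm_powr_slice A h P)
  also have "\<dots> <= T * M powr enn2real p" using h by (simp add: mult_right_mono)
  also have "\<dots> = (M * T powr inv_exp p) powr enn2real p"
   using h P False by (simp add: inv_exp_def powr_mult powr_powr)
  finally show "if p = \<infinity> then \<forall>s\<in>{0..T - h}. norm (A s (s + h)) <= M * T powr inv_exp p
   else integral {0..T - h} (%s. norm (A s (s + h)) powr enn2real p) <= (M * T powr inv_exp p) powr enn2real p"
   using False by simp
 qed
qed

lemma Lp_finite:
 assumes T: "0 < T" and A: "cont2 T A" and h: "0 <= h" "h <= T" and p: "0 < p"
 obtains c where "0 <= c" "Lp p T A h = ennreal c"
proof -
 obtain M where M: "0 <= M" "\<And>s t. 0 <= s ==> s <= t ==> t <= T ==> norm (A s t) <= M"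
  using cont2_bounded[OF A] by blast
 have "Lp p T A h \<noteq> top" using Lp_le_bound[OF T A h p M] by (auto simp: top_unique)
 then show ?thesis using that by (cases "Lp p T A h" rule: ennreal_cases) auto
qed

lemma Lp_quasi_triangle:
 assumes B: "cont2 T B" and E: "cont2 T E" and h: "0 <= h" "h <= T" and p: "0 < p" and c: "0 < c"
  and le: "\<And>s t. 0 <= s ==> s <= t ==> t <= T ==> norm (A s t) <= c * (norm (B s t) + norm (E s t))"
 shows "Lp p T A h <= ennreal (c * 2 * 2 powr inv_exp p) * (Lp p T B h + Lp p T E h)"
 unfolding Lp_def
proof (rule lp_norm_quasi_triangle[OF p c])
 have m: "(%s. norm (D s (s + h))) \<in> borel_measurable (restrict_space lborel {0..T - h})" if "cont2 T D"
  for D :: "real => real => 'z::real_normed_vector"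
 proof -
  have "(%s. norm (D s (s + h))) \<in> borel_measurable (restrict_space borel {0..T - h})"
   by (intro borel_measurable_continuous_on_restrict continuous_intros cont2_slice that h)
  then show ?thesis by (simp cong: measurable_cong_sets add: sets_restrict_space)
 qed
 show "(%s. ennreal (norm (B s (s + h)))) \<in> borel_measurable (restrict_space lborel {0..T - h})"
  "(%s. ennreal (norm (E s (s + h)))) \<in> borel_measurable (restrict_space lborel {0..T - h})"
  using m[OF B] m[OF E] by measurable
 show "ennreal (norm (A s (s + h))) <= ennreal c * (ennreal (norm (B s (s + h))) + ennreal (norm (E s (s + h))))"
  if "s \<in> space (restrict_space lborel {0..T - h})" for s
 proof -
  have "ennreal (norm (A s (s + h))) <= ennreal (c * (norm (B s (s + h)) + norm (E s (s + h))))"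
   using that h by (intro ennreal_leI le) (auto simp: space_restrict_space)
  then show ?thesis using c by (simp add: ennreal_mult)
 qed
qed

lemma modulus_mono: "\<sigma> <= \<tau> ==> modulus p T A \<sigma> <= modulus p T A \<tau>"
 unfolding modulus_def by (intro SUP_subset_mono) auto

lemma modulus_finite:
 assumes T: "0 < T" and A: "cont2 T A" and t: "\<tau> <= T" and p: "0 < p"
 shows "modulus p T A \<tau> < top"
proof -
 obtain M where M: "0 <= M" "\<And>s t. 0 <= s ==> s <= t ==> t <= T ==> norm (A s t) <= M"
  using cont2_bounded[OF A] by blast
 have "modulus p T A \<tau> <= ennreal (M * T powr inv_exp p)"
  unfolding modulus_def using t by (intro SUP_least Lp_le_bound[OF T A _ _ p M]) auto
 then show ?thesis by (rule le_less_trans) simp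
qed

text \<open>Monotonicity in the scale gives measurability; finiteness, which comes from continuity
  of \<open>A\<close>, permits the passage to real values.\<close>

lemma modulus_measurable:
 assumes T: "0 < T" and A: "cont2 T A" and p: "0 < p"
 shows "(%\<tau>. ennreal (\<tau> powr - \<gamma>) * modulus p T A \<tau>) \<in> borel_measurable (scale_measure_on T)"
proof -
 have fin: "modulus p T A \<tau> < top" if "\<tau> \<in> {0<..T}" for \<tau> using that by (intro modulus_finite T A p) auto
 have "mono_on {0<..T} (%\<tau>. enn2real (modulus p T A \<tau>))"
  by (intro mono_onI enn2real_mono modulus_mono fin)
 then have "(%\<tau>. enn2real (modulus p T A \<tau>)) \<in> borel_measurable (restrict_space borel {0<..T})"
  by (rule borel_measurable_mono_on_fnc)
 then have "(%\<tau>. enn2real (modulus p T A \<tau>)) \<in> borel_measurable (scale_measure_on T)"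
  using measurable_cong_sets[OF sets_scale_measure refl] by blast
 moreover have "(%\<tau>::real. \<tau> powr - \<gamma>) \<in> borel_measurable (scale_measure_on T)"
 proof -
  have "(%\<tau>::real. \<tau> powr - \<gamma>) \<in> borel_measurable (restrict_space borel {0<..T})"
   by (rule measurable_restrict_space1) measurable
  then show ?thesis using measurable_cong_sets[OF sets_scale_measure refl] by blast
 qed
 ultimately have "(%\<tau>. ennreal (\<tau> powr - \<gamma>) * ennreal (enn2real (modulus p T A \<tau>))) \<in> borel_measurable (scale_measure_on T)"
  by measurable
 then show ?thesis
  by (rule measurable_cong[THEN iffD1, rotated]) (use fin in auto)
qed

lemma besov2_norm_quasi_triangle:
 assumes T: "0 < T" and B: "cont2 T B" and E: "cont2 T E" and p: "0 < p" and q: "0 < q" and c: "0 < c"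
  and le: "\<And>s t. 0 <= s ==> s <= t ==> t <= T ==> norm (A s t) <= c * (norm (B s t) + norm (E s t))"
 shows "besov2_norm \<gamma> p q T A
  <= ennreal (c * 2 * 2 powr inv_exp p * 2 * 2 powr inv_exp q) * (besov2_norm \<gamma> p q T B + besov2_norm \<gamma> p q T E)"
 unfolding besov2_norm_eq
proof (rule lp_norm_quasi_triangle[OF q _ modulus_measurable[OF T B p] modulus_measurable[OF T E p]])
 let ?C = "c * 2 * 2 powr inv_exp p"
 show "0 < ?C" using c by simp
 fix \<tau> assume "\<tau> \<in> space (scale_measure_on T)"
 then have t: "0 < \<tau>" "\<tau> <= T" by auto
 have "modulus p T A \<tau> <= ennreal ?C * (modulus p T B \<tau> + modulus p T E \<tau>)"
  unfolding modulus_def[of _ _ A]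
 proof (rule SUP_least)
  fix h assume h: "h \<in> {0..\<tau>}"
  then have "Lp p T A h <= ennreal ?C * (Lp p T B h + Lp p T E h)"
   using t by (intro Lp_quasi_triangle[OF B E _ _ p c le]) auto
  also have "\<dots> <= ennreal ?C * (modulus p T B \<tau> + modulus p T E \<tau>)"
   unfolding modulus_def using h by (intro mult_left_mono add_mono SUP_upper) auto
  finally show "Lp p T A h <= ennreal ?C * (modulus p T B \<tau> + modulus p T E \<tau>)" .
 qed
 then have "ennreal (\<tau> powr - \<gamma>) * modulus p T A \<tau> <= ennreal (\<tau> powr - \<gamma>) * (ennreal ?C * (modulus p T B \<tau> + modulus p T E \<tau>))"
  by (rule mult_left_mono) simp
 then show "ennreal (\<tau> powr - \<gamma>) * modulus p T A \<tau>
   <= ennreal ?C * (ennreal (\<tau> powr - \<gamma>) * modulus p T B \<tau> + ennreal (\<tau> powr - \<gamma>) * modulus p T E \<tau>)"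
  by (simp only: distrib_left distrib_right mult_ac)
qed

text \<open>Meant for the quadratic Taylor term of \<open>f(Y)\<close>: squaring doubles the order
  and halves both exponents.\<close>

lemma besov2_norm_square_le:
 fixes B :: "real => real => 'v::real_normed_vector"
 assumes p: "0 < p" and q: "0 < q"
 shows "besov2_norm (2 * \<gamma>) (p / 2) (q / 2) T (%s t. (norm (B s t))\<^sup>2) <= (besov2_norm \<gamma> p q T B)\<^sup>2"
proof -
 have L: "Lp (p / 2) T (%s t. (norm (B s t))\<^sup>2) h <= (Lp p T B h)\<^sup>2" for h
  using lp_norm_square_le[OF p, of "restrict_space lborel {0..T - h}" "%s. ennreal (norm (B s (s + h)))"]
  by (simp add: Lp_def ennreal_power)
 have M: "modulus (p / 2) T (%s t. (norm (B s t))\<^sup>2) \<tau> <= (modulus p T B \<tau>)\<^sup>2" for \<tau>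
  unfolding modulus_def by (rule SUP_least) (auto intro!: order_trans[OF L] power_mono SUP_upper)
 have "besov2_norm (2 * \<gamma>) (p / 2) (q / 2) T (%s t. (norm (B s t))\<^sup>2)
   <= lp_norm (q / 2) (scale_measure_on T) (%\<tau>. (ennreal (\<tau> powr - \<gamma>) * modulus p T B \<tau>)\<^sup>2)"
  unfolding besov2_norm_eq
 proof (rule lp_norm_mono)
  fix \<tau> :: real
  have "\<tau> powr - (2 * \<gamma>) = (\<tau> powr - \<gamma>)\<^sup>2" by (simp add: powr_powr mult.commute flip: powr_numeral)
  then have "ennreal (\<tau> powr - (2 * \<gamma>)) = (ennreal (\<tau> powr - \<gamma>))\<^sup>2" by (simp add: ennreal_power)
  then show "ennreal (\<tau> powr - (2 * \<gamma>)) * modulus (p / 2) T (%s t. (norm (B s t))\<^sup>2) \<tau> <= (ennreal (\<tau> powr - \<gamma>) * modulus p T B \<tau>)\<^sup>2"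
   by (simp add: power_mult_distrib M mult_left_mono)
 qed
 also have "\<dots> <= (besov2_norm \<gamma> p q T B)\<^sup>2"
  unfolding besov2_norm_eq by (rule lp_norm_square_le[OF q])
 finally show ?thesis .
qed

lemma nn_integral_scale_measure:
 assumes "f \<in> borel_measurable (restrict_space lborel {0<..T})"
 shows "(\<integral>\<^sup>+\<tau>. f \<tau> \<partial>scale_measure_on T) = (\<integral>\<^sup>+\<tau>\<in>{0<..T}. ennreal (1 / \<tau>) * f \<tau> \<partial>lborel)"
proof -
 have "(%\<tau>::real. ennreal (1 / \<tau>)) \<in> borel_measurable (restrict_space lborel {0<..T})"
  by (rule measurable_restrict_space1) measurable
 then show ?thesis unfolding scale_measure_on_def
  by (simp add: nn_integral_density assms nn_integral_restrict_space)
qed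

text \<open>The surplus \<open>\<gamma>' - \<gamma>\<close> makes the scale integral converge for
  every \<open>q\<close>. \<open>K\<close> is chosen before \<open>E\<close> and \<open>C\<close>
  enters linearly, which keeps the a priori bound uniform.\<close>

lemma besov2_norm_power_bound:
 assumes T: "0 < T" and q: "0 < q" and g: "\<gamma> < \<gamma>'" "0 <= \<gamma>'"
 shows "\<exists>K\<ge>0. \<forall>C\<ge>0. \<forall>E :: real => real => 'v::real_normed_vector.
  (\<forall>h\<in>{0..T}. Lp p T E h <= ennreal (C * h powr \<gamma>')) --> besov2_norm \<gamma> p q T E <= ennreal (C * K)"
proof -
 let ?\<epsilon> = "\<gamma>' - \<gamma>"
 have pt: "ennreal (\<tau> powr - \<gamma>) * modulus p T E \<tau> <= ennreal (C * \<tau> powr ?\<epsilon>)"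
  if "0 <= C" and L: "\<forall>h\<in>{0..T}. Lp p T E h <= ennreal (C * h powr \<gamma>')" and t: "0 < \<tau>" "\<tau> <= T"
  for E :: "real => real => 'v" and C \<tau>
 proof -
  have "modulus p T E \<tau> <= ennreal (C * \<tau> powr \<gamma>')"
   unfolding modulus_def
  proof (rule SUP_least)
   fix h assume h: "h \<in> {0..\<tau>}"
   then have "Lp p T E h <= ennreal (C * h powr \<gamma>')" using L t by auto
   also have "\<dots> <= ennreal (C * \<tau> powr \<gamma>')"
    using h g that(1) by (intro ennreal_leI mult_left_mono powr_mono2) auto
   finally show "Lp p T E h <= ennreal (C * \<tau> powr \<gamma>')" .
  qed
  then have "ennreal (\<tau> powr - \<gamma>) * modulus p T E \<tau> <= ennreal (\<tau> powr - \<gamma>) * ennreal (C * \<tau> powr \<gamma>')"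
   by (rule mult_left_mono) simp
  also have "\<dots> = ennreal (C * \<tau> powr ?\<epsilon>)"
   using that(1) t by (simp add: ennreal_mult[symmetric] powr_diff powr_minus field_simps)
  finally show ?thesis .
 qed
 show ?thesis
 proof (cases "q = \<infinity>")
  case True
  show ?thesis
  proof (intro exI[of _ "T powr ?\<epsilon>"] conjI allI impI)
   fix C :: real and E :: "real => real => 'v"
   assume C: "0 <= C" and L: "\<forall>h\<in>{0..T}. Lp p T E h <= ennreal (C * h powr \<gamma>')"
   show "besov2_norm \<gamma> p q T E <= ennreal (C * T powr ?\<epsilon>)"
    unfolding besov2_norm_eq lp_norm_def if_P[OF True]
   proof (rule SUP_least)
    fix \<tau> assume "\<tau> \<in> space (scale_measure_on T)"
    then have t: "0 < \<tau>" "\<tau> <= T" by auto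
    have "C * \<tau> powr ?\<epsilon> <= C * T powr ?\<epsilon>" using t g C by (intro mult_left_mono powr_mono2) auto
    then show "ennreal (\<tau> powr - \<gamma>) * modulus p T E \<tau> <= ennreal (C * T powr ?\<epsilon>)"
     using pt[OF C L t] by (meson ennreal_leI order_trans)
   qed
  qed simp
 next
  case False
  define Q where "Q = enn2real q"
  have Q: "0 < Q" unfolding Q_def by (rule enn2real_pos[OF q False])
  define I where "I = T powr (?\<epsilon> * Q) / (?\<epsilon> * Q)"
  have I: "0 <= I" using g Q T by (simp add: I_def)
  have eQ: "0 < ?\<epsilon> * Q" using g Q by simp
  show ?thesis
  proof (intro exI[of _ "I powr (1 / Q)"] conjI allI impI)
   fix C :: real and E :: "real => real => 'v"
   assume C: "0 <= C" and L: "\<forall>h\<in>{0..T}. Lp p T E h <= ennreal (C * h powr \<gamma>')"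
   have m: "(%\<tau>. ennreal ((C * \<tau> powr ?\<epsilon>) powr Q)) \<in> borel_measurable (restrict_space lborel {0<..T})"
    by (rule measurable_restrict_space1) measurable
   have "(\<integral>\<^sup>+\<tau>. epowr (ennreal (\<tau> powr - \<gamma>) * modulus p T E \<tau>) Q \<partial>scale_measure_on T)
     <= (\<integral>\<^sup>+\<tau>. ennreal ((C * \<tau> powr ?\<epsilon>) powr Q) \<partial>scale_measure_on T)"
   proof (rule nn_integral_mono)
    fix \<tau> assume "\<tau> \<in> space (scale_measure_on T)"
    then have t: "0 < \<tau>" "\<tau> <= T" by auto
    have "epowr (ennreal (\<tau> powr - \<gamma>) * modulus p T E \<tau>) Q <= epowr (ennreal (C * \<tau> powr ?\<epsilon>)) Q"
     using Q by (intro epowr_mono pt[OF C L t]) simp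
    then show "epowr (ennreal (\<tau> powr - \<gamma>) * modulus p T E \<tau>) Q <= ennreal ((C * \<tau> powr ?\<epsilon>) powr Q)"
     using C by (simp add: epowr_ennreal)
   qed
   also have "\<dots> = (\<integral>\<^sup>+\<tau>\<in>{0<..T}. ennreal (1 / \<tau>) * ennreal ((C * \<tau> powr ?\<epsilon>) powr Q) \<partial>lborel)"
    by (rule nn_integral_scale_measure[OF m])
   also have "\<dots> <= (\<integral>\<^sup>+\<tau>\<in>{0..T}. ennreal (C powr Q * \<tau> powr (?\<epsilon> * Q - 1)) \<partial>lborel)"
   proof (rule nn_integral_mono)
    fix \<tau> :: real
    have "ennreal (1 / \<tau>) * ennreal ((C * \<tau> powr ?\<epsilon>) powr Q) = ennreal (C powr Q * \<tau> powr (?\<epsilon> * Q - 1))" if "0 < \<tau>"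
    proof -
     have "(C * \<tau> powr ?\<epsilon>) powr Q = C powr Q * \<tau> powr (?\<epsilon> * Q)" by (simp only: powr_mult powr_powr)
     moreover have "\<tau> powr (?\<epsilon> * Q - 1) = \<tau> powr (?\<epsilon> * Q) / \<tau>" using that by (simp only: powr_diff powr_one)
     ultimately show ?thesis using that by (simp add: ennreal_mult[symmetric])
    qed
    then show "ennreal (1 / \<tau>) * ennreal ((C * \<tau> powr ?\<epsilon>) powr Q) * indicator {0<..T} \<tau>
      <= ennreal (C powr Q * \<tau> powr (?\<epsilon> * Q - 1)) * indicator {0..T} \<tau>"
     by (auto simp: indicator_def)
   qed
   also have "\<dots> = ennreal (C powr Q * I)"
   proof (rule nn_integral_has_integral_lebesgue')
    have "((%x. x powr (?\<epsilon> * Q - 1)) has_integral (T powr ((?\<epsilon> * Q - 1) + 1) / ((?\<epsilon> * Q - 1) + 1))) {0..T}"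
     using eQ T by (intro has_integral_powr_from_0) auto
    then show "((%x. C powr Q * x powr (?\<epsilon> * Q - 1)) has_integral C powr Q * I) {0..T}"
     by (intro has_integral_mult_right) (simp add: I_def)
   qed simp
   also have "C powr Q * I = (C * I powr (1 / Q)) powr Q"
    using C I Q by (simp add: powr_mult powr_powr)
   finally show "besov2_norm \<gamma> p q T E <= ennreal (C * I powr (1 / Q))"
    unfolding besov2_norm_eq using C by (subst lp_norm_le_finite_iff[OF _ q False]) (auto simp: Q_def)
  qed simp
 qed
qed

section \<open>Discretisation of the scale integral\<close>

text \<open>The exact mass of the shell is \<open>ln 2\<close>; the bound 1/2 arises when the
  density \<open>1 / \<tau>\<close> is replaced by its minimum on the shell.\<close>

lemma emeasure_scale_measure_ge:
 assumes T: "0 < T" and n: "1 <= n"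
 shows "ennreal (1 / 2) <= emeasure (scale_measure_on T) {T / 2 ^ n<..2 * T / 2 ^ n}"
proof -
 let ?I = "{T / 2 ^ n<..2 * T / 2 ^ n}"
 have "(2::real) <= 2 ^ n" using n power_increasing[of 1 n "2::real"] by simp
 then have le: "2 * T / 2 ^ n <= T" using T by (simp add: divide_le_eq mult.commute)
 have sub: "?I \<subseteq> {0<..T}"
 proof
  fix x assume "x \<in> ?I"
  moreover have "0 < T / 2 ^ n" using T by simp
  ultimately show "x \<in> {0<..T}" using le by (simp only: greaterThanAtMost_iff) linarith
 qed
 have m: "(indicator ?I :: real => ennreal) \<in> borel_measurable (restrict_space lborel {0<..T})"
  by (rule measurable_restrict_space1) measurable
 have "?I \<in> sets (scale_measure_on T)"
  using sub by (simp add: sets_scale_measure sets_restrict_space_iff)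
 then have "emeasure (scale_measure_on T) ?I = (\<integral>\<^sup>+\<tau>. indicator ?I \<tau> \<partial>scale_measure_on T)"
  by simp
 also have "\<dots> = (\<integral>\<^sup>+\<tau>\<in>{0<..T}. ennreal (1 / \<tau>) * indicator ?I \<tau> \<partial>lborel)"
  by (rule nn_integral_scale_measure[OF m])
 also have "\<dots> \<ge> (\<integral>\<^sup>+\<tau>. ennreal (2 ^ n / (2 * T)) * indicator ?I \<tau> \<partial>lborel)"
 proof (rule nn_integral_mono)
  fix \<tau> :: real
  show "ennreal (2 ^ n / (2 * T)) * indicator ?I \<tau> <= ennreal (1 / \<tau>) * indicator ?I \<tau> * indicator {0<..T} \<tau>"
  proof (cases "\<tau> \<in> ?I")
   case True
   then have t: "0 < \<tau>" "\<tau> <= 2 * T / 2 ^ n" "\<tau> \<in> {0<..T}" using sub by auto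
   then have "2 ^ n / (2 * T) <= 1 / \<tau>" using T by (simp add: field_simps)
   then show ?thesis using True t by (simp add: ennreal_leI)
  qed simp
 qed
 also have "(\<integral>\<^sup>+\<tau>. ennreal (2 ^ n / (2 * T)) * indicator ?I \<tau> \<partial>lborel) = ennreal (2 ^ n / (2 * T)) * emeasure lborel ?I"
  by (rule nn_integral_cmult_indicator) simp
 also have "\<dots> = ennreal (1 / 2)"
  using T by (simp add: ennreal_mult[symmetric] divide_right_mono field_simps)
 finally show ?thesis .
qed

text \<open>On the shell of generation \<open>n\<close> the integrand is bounded below by taking the
  decreasing weight at the right end and the increasing modulus at the left end. The shells are
  disjoint, so these bounds add up.\<close>

lemma besov2_norm_discrete_sum:
 assumes T: "0 < T" and q: "0 < q" "q \<noteq> \<infinity>" and g: "0 < \<gamma>"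
 shows "(\<Sum>n=1..N. ennreal (1 / 2) * epowr (ennreal ((2 * T / 2 ^ n) powr - \<gamma>) * modulus p T A (T / 2 ^ n)) (enn2real q))
  <= (\<integral>\<^sup>+\<tau>. epowr (ennreal (\<tau> powr - \<gamma>) * modulus p T A \<tau>) (enn2real q) \<partial>scale_measure_on T)"
proof -
 let ?I = "%n::nat. {T / 2 ^ n<..2 * T / 2 ^ n}"
 define c where "c n = epowr (ennreal ((2 * T / 2 ^ n) powr - \<gamma>) * modulus p T A (T / 2 ^ n)) (enn2real q)" for n :: nat
 let ?V = "%\<tau>. epowr (ennreal (\<tau> powr - \<gamma>) * modulus p T A \<tau>) (enn2real q)"
 note Q = enn2real_pos[OF q]
 have le: "2 * T / 2 ^ n <= T" if "1 <= n" for n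
 proof -
  have "(2::real) <= 2 ^ n" using that power_increasing[of 1 n "2::real"] by simp
  then show ?thesis using T by (simp add: divide_le_eq mult.commute)
 qed
 have I: "?I n \<in> sets (scale_measure_on T)" if "1 <= n" for n
 proof -
  have "0 < T / 2 ^ n" using T by simp
  then have "?I n \<subseteq> {0<..T}" using le[OF that] by (auto intro: less_trans)
  then show ?thesis by (simp add: sets_scale_measure sets_restrict_space_iff)
 qed
 have sep: "\<tau> \<notin> ?I n" if "\<tau> \<in> ?I m" "n \<noteq> m" for \<tau> n m
 proof
  assume a: "\<tau> \<in> ?I n"
  have *: False if "i < j" "T / 2 ^ i < \<tau>" "\<tau> <= 2 * T / 2 ^ j" for i j
  proof -
   have "2 * (2::real) ^ i <= 2 ^ j" using power_increasing[of "Suc i" j "2::real"] that(1) by simp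
   then have "2 * T / 2 ^ j <= T / 2 ^ i" using T by (simp add: field_simps)
   then show False using that by linarith
  qed
  show False using *[of n m] *[of m n] a that by (cases "n < m") auto
 qed
 have pt: "(\<Sum>n=1..N. c n * indicator (?I n) \<tau>) <= ?V \<tau>" if "\<tau> \<in> {0<..T}" for \<tau>
 proof (cases "\<exists>m\<in>{1..N}. \<tau> \<in> ?I m")
  case True
  then obtain m where m: "m \<in> {1..N}" "\<tau> \<in> ?I m" by blast
  have "(\<Sum>n=1..N. c n * indicator (?I n) \<tau>) = (\<Sum>n\<in>{m}. c n * indicator (?I n) \<tau>)"
   using m sep[OF m(2)] by (intro sum.mono_neutral_right) auto
  also have "\<dots> = c m" using m by simp
  also have "\<dots> <= ?V \<tau>" unfolding c_def
  proof (intro epowr_mono mult_mono ennreal_leI modulus_mono)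
   show "(2 * T / 2 ^ m) powr - \<gamma> <= \<tau> powr - \<gamma>"
    using m(2) that g by (intro powr_mono2') auto
  qed (use m(2) Q in auto)
  finally show ?thesis .
 next
  case False
  then have "(\<Sum>n=1..N. c n * indicator (?I n) \<tau>) = 0" by (intro sum.neutral) auto
  then show ?thesis by simp
 qed
 have "(\<Sum>n=1..N. ennreal (1 / 2) * c n) <= (\<Sum>n=1..N. c n * emeasure (scale_measure_on T) (?I n))"
 proof (rule sum_mono)
  fix n assume "n \<in> {1..N}"
  then show "ennreal (1 / 2) * c n <= c n * emeasure (scale_measure_on T) (?I n)"
   unfolding mult.commute[of _ "c n"] by (intro mult_left_mono emeasure_scale_measure_ge[OF T]) auto
 qed
 also have "\<dots> = (\<integral>\<^sup>+\<tau>. (\<Sum>n=1..N. c n * indicator (?I n) \<tau>) \<partial>scale_measure_on T)"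
  using I by (subst nn_integral_sum) (auto simp: nn_integral_cmult_indicator)
 also have "\<dots> <= (\<integral>\<^sup>+\<tau>. ?V \<tau> \<partial>scale_measure_on T)"
  by (intro nn_integral_mono pt) simp
 finally show ?thesis by (simp add: c_def)
qed

text \<open>For finite \<open>q\<close>, \<open>x n\<close> is the modulus at scale
  \<open>T / 2 ^ n\<close>; for \<open>q = \<infinity>\<close> it is the power of the scale that
  bounds it. Since \<open>C\<close> is quantified before \<open>A\<close>, it depends on
  \<open>A\<close> through the norm bound \<open>\<rho>\<close> alone.\<close>

lemma besov2_norm_discretise:
 assumes T: "0 < T" and q: "0 < q" and g: "0 < \<gamma>" and rho: "0 <= \<rho>"
 shows "\<exists>C\<ge>0. \<forall>A :: real => real => 'v::real_normed_vector. besov2_norm \<gamma> p q T A <= ennreal \<rho> -->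
  (\<exists>x::nat => real. (\<forall>n\<ge>1. 0 <= x n \<and> (\<forall>h\<in>{0..T / 2 ^ n}. Lp p T A h <= ennreal (x n)) \<and> x n <= C * 2 powr (- \<gamma> * n)) \<and>
   (q \<noteq> \<infinity> --> (\<forall>N. (\<Sum>n=1..N. (2 powr (\<gamma> * n) * x n) powr enn2real q) <= C)))"
proof (cases "q = \<infinity>")
 case True
 have c2: "(T / 2 ^ n) powr \<gamma> = T powr \<gamma> * 2 powr (- \<gamma> * n)" for n
  by (simp add: powr_divide powr_powr powr_minus field_simps flip: powr_realpow)
 show ?thesis
 proof (intro exI[of _ "\<rho> * T powr \<gamma>"] conjI allI impI)
  fix A :: "real => real => 'v" assume A: "besov2_norm \<gamma> p q T A <= ennreal \<rho>"
  show "\<exists>x::nat => real. (\<forall>n\<ge>1. 0 <= x n \<and> (\<forall>h\<in>{0..T / 2 ^ n}. Lp p T A h <= ennreal (x n)) \<and> x n <= (\<rho> * T powr \<gamma>) * 2 powr (- \<gamma> * n)) \<and>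
   (q \<noteq> \<infinity> --> (\<forall>N. (\<Sum>n=1..N. (2 powr (\<gamma> * n) * x n) powr enn2real q) <= \<rho> * T powr \<gamma>))"
  proof (intro exI[of _ "%n. \<rho> * (T / 2 ^ n) powr \<gamma>"] conjI allI impI ballI)
   fix n :: nat and h assume n: "1 <= n" and h: "h \<in> {0..T / 2 ^ n}"
   let ?t = "T / 2 ^ n"
   have t: "?t \<in> {0<..T}" using T by (simp add: divide_le_eq)
   then have "ennreal (?t powr - \<gamma>) * modulus p T A ?t <= ennreal \<rho>"
    using A True unfolding besov2_norm_eq lp_norm_def by (simp add: SUP_le_iff)
   then have "ennreal (?t powr \<gamma>) * (ennreal (?t powr - \<gamma>) * modulus p T A ?t) <= ennreal (?t powr \<gamma>) * ennreal \<rho>"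
    by (rule mult_left_mono) simp
   moreover have "ennreal (?t powr \<gamma>) * ennreal (?t powr - \<gamma>) = 1"
    using t by (simp add: ennreal_mult[symmetric] powr_add[symmetric])
   ultimately have "modulus p T A ?t <= ennreal (\<rho> * ?t powr \<gamma>)"
    using rho by (simp add: mult.assoc[symmetric] ennreal_mult mult.commute)
   moreover have "Lp p T A h <= modulus p T A ?t" unfolding modulus_def using h by (intro SUP_upper)
   ultimately show "Lp p T A h <= ennreal (\<rho> * ?t powr \<gamma>)" by (rule order_trans[rotated])
  qed (use rho True c2 in auto)
 qed (use rho in auto)
next
 case False
 define Q where "Q = enn2real q"
 have Q: "0 < Q" unfolding Q_def by (rule enn2real_pos[OF q False])
 define b where "b = (2 * T) powr \<gamma>"
 have b: "0 < b" using T by (simp add: b_def)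
 \<comment> \<open>The first entry bounds a single term of the sum after taking a root, the second
   bounds the whole sum.\<close>
 define C where "C = max (b * (2 powr (1 / Q) * \<rho>)) (2 * b powr Q * \<rho> powr Q)"
 have bn: "(2 * T / 2 ^ n) powr - \<gamma> = 2 powr (\<gamma> * n) / b" for n
  using T by (simp add: b_def powr_divide powr_powr powr_minus field_simps flip: powr_realpow)
 show ?thesis
 proof (intro exI[of _ C] conjI allI impI)
  show "0 <= C" using b rho by (simp add: C_def le_max_iff_disj)
  fix A :: "real => real => 'v" assume A: "besov2_norm \<gamma> p q T A <= ennreal \<rho>"
  let ?s = "%n. modulus p T A (T / 2 ^ n)"
  have S: "(\<Sum>n=1..N. ennreal (1 / 2) * epowr (ennreal (2 powr (\<gamma> * n) / b) * ?s n) Q) <= ennreal (\<rho> powr Q)" for N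
  proof -
   have "(\<Sum>n=1..N. ennreal (1 / 2) * epowr (ennreal (2 powr (\<gamma> * n) / b) * ?s n) Q)
     <= (\<integral>\<^sup>+\<tau>. epowr (ennreal (\<tau> powr - \<gamma>) * modulus p T A \<tau>) Q \<partial>scale_measure_on T)"
    using besov2_norm_discrete_sum[OF T q False g, where N = N and p = p and A = A] by (simp add: bn Q_def)
   also have "\<dots> <= ennreal (\<rho> powr Q)"
    using A unfolding besov2_norm_eq lp_norm_le_finite_iff[OF rho q False] Q_def .
   finally show ?thesis .
  qed
  have fin: "?s n \<noteq> top" if "1 <= n" for n
  proof
   assume top: "?s n = top"
   have "ennreal (1 / 2) * epowr (ennreal (2 powr (\<gamma> * n) / b) * ?s n) Q
     <= (\<Sum>n=1..n. ennreal (1 / 2) * epowr (ennreal (2 powr (\<gamma> * n) / b) * ?s n) Q)"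
    using that by (intro member_le_sum) auto
   with S[of n] have "ennreal (1 / 2) * epowr (ennreal (2 powr (\<gamma> * n) / b) * ?s n) Q <= ennreal (\<rho> powr Q)"
    by (rule order_trans[rotated])
   moreover have "ennreal (2 powr (\<gamma> * n) / b) * ?s n = top"
    unfolding top using b by (simp add: ennreal_mult_top)
   ultimately show False by (simp add: ennreal_mult_top top_unique)
  qed
  define x where "x n = enn2real (?s n)" for n
  have sx: "?s n = ennreal (x n)" if "1 <= n" for n using fin[OF that] by (simp add: x_def top.not_eq_extremum)
  have x0: "0 <= x n" for n by (simp add: x_def)
  have S': "(\<Sum>n=1..N. (2 powr (\<gamma> * n) * x n) powr Q) <= 2 * b powr Q * \<rho> powr Q" for N
  proof -
   have "ennreal (\<Sum>n=1..N. 1 / 2 * (2 powr (\<gamma> * n) / b * x n) powr Q)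
     = (\<Sum>n=1..N. ennreal (1 / 2 * (2 powr (\<gamma> * n) / b * x n) powr Q))"
    by (rule sum_ennreal[symmetric]) simp
   also have "\<dots> = (\<Sum>n=1..N. ennreal (1 / 2) * epowr (ennreal (2 powr (\<gamma> * n) / b) * ?s n) Q)"
   proof (rule sum.cong[OF refl])
    fix n assume "n \<in> {1..N}"
    then have "ennreal (2 powr (\<gamma> * n) / b) * ?s n = ennreal (2 powr (\<gamma> * n) / b * x n)"
     using sx[of n] x0[of n] b by (simp add: ennreal_mult[symmetric])
    then have "epowr (ennreal (2 powr (\<gamma> * n) / b) * ?s n) Q = ennreal ((2 powr (\<gamma> * n) / b * x n) powr Q)"
     using x0[of n] b by (simp add: epowr_ennreal)
    moreover have "ennreal (1 / 2 * y) = ennreal (1 / 2) * ennreal y" if "0 <= y" for y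
     using that by (intro ennreal_mult) auto
    ultimately show "ennreal (1 / 2 * (2 powr (\<gamma> * n) / b * x n) powr Q) = ennreal (1 / 2) * epowr (ennreal (2 powr (\<gamma> * n) / b) * ?s n) Q"
     by (simp only: powr_ge_zero)
   qed
   also have "\<dots> <= ennreal (\<rho> powr Q)" by (rule S)
   finally have "(\<Sum>n=1..N. 1 / 2 * (2 powr (\<gamma> * n) / b * x n) powr Q) <= \<rho> powr Q"
    by (simp add: ennreal_le_iff)
   moreover have "(\<Sum>n=1..N. 1 / 2 * (2 powr (\<gamma> * n) / b * x n) powr Q)
     = (\<Sum>n=1..N. (2 powr (\<gamma> * n) * x n) powr Q) / (2 * b powr Q)"
    unfolding sum_divide_distrib by (intro sum.cong refl) (simp add: powr_divide powr_mult)
   ultimately have "(\<Sum>n=1..N. (2 powr (\<gamma> * n) * x n) powr Q) / (2 * b powr Q) <= \<rho> powr Q" by (simp only:)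
   moreover have "0 < 2 * b powr Q" using b by simp
   ultimately have "(\<Sum>n=1..N. (2 powr (\<gamma> * n) * x n) powr Q) <= \<rho> powr Q * (2 * b powr Q)"
    by (simp only: pos_divide_le_eq)
   then show ?thesis by (simp only: mult_ac)
  qed
  have xb: "x n <= C * 2 powr (- \<gamma> * n)" if "1 <= n" for n
  proof -
   have "(2 powr (\<gamma> * n) * x n) powr Q <= (\<Sum>n=1..n. (2 powr (\<gamma> * n) * x n) powr Q)"
    using that by (intro member_le_sum) auto
   also note S'
   finally have "((2 powr (\<gamma> * n) * x n) powr Q) powr (1 / Q) <= (2 * b powr Q * \<rho> powr Q) powr (1 / Q)"
    using Q by (intro powr_mono2[where a = "1 / Q"]) auto
   then have "2 powr (\<gamma> * n) * x n <= b * (2 powr (1 / Q) * \<rho>)"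
    using Q x0[of n] b rho by (simp add: powr_powr powr_mult mult_ac)
   also have "\<dots> <= C" by (simp add: C_def)
   finally show ?thesis by (simp add: powr_minus field_simps)
  qed
  show "\<exists>x::nat => real. (\<forall>n\<ge>1. 0 <= x n \<and> (\<forall>h\<in>{0..T / 2 ^ n}. Lp p T A h <= ennreal (x n)) \<and> x n <= C * 2 powr (- \<gamma> * n)) \<and>
   (q \<noteq> \<infinity> --> (\<forall>N. (\<Sum>n=1..N. (2 powr (\<gamma> * n) * x n) powr enn2real q) <= C))"
  proof (intro exI[of _ x] conjI allI impI ballI)
   fix n :: nat and h assume n: "1 <= n" and h: "h \<in> {0..T / 2 ^ n}"
   have "Lp p T A h <= ?s n" unfolding modulus_def using h by (intro SUP_upper)
   then show "Lp p T A h <= ennreal (x n)" using sx[OF n] by simp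
  next
   fix N
   show "(\<Sum>n=1..N. (2 powr (\<gamma> * n) * x n) powr enn2real q) <= C"
    using S'[of N] by (simp add: Q_def C_def)
  qed (use x0 xb in auto)
 qed
qed

section \<open>Oscillation on dyadic cells\<close>

definition cellsup :: "real => (real => real => 'v::real_normed_vector) => nat => nat => real" where
 "cellsup T A n i = (SUP z\<in>{(s, t). dpt T n i <= s \<and> s <= t \<and> t <= dpt T n (Suc i)}. norm (A (fst z) (snd z)))"

lemma dpt_cell_bounds:
 assumes "0 < T" "i < 2 ^ n"
 shows "0 <= dpt T n i" "dpt T n (Suc i) <= T" "dpt T n i <= dpt T n (Suc i)"
 using dpt_bounds[of T i n] dpt_bounds[of T "Suc i" n] dpt_mono[of T i "Suc i" n] assms by auto

lemma cellsup_upper: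
 assumes A: "cont2 T A" and T: "0 < T" and i: "i < 2 ^ n" and st: "dpt T n i <= s" "s <= t" "t <= dpt T n (Suc i)"
 shows "norm (A s t) <= cellsup T A n i"
proof -
 obtain M where M: "0 <= M" "\<And>s t. 0 <= s ==> s <= t ==> t <= T ==> norm (A s t) <= M"
  using cont2_bounded[OF A] by blast
 note b = dpt_cell_bounds[OF T i]
 have "norm (A (fst (s, t)) (snd (s, t))) <= cellsup T A n i"
  unfolding cellsup_def
 proof (rule cSUP_upper)
  show "bdd_above ((%z. norm (A (fst z) (snd z))) ` {(s, t). dpt T n i <= s \<and> s <= t \<and> t <= dpt T n (Suc i)})"
  proof (rule bdd_aboveI[of _ M])
   fix x assume "x \<in> (%z. norm (A (fst z) (snd z))) ` {(s, t). dpt T n i <= s \<and> s <= t \<and> t <= dpt T n (Suc i)}"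
   then obtain s' t' where st': "x = norm (A s' t')" "dpt T n i <= s'" "s' <= t'" "t' <= dpt T n (Suc i)" by auto
   have "0 <= s'" "t' <= T" using st' b by linarith+
   then show "x <= M" using M(2) st' by simp
  qed
 qed (use st in auto)
 then show ?thesis by simp
qed

lemma cellsup_least:
 assumes T: "0 < T" and B: "\<And>s t. dpt T n i <= s ==> s <= t ==> t <= dpt T n (Suc i) ==> norm (A s t) <= B"
 shows "cellsup T A n i <= B"
 unfolding cellsup_def
proof (rule cSUP_least)
 have "(dpt T n i, dpt T n i) \<in> {(s, t). dpt T n i <= s \<and> s <= t \<and> t <= dpt T n (Suc i)}"
  using dpt_mono[OF T, of i "Suc i" n] by auto
 then show "{(s, t). dpt T n i <= s \<and> s <= t \<and> t <= dpt T n (Suc i)} \<noteq> {}" by blast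
qed (use B in auto)

lemma cellsup_nonneg:
 assumes "cont2 T A" "0 < T" "i < 2 ^ n"
 shows "0 <= cellsup T A n i"
 using cellsup_upper[OF assms order_refl order_refl dpt_cell_bounds(3)[OF assms(2,3)]] norm_ge_zero order_trans by blast

text \<open>Jensen up to the factor \<open>2 powr r\<close>, by elementary means: integrate
  \<open>f <= l + l powr (1 - r) * f powr r\<close> and take \<open>l = m powr (1 / r)\<close>,
  where \<open>m\<close> is the mean of \<open>f powr r\<close>.\<close>

lemma integral_powr_mean:
 fixes f :: "real => real"
 assumes f: "continuous_on {a..b} f" "\<And>x. x \<in> {a..b} ==> 0 <= f x" and ab: "a < b" and r: "1 <= r"
 shows "(integral {a..b} f / (b - a)) powr r <= 2 powr r * (integral {a..b} (%x. f x powr r) / (b - a))"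
proof -
 have cr: "continuous_on {a..b} (%x. f x powr r)"
  using f r by (intro continuous_on_powr' continuous_intros) auto
 define m where "m = integral {a..b} (%x. f x powr r) / (b - a)"
 have m0: "0 <= m" unfolding m_def using ab
  by (intro divide_nonneg_pos integral_nonneg integrable_continuous_interval cr) auto
 have key: "integral {a..b} f / (b - a) <= l + l powr (1 - r) * m" if l: "0 < l" for l
 proof -
  have "integral {a..b} f <= integral {a..b} (%x. l + l powr (1 - r) * f x powr r)"
  proof (rule integral_le)
   fix x assume x: "x \<in> {a..b}"
   show "f x <= l + l powr (1 - r) * f x powr r"
   proof (cases "f x <= l")
    case False
    then have fx: "0 < f x" "l <= f x" using l by auto
    have "f x = f x powr (1 - r) * f x powr r" using fx by (simp add: powr_add[symmetric])
    also have "\<dots> <= l powr (1 - r) * f x powr r"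
     using fx l r by (intro mult_right_mono powr_mono2') auto
    finally show ?thesis using l by simp
   qed (use l in \<open>auto intro: add_increasing2\<close>)
  qed (intro integrable_continuous_interval continuous_intros f cr)+
  also have "\<dots> = l * (b - a) + l powr (1 - r) * integral {a..b} (%x. f x powr r)"
   using ab by (subst integral_add) (auto intro!: integrable_continuous_interval continuous_intros cr)
  finally have "integral {a..b} f / (b - a) <= (l * (b - a) + l powr (1 - r) * integral {a..b} (%x. f x powr r)) / (b - a)"
   using ab by (intro divide_right_mono) auto
  also have "\<dots> = l + l powr (1 - r) * m" using ab by (simp add: m_def add_divide_distrib)
  finally show ?thesis .
 qed
 have "integral {a..b} f / (b - a) <= 2 * m powr (1 / r)"
 proof (cases "m = 0")
  case True
  have "integral {a..b} f / (b - a) <= 0"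
   by (rule field_le_epsilon) (use key True in auto)
  then show ?thesis using True by simp
 next
  case False
  then have "0 < m" using m0 by simp
  then have "m powr (1 / r) + (m powr (1 / r)) powr (1 - r) * m = 2 * m powr (1 / r)"
   using r by (simp add: powr_powr powr_diff diff_divide_distrib)
  then show ?thesis using key[of "m powr (1 / r)"] \<open>0 < m\<close> by simp
 qed
 moreover have "0 <= integral {a..b} f / (b - a)"
  using ab f by (intro divide_nonneg_pos integral_nonneg integrable_continuous_interval) auto
 ultimately have "(integral {a..b} f / (b - a)) powr r <= (2 * m powr (1 / r)) powr r"
  using r by (intro powr_mono2) auto
 also have "(2 * m powr (1 / r)) powr r = 2 powr r * m" using r m0 by (simp add: powr_mult powr_powr)
 finally show ?thesis by (simp only: m_def)
qed

lemma integral_dyadic_cells: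
 fixes f :: "real => real"
 assumes T: "0 < T" and f: "continuous_on {0..dpt T n k} f"
 shows "(\<Sum>i<k. integral {dpt T n i..dpt T n (Suc i)} f) = integral {0..dpt T n k} f"
 using f
proof (induction k)
 case (Suc k)
 have le: "0 <= dpt T n k" "dpt T n k <= dpt T n (Suc k)" using dpt_mono[OF T, of 0 k n] dpt_mono[OF T, of k "Suc k" n] by auto
 have "continuous_on {0..dpt T n k} f" using Suc.prems by (rule continuous_on_subset) (use le in auto)
 then show ?case using Suc.IH
   Henstock_Kurzweil_Integration.integral_combine[OF le integrable_continuous_interval[OF Suc.prems]] by simp
qed simp

section \<open>Chaining over successive bisections\<close>

text \<open>\<open>r\<close> is the integrability exponent of the slices and may lie on either side
  of 1. It is factored as \<open>\<rho> * \<sigma>\<close> with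
  \<open>\<rho> <= 1 <= \<sigma>\<close>: the power \<open>\<rho>\<close> turns approximate
  additivity of \<open>A\<close> into an approximate triangle inequality, and the power
  \<open>\<sigma>\<close> is handled by Jensen.\<close>

locale chaining =
 fixes T :: real and A :: "real => real => 'v::real_normed_vector" and d :: "nat => nat => real" and r :: real
 assumes T: "0 < T" and A: "cont2 T A" and diag: "\<And>s. 0 <= s ==> s <= T ==> A s s = 0" and r: "0 < r"
  and d0: "\<And>n i. 1 <= n ==> i < 2 ^ n ==> 0 <= d n i"
  and defect: "\<And>n i s u t. 1 <= n ==> i < 2 ^ n ==> dpt T n i <= s ==> s <= u ==> u <= t ==> t <= dpt T n (Suc i) ==>
   norm (A s t - A s u - A u t) <= d n i"
begin

definition \<rho> :: real where "\<rho> = min 1 r"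

definition \<sigma> :: real where "\<sigma> = max 1 r"

lemma rho_sigma: "0 < \<rho>" "\<rho> <= 1" "1 <= \<sigma>" "\<rho> * \<sigma> = r"
 using r by (auto simp: \<rho>_def \<sigma>_def min_def max_def)

text \<open>Symmetrised so that it acts as a distance on the cell, up to the error
  \<open>d n i powr \<rho>\<close> in the triangle inequality.\<close>

definition F :: "real => real => real" where
 "F s t = norm (A (min s t) (max s t)) powr \<rho>"

definition avg :: "nat => nat => real => real" where
 "avg n i s = integral {dpt T n i..dpt T n (Suc i)} (F s) / (T / 2 ^ n)"

text \<open>The mean of \<open>F\<close> between a point of the left child and its translate in the
  right child: the cost of moving an average from one child to the other.\<close>

definition half_step :: "nat => nat => real" where
 "half_step n i = integral {dpt T (Suc n) (2 * i)..dpt T (Suc n) (Suc (2 * i))}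
   (%u. norm (A u (u + T / 2 ^ Suc n)) powr \<rho>) / (T / 2 ^ Suc n)"

definition link :: "nat => nat => real" where
 "link n i = half_step n i + d n i powr \<rho>"

lemma F_sym: "F s t = F t s"
 by (simp add: F_def min.commute max.commute)

lemma F_nonneg: "0 <= F s t"
 by (simp add: F_def)

lemma F_triangle:
 assumes n: "1 <= n" "i < 2 ^ n" and u: "u \<in> {dpt T n i..dpt T n (Suc i)}" and v: "v \<in> {dpt T n i..dpt T n (Suc i)}"
  and w: "w \<in> {dpt T n i..dpt T n (Suc i)}"
 shows "F u w <= F u v + F v w + d n i powr \<rho>"
proof -
 let ?a = "%s t. norm (A (min s t) (max s t))"
 have D: "norm (A x z) <= norm (A x y) + norm (A y z) + d n i \<and> norm (A x y) <= norm (A x z) + norm (A y z) + d n i \<and>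
   norm (A y z) <= norm (A x z) + norm (A x y) + d n i"
  if "x <= y" "y <= z" "dpt T n i <= x" "z <= dpt T n (Suc i)" for x y z
  using defect[OF n, of x y z] that by norm
 have a: "?a u w <= ?a u v + ?a v w + d n i"
  using D[of u v w] D[of u w v] D[of v u w] D[of v w u] D[of w u v] D[of w v u] u v w
  by (cases "u <= v"; cases "v <= w"; cases "u <= w") (auto simp: min_def max_def)
 have "F u w <= (?a u v + ?a v w + d n i) powr \<rho>"
  unfolding F_def using a rho_sigma by (intro powr_mono2) auto
 also have "\<dots> <= F u v + F v w + d n i powr \<rho>"
 proof -
  have two: "(x + y) powr \<rho> <= x powr \<rho> + y powr \<rho>" if "0 <= x" "0 <= y" for x y :: real
   using powr_sum_le_sum_powr[of "{True, False}" "%b. if b then x else y" \<rho>] that rho_sigma by simp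
  show ?thesis unfolding F_def
   using two[of "?a u v + ?a v w" "d n i"] two[of "?a u v" "?a v w"] d0[OF n] by auto
 qed
 finally show ?thesis .
qed

lemma F_continuous:
 assumes "s \<in> {0..T}"
 shows "continuous_on {0..T} (F s)"
proof -
 have "continuous_on {0..T} (%t. (%(s, t). A s t) (min s t, max s t))"
  by (rule continuous_on_compose2[OF A]) (use assms in \<open>auto intro!: continuous_intros simp: simplex2_def\<close>)
 then show ?thesis unfolding F_def using rho_sigma by (intro continuous_on_powr' continuous_intros) auto
qed

lemma F_integrable:
 assumes "s \<in> {0..T}" "i < 2 ^ n"
 shows "F s integrable_on {dpt T n i..dpt T n (Suc i)}" "continuous_on {dpt T n i..dpt T n (Suc i)} (F s)"
proof -
 show c: "continuous_on {dpt T n i..dpt T n (Suc i)} (F s)"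
  by (rule continuous_on_subset[OF F_continuous[OF assms(1)]]) (use dpt_cell_bounds[OF T assms(2)] in auto)
 show "F s integrable_on {dpt T n i..dpt T n (Suc i)}" by (rule integrable_continuous_interval[OF c])
qed

lemma step_continuous: "0 <= h ==> b <= T - h ==> 0 <= a ==> continuous_on {a..b} (%u. norm (A u (u + h)) powr \<rho>)"
 by (rule continuous_on_subset[OF continuous_norm_powr_slice[OF A _ rho_sigma(1)]]) auto

text \<open>The average over a cell is the mean of the averages over its children. The child without
  \<open>s\<close> is translated onto the one containing \<open>s\<close>, which costs one
  \<open>half_step\<close> and one defect by the triangle inequality.\<close>

lemma avg_child:
 assumes n: "1 <= n" "i < 2 ^ n" and j: "j = 2 * i \<or> j = Suc (2 * i)"
  and s: "s \<in> {dpt T (Suc n) j..dpt T (Suc n) (Suc j)}"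
 shows "avg n i s <= avg (Suc n) j s + link n i"
proof -
 define l where "l = T / 2 ^ Suc n"
 define a where "a = dpt T n i"
 define m where "m = dpt T (Suc n) (Suc (2 * i))"
 define b where "b = dpt T n (Suc i)"
 have ends: "dpt T (Suc n) (2 * i) = a" "dpt T (Suc n) (Suc (2 * i)) = m" "dpt T (Suc n) (Suc (Suc (2 * i))) = b"
  using dpt_double[of T n "Suc i"] by (simp_all add: dpt_double a_def b_def m_def)
 have l: "0 < l" "m = a + l" "b = a + 2 * l" "T / 2 ^ n = 2 * l"
  using T dpt_Suc[of T "Suc n" "2 * i", unfolded ends] dpt_Suc[of T "Suc n" "Suc (2 * i)", unfolded ends]
  unfolding l_def by auto
 note bd = dpt_cell_bounds[OF T n(2), folded a_def b_def]
 have sj: "j = 2 * i ==> s \<in> {a..m}" "j = Suc (2 * i) ==> s \<in> {m..b}"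
  using s by (auto simp: ends)
 have sc: "s \<in> {a..b}" using sj j l(1-3) by auto
 then have sT: "s \<in> {0..T}" using bd by auto
 have i2: "2 * i < 2 ^ Suc n" "Suc (2 * i) < 2 ^ Suc n" using n by auto
 have iL: "F s integrable_on {a..m}" and cL: "continuous_on {a..m} (F s)"
  using F_integrable[OF sT i2(1)] unfolding ends by auto
 have iR: "F s integrable_on {m..b}" and cR: "continuous_on {m..b} (F s)"
  using F_integrable[OF sT i2(2)] unfolding ends by auto
 have cS: "continuous_on {a..m} (%u. F s (u + l))"
  by (rule continuous_on_compose2[OF cR]) (use l in \<open>auto intro!: continuous_intros\<close>)
 have shift: "integral {m..b} (F s) = integral {a..m} (%u. F s (u + l))"
 proof -
  have "F s \<circ> (+) l = (%u. F s (u + l))" by (simp add: o_def add.commute)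
  moreover have "a + l = m" "m + l = b" using l(2,3) by simp_all
  ultimately show ?thesis using integral_shift_Icc_real[of a m "F s" l] by simp
 qed
 let ?g = "%u. norm (A u (u + l)) powr \<rho>"
 have cg: "continuous_on {a..m} ?g" using bd l by (intro step_continuous) auto
 have Fg: "F u (u + l) = ?g u" "F (u + l) u = ?g u" for u using l by (simp_all add: F_def min_def max_def)
 have const: "integral {a..m} (%u. D) = l * D" for D :: real using l by simp
 have comb: "integral {a..b} (F s) = integral {a..m} (F s) + integral {m..b} (F s)"
  using Henstock_Kurzweil_Integration.integral_combine[of a m b "F s"] F_integrable(1)[OF sT n(2), folded a_def b_def] l by simp
 have tri: "integral {a..m} f <= integral {a..m} h + l * half_step n i + l * d n i powr \<rho>"
  if f: "continuous_on {a..m} f" and h: "continuous_on {a..m} h"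
   and le: "\<And>u. u \<in> {a..m} ==> f u <= h u + ?g u + d n i powr \<rho>" for f h
 proof -
  have "integral {a..m} f <= integral {a..m} (%u. (h u + ?g u) + d n i powr \<rho>)"
   using le by (intro integral_le integrable_continuous_interval continuous_intros f h cg) auto
  also have "\<dots> = (integral {a..m} h + integral {a..m} ?g) + integral {a..m} (%u. d n i powr \<rho>)"
   by (simp add: integral_add integrable_continuous_interval continuous_on_add h cg)
  also have "integral {a..m} ?g = l * half_step n i" unfolding half_step_def ends l_def[symmetric] using l(1) by simp
  finally show ?thesis unfolding const by simp
 qed
 have inc: "u \<in> {a..b}" "u + l \<in> {a..b}" if "u \<in> {a..m}" for u using that l by auto
 note nn = F_nonneg
 have half0: "0 <= half_step n i" unfolding half_step_def ends l_def[symmetric]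
  using l(1) cg by (intro divide_nonneg_nonneg integral_nonneg integrable_continuous_interval) auto
 have "integral {a..b} (F s) <= 2 * (l * avg (Suc n) j s) + l * half_step n i + l * d n i powr \<rho>"
  using j
 proof
  assume "j = 2 * i"
  then have av: "l * avg (Suc n) j s = integral {a..m} (F s)" unfolding avg_def l_def[symmetric] using l(1) \<open>j = 2 * i\<close> by (simp add: ends)
  have "integral {a..m} (%u. F s (u + l)) <= integral {a..m} (F s) + l * half_step n i + l * d n i powr \<rho>"
  proof (rule tri[OF cS cL])
   show "F s (u + l) <= F s u + ?g u + d n i powr \<rho>" if "u \<in> {a..m}" for u
    using F_triangle[OF n, folded a_def b_def, OF sc inc(1)[OF that] inc(2)[OF that]] Fg(1)[of u] by simp
  qed
  then show ?thesis unfolding comb shift av by simp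
 next
  assume "j = Suc (2 * i)"
  then have av: "l * avg (Suc n) j s = integral {a..m} (%u. F s (u + l))"
   unfolding avg_def l_def[symmetric] using l(1) \<open>j = Suc (2 * i)\<close> by (simp add: ends shift)
  have "integral {a..m} (F s) <= integral {a..m} (%u. F s (u + l)) + l * half_step n i + l * d n i powr \<rho>"
  proof (rule tri[OF cL cS])
   show "F s u <= F s (u + l) + ?g u + d n i powr \<rho>" if "u \<in> {a..m}" for u
    using F_triangle[OF n, folded a_def b_def, OF sc inc(2)[OF that] inc(1)[OF that]] Fg(2)[of u] by simp
  qed
  then show ?thesis unfolding comb shift av by simp
 qed
 then have "avg n i s <= (2 * (l * avg (Suc n) j s) + l * half_step n i + l * d n i powr \<rho>) / (2 * l)"
  unfolding avg_def[of n] l(4) a_def[symmetric] b_def[symmetric] using l(1) by (intro divide_right_mono) auto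
 also have "\<dots> = avg (Suc n) j s + (half_step n i + d n i powr \<rho>) / 2"
  using l(1) by (simp add: field_simps)
 also have "\<dots> <= avg (Suc n) j s + link n i" using half0 by (simp add: link_def)
 finally show ?thesis .
qed

lemma link_nonneg:
 assumes "i < 2 ^ n"
 shows "0 <= half_step n i" "0 <= link n i"
proof -
 have i2: "Suc (2 * i) < 2 ^ Suc n" "2 * i < 2 ^ Suc n" using assms by auto
 have "dpt T (Suc n) (Suc (2 * i)) + T / 2 ^ Suc n <= T"
  using dpt_cell_bounds[OF T i2(1)] dpt_Suc[of T "Suc n" "Suc (2 * i)"] by simp
 then have "continuous_on {dpt T (Suc n) (2 * i)..dpt T (Suc n) (Suc (2 * i))} (%u. norm (A u (u + T / 2 ^ Suc n)) powr \<rho>)"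
  using dpt_cell_bounds[OF T i2(2)] T by (intro step_continuous) auto
 then show "0 <= half_step n i" unfolding half_step_def
  using T by (intro divide_nonneg_nonneg integral_nonneg integrable_continuous_interval) auto
 then show "0 <= link n i" by (simp add: link_def)
qed

text \<open>Stands for the largest link among the descendants of one generation; the maximum is
  replaced by a sum of powers \<open>\<sigma>\<close> so that it can later be summed over all
  cells.\<close>

definition gen_max :: "nat => nat => nat => real" where
 "gen_max n i k = (\<Sum>j\<in>{i * 2 ^ k..<Suc i * 2 ^ k}. link (n + k) j powr \<sigma>) powr (1 / \<sigma>)"

lemma link_le_gen_max:
 assumes "i < 2 ^ n" "j \<in> {i * 2 ^ k..<Suc i * 2 ^ k}"
 shows "link (n + k) j <= gen_max n i k"
proof -
 have j: "j < 2 ^ (n + k)" using descendant_less[OF assms(1)] assms(2) by auto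
 have "link (n + k) j powr \<sigma> <= (\<Sum>j\<in>{i * 2 ^ k..<Suc i * 2 ^ k}. link (n + k) j powr \<sigma>)"
  using assms(2) by (intro member_le_sum) auto
 then have "(link (n + k) j powr \<sigma>) powr (1 / \<sigma>) <= gen_max n i k"
  unfolding gen_max_def using rho_sigma by (intro powr_mono2[where a = "1 / \<sigma>"]) auto
 then show ?thesis using link_nonneg(2)[OF j] rho_sigma by (simp add: powr_powr)
qed

text \<open>Follow the descendants that contain \<open>s\<close>; each bisection costs one link,
  bounded by \<open>gen_max\<close> of its generation.\<close>

lemma avg_chain:
 assumes n: "1 <= n" "i < 2 ^ n" and s: "s \<in> {dpt T n i..dpt T n (Suc i)}"
 shows "\<exists>j\<in>{i * 2 ^ K..<Suc i * 2 ^ K}. s \<in> {dpt T (n + K) j..dpt T (n + K) (Suc j)} \<and>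
  avg n i s <= (\<Sum>k<K. gen_max n i k) + avg (n + K) j s"
proof (induction K)
 case 0
 then show ?case using s by auto
next
 case (Suc K)
 then obtain j where j: "j \<in> {i * 2 ^ K..<Suc i * 2 ^ K}" "s \<in> {dpt T (n + K) j..dpt T (n + K) (Suc j)}"
  "avg n i s <= (\<Sum>k<K. gen_max n i k) + avg (n + K) j s" by blast
 have jl: "j < 2 ^ (n + K)" using descendant_less[OF n(2)] j(1) by auto
 have ends: "dpt T (Suc (n + K)) (2 * j) = dpt T (n + K) j" "dpt T (Suc (n + K)) (Suc (Suc (2 * j))) = dpt T (n + K) (Suc j)"
  using dpt_double[of T "n + K" "Suc j"] by (simp_all add: dpt_double)
 obtain j' where j': "j' = 2 * j \<or> j' = Suc (2 * j)" "s \<in> {dpt T (Suc (n + K)) j'..dpt T (Suc (n + K)) (Suc j')}"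
 proof (cases "s <= dpt T (Suc (n + K)) (Suc (2 * j))")
  case True
  then show ?thesis using that[of "2 * j"] j(2) ends by auto
 next
  case False
  then show ?thesis using that[of "Suc (2 * j)"] j(2) ends by auto
 qed
 have "i * 2 ^ Suc K <= 2 * j"
  using j(1) by simp
 moreover have "Suc (Suc (2 * j)) <= Suc i * 2 ^ Suc K"
 proof -
  have "Suc j <= Suc i * 2 ^ K" using j(1) by auto
  then have "2 * Suc j <= 2 * (Suc i * 2 ^ K)" by (rule mult_le_mono2)
  also have "2 * (Suc i * 2 ^ K) = Suc i * 2 ^ Suc K" by (simp only: power_Suc mult_ac)
  finally show ?thesis by simp
 qed
 ultimately have "i * 2 ^ Suc K <= j'" "j' < Suc i * 2 ^ Suc K" using j'(1) by linarith+
 then have jj: "j' \<in> {i * 2 ^ Suc K..<Suc i * 2 ^ Suc K}" by simp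
 have "avg (n + K) j s <= avg (Suc (n + K)) j' s + link (n + K) j"
  using n by (intro avg_child jl j') auto
 also have "link (n + K) j <= gen_max n i K" by (rule link_le_gen_max[OF n(2) j(1)])
 finally show ?case using j(3) jj j'(2) by (intro bexI[OF _ jj]) auto
qed

text \<open>Over shrinking cells around \<open>s\<close> the average tends to
  \<open>F s s = 0\<close> by continuity, so only the links remain.\<close>

lemma avg_le:
 assumes n: "1 <= n" "i < 2 ^ n" and s: "s \<in> {dpt T n i..dpt T n (Suc i)}"
  and B: "\<And>K. (\<Sum>k<K. gen_max n i k) <= B"
 shows "avg n i s <= B"
proof (rule field_le_epsilon)
 fix e :: real assume e: "0 < e"
 have sT: "s \<in> {0..T}" using s dpt_cell_bounds[OF T n(2)] by auto
 have "F s s = 0" using diag sT by (simp add: F_def)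
 then obtain \<delta> where \<delta>: "0 < \<delta>" "\<And>u. u \<in> {0..T} ==> \<bar>u - s\<bar> < \<delta> ==> F s u < e"
  using F_continuous[OF sT, unfolded continuous_on_iff, rule_format, OF sT e] F_nonneg
  by (auto simp: dist_real_def)
 obtain K where K: "(1 / 2) ^ K < \<delta> / T" using real_arch_pow_inv[of "\<delta> / T" "1 / 2"] \<delta> T by auto
 have "T / 2 ^ (n + K) <= T * (1 / 2) ^ K" using T by (simp add: power_divide power_add field_simps)
 also have "\<dots> < \<delta>" using K T by (simp add: field_simps)
 finally have small: "T / 2 ^ (n + K) < \<delta>" .
 obtain j where j: "j \<in> {i * 2 ^ K..<Suc i * 2 ^ K}" "s \<in> {dpt T (n + K) j..dpt T (n + K) (Suc j)}"
  "avg n i s <= (\<Sum>k<K. gen_max n i k) + avg (n + K) j s"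
  using avg_chain[OF n s, of K] by blast
 have jl: "j < 2 ^ (n + K)" using descendant_less[OF n(2)] j(1) by auto
 have "integral {dpt T (n + K) j..dpt T (n + K) (Suc j)} (F s) <= integral {dpt T (n + K) j..dpt T (n + K) (Suc j)} (%_. e)"
 proof (intro integral_le F_integrable sT jl)
  fix u assume u: "u \<in> {dpt T (n + K) j..dpt T (n + K) (Suc j)}"
  have "\<bar>u - s\<bar> <= T / 2 ^ (n + K)" using u j(2) by (auto simp: dpt_Suc)
  then show "F s u <= e" using \<delta>(2)[of u] small u dpt_cell_bounds[OF T jl] by auto
 qed auto
 also have "\<dots> = e * (T / 2 ^ (n + K))" using T by (simp add: dpt_Suc)
 finally have "avg (n + K) j s <= e" using T by (simp add: avg_def field_simps)
 then show "avg n i s <= B + e" using j(3) B[of K] by linarith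
qed

text \<open>Average the triangle inequality through an intermediate point over the cell. The two
  averages and the defect are at most \<open>B\<close> each, hence the factor 3.\<close>

lemma norm_le_avg:
 assumes n: "1 <= n" "i < 2 ^ n" and st: "dpt T n i <= s" "s <= t" "t <= dpt T n (Suc i)"
  and B: "\<And>K. (\<Sum>k<K. gen_max n i k) <= B"
 shows "norm (A s t) powr \<rho> <= 3 * B"
proof -
 let ?a = "dpt T n i" and ?b = "dpt T n (Suc i)"
 define L where "L = T / 2 ^ n"
 have L: "0 < L" using T by (simp add: L_def)
 have const: "integral {?a..?b} (%_. c) = L * c" for c :: real using L by (simp add: dpt_Suc L_def[symmetric])
 have av: "integral {?a..?b} (F x) = L * avg n i x" for x using L by (simp add: avg_def L_def[symmetric])
 have sc: "s \<in> {?a..?b}" "t \<in> {?a..?b}" using st by auto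
 then have sT: "s \<in> {0..T}" "t \<in> {0..T}" using dpt_cell_bounds[OF T n(2)] by auto
 have "integral {?a..?b} (%_. F s t) <= integral {?a..?b} (%u. (F s u + F t u) + d n i powr \<rho>)"
  using F_triangle[OF n sc(1) _ sc(2)] F_sym
  by (intro integral_le integrable_add F_integrable sT n) auto
 also have "\<dots> = (integral {?a..?b} (F s) + integral {?a..?b} (F t)) + integral {?a..?b} (%_. d n i powr \<rho>)"
  using F_integrable(1)[OF sT(1) n(2)] F_integrable(1)[OF sT(2) n(2)]
  by (subst integral_add) (auto intro: integrable_add simp: integral_add)
 finally have "L * F s t <= L * (avg n i s + avg n i t + d n i powr \<rho>)"
  unfolding const av by (simp only: distrib_left)
 then have "F s t <= avg n i s + avg n i t + d n i powr \<rho>" using L by (simp only: mult_le_cancel_left_pos)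
 moreover have "d n i powr \<rho> <= B"
 proof -
  have "d n i powr \<rho> <= link n i" using link_nonneg(1)[OF n(2)] by (simp add: link_def)
  also have "\<dots> <= gen_max n i 0" using link_le_gen_max[OF n(2), of i 0] by simp
  also have "\<dots> <= B" using B[of 1] by simp
  finally show ?thesis .
 qed
 moreover have "F s t = norm (A s t) powr \<rho>" using st by (simp add: F_def)
 ultimately show ?thesis using avg_le[OF n sc(1) B] avg_le[OF n sc(2) B] by simp
qed

text \<open>Only left children occur. They have even index in generation \<open>n + 1\<close> and
  are disjoint parts of the slice at lag \<open>T / 2 ^ Suc n\<close>; the last cell, whose
  translate would leave the interval, has odd index.\<close>

lemma half_step_sum:
 assumes x: "integral {0..T - T / 2 ^ Suc n} (%s. norm (A s (s + T / 2 ^ Suc n)) powr r) <= x powr r"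
 shows "(\<Sum>i<2 ^ n. half_step n i powr \<sigma>) <= 2 powr \<sigma> * (2 ^ Suc n / T) * x powr r"
proof -
 define l where "l = T / 2 ^ Suc n"
 have l: "0 < l" using T by (simp add: l_def)
 let ?I = "%j. integral {dpt T (Suc n) j..dpt T (Suc n) (Suc j)} (%s. norm (A s (s + l)) powr r)"
 have last: "dpt T (Suc n) (2 ^ Suc n - 1) = T - l"
  using dpt_Suc[of T "Suc n" "2 ^ Suc n - 1"] dpt_end[of T "Suc n"] by (simp add: l_def)
 have cell: "0 <= dpt T (Suc n) j" "dpt T (Suc n) (Suc j) <= T - l" if "j < 2 ^ Suc n - 1" for j
  using dpt_bounds[OF T, of j "Suc n"] dpt_mono[OF T, of "Suc j" "2 ^ Suc n - 1" "Suc n"] that unfolding last by auto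
 have cr: "continuous_on {0..T - l} (%s. norm (A s (s + l)) powr r)"
  using l by (intro continuous_norm_powr_slice[OF A] r) simp
 have I0: "0 <= ?I j" if "j < 2 ^ Suc n - 1" for j
  using cell[OF that] by (intro integral_nonneg integrable_continuous_interval continuous_on_subset[OF cr]) auto
 have even_lt: "2 * i < 2 ^ Suc n - 1" if "i < 2 ^ n" for i :: nat
 proof -
  have "Suc i <= 2 ^ n" using that by simp
  then have "2 * Suc i <= 2 * 2 ^ n" by (rule mult_le_mono2)
  then show ?thesis by simp
 qed
 have "(\<Sum>i<2 ^ n. half_step n i powr \<sigma>) <= (\<Sum>i<2 ^ n. 2 powr \<sigma> * (?I (2 * i) / l))"
 proof (rule sum_mono)
  fix i :: nat assume "i \<in> {..<2 ^ n}"
  then have j: "2 * i < 2 ^ Suc n - 1" using even_lt by simp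
  have len: "dpt T (Suc n) (Suc (2 * i)) - dpt T (Suc n) (2 * i) = l" by (simp add: dpt_Suc l_def)
  have "(integral {dpt T (Suc n) (2 * i)..dpt T (Suc n) (Suc (2 * i))} (%u. norm (A u (u + l)) powr \<rho>) / l) powr \<sigma>
    <= 2 powr \<sigma> * (integral {dpt T (Suc n) (2 * i)..dpt T (Suc n) (Suc (2 * i))} (%u. (norm (A u (u + l)) powr \<rho>) powr \<sigma>) / l)"
   unfolding len[symmetric]
  proof (rule integral_powr_mean)
   show "continuous_on {dpt T (Suc n) (2 * i)..dpt T (Suc n) (Suc (2 * i))}
     (%u. norm (A u (u + (dpt T (Suc n) (Suc (2 * i)) - dpt T (Suc n) (2 * i)))) powr \<rho>)"
    unfolding len using l cell[OF j] by (intro step_continuous) auto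
  qed (use l len rho_sigma in auto)
  then show "half_step n i powr \<sigma> <= 2 powr \<sigma> * (?I (2 * i) / l)"
   unfolding half_step_def l_def[symmetric] powr_powr rho_sigma(4) .
 qed
 also have "\<dots> = 2 powr \<sigma> * ((\<Sum>i<2 ^ n. ?I (2 * i)) / l)"
  by (simp only: sum_distrib_left sum_divide_distrib)
 also have "(\<Sum>i<2 ^ n. ?I (2 * i)) = sum ?I ((%i. 2 * i) ` {..<2 ^ n})"
  by (subst sum.reindex) (auto simp: inj_on_def o_def)
 also have "\<dots> <= (\<Sum>j<2 ^ Suc n - 1. ?I j)"
 proof (rule sum_mono2)
  show "(%i. 2 * i) ` {..<2 ^ n} \<subseteq> {..<2 ^ Suc n - (1::nat)}" using even_lt by blast
 qed (use I0 in auto)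
 also have "\<dots> = integral {0..T - l} (%s. norm (A s (s + l)) powr r)"
  using integral_dyadic_cells[OF T, of "Suc n" "2 ^ Suc n - 1"] cr unfolding last by simp
 also have "\<dots> <= x powr r" using x by (simp only: l_def)
 finally have "(\<Sum>i<2 ^ n. half_step n i powr \<sigma>) <= 2 powr \<sigma> * (x powr r / l)"
  using l by (simp add: divide_right_mono mult_left_mono)
 also have "\<dots> = 2 powr \<sigma> * (2 ^ Suc n / T) * x powr r" using T by (simp add: l_def)
 finally show ?thesis .
qed

text \<open>The weight \<open>2 powr (e * n)\<close> in \<open>b\<close> trades the sum over
  generations of maxima for a geometric series: each \<open>gen_max\<close> is at most
  \<open>2 powr (- e / \<sigma> * k)\<close> times a root of one rescaled tree sum, and tree sums
  can be added over cells.\<close>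

lemma cellsup_sum:
 fixes x \<delta> :: "nat => real"
 assumes e: "0 < e"
  and x: "\<And>n. 1 <= n ==> integral {0..T - T / 2 ^ n} (%s. norm (A s (s + T / 2 ^ n)) powr r) <= x n powr r"
  and dd: "\<And>n. 1 <= n ==> (\<Sum>i<2 ^ n. d n i powr r) <= 2 ^ n * \<delta> n powr r"
  and S: "S = (%m. 2 powr ((1 + e) * real m) * (x (Suc m) powr r + \<delta> m powr r))" "summable S"
  and n: "1 <= n"
 shows "(\<Sum>i<2 ^ n. cellsup T A n i powr r)
  <= (3 / (1 - 2 powr (- e / max 1 r))) powr max 1 r * (2 powr max 1 r * (2 powr max 1 r * 2 / T + 1)) * 2 powr (- e * n) * (\<Sum>k. S (n + k))"
proof -
 define b where "b n i = 2 powr (e * real n) * link n i powr \<sigma>" for n i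
 define C where "C = 2 powr \<sigma> * (2 powr \<sigma> * 2 / T + 1)"
 define c where "c = 1 / (1 - 2 powr (- e / \<sigma>))"
 have C0: "0 <= C" using T by (simp add: C_def)
 have e\<sigma>: "- e / \<sigma> < 0" using e rho_sigma by (simp add: divide_neg_pos)
 have "2 powr (- e / \<sigma>) < 1" using e\<sigma> powr_less_mono[of "- e / \<sigma>" 0 2] by simp
 then have c0: "0 <= c" by (simp add: c_def)
 have S0: "0 <= S m" for m by (simp add: S(1))
 have level: "level_sum b m <= C * S m" if m: "1 <= m" for m
 proof -
  have "(\<Sum>i<2 ^ m. link m i powr \<sigma>) <= (\<Sum>i<2 ^ m. 2 powr \<sigma> * (half_step m i powr \<sigma> + d m i powr r))"
  proof (rule sum_mono)
   fix i :: nat assume "i \<in> {..<2 ^ m}"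
   then have "0 <= half_step m i" using link_nonneg by simp
   from powr_add_le[OF this, of "d m i powr \<rho>" \<sigma>] rho_sigma
   show "link m i powr \<sigma> <= 2 powr \<sigma> * (half_step m i powr \<sigma> + d m i powr r)"
    by (simp add: link_def powr_powr)
  qed
  also have "\<dots> = 2 powr \<sigma> * ((\<Sum>i<2 ^ m. half_step m i powr \<sigma>) + (\<Sum>i<2 ^ m. d m i powr r))"
   by (simp only: sum_distrib_left[symmetric] sum.distrib)
  also have "\<dots> <= 2 powr \<sigma> * (2 powr \<sigma> * (2 ^ Suc m / T) * x (Suc m) powr r + 2 ^ m * \<delta> m powr r)"
   using half_step_sum[OF x[of "Suc m"]] dd[OF m] by (intro mult_left_mono add_mono) auto
  also have "\<dots> = 2 powr \<sigma> * 2 ^ m * (2 powr \<sigma> * 2 / T * x (Suc m) powr r + \<delta> m powr r)"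
   by (simp add: algebra_simps)
  also have "\<dots> <= 2 powr \<sigma> * 2 ^ m * ((2 powr \<sigma> * 2 / T + 1) * (x (Suc m) powr r + \<delta> m powr r))"
  proof (rule mult_left_mono)
   have *: "q * X + D <= (q + 1) * (X + D)" if "0 <= q" "0 <= X" "0 <= D" for q X D :: real
    using that mult_nonneg_nonneg[of q D] by (simp add: algebra_simps)
   show "2 powr \<sigma> * 2 / T * x (Suc m) powr r + \<delta> m powr r <= (2 powr \<sigma> * 2 / T + 1) * (x (Suc m) powr r + \<delta> m powr r)"
    by (rule *) (use T in auto)
  qed simp
  also have "\<dots> = C * (2 ^ m * (x (Suc m) powr r + \<delta> m powr r))" by (simp add: C_def)
  finally have "2 powr (e * m) * (\<Sum>i<2 ^ m. link m i powr \<sigma>) <= 2 powr (e * m) * (C * (2 ^ m * (x (Suc m) powr r + \<delta> m powr r)))"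
   by (rule mult_left_mono) simp
  also have "\<dots> = C * S m" by (simp add: S(1) distrib_right powr_add powr_realpow)
  finally show ?thesis by (simp add: level_sum_def b_def sum_distrib_left)
 qed
 have b0: "0 <= b n i" for n i by (simp add: b_def)
 have bts: "tree_summable b" unfolding tree_summable_def
 proof (intro conjI allI impI b0)
  show "summable (level_sum b)"
   by (rule summable_comparison_test'[OF summable_mult[OF S(2), of C], of 1])
    (use level b0 in \<open>auto simp: level_sum_def sum_nonneg\<close>)
 qed
 have pt: "cellsup T A n i powr r <= (3 * c) powr \<sigma> * (2 powr (- e * n) * tree_sum b n i)" if i: "i < 2 ^ n" for i
 proof -
  define Z where "Z = 2 powr (- e * n) * tree_sum b n i"
  have Z0: "0 <= Z" using tree_sum_nonneg[OF bts i] by (simp add: Z_def)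
  define g where "g k = (\<Sum>j\<in>{i * 2 ^ k..<Suc i * 2 ^ k}. link (n + k) j powr \<sigma>)" for k
  \<comment> \<open>A single generation is at most the whole tree sum of \<open>b\<close>; undoing
    the weight gives decay in \<open>k\<close>.\<close>
  have g: "g k <= 2 powr (- e * k) * Z" for k
  proof -
   have "2 powr (e * real (n + k)) * g k = (\<Sum>j\<in>{i * 2 ^ k..<Suc i * 2 ^ k}. b (n + k) j)"
    by (simp only: g_def b_def sum_distrib_left)
   also have "\<dots> <= tree_sum b n i"
    unfolding tree_sum_def
    using sum_le_suminf[OF summable_descendants[OF bts i], of "{k}"] b0 by (simp add: sum_nonneg)
   finally have "2 powr (- e * real (n + k)) * (2 powr (e * real (n + k)) * g k) <= 2 powr (- e * real (n + k)) * tree_sum b n i"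
    by (rule mult_left_mono) simp
   moreover have "2 powr (- e * real (n + k)) * 2 powr (e * real (n + k)) = 1" by (simp add: powr_add[symmetric])
   moreover have "2 powr (- e * real (n + k)) = 2 powr (- e * k) * 2 powr (- e * n)"
    by (simp add: powr_add[symmetric] algebra_simps)
   ultimately show ?thesis by (simp only: Z_def mult.assoc[symmetric] mult_1)
  qed
  have gm: "gen_max n i k <= 2 powr (- e / \<sigma> * k) * Z powr (1 / \<sigma>)" for k
  proof -
   have "gen_max n i k <= (2 powr (- e * k) * Z) powr (1 / \<sigma>)"
    unfolding gen_max_def g_def[symmetric] using rho_sigma
    by (intro powr_mono2 g) (auto simp: g_def sum_nonneg)
   then show ?thesis by (simp add: powr_mult powr_powr)
  qed
  have sums: "(%k. 2 powr (- e / \<sigma> * real (0 + k))) sums (2 powr (- e / \<sigma> * real 0) / (1 - 2 powr (- e / \<sigma>)))"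
   by (rule powr_geometric_sums[OF e\<sigma>])
  have B: "(\<Sum>k<K. gen_max n i k) <= c * Z powr (1 / \<sigma>)" for K
  proof -
   have "(\<Sum>k<K. gen_max n i k) <= (\<Sum>k<K. 2 powr (- e / \<sigma> * real (0 + k))) * Z powr (1 / \<sigma>)"
    unfolding sum_distrib_right using gm by (intro sum_mono) simp
   also have "(\<Sum>k<K. 2 powr (- e / \<sigma> * real (0 + k))) <= c"
    using sum_le_suminf[OF sums_summable[OF sums], of "{..<K}"] sums_unique[OF sums] by (simp add: c_def)
   finally show ?thesis by (simp add: mult_right_mono)
  qed
  have "norm (A s t) <= ((3 * c) powr \<sigma> * Z) powr (1 / r)" if st: "dpt T n i <= s" "s <= t" "t <= dpt T n (Suc i)" for s t
  proof -
   have "norm (A s t) powr \<rho> <= 3 * (c * Z powr (1 / \<sigma>))" by (rule norm_le_avg[OF n i st B])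
   then have "(norm (A s t) powr \<rho>) powr (\<sigma> * (1 / r)) <= (3 * (c * Z powr (1 / \<sigma>))) powr (\<sigma> * (1 / r))"
    by (intro powr_mono2[where a = "\<sigma> * (1 / r)"]) (use rho_sigma(3) r in auto)
   also have "(3 * (c * Z powr (1 / \<sigma>))) powr (\<sigma> * (1 / r)) = ((3 * c) powr \<sigma> * Z) powr (1 / r)"
   proof -
    have "(3 * (c * Z powr (1 / \<sigma>))) powr \<sigma> = (3 * c) powr \<sigma> * Z"
     using rho_sigma(3) Z0 by (simp add: powr_mult powr_powr)
    then show ?thesis by (simp only: powr_powr[symmetric])
   qed
   also have "(norm (A s t) powr \<rho>) powr (\<sigma> * (1 / r)) = norm (A s t)"
   proof -
    have "\<rho> * (\<sigma> * (1 / r)) = 1" unfolding mult.assoc[symmetric] rho_sigma(4) using r by simp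
    then show ?thesis by (simp only: powr_powr) simp
   qed
   finally show ?thesis .
  qed
  then have "cellsup T A n i <= ((3 * c) powr \<sigma> * Z) powr (1 / r)" by (intro cellsup_least[OF T])
  then have "cellsup T A n i powr r <= (((3 * c) powr \<sigma> * Z) powr (1 / r)) powr r"
   using r cellsup_nonneg[OF A T i] by (intro powr_mono2) auto
  then show ?thesis using r Z0 by (simp add: powr_powr Z_def)
 qed
 have sS: "summable (%k. S (n + k))"
  using summable_ignore_initial_segment[OF S(2), of n] by (simp add: add.commute)
 have "(\<Sum>i<2 ^ n. cellsup T A n i powr r) <= (\<Sum>i<2 ^ n. (3 * c) powr \<sigma> * (2 powr (- e * n) * tree_sum b n i))"
  using pt by (intro sum_mono) simp
 also have "\<dots> = (3 * c) powr \<sigma> * (2 powr (- e * n) * (\<Sum>k. level_sum b (n + k)))"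
  by (simp only: sum_distrib_left[symmetric] level_sum_tree_sum[OF bts])
 also have "\<dots> <= (3 * c) powr \<sigma> * (2 powr (- e * n) * (\<Sum>k. C * S (n + k)))"
  using n by (intro mult_left_mono suminf_le level summable_level_tail[OF bts] summable_mult sS) auto
 also have "(\<Sum>k. C * S (n + k)) = C * (\<Sum>k. S (n + k))" by (rule suminf_mult[OF sS])
 finally show ?thesis unfolding c_def C_def \<sigma>_def by (simp add: mult_ac)
qed

end

section \<open>Admissible cell bounds from Besov norms\<close>

text \<open>\<open>e\<close> is half of the gap \<open>\<alpha> * P - 1\<close>, so that
  \<open>1 + e - \<alpha> * P = - e\<close> and the tails converge geometrically. At \<alpha> = 1/3
  the cubic sum survives: \<open>3 / P < 1\<close> makes the power subadditive and leaves a
  convolution with the summable kernel \<open>2 powr (\<eta> * k)\<close>.\<close>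

lemma admissible_convolution:
 fixes \<alpha> P e C K :: real
 assumes al: "1 / 3 <= \<alpha>" and P: "1 < \<alpha> * P" "0 < P" and e: "e = (\<alpha> * P - 1) / 2" and C: "0 <= C" and K: "0 <= K"
 shows "\<exists>K'\<ge>0. \<forall>z. admissible \<alpha> K z --> summable (%m. 2 powr ((1 + e) * real m) * z m powr P) \<and>
  admissible \<alpha> K' (%n. (C * 2 powr (- (1 + e) * n) * (\<Sum>k. 2 powr ((1 + e) * real (n + k)) * z (n + k) powr P)) powr (1 / P))"
proof -
 have e0: "0 < e" "1 + e - \<alpha> * P = - e" using P e by (auto simp: field_simps)
 define c where "c = 1 / (1 - 2 powr - e)"
 have "2 powr - e < 1" using e0 powr_less_mono[of "- e" 0 2] by simp
 then have c0: "0 <= c" by (simp add: c_def)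
 define \<eta> where "\<eta> = 3 * (1 + e) / P - 1"
 define K1 where "K1 = (C * c) powr (1 / P) * K"
 define K2 where "K2 = C powr (3 / P) * (K / (1 - 2 powr \<eta>))"
 show ?thesis
 proof (intro exI[of _ "max K1 K2"] conjI allI impI)
  show "0 <= max K1 K2" using K by (simp add: K1_def le_max_iff_disj)
  fix z assume z: "admissible \<alpha> K z"
  have zb: "0 <= z n" "z n <= K * 2 powr (- \<alpha> * n)" if "1 <= n" for n
   using z that by (auto simp: admissible_def)
  let ?S = "%m. 2 powr ((1 + e) * real m) * z m powr P"
  have Sb: "?S m <= K powr P * 2 powr (- e * m)" if m: "1 <= m" for m
  proof -
   have "?S m <= 2 powr ((1 + e) * real m) * (K * 2 powr (- \<alpha> * m)) powr P"
    using zb[OF m] P by (intro mult_left_mono powr_mono2) auto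
   also have "\<dots> = K powr P * (2 powr ((1 + e) * real m) * 2 powr (- \<alpha> * m * P))"
    by (simp add: powr_mult powr_powr)
   also have "2 powr ((1 + e) * real m) * 2 powr (- \<alpha> * m * P) = 2 powr (- e * m)"
    unfolding powr_add[symmetric] using e0(2) by (simp add: algebra_simps flip: e0(2))
   finally show ?thesis .
  qed
  have g: "(%k. K powr P * 2 powr (- e * real (n + k))) sums (K powr P * (2 powr (- e * n) / (1 - 2 powr - e)))" for n
   using e0 by (intro sums_mult powr_geometric_sums) auto
  have sS: "summable (%k. ?S (n + k))" if "1 <= n" for n
  proof (rule summable_comparison_test'[OF sums_summable[OF g[of n]], of 0])
   fix k :: nat show "norm (?S (n + k)) <= K powr P * 2 powr (- e * real (n + k))"
    using Sb[of "n + k"] that by (simp del: of_nat_add)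
  qed
  show sm: "summable ?S" using sS[of 1] summable_Suc_iff[of ?S] by simp
  define w where "w n = (\<Sum>k. ?S (n + k))" for n
  have w0: "0 <= w n" if "1 <= n" for n unfolding w_def by (intro suminf_nonneg sS that) simp
  define v where "v n = (C * 2 powr (- (1 + e) * n) * w n) powr (1 / P)" for n :: nat
  have vb: "v n <= K1 * 2 powr (- \<alpha> * n)" if n: "1 <= n" for n
  proof -
   have "w n <= K powr P * (2 powr (- e * n) * c)"
    unfolding w_def using suminf_le[OF Sb sS[OF n] sums_summable[OF g[of n]]] n sums_unique[OF g[of n]]
    by (simp add: c_def)
   then have "C * 2 powr (- (1 + e) * n) * w n <= C * 2 powr (- (1 + e) * n) * (K powr P * (2 powr (- e * n) * c))"
    using C by (intro mult_left_mono) auto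
   also have "\<dots> = (C * c) * K powr P * (2 powr (- (1 + e) * n) * 2 powr (- e * n))" by simp
   also have "2 powr (- (1 + e) * n) * 2 powr (- e * n) = 2 powr (- \<alpha> * n * P)"
   proof -
    have "\<alpha> * P = 1 + 2 * e" using e by (simp add: field_simps)
    then have "- (\<alpha> * P) * n = - (1 + 2 * e) * n" by (simp only:)
    moreover have "- (1 + 2 * e) * n = - (1 + e) * n + - e * n" by (simp add: algebra_simps)
    moreover have "- (\<alpha> * P) * n = - \<alpha> * n * P" by simp
    ultimately have "- (1 + e) * n + - e * n = - \<alpha> * n * P" by (simp only:)
    then show ?thesis by (simp only: powr_add[symmetric])
   qed
   finally have "v n <= ((C * c) * K powr P * 2 powr (- \<alpha> * n * P)) powr (1 / P)"
    unfolding v_def using C w0[OF n] P by (intro powr_mono2) auto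
   also have "\<dots> = K1 * 2 powr (- \<alpha> * n)"
    using P K by (simp add: powr_mult powr_powr K1_def)
   finally show ?thesis .
  qed
  have crit: "(\<Sum>n=1..N. 2 ^ n * v n ^ 3) <= K2" if a: "\<alpha> = 1 / 3" for N
  proof -
   have P3: "3 < P" using P a by simp
   have \<eta>: "\<eta> < 0" using P3 e a unfolding \<eta>_def by (simp add: field_simps)
   have \<eta>1: "2 powr \<eta> < 1" using \<eta> powr_less_mono[of \<eta> 0 2] by simp
   have tm: "2 ^ n * v n ^ 3 = C powr (3 / P) * (2 ^ n * (2 powr (- (1 + e) * n) * w n) powr (3 / P))" if "1 <= n" for n
   proof -
    have "v n ^ 3 = v n powr 3" by (simp add: v_def)
    also have "\<dots> = C powr (3 / P) * (2 powr (- (1 + e) * n) * w n) powr (3 / P)"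
     using C w0[OF that] by (simp add: v_def powr_powr powr_mult)
    finally show ?thesis by simp
   qed
   let ?p = "%M n. 2 powr (- (1 + e) * real n) * (\<Sum>k<M. ?S (n + k))"
   \<comment> \<open>Subadditivity is applied to finitely many terms, with a bound independent of
     \<open>M\<close>; the limit is taken afterwards.\<close>
   have fin: "(\<Sum>n=1..N. 2 ^ n * ?p M n powr (3 / P)) <= K / (1 - 2 powr \<eta>)" for M
   proof -
    have "(\<Sum>n=1..N. 2 ^ n * ?p M n powr (3 / P)) <= (\<Sum>n=1..N. \<Sum>k<M. 2 powr (\<eta> * k) * (2 ^ (n + k) * z (n + k) ^ 3))"
    proof (rule sum_mono)
     fix n assume "n \<in> {1..N}"
     then have n: "1 <= n" by simp
     have "?p M n = (\<Sum>k<M. 2 powr ((1 + e) * k) * z (n + k) powr P)"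
      unfolding sum_distrib_left mult.assoc[symmetric] powr_add[symmetric] by (simp add: algebra_simps)
     then have "?p M n powr (3 / P) <= (\<Sum>k<M. (2 powr ((1 + e) * k) * z (n + k) powr P) powr (3 / P))"
      using P3 by (simp only:) (intro powr_sum_le_sum_powr, auto)
     also have "\<dots> = (\<Sum>k<M. 2 powr ((\<eta> + 1) * k) * z (n + k) ^ 3)"
     proof (intro sum.cong refl)
      fix k :: nat
      have "(1 + e) * k * (3 / P) = (\<eta> + 1) * k" by (simp add: \<eta>_def)
      then show "(2 powr ((1 + e) * k) * z (n + k) powr P) powr (3 / P) = 2 powr ((\<eta> + 1) * k) * z (n + k) ^ 3"
       using P zb(1)[of "n + k"] n by (simp add: powr_mult powr_powr)
     qed
     finally have "2 ^ n * ?p M n powr (3 / P) <= 2 ^ n * (\<Sum>k<M. 2 powr ((\<eta> + 1) * k) * z (n + k) ^ 3)"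
      by (rule mult_left_mono) simp
     also have "\<dots> = (\<Sum>k<M. 2 powr (\<eta> * k) * (2 ^ (n + k) * z (n + k) ^ 3))"
     proof -
      have pe: "2 powr ((\<eta> + 1) * k) = 2 powr (\<eta> * k) * 2 ^ k" for k :: nat
       by (simp add: distrib_right powr_add powr_realpow)
      show ?thesis unfolding sum_distrib_left pe by (simp add: power_add mult_ac)
     qed
     finally show "2 ^ n * ?p M n powr (3 / P) <= (\<Sum>k<M. 2 powr (\<eta> * k) * (2 ^ (n + k) * z (n + k) ^ 3))" .
    qed
    also have "\<dots> = (\<Sum>k<M. 2 powr (\<eta> * k) * (\<Sum>n=1..N. 2 ^ (n + k) * z (n + k) ^ 3))"
     unfolding sum_distrib_left by (rule sum.swap)
    also have "\<dots> <= (\<Sum>k<M. 2 powr (\<eta> * k) * K)"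
    proof (intro sum_mono mult_left_mono)
     fix k :: nat
     have "(\<Sum>n=1..N. 2 ^ (n + k) * z (n + k) ^ 3) = (\<Sum>n=1+k..N+k. 2 ^ n * z n ^ 3)"
      by (rule sum.reindex_bij_witness[of _ "%n. n - k" "%n. n + k"]) auto
     also have "\<dots> <= (\<Sum>n=1..N+k. 2 ^ n * z n ^ 3)" using zb(1) by (intro sum_mono2) auto
     also have "\<dots> <= K" using z a by (simp add: admissible_def)
     finally show "(\<Sum>n=1..N. 2 ^ (n + k) * z (n + k) ^ 3) <= K" .
    qed simp
    also have "\<dots> = (\<Sum>k<M. 2 powr (\<eta> * real (0 + k))) * K" by (simp add: sum_distrib_right)
    also have "\<dots> <= 1 / (1 - 2 powr \<eta>) * K"
     using sum_le_suminf[OF sums_summable[OF powr_geometric_sums[OF \<eta>, of 0]], of "{..<M}"]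
      sums_unique[OF powr_geometric_sums[OF \<eta>, of 0]] K by (intro mult_right_mono) auto
    finally show ?thesis by simp
   qed
   have "(%M. \<Sum>n=1..N. 2 ^ n * ?p M n powr (3 / P)) \<longlonglongrightarrow> (\<Sum>n=1..N. 2 ^ n * (2 powr (- (1 + e) * n) * w n) powr (3 / P))"
   proof (rule tendsto_sum, rule tendsto_mult_left)
    fix n assume "n \<in> {1..N}"
    then have n: "1 <= n" by simp
    have l: "(%M. ?p M n) \<longlonglongrightarrow> 2 powr (- (1 + e) * n) * w n"
     unfolding w_def by (intro tendsto_mult_left summable_LIMSEQ sS n)
    show "(%M. ?p M n powr (3 / P)) \<longlonglongrightarrow> (2 powr (- (1 + e) * n) * w n) powr (3 / P)"
     by (rule tendsto_powr'[OF l tendsto_const])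
      (use P in \<open>auto intro!: always_eventually mult_nonneg_nonneg sum_nonneg\<close>)
   qed
   then have "(\<Sum>n=1..N. 2 ^ n * (2 powr (- (1 + e) * n) * w n) powr (3 / P)) <= K / (1 - 2 powr \<eta>)"
    by (rule LIMSEQ_le_const2) (use fin in auto)
   then have "C powr (3 / P) * (\<Sum>n=1..N. 2 ^ n * (2 powr (- (1 + e) * n) * w n) powr (3 / P)) <= K2"
    unfolding K2_def by (rule mult_left_mono) simp
   moreover have "(\<Sum>n=1..N. 2 ^ n * v n ^ 3) = C powr (3 / P) * (\<Sum>n=1..N. 2 ^ n * (2 powr (- (1 + e) * n) * w n) powr (3 / P))"
    unfolding sum_distrib_left using tm by (intro sum.cong refl) simp
   ultimately show ?thesis by simp
  qed
  have "admissible \<alpha> (max K1 K2) v" unfolding admissible_def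
  proof (intro conjI allI impI)
   show "0 <= v n" for n by (simp add: v_def)
   show "v n <= max K1 K2 * 2 powr (- \<alpha> * n)" if "1 <= n" for n
    by (rule order_trans[OF vb[OF that] mult_right_mono]) auto
   show "(\<Sum>n=1..N. 2 ^ n * v n ^ 3) <= max K1 K2" if "\<alpha> = 1 / 3" for N
    using crit[OF that, of N] by simp
  qed
  then show "admissible \<alpha> (max K1 K2) (%n. (C * 2 powr (- (1 + e) * n) * (\<Sum>k. ?S (n + k))) powr (1 / P))"
   unfolding v_def[abs_def] w_def .
 qed
qed

lemma admissible_shift:
 assumes "admissible \<alpha> K z" "0 <= \<alpha>"
 shows "admissible \<alpha> K (%n. z (Suc n))"
 unfolding admissible_def
proof (intro conjI allI impI)
 have zb: "0 <= z n" "z n <= K * 2 powr (- \<alpha> * n)" if "1 <= n" for n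
  using assms that by (auto simp: admissible_def)
 fix n :: nat
 show "0 <= z (Suc n)" using zb by simp
 have "2 powr (- \<alpha> * real (Suc n)) <= 2 powr (- \<alpha> * n)" using assms(2) by (intro powr_mono) (auto simp: algebra_simps)
 then have "K * 2 powr (- \<alpha> * real (Suc n)) <= K * 2 powr (- \<alpha> * n)"
  using admissible_nonneg[OF assms(1)] by (rule mult_left_mono)
 then show "z (Suc n) <= K * 2 powr (- \<alpha> * n)" using zb(2)[of "Suc n"] by simp
next
 fix N assume a: "\<alpha> = 1 / 3"
 have z0: "0 <= z n" if "1 <= n" for n using assms that by (auto simp: admissible_def)
 have "(\<Sum>n=1..N. 2 ^ n * z (Suc n) ^ 3) <= (\<Sum>n=1..N. 2 ^ Suc n * z (Suc n) ^ 3)"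
  using z0 by (intro sum_mono mult_right_mono power_increasing) auto
 also have "\<dots> = (\<Sum>n=2..Suc N. 2 ^ n * z n ^ 3)"
  by (rule sum.reindex_bij_witness[of _ "%n. n - 1" Suc]) auto
 also have "\<dots> <= (\<Sum>n=1..Suc N. 2 ^ n * z n ^ 3)" using z0 by (intro sum_mono2) auto
 also have "\<dots> <= K" using assms a by (simp add: admissible_def del: sum.cl_ivl_Suc)
 finally show "(\<Sum>n=1..N. 2 ^ n * z (Suc n) ^ 3) <= K" .
qed

text \<open>For \<open>\<beta> = 2\<close> the second level, of order \<open>2 * \<alpha>\<close>,
  is brought to order \<alpha> by a root. The hypothesis \<open>q <= 3\<close> enters here: it
  embeds the discrete \<open>l^q\<close> bound in \<open>l^3\<close>.\<close>

lemma besov2_norm_admissible: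
 assumes T: "0 < T" and al: "1 / 3 <= \<alpha>" and q: "0 < q" "\<alpha> = 1 / 3 ==> q <= 3" and b: "1 <= \<beta>" and rho: "0 <= \<rho>"
 shows "\<exists>K\<ge>0. \<forall>A :: real => real => 'v::real_normed_vector. besov2_norm (\<beta> * \<alpha>) p (q / ennreal \<beta>) T A <= ennreal \<rho> -->
  (\<exists>x::nat => real. (\<forall>n\<ge>1. 0 <= x n \<and> (\<forall>h\<in>{0..T / 2 ^ n}. Lp p T A h <= ennreal (x n))) \<and>
   admissible \<alpha> K (%n. x n powr (1 / \<beta>)))"
proof -
 have b0: "0 < \<beta>" and al0: "0 < \<alpha>" using b al by auto
 have qb: "0 < q / ennreal \<beta>" using q b0 by (simp add: ennreal_zero_less_divide)
 obtain C where C: "0 <= C" and disc: "\<And>A :: real => real => 'v. besov2_norm (\<beta> * \<alpha>) p (q / ennreal \<beta>) T A <= ennreal \<rho> ==>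
  \<exists>x::nat => real. (\<forall>n\<ge>1. 0 <= x n \<and> (\<forall>h\<in>{0..T / 2 ^ n}. Lp p T A h <= ennreal (x n)) \<and> x n <= C * 2 powr (- (\<beta> * \<alpha>) * n)) \<and>
   (q / ennreal \<beta> \<noteq> \<infinity> --> (\<forall>N. (\<Sum>n=1..N. (2 powr (\<beta> * \<alpha> * n) * x n) powr enn2real (q / ennreal \<beta>)) <= C))"
  using besov2_norm_discretise[OF T qb _ rho, of "\<beta> * \<alpha>" p, where 'v = 'v] b0 al0 by auto
 define K where "K = max (C powr (1 / \<beta>)) (C powr (3 / enn2real q))"
 show ?thesis
 proof (intro exI[of _ K] conjI allI impI)
  show "0 <= K" by (simp add: K_def le_max_iff_disj)
  fix A :: "real => real => 'v" assume "besov2_norm (\<beta> * \<alpha>) p (q / ennreal \<beta>) T A <= ennreal \<rho>"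
  then obtain x :: "nat => real" where x: "\<forall>n\<ge>1. 0 <= x n \<and> (\<forall>h\<in>{0..T / 2 ^ n}. Lp p T A h <= ennreal (x n)) \<and> x n <= C * 2 powr (- (\<beta> * \<alpha>) * n)"
   "q / ennreal \<beta> \<noteq> \<infinity> --> (\<forall>N. (\<Sum>n=1..N. (2 powr (\<beta> * \<alpha> * n) * x n) powr enn2real (q / ennreal \<beta>)) <= C)"
   using disc by blast
  have "admissible \<alpha> K (%n. x n powr (1 / \<beta>))" unfolding admissible_def
  proof (intro conjI allI impI)
   fix n :: nat assume n: "1 <= n"
   have "x n powr (1 / \<beta>) <= (C * 2 powr (- (\<beta> * \<alpha>) * n)) powr (1 / \<beta>)"
    using x(1) n b0 by (intro powr_mono2) auto
   also have "\<dots> = C powr (1 / \<beta>) * 2 powr (- \<alpha> * n)"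
    using b0 by (simp add: powr_mult powr_powr)
   also have "\<dots> <= K * 2 powr (- \<alpha> * n)" by (intro mult_right_mono) (auto simp: K_def)
   finally show "x n powr (1 / \<beta>) <= K * 2 powr (- \<alpha> * n)" .
  next
   fix N assume a: "\<alpha> = 1 / 3"
   have qf: "q \<noteq> \<infinity>" using q(2)[OF a] by (auto simp: top_unique)
   define Q where "Q = enn2real q"
   have Q: "0 < Q" unfolding Q_def by (rule enn2real_pos[OF q(1) qf])
   have qQ: "q = ennreal Q" using qf by (simp add: Q_def top.not_eq_extremum)
   have Q3: "Q <= 3" using q(2)[OF a] unfolding qQ using ennreal_le_iff[of 3 Q] by simp
   have qb': "q / ennreal \<beta> = ennreal (Q / \<beta>)" unfolding qQ using Q b0 by (simp add: divide_ennreal)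
   then have S: "(\<Sum>n=1..N. (2 powr (\<beta> * \<alpha> * n) * x n) powr (Q / \<beta>)) <= C"
    using x(2) Q b0 by (simp del: One_nat_def)
   have "(\<Sum>n=1..N. 2 ^ n * (x n powr (1 / \<beta>)) ^ 3) = (\<Sum>n=1..N. ((2 powr (\<beta> * \<alpha> * n) * x n) powr (Q / \<beta>)) powr (3 / Q))"
   proof (intro sum.cong refl)
    fix n assume "n \<in> {1..N}"
    then have x0: "0 <= x n" using x(1) by simp
    have "(x n powr (1 / \<beta>)) ^ 3 = x n powr (3 / \<beta>)" by (simp add: powr_powr flip: powr_numeral)
    moreover have "((2 powr (\<beta> * \<alpha> * n) * x n) powr (Q / \<beta>)) powr (3 / Q) = 2 powr (\<beta> * \<alpha> * n * (3 / \<beta>)) * x n powr (3 / \<beta>)"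
     using Q by (simp add: powr_powr powr_mult)
    moreover have "\<beta> * \<alpha> * n * (3 / \<beta>) = n" using b0 a by simp
    ultimately show "2 ^ n * (x n powr (1 / \<beta>)) ^ 3 = ((2 powr (\<beta> * \<alpha> * n) * x n) powr (Q / \<beta>)) powr (3 / Q)"
     by (simp only:) (simp add: powr_realpow)
   qed
   also have "\<dots> <= (\<Sum>n=1..N. (2 powr (\<beta> * \<alpha> * n) * x n) powr (Q / \<beta>)) powr (3 / Q)"
    using Q Q3 by (intro sum_powr_le_powr_sum) auto
   also have "\<dots> <= C powr (3 / Q)" using S Q by (intro powr_mono2 sum_nonneg) auto
   also have "\<dots> <= K" by (simp add: K_def Q_def)
   finally show "(\<Sum>n=1..N. 2 ^ n * (x n powr (1 / \<beta>)) ^ 3) <= K" .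
  qed simp
  with x(1) show "\<exists>x::nat => real. (\<forall>n\<ge>1. 0 <= x n \<and> (\<forall>h\<in>{0..T / 2 ^ n}. Lp p T A h <= ennreal (x n))) \<and>
   admissible \<alpha> K (%n. x n powr (1 / \<beta>))" by blast
 qed
qed

text \<open>\<open>\<beta>\<close> is the level. Chaining with exponent \<open>p / \<beta>\<close>
  bounds suprema over cells by slice norms and defects, and the root of order \<open>\<beta>\<close>
  restores the homogeneity of a path. For \<open>p = \<infinity>\<close> the slice norms are suprema
  already and bound the cells directly. One \<open>K\<close> serves all \<open>A\<close> with the
  given bounds.\<close>

theorem besov_cell_bound:
 assumes T: "0 < T" and al: "1 / 3 <= \<alpha>" and p: "0 < p" "inv_exp p < \<alpha>" and q: "0 < q" "\<alpha> = 1 / 3 ==> q <= 3"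
  and b: "1 <= \<beta>" and rho: "0 <= \<rho>" and L: "0 <= L"
 shows "\<exists>K\<ge>0. \<forall>(A :: real => real => 'v::real_normed_vector) D dd.
  cont2 T A --> (\<forall>s\<in>{0..T}. A s s = 0) --> besov2_norm (\<beta> * \<alpha>) (p / ennreal \<beta>) (q / ennreal \<beta>) T A <= ennreal \<rho> -->
  cell_bound p D dd --> admissible \<alpha> L dd -->
  (\<forall>n i s u t. 1 <= n --> i < 2 ^ n --> dpt T n i <= s --> s <= u --> u <= t --> t <= dpt T n (Suc i) -->
   norm (A s t - A s u - A u t) <= D n i powr \<beta>) -->
  (\<exists>v. admissible \<alpha> K v \<and> cell_bound p (%n i. cellsup T A n i powr (1 / \<beta>)) v)"
proof -
 have b0: "0 < \<beta>" using b by simp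
 have pb: "0 < p / ennreal \<beta>" using p b0 by (simp add: ennreal_zero_less_divide)
 obtain K0 where K0: "0 <= K0" and disc: "\<And>A :: real => real => 'v. besov2_norm (\<beta> * \<alpha>) (p / ennreal \<beta>) (q / ennreal \<beta>) T A <= ennreal \<rho> ==>
  \<exists>x::nat => real. (\<forall>n\<ge>1. 0 <= x n \<and> (\<forall>h\<in>{0..T / 2 ^ n}. Lp (p / ennreal \<beta>) T A h <= ennreal (x n))) \<and>
   admissible \<alpha> K0 (%n. x n powr (1 / \<beta>))"
  using besov2_norm_admissible[OF T al q b rho, of "p / ennreal \<beta>", where 'v = 'v] by auto
 show ?thesis
 proof (cases "p = \<infinity>")
  case True
  then have pb': "p / ennreal \<beta> = \<infinity>" by (simp add: ennreal_top_divide)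
  show ?thesis
  proof (intro exI[of _ K0] conjI K0 allI impI)
   fix A :: "real => real => 'v" and D dd
   assume A: "cont2 T A" and n: "besov2_norm (\<beta> * \<alpha>) (p / ennreal \<beta>) (q / ennreal \<beta>) T A <= ennreal \<rho>"
   obtain x :: "nat => real" where x: "\<forall>n\<ge>1. 0 <= x n \<and> (\<forall>h\<in>{0..T / 2 ^ n}. Lp (p / ennreal \<beta>) T A h <= ennreal (x n))"
    "admissible \<alpha> K0 (%n. x n powr (1 / \<beta>))" using disc[OF n] by blast
   have "cell_bound p (%n i. cellsup T A n i powr (1 / \<beta>)) (%n. x n powr (1 / \<beta>))"
    unfolding cell_bound_def if_P[OF True]
   proof (intro allI impI conjI)
    fix n i :: nat assume n: "1 <= n" and i: "i < 2 ^ n"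
    have "cellsup T A n i <= x n"
    proof (rule cellsup_least[OF T])
     fix s t assume st: "dpt T n i <= s" "s <= t" "t <= dpt T n (Suc i)"
     have h: "t - s \<in> {0..T / 2 ^ n}" using st by (auto simp: dpt_Suc)
     have "Lp (p / ennreal \<beta>) T A (t - s) <= ennreal (x n)" using x(1) n h by blast
     then have "\<forall>u\<in>{0..T - (t - s)}. norm (A u (u + (t - s))) <= x n"
      using Lp_le_iff[OF A _ pb, of "t - s" "x n"] h x(1) n pb' by auto
     moreover have "s \<in> {0..T - (t - s)}" using st dpt_cell_bounds[OF T i] by auto
     ultimately show "norm (A s t) <= x n" by force
    qed
    then show "cellsup T A n i powr (1 / \<beta>) <= x n powr (1 / \<beta>)"
     using b0 cellsup_nonneg[OF A T i] by (intro powr_mono2) auto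
   qed auto
   with x(2) show "\<exists>v. admissible \<alpha> K0 v \<and> cell_bound p (%n i. cellsup T A n i powr (1 / \<beta>)) v" by blast
  qed
 next
  case False
  define P where "P = enn2real p"
  have P: "0 < P" unfolding P_def by (rule enn2real_pos[OF p(1) False])
  have pP: "p = ennreal P" using False by (simp add: P_def top.not_eq_extremum)
  have aP: "1 < \<alpha> * P" using p(2) False P by (simp add: inv_exp_def P_def[symmetric] field_simps)
  define r where "r = P / \<beta>"
  have r: "0 < r" using P b0 by (simp add: r_def)
  have pr: "p / ennreal \<beta> = ennreal r" unfolding pP r_def using P b0 by (simp add: divide_ennreal)
  define e where "e = (\<alpha> * P - 1) / 2"
  have e: "0 < e" using aP by (simp add: e_def)
  define C where "C = (3 / (1 - 2 powr (- e / max 1 r))) powr max 1 r * (2 powr max 1 r * (2 powr max 1 r * 2 / T + 1)) * 2"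
  have C: "0 <= C" using T by (simp add: C_def)
  obtain K where K: "0 <= K" and conv: "\<And>z. admissible \<alpha> (8 * (K0 + L)) z ==> summable (%m. 2 powr ((1 + e) * real m) * z m powr P) \<and>
   admissible \<alpha> K (%n. (C * 2 powr (- (1 + e) * n) * (\<Sum>k. 2 powr ((1 + e) * real (n + k)) * z (n + k) powr P)) powr (1 / P))"
   using admissible_convolution[OF al aP P e_def C, of "8 * (K0 + L)"] K0 L by auto
  show ?thesis
  proof (intro exI[of _ K] conjI K allI impI)
   fix A :: "real => real => 'v" and D dd
   assume A: "cont2 T A" and diag: "\<forall>s\<in>{0..T}. A s s = 0"
    and nA: "besov2_norm (\<beta> * \<alpha>) (p / ennreal \<beta>) (q / ennreal \<beta>) T A <= ennreal \<rho>"
    and D: "cell_bound p D dd" and dd: "admissible \<alpha> L dd"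
    and defect: "\<forall>n i s u t. 1 <= n --> i < 2 ^ n --> dpt T n i <= s --> s <= u --> u <= t --> t <= dpt T n (Suc i) -->
     norm (A s t - A s u - A u t) <= D n i powr \<beta>"
   obtain x :: "nat => real" where x: "\<forall>n\<ge>1. 0 <= x n \<and> (\<forall>h\<in>{0..T / 2 ^ n}. Lp (p / ennreal \<beta>) T A h <= ennreal (x n))"
    "admissible \<alpha> K0 (%n. x n powr (1 / \<beta>))" using disc[OF nA] by blast
   \<comment> \<open>The shift is due to the links, which at generation \<open>n\<close> use the lag
     \<open>T / 2 ^ Suc n\<close>; adding the defects lets one sequence carry both
     contributions.\<close>
   define z where "z n = x (Suc n) powr (1 / \<beta>) + dd n" for n
   have z: "admissible \<alpha> (8 * (K0 + L)) z"
    unfolding z_def by (rule admissible_add[OF admissible_shift[OF x(2)] dd]) (use al in simp)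
   note cz = conv[OF z]
   interpret chaining T A "%n i. D n i powr \<beta>" r
    by standard (use T A diag r defect in auto)
   let ?S' = "%m. 2 powr ((1 + e) * real m) * z m powr P"
   define S where "S = (%m. 2 powr ((1 + e) * real m) * (x (Suc m) powr r + (dd m powr \<beta>) powr r))"
   have S0: "0 <= S m" for m by (simp add: S_def)
   have Sle: "S m <= 2 * ?S' m" if m: "1 <= m" for m
   proof -
    have nn: "0 <= x (Suc m) powr (1 / \<beta>)" "0 <= dd m" using dd m by (auto simp: admissible_def)
    have x0: "0 <= x (Suc m)" using x(1) by simp
    have "x (Suc m) powr r = (x (Suc m) powr (1 / \<beta>)) powr P" by (simp add: powr_powr r_def)
    also have "\<dots> <= z m powr P" unfolding z_def using nn P by (intro powr_mono2) auto
    finally have 1: "x (Suc m) powr r <= z m powr P" .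
    have "(dd m powr \<beta>) powr r = dd m powr P" using b0 by (simp add: powr_powr r_def)
    also have "\<dots> <= z m powr P" unfolding z_def using nn P by (intro powr_mono2) auto
    finally have "x (Suc m) powr r + (dd m powr \<beta>) powr r <= 2 * z m powr P" using 1 by simp
    from mult_left_mono[OF this, of "2 powr ((1 + e) * real m)"] show ?thesis by (simp add: S_def mult_ac)
   qed
   have sS: "summable S"
    by (rule summable_comparison_test'[OF summable_mult[OF conjunct1[OF cz], of 2], of 1]) (use Sle S0 in auto)
   have tail: "summable (%k. f (n + k))" if "summable f" for f :: "nat => real" and n
    using summable_ignore_initial_segment[OF that, of n] by (simp add: add.commute)
   define v where "v n = (C * 2 powr (- (1 + e) * n) * (\<Sum>k. ?S' (n + k))) powr (1 / P)" for n :: nat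
   have "cell_bound p (%n i. cellsup T A n i powr (1 / \<beta>)) v"
    unfolding cell_bound_def if_not_P[OF False] P_def[symmetric]
   proof (intro allI impI conjI)
    fix n :: nat assume n: "1 <= n"
    show "0 <= v n" by (simp add: v_def)
    have "(\<Sum>i<2 ^ n. (cellsup T A n i powr (1 / \<beta>)) powr P) = (\<Sum>i<2 ^ n. cellsup T A n i powr r)"
     by (simp add: powr_powr r_def)
    also have "\<dots> <= (3 / (1 - 2 powr (- e / max 1 r))) powr max 1 r * (2 powr max 1 r * (2 powr max 1 r * 2 / T + 1)) * 2 powr (- e * n) * (\<Sum>k. S (n + k))"
    proof (rule cellsup_sum[OF e _ _ S_def sS n])
     fix m :: nat assume m: "1 <= m"
     have "Lp (p / ennreal \<beta>) T A (T / 2 ^ m) <= ennreal (x m)" "0 <= x m" using x(1) m T by auto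
     then show "integral {0..T - T / 2 ^ m} (%s. norm (A s (s + T / 2 ^ m)) powr r) <= x m powr r"
      using Lp_le_iff[OF A _ pb, of "T / 2 ^ m" "x m"] T r by (simp add: pr)
     have "(\<Sum>i<2 ^ m. (D m i powr \<beta>) powr r) = (\<Sum>i<2 ^ m. D m i powr P)"
      using b0 by (simp add: powr_powr r_def)
     also have "\<dots> <= 2 ^ m * dd m powr P" using cell_bound_finiteD[OF D False m] by (simp add: P_def)
     also have "dd m powr P = (dd m powr \<beta>) powr r" using b0 by (simp add: powr_powr r_def)
     finally show "(\<Sum>i<2 ^ m. (D m i powr \<beta>) powr r) <= 2 ^ m * (dd m powr \<beta>) powr r" .
    qed
    also have "\<dots> <= (3 / (1 - 2 powr (- e / max 1 r))) powr max 1 r * (2 powr max 1 r * (2 powr max 1 r * 2 / T + 1)) * 2 powr (- e * n) * (\<Sum>k. 2 * ?S' (n + k))"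
     using n T by (intro mult_left_mono suminf_le Sle tail sS summable_mult conjunct1[OF cz]) auto
    also have "(\<Sum>k. 2 * ?S' (n + k)) = 2 * (\<Sum>k. ?S' (n + k))"
     by (rule suminf_mult) (rule tail[OF conjunct1[OF cz]])
    also have "(3 / (1 - 2 powr (- e / max 1 r))) powr max 1 r * (2 powr max 1 r * (2 powr max 1 r * 2 / T + 1)) * 2 powr (- e * n) * (2 * (\<Sum>k. ?S' (n + k)))
      = C * (2 powr (- e * n) * (\<Sum>k. ?S' (n + k)))" by (simp add: C_def mult_ac)
    also have "\<dots> = 2 ^ n * (C * 2 powr (- (1 + e) * n) * (\<Sum>k. ?S' (n + k)))"
    proof -
     have "- e * n = real n + - (1 + e) * n" by (simp add: algebra_simps)
     then have "2 powr (- e * n) = 2 ^ n * 2 powr (- (1 + e) * n)"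
      by (simp only: powr_add) (simp add: powr_realpow)
     then show ?thesis by simp
    qed
    also have "C * 2 powr (- (1 + e) * n) * (\<Sum>k. ?S' (n + k)) = v n powr P"
    proof -
     have "0 <= (\<Sum>k. ?S' (n + k))" by (intro suminf_nonneg tail[OF conjunct1[OF cz]]) simp
     then have nn: "0 <= C * 2 powr (- (1 + e) * n) * (\<Sum>k. ?S' (n + k))" using C by simp
     have "1 / P * P = 1" using P by simp
     then show ?thesis by (simp only: v_def powr_powr powr_one[OF nn])
    qed
    finally show "(\<Sum>i<2 ^ n. (cellsup T A n i powr (1 / \<beta>)) powr P) <= 2 ^ n * v n powr P" .
   qed simp
   moreover have "admissible \<alpha> K v" unfolding v_def[abs_def] by (rule conjunct2[OF cz])
   ultimately show "\<exists>v. admissible \<alpha> K v \<and> cell_bound p (%n i. cellsup T A n i powr (1 / \<beta>)) v" by blast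
  qed
 qed
qed

section \<open>From cell bounds back to Lebesgue norms\<close>

text \<open>Neighbouring cells are included because a pair of points with a short lag may straddle a
  grid point.\<close>

definition cell_dominated :: "real => (real => real => 'v::real_normed_vector) => (nat => nat => real) => nat => bool" where
 "cell_dominated T A V n \<longleftrightarrow> (\<forall>i j s t. i < 2 ^ n --> j < 2 ^ n --> j = i \<or> j = Suc i -->
   dpt T n i <= s --> s <= dpt T n (Suc i) --> dpt T n j <= t --> t <= dpt T n (Suc j) --> s <= t -->
   norm (A s t) <= V n i + V n j)"

lemma cell_dominatedD:
 assumes "cell_dominated T A V n" "i < 2 ^ n" "j < 2 ^ n" "j = i \<or> j = Suc i"
  "dpt T n i <= s" "s <= dpt T n (Suc i)" "dpt T n j <= t" "t <= dpt T n (Suc j)" "s <= t"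
 shows "norm (A s t) <= V n i + V n j"
 using assms unfolding cell_dominated_def by blast

text \<open>Integrate over the cell in which the slice starts; every cell is charged for itself and
  for its right neighbour.\<close>

lemma cell_Lp:
 assumes T: "0 < T" and A: "cont2 T A" and p: "0 < p" and V: "cell_bound p V v" and n: "1 <= n"
  and h: "0 <= h" "h <= T / 2 ^ n" and dom: "cell_dominated T A V n"
 shows "Lp p T A h <= ennreal (4 * (2 * T) powr inv_exp p * v n)"
proof -
 have v0: "0 <= v n" by (rule cell_bound_nonneg(1)[OF V n])
 have V0: "0 <= V n i" if "i < 2 ^ n" for i by (rule cell_bound_nonneg(2)[OF V n that])
 have hT: "h <= T"
 proof -
  have "T / 2 ^ n <= T" using T by (simp add: divide_le_eq)
  then show ?thesis using h by simp
 qed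
 have c0: "0 <= 4 * (2 * T) powr inv_exp p * v n" using v0 by simp
 show ?thesis unfolding Lp_le_iff[OF A h(1) p c0]
 proof (cases "p = \<infinity>")
  case True
  have "norm (A s (s + h)) <= 4 * v n" if s: "s \<in> {0..T - h}" for s
  proof -
   have st: "0 <= s" "s <= s + h" "s + h <= T" "s + h - s <= T / 2 ^ n" using s h by auto
   obtain i j where ij: "i < 2 ^ n" "j < 2 ^ n" "j = i \<or> j = Suc i" "dpt T n i <= s" "s <= dpt T n (Suc i)"
    "dpt T n j <= s + h" "s + h <= dpt T n (Suc j)"
    by (rule adjacent_cells[OF T st])
   have "norm (A s (s + h)) <= V n i + V n j" by (rule cell_dominatedD[OF dom ij st(2)])
   moreover have "V n i <= v n" "V n j <= v n" using cell_bound_infD[of V v n] V True n ij by auto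
   ultimately show ?thesis using v0 by simp
  qed
  then show "if p = \<infinity> then \<forall>s\<in>{0..T - h}. norm (A s (s + h)) <= 4 * (2 * T) powr inv_exp p * v n
   else integral {0..T - h} (%s. norm (A s (s + h)) powr enn2real p) <= (4 * (2 * T) powr inv_exp p * v n) powr enn2real p"
   using True T by (simp add: inv_exp_def)
 next
  case False
  define P where "P = enn2real p"
  have P: "0 < P" unfolding P_def by (rule enn2real_pos[OF p False])
  \<comment> \<open>Zero beyond the last cell, which then needs no separate treatment.\<close>
  define V' where "V' i = (if i < 2 ^ n then V n i else 0)" for i
  have V'0: "0 <= V' i" for i using V0 by (simp add: V'_def)
  \<comment> \<open>Cutting the second argument at \<open>T\<close> extends the integrand
    continuously to the whole interval, so that it can be split into cells.\<close>
  define \<phi> where "\<phi> s = norm (A s (min (s + h) T)) powr P" for s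
  have c\<phi>: "continuous_on {0..T} \<phi>"
  proof -
   have "continuous_on {0..T} (%s. (%(s, t). A s t) (s, min (s + h) T))"
    by (rule continuous_on_compose2[OF A]) (use h in \<open>auto intro!: continuous_intros simp: simplex2_def\<close>)
   then show ?thesis unfolding \<phi>_def using P by (intro continuous_on_powr' continuous_intros) auto
  qed
  have "integral {0..T - h} (%s. norm (A s (s + h)) powr P) = integral {0..T - h} \<phi>"
   by (rule integral_cong) (simp add: \<phi>_def)
  also have "\<dots> <= integral {0..T} \<phi>"
  proof (rule integral_subset_le)
   show "\<phi> integrable_on {0..T - h}" "\<phi> integrable_on {0..T}"
    using h by (auto intro!: integrable_continuous_interval continuous_on_subset[OF c\<phi>])
  qed (use h in \<open>auto simp: \<phi>_def\<close>)
  also have "\<dots> = (\<Sum>i<2 ^ n. integral {dpt T n i..dpt T n (Suc i)} \<phi>)"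
   using integral_dyadic_cells[OF T, of n "2 ^ n" \<phi>] c\<phi> by simp
  also have "\<dots> <= (\<Sum>i<2 ^ n. T / 2 ^ n * (2 powr P * ((2 * V n i) powr P + V' (Suc i) powr P)))"
  proof (rule sum_mono)
   fix i :: nat assume "i \<in> {..<2 ^ n}"
   then have i: "i < 2 ^ n" by simp
   note bd = dpt_cell_bounds[OF T i]
   have "integral {dpt T n i..dpt T n (Suc i)} \<phi> <= integral {dpt T n i..dpt T n (Suc i)} (%_. 2 powr P * ((2 * V n i) powr P + V' (Suc i) powr P))"
   proof (rule integral_le)
    fix s assume s: "s \<in> {dpt T n i..dpt T n (Suc i)}"
    define t where "t = min (s + h) T"
    have t: "s <= t" "t <= T" "t <= dpt T n (Suc i) + T / 2 ^ n" using s bd h by (auto simp: t_def)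
    have "norm (A s t) <= 2 * V n i + V' (Suc i)"
    proof (cases "t <= dpt T n (Suc i)")
     case True
     have "norm (A s t) <= V n i + V n i"
      by (rule cell_dominatedD[OF dom i i]) (use s t True in auto)
     then show ?thesis using V'0[of "Suc i"] by simp
    next
     case False
     then have "dpt T n (Suc i) < T" using t(2) by simp
     then have "Suc i \<noteq> 2 ^ n" by auto
     then have Si: "Suc i < 2 ^ n" using i by simp
     have "norm (A s t) <= V n i + V n (Suc i)"
      by (rule cell_dominatedD[OF dom i Si]) (use s t False in \<open>auto simp: dpt_Suc\<close>)
     then show ?thesis using V0[OF i] Si by (simp add: V'_def)
    qed
    then have "\<phi> s <= (2 * V n i + V' (Suc i)) powr P"
     unfolding \<phi>_def t_def[symmetric] using P by (intro powr_mono2) auto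
    also have "\<dots> <= 2 powr P * ((2 * V n i) powr P + V' (Suc i) powr P)"
     using V0[OF i] V'0 P by (intro powr_add_le) auto
    finally show "\<phi> s <= 2 powr P * ((2 * V n i) powr P + V' (Suc i) powr P)" .
   qed (use bd in \<open>auto intro!: integrable_continuous_interval continuous_on_subset[OF c\<phi>]\<close>)
   also have "\<dots> = T / 2 ^ n * (2 powr P * ((2 * V n i) powr P + V' (Suc i) powr P))"
    using T by (simp add: dpt_Suc)
   finally show "integral {dpt T n i..dpt T n (Suc i)} \<phi> <= T / 2 ^ n * (2 powr P * ((2 * V n i) powr P + V' (Suc i) powr P))" .
  qed
  also have "\<dots> = T / 2 ^ n * (2 powr P * (2 powr P * (\<Sum>i<2 ^ n. V n i powr P) + (\<Sum>i<2 ^ n. V' (Suc i) powr P)))"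
   by (simp only: sum_distrib_left[symmetric] sum.distrib powr_mult)
  also have "\<dots> <= T / 2 ^ n * (2 powr P * (2 powr P * (2 ^ n * v n powr P) + 2 powr P * (2 ^ n * v n powr P)))"
  proof -
   have a: "(\<Sum>i<2 ^ n. V n i powr P) <= 2 ^ n * v n powr P"
    using cell_bound_finiteD[OF V False n] by (simp add: P_def)
   have "(\<Sum>i<2 ^ n. V' (Suc i) powr P) = (\<Sum>i\<in>{1..2 ^ n}. V' i powr P)"
    by (rule sum.reindex_bij_witness[of _ "%i. i - 1" Suc]) auto
   also have "\<dots> <= (\<Sum>i\<in>insert (2 ^ n) {..<2 ^ n}. V' i powr P)" by (intro sum_mono2) auto
   also have "\<dots> = (\<Sum>i<2 ^ n. V n i powr P)" using P by (simp add: V'_def)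
   finally have b: "(\<Sum>i<2 ^ n. V' (Suc i) powr P) <= 2 ^ n * v n powr P" using a by simp
   have "1 <= 2 powr P" using P by (simp add: ge_one_powr_ge_zero)
   then have h1: "1 * (2 ^ n * v n powr P) <= 2 powr P * (2 ^ n * v n powr P)" by (intro mult_right_mono) auto
   have b': "(\<Sum>i<2 ^ n. V' (Suc i) powr P) <= 2 powr P * (2 ^ n * v n powr P)" using b h1 by linarith
   show ?thesis using T by (intro mult_left_mono add_mono a b') auto
  qed
  also have "\<dots> = (4 * (2 * T) powr inv_exp p * v n) powr P"
  proof -
   have "(4::real) = 2 * 2" by simp
   then have "(4::real) powr P = 2 powr P * 2 powr P" by (simp only: powr_mult)
   moreover have "((2 * T) powr inv_exp p) powr P = 2 * T" using False P T by (simp add: inv_exp_def P_def powr_powr)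
   ultimately have "(4 * (2 * T) powr inv_exp p * v n) powr P = 2 powr P * 2 powr P * (2 * T) * v n powr P"
    by (simp only: powr_mult)
   then show ?thesis by simp
  qed
  finally show "if p = \<infinity> then \<forall>s\<in>{0..T - h}. norm (A s (s + h)) <= 4 * (2 * T) powr inv_exp p * v n
   else integral {0..T - h} (%s. norm (A s (s + h)) powr enn2real p) <= (4 * (2 * T) powr inv_exp p * v n) powr enn2real p"
   using False by (simp add: P_def)
 qed
qed

lemma Lp_zero:
 assumes A: "cont2 T A" and p: "0 < p" and diag: "\<And>s. 0 <= s ==> s <= T ==> A s s = 0"
 shows "Lp p T A 0 = 0"
proof -
 have "integral {0..T} (%s. norm (A s s) powr enn2real p) = integral {0..T} (%s. 0)"
  by (rule integral_cong) (simp add: diag)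
 then have "Lp p T A 0 <= ennreal 0"
  using diag by (subst Lp_le_iff[OF A order_refl p order_refl]) auto
 then show ?thesis by simp
qed

text \<open>The finest generation whose cells are still at least as long as \<open>h\<close>, found
  as the least \<open>m\<close> with \<open>T / 2 ^ Suc m < h\<close>.\<close>

lemma dyadic_scale:
 fixes T h :: real
 assumes "0 < T" "0 < h" "h <= T / 2 ^ n0"
 obtains n where "n0 <= n" "T / 2 ^ Suc n < h" "h <= T / 2 ^ n"
proof -
 obtain k where k: "(1 / 2) ^ k < h / T" using real_arch_pow_inv[of "h / T" "1 / 2"] assms by auto
 have *: "T / 2 ^ k < h" using k assms by (simp add: field_simps power_divide)
 define n where "n = (LEAST m. T / 2 ^ Suc m < h)"
 have ex: "T / 2 ^ Suc k < h"
 proof -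
  have "T / 2 ^ Suc k <= T / 2 ^ k" using assms by (intro divide_left_mono) auto
  then show ?thesis using * by simp
 qed
 have n1: "T / 2 ^ Suc n < h" unfolding n_def by (rule LeastI[of _ k]) (rule ex)
 have n2: "h <= T / 2 ^ Suc m" if "m < n" for m
  using not_less_Least[OF that[unfolded n_def]] by simp
 have n0: "n0 <= n"
 proof (rule ccontr)
  assume "\<not> n0 <= n"
  then have "T / 2 ^ n0 <= T / 2 ^ Suc n" using assms by (intro divide_left_mono power_increasing) auto
  then show False using n1 assms by simp
 qed
 have "h <= T / 2 ^ n"
 proof (cases "n = n0")
  case True
  then show ?thesis using assms by simp
 next
  case False
  then have "n - 1 < n" "Suc (n - 1) = n" using n0 by auto
  then show ?thesis using n2[of "n - 1"] by simp
 qed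
 then show thesis using that n0 n1 by blast
qed

text \<open>Lags up to \<open>T / 2 ^ n0\<close> are matched with a dyadic scale. Longer ones are
  bounded by the supremum \<open>M\<close>, and \<open>(2 ^ n0 / T * h) powr \<gamma> >= 1\<close>
  brings that bound into the same form.\<close>

lemma cell_power_Lp:
 assumes T: "0 < T" and A: "cont2 T A" and p: "0 < p" and V: "cell_bound p V v" and n0: "1 <= n0"
  and dom: "\<And>n. n0 <= n ==> cell_dominated T A V n" and v: "\<And>n. n0 <= n ==> v n <= K * 2 powr (- \<gamma> * n)"
  and diag: "\<And>s. 0 <= s ==> s <= T ==> A s s = 0" and g: "0 <= \<gamma>" and K: "0 <= K"
  and M: "0 <= M" "\<And>s t. 0 <= s ==> s <= t ==> t <= T ==> norm (A s t) <= M"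
  and h: "h \<in> {0..T}"
 shows "Lp p T A h <= ennreal ((4 * (2 * T) powr inv_exp p * K * (2 / T) powr \<gamma> + M * T powr inv_exp p * (2 ^ n0 / T) powr \<gamma>) * h powr \<gamma>)"
  (is "_ <= ennreal ((?a + ?b) * _)")
proof -
 have ab: "0 <= ?a" "0 <= ?b" using K M by auto
 consider "h = 0" | "0 < h" "h <= T / 2 ^ n0" | "T / 2 ^ n0 < h" using h by fastforce
 then show ?thesis
 proof cases
  case 1
  then show ?thesis using Lp_zero[OF A p diag] by simp
 next
  case 2
  then obtain n where n: "n0 <= n" "T / 2 ^ Suc n < h" "h <= T / 2 ^ n" using dyadic_scale[OF T] by blast
  have n1: "1 <= n" using n n0 by simp
  have "Lp p T A h <= ennreal (4 * (2 * T) powr inv_exp p * v n)"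
   using 2 n by (intro cell_Lp[OF T A p V n1 _ _ dom]) auto
  also have "\<dots> <= ennreal ((?a + ?b) * h powr \<gamma>)"
  proof (rule ennreal_leI)
   have "2 powr (- \<gamma> * n) = (2 / T) powr \<gamma> * (T / 2 ^ Suc n) powr \<gamma>"
   proof -
    have "2 powr (- \<gamma> * n) = (2 powr (- real n)) powr \<gamma>" by (simp add: powr_powr mult.commute)
    also have "2 powr (- real n) = 2 / T * (T / 2 ^ Suc n)"
     using T by (simp add: powr_minus powr_realpow field_simps)
    finally show ?thesis by (simp only: powr_mult)
   qed
   also have "\<dots> <= (2 / T) powr \<gamma> * h powr \<gamma>"
    using n(2) T g by (intro mult_left_mono powr_mono2) auto
   finally have "v n <= K * ((2 / T) powr \<gamma> * h powr \<gamma>)"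
    using v[OF n(1)] mult_left_mono[OF _ K] order_trans by blast
   then have "4 * (2 * T) powr inv_exp p * v n <= 4 * (2 * T) powr inv_exp p * (K * ((2 / T) powr \<gamma> * h powr \<gamma>))"
    by (intro mult_left_mono) auto
   also have "\<dots> = ?a * h powr \<gamma>" by simp
   also have "\<dots> <= (?a + ?b) * h powr \<gamma>" using ab by (intro mult_right_mono) auto
   finally show "4 * (2 * T) powr inv_exp p * v n <= (?a + ?b) * h powr \<gamma>" .
  qed
  finally show ?thesis .
 next
  case 3
  have "Lp p T A h <= ennreal (M * T powr inv_exp p)"
   using h by (intro Lp_le_bound[OF T A _ _ p M]) auto
  also have "\<dots> <= ennreal ((?a + ?b) * h powr \<gamma>)"
  proof (rule ennreal_leI)
   have "1 <= 2 ^ n0 / T * h" using 3 T by (simp add: field_simps)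
   then have "1 <= (2 ^ n0 / T * h) powr \<gamma>" using g by (rule ge_one_powr_ge_zero)
   then have "M * T powr inv_exp p * 1 <= M * T powr inv_exp p * (2 ^ n0 / T * h) powr \<gamma>"
    using M by (intro mult_left_mono) auto
   also have "\<dots> = ?b * h powr \<gamma>" by (simp only: powr_mult mult.assoc)
   also have "\<dots> <= (?a + ?b) * h powr \<gamma>" using ab by (intro mult_right_mono) auto
   finally show "M * T powr inv_exp p <= (?a + ?b) * h powr \<gamma>" by simp
  qed
  finally show ?thesis .
 qed
qed

text \<open>At \<alpha> = 1/3 this takes the place of a bound by a power of \<open>h\<close> with
  exponent above 1.\<close>

lemma cell_little_o_Lp:
 assumes T: "0 < T" and A: "cont2 T A" and p: "0 < p" and V: "cell_bound p V v" and n0: "1 <= n0"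
  and dom: "\<And>n. n0 <= n ==> cell_dominated T A V n" and v: "(%n. 2 ^ n * v n) \<longlonglongrightarrow> 0"
  and diag: "\<And>s. 0 <= s ==> s <= T ==> A s s = 0" and e: "0 < \<epsilon>"
 shows "\<exists>\<eta>>0. \<forall>h. 0 <= h \<and> h <= \<eta> --> Lp p T A h <= ennreal (\<epsilon> * h)"
proof -
 define \<epsilon>' where "\<epsilon>' = \<epsilon> * T / (8 * (2 * T) powr inv_exp p)"
 have e': "0 < \<epsilon>'" using e T by (simp add: \<epsilon>'_def)
 obtain n1 where n1: "\<And>n. n1 <= n ==> 2 ^ n * v n < \<epsilon>'"
  using order_tendstoD(2)[OF v e'] by (auto simp: eventually_sequentially)
 define n2 where "n2 = max n0 n1"
 show ?thesis
 proof (intro exI[of _ "T / 2 ^ n2"] conjI allI impI)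
  show "0 < T / 2 ^ n2" using T by simp
  fix h assume h: "0 <= h \<and> h <= T / 2 ^ n2"
  show "Lp p T A h <= ennreal (\<epsilon> * h)"
  proof (cases "h = 0")
   case True
   then show ?thesis using Lp_zero[OF A p diag] by simp
  next
   case False
   then have "0 < h" "h <= T / 2 ^ n2" using h by auto
   then obtain n where n: "n2 <= n" "T / 2 ^ Suc n < h" "h <= T / 2 ^ n" using dyadic_scale[OF T] by blast
   then have nn: "n0 <= n" "n1 <= n" by (auto simp: n2_def)
   have "Lp p T A h <= ennreal (4 * (2 * T) powr inv_exp p * v n)"
    using h n nn n0 by (intro cell_Lp[OF T A p V _ _ _ dom]) auto
   also have "\<dots> <= ennreal (\<epsilon> * h)"
   proof (rule ennreal_leI)
    have "v n <= \<epsilon>' / 2 ^ n" using n1[OF nn(2)] by (simp add: field_simps)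
    then have "4 * (2 * T) powr inv_exp p * v n <= 4 * (2 * T) powr inv_exp p * (\<epsilon>' / 2 ^ n)"
     by (intro mult_left_mono) auto
    also have "\<dots> = \<epsilon> * (T / 2 ^ Suc n)" using T by (simp add: \<epsilon>'_def)
    also have "\<dots> <= \<epsilon> * h" by (rule mult_left_mono) (use n(2) e in auto)
    finally show "4 * (2 * T) powr inv_exp p * v n <= \<epsilon> * h" .
   qed
   finally show ?thesis .
  qed
 qed
qed

section \<open>Sums over partitions\<close>

definition partition_sum :: "(real => real => 'v::real_normed_vector) => nat => (nat => real) => real => real => 'v" where
 "partition_sum A N \<tau> s t = (\<Sum>i<N. A (s + \<tau> i * (t - s)) (s + \<tau> (Suc i) * (t - s)))"

lemma unit_partition_bounds:
 assumes "unit_partition N \<tau>" "i < N"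
 shows "0 <= \<tau> i" "\<tau> i < \<tau> (Suc i)" "\<tau> (Suc i) <= 1"
proof -
 have step: "\<tau> k < \<tau> (Suc k)" if "k < N" for k using assms that by (auto simp: unit_partition_def)
 have mono: "\<tau> a <= \<tau> b" if "a <= b" "b <= N" for a b
  using that
 proof (induction b rule: dec_induct)
  case (step n)
  then show ?case using \<open>\<And>k. k < N ==> \<tau> k < \<tau> (Suc k)\<close>[of n] by simp
 qed simp
 have e: "\<tau> 0 = 0" "\<tau> N = 1" using assms by (auto simp: unit_partition_def)
 show "0 <= \<tau> i" using mono[of 0 i] assms e by simp
 show "\<tau> i < \<tau> (Suc i)" by (rule step[OF assms(2)])
 show "\<tau> (Suc i) <= 1" using mono[of "Suc i" N] assms e by simp
qed

lemma unit_partition_sum: "unit_partition N \<tau> ==> (\<Sum>i<N. \<tau> (Suc i) - \<tau> i) = 1"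
 by (simp add: sum_lessThan_telescope unit_partition_def)

lemma partition_sum_cont2:
 assumes A: "cont2 T A" and \<tau>: "unit_partition N \<tau>"
 shows "cont2 T (partition_sum A N \<tau>)"
proof -
 have "continuous_on (simplex2 T) (%z. (%(s, t). A s t) (fst z + \<tau> i * (snd z - fst z), fst z + \<tau> (Suc i) * (snd z - fst z)))"
  if i: "i < N" for i
 proof (rule continuous_on_compose2[OF A])
  note b = unit_partition_bounds[OF \<tau> i]
  have "s + \<tau> (Suc i) * (t - s) <= T" "s + \<tau> i * (t - s) <= s + \<tau> (Suc i) * (t - s)" "0 <= s + \<tau> i * (t - s)"
   if "0 <= s" "s <= t" "t <= T" for s t
  proof -
   have "\<tau> (Suc i) * (t - s) <= 1 * (t - s)" using b that by (intro mult_right_mono) auto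
   then show "s + \<tau> (Suc i) * (t - s) <= T" using that by simp
   show "s + \<tau> i * (t - s) <= s + \<tau> (Suc i) * (t - s)" using b that by (simp add: mult_right_mono)
   show "0 <= s + \<tau> i * (t - s)" using b that by simp
  qed
  then show "(%z. (fst z + \<tau> i * (snd z - fst z), fst z + \<tau> (Suc i) * (snd z - fst z))) ` simplex2 T \<subseteq> simplex2 T"
   by (auto simp: simplex2_def)
 qed (intro continuous_intros)
 then show ?thesis unfolding partition_sum_def case_prod_beta' by (intro continuous_on_sum) auto
qed

text \<open>The summands are translated slices at the lags \<open>\<theta> i * h\<close>. For
  \<open>p >= 1\<close>, Jensen with the weights \<open>\<theta> i\<close> of total mass 1 asks for
  a bound linear in \<open>\<theta> i\<close>; for \<open>p < 1\<close>, subadditivity of the power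
  asks for \<open>\<theta> i powr (1 / p)\<close>. This is the origin of the exponent
  \<open>max 1 (inv_exp p)\<close>.\<close>

lemma partition_sum_Lp:
 assumes T: "0 < T" and A: "cont2 T A" and p: "0 < p" and \<tau>: "unit_partition N \<tau>" and h: "h \<in> {0..T}" and H: "0 <= H"
  and le: "\<And>i. i < N ==> Lp p T A ((\<tau> (Suc i) - \<tau> i) * h) <= ennreal ((\<tau> (Suc i) - \<tau> i) powr max 1 (inv_exp p) * H)"
 shows "Lp p T (partition_sum A N \<tau>) h <= ennreal H"
proof -
 define \<theta> where "\<theta> i = \<tau> (Suc i) - \<tau> i" for i
 define \<kappa> where "\<kappa> = max 1 (inv_exp p)"
 have \<theta>: "0 < \<theta> i" "\<theta> i * h <= h" "\<tau> i * h + \<theta> i * h <= h" "0 <= \<tau> i * h" if "i < N" for i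
 proof -
  note b = unit_partition_bounds[OF \<tau> that]
  show "0 < \<theta> i" using b by (simp add: \<theta>_def)
  have "\<tau> (Suc i) * h <= 1 * h" using b h by (intro mult_right_mono) auto
  then show "\<tau> i * h + \<theta> i * h <= h" by (simp add: \<theta>_def algebra_simps)
  moreover show "0 <= \<tau> i * h" using b h by simp
  ultimately show "\<theta> i * h <= h" by simp
 qed
 have h0: "0 <= h" using h by simp
 have \<theta>1: "(\<Sum>i<N. \<theta> i) = 1" unfolding \<theta>_def by (rule unit_partition_sum[OF \<tau>])
 note leD = le[folded \<theta>_def \<kappa>_def]
 have c0: "0 <= \<theta> i powr \<kappa> * H" for i using H by simp
 have th0: "0 <= \<theta> i * h" if "i < N" for i using \<theta>[OF that] h0 by simp
 have eq: "partition_sum A N \<tau> s (s + h) = (\<Sum>i<N. A (s + \<tau> i * h) ((s + \<tau> i * h) + \<theta> i * h))" for s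
  by (simp add: partition_sum_def \<theta>_def algebra_simps)
 note cS = partition_sum_cont2[OF A \<tau>]
 show ?thesis unfolding Lp_le_iff[OF cS h0 p H]
 proof (cases "p = \<infinity>")
  case True
  have "norm (partition_sum A N \<tau> s (s + h)) <= H" if s: "s \<in> {0..T - h}" for s
  proof -
   have "norm (partition_sum A N \<tau> s (s + h)) <= (\<Sum>i<N. norm (A (s + \<tau> i * h) ((s + \<tau> i * h) + \<theta> i * h)))"
    unfolding eq by (rule norm_sum)
   also have "\<dots> <= (\<Sum>i<N. \<theta> i * H)"
   proof (rule sum_mono)
    fix i assume "i \<in> {..<N}"
    then have i: "i < N" by simp
    have "\<forall>s\<in>{0..T - \<theta> i * h}. norm (A s (s + \<theta> i * h)) <= \<theta> i powr \<kappa> * H"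
     using leD[OF i] Lp_le_iff[OF A th0[OF i] p c0] True by simp
    moreover have "s + \<tau> i * h \<in> {0..T - \<theta> i * h}" using s \<theta>[OF i] by auto
    ultimately show "norm (A (s + \<tau> i * h) ((s + \<tau> i * h) + \<theta> i * h)) <= \<theta> i * H"
     using \<theta>(1)[OF i] True by (auto simp: \<kappa>_def inv_exp_def)
   qed
   also have "\<dots> = H" by (simp add: sum_distrib_right[symmetric] \<theta>1)
   finally show ?thesis .
  qed
  then show "if p = \<infinity> then \<forall>s\<in>{0..T - h}. norm (partition_sum A N \<tau> s (s + h)) <= H
   else integral {0..T - h} (%s. norm (partition_sum A N \<tau> s (s + h)) powr enn2real p) <= H powr enn2real p"
   using True by simp
 next
  case False
  define r where "r = enn2real p"
  have r: "0 < r" unfolding r_def by (rule enn2real_pos[OF p False])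
  have \<kappa>r: "\<kappa> = max 1 (1 / r)" using False by (simp add: \<kappa>_def inv_exp_def r_def)
  let ?g = "%i s. norm (A (s + \<tau> i * h) ((s + \<tau> i * h) + \<theta> i * h))"
  have cA: "continuous_on {0..T - \<theta> i * h} (%s. norm (A s (s + \<theta> i * h)) powr r)" if "i < N" for i
   by (rule continuous_norm_powr_slice[OF A th0[OF that] r])
  have cg: "continuous_on {0..T - h} (%s. ?g i s powr r)" if i: "i < N" for i
   by (rule continuous_on_compose2[OF cA[OF i]]) (use \<theta>[OF i] in \<open>auto intro!: continuous_intros\<close>)
  have Ig: "integral {0..T - h} (%s. ?g i s powr r) <= (\<theta> i powr \<kappa> * H) powr r" if i: "i < N" for i
  proof -
   have "integral {0..T - h} (%s. ?g i s powr r) = integral {\<tau> i * h..T - h + \<tau> i * h} (%s. norm (A s (s + \<theta> i * h)) powr r)"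
    using integral_shift_Icc_real[of 0 "T - h" "%s. norm (A s (s + \<theta> i * h)) powr r" "\<tau> i * h"]
    by (simp add: o_def add.commute)
   also have "\<dots> <= integral {0..T - \<theta> i * h} (%s. norm (A s (s + \<theta> i * h)) powr r)"
    using \<theta>[OF i]
    by (intro integral_subset_le integrable_continuous_interval cA[OF i] continuous_on_subset[OF cA[OF i]]) auto
   also have "\<dots> <= (\<theta> i powr \<kappa> * H) powr r"
    using leD[OF i] Lp_le_iff[OF A th0[OF i] p c0] False by (simp add: r_def)
   finally show ?thesis .
  qed
  define wt where "wt i = (if 1 <= r then \<theta> i powr (1 - r) else 1)" for i
  have pt: "norm (partition_sum A N \<tau> s (s + h)) powr r <= (\<Sum>i<N. wt i * ?g i s powr r)" for s
  proof -
   have "norm (partition_sum A N \<tau> s (s + h)) powr r <= (\<Sum>i<N. ?g i s) powr r"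
    unfolding eq using r by (intro powr_mono2 norm_sum) auto
   also have "\<dots> <= (\<Sum>i<N. wt i * ?g i s powr r)"
   proof (cases "1 <= r")
    case True
    have "(\<Sum>i<N. ?g i s) powr r <= (\<Sum>i<N. \<theta> i) powr (r - 1) * (\<Sum>i<N. \<theta> i * (?g i s / \<theta> i) powr r)"
     using \<theta>(1) True by (intro powr_sum_weighted) (auto simp: less_imp_le less_imp_neq[THEN not_sym])
    also have "\<dots> = (\<Sum>i<N. wt i * ?g i s powr r)"
    proof -
     have "\<theta> i * (?g i s / \<theta> i) powr r = wt i * ?g i s powr r" if "i < N" for i
      using \<theta>(1)[OF that] True by (simp add: wt_def powr_divide powr_diff)
     then show ?thesis unfolding \<theta>1 by simp
    qed
    finally show ?thesis .
   next
    case False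
    then show ?thesis using r powr_sum_le_sum_powr[of "{..<N}" "%i. ?g i s" r] by (simp add: wt_def)
   qed
   finally show ?thesis .
  qed
  have "integral {0..T - h} (%s. norm (partition_sum A N \<tau> s (s + h)) powr r)
    <= integral {0..T - h} (%s. \<Sum>i<N. wt i * ?g i s powr r)"
   by (intro integral_le pt integrable_continuous_interval continuous_norm_powr_slice[OF cS h0 r]
     continuous_on_sum continuous_on_mult continuous_on_const cg) auto
  also have "\<dots> = (\<Sum>i<N. wt i * integral {0..T - h} (%s. ?g i s powr r))"
   by (subst integral_sum) (auto intro!: integrable_continuous_interval continuous_on_mult continuous_on_const cg)
  also have "\<dots> <= (\<Sum>i<N. \<theta> i * H powr r)"
  proof (rule sum_mono)
   fix i assume "i \<in> {..<N}"
   then have i: "i < N" by simp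
   have "wt i * integral {0..T - h} (%s. ?g i s powr r) <= wt i * (\<theta> i powr \<kappa> * H) powr r"
    by (intro mult_left_mono Ig i) (simp add: wt_def)
   also have "\<dots> = \<theta> i * H powr r"
   proof (cases "1 <= r")
    case True
    then have "\<kappa> = 1" using r by (simp add: \<kappa>r)
    then have "wt i * (\<theta> i powr \<kappa> * H) powr r = (\<theta> i powr (1 - r) * \<theta> i powr r) * H powr r"
     using True \<theta>(1)[OF i] by (simp add: wt_def powr_mult)
    also have "\<theta> i powr (1 - r) * \<theta> i powr r = \<theta> i" using \<theta>(1)[OF i] by (simp add: powr_add[symmetric])
    finally show ?thesis .
   next
    case False
    then have "\<kappa> = 1 / r" using r by (simp add: \<kappa>r max_def)
    then show ?thesis using False r \<theta>(1)[OF i] by (simp add: wt_def powr_mult powr_powr)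
   qed
   finally show "wt i * integral {0..T - h} (%s. ?g i s powr r) <= \<theta> i * H powr r" .
  qed
  also have "\<dots> = H powr r" by (simp add: sum_distrib_right[symmetric] \<theta>1)
  finally show "if p = \<infinity> then \<forall>s\<in>{0..T - h}. norm (partition_sum A N \<tau> s (s + h)) <= H
   else integral {0..T - h} (%s. norm (partition_sum A N \<tau> s (s + h)) powr enn2real p) <= H powr enn2real p"
   using False by (simp add: r_def)
 qed
qed

lemma besov2_norm_top_le:
 assumes L: "\<And>h. h \<in> {0..T} ==> Lp p T A h <= ennreal (\<omega> * h powr \<gamma>)" and w: "0 <= \<omega>" and g: "0 <= \<gamma>"
 shows "besov2_norm \<gamma> p \<infinity> T A <= ennreal \<omega>"
proof -
 have "ennreal (\<tau> powr - \<gamma>) * modulus p T A \<tau> <= ennreal \<omega>" if t: "0 < \<tau>" "\<tau> <= T" for \<tau>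
 proof -
  have "modulus p T A \<tau> <= ennreal (\<omega> * \<tau> powr \<gamma>)"
   unfolding modulus_def
  proof (rule SUP_least)
   fix h assume h: "h \<in> {0..\<tau>}"
   then have "Lp p T A h <= ennreal (\<omega> * h powr \<gamma>)" using t by (intro L) auto
   also have "\<dots> <= ennreal (\<omega> * \<tau> powr \<gamma>)"
    using h w g by (intro ennreal_leI mult_left_mono powr_mono2) auto
   finally show "Lp p T A h <= ennreal (\<omega> * \<tau> powr \<gamma>)" .
  qed
  then have "ennreal (\<tau> powr - \<gamma>) * modulus p T A \<tau> <= ennreal (\<tau> powr - \<gamma>) * ennreal (\<omega> * \<tau> powr \<gamma>)"
   by (rule mult_left_mono) simp
  also have "\<dots> = ennreal \<omega>" using w t by (simp add: ennreal_mult[symmetric] powr_minus)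
  finally show ?thesis .
 qed
 then show ?thesis unfolding besov2_norm_eq lp_norm_def by (auto intro!: SUP_least)
qed

lemma Lp_le_besov2_norm_top:
 assumes h: "0 <= h" "0 < \<tau>" "h <= \<tau>" "\<tau> <= T" and b: "besov2_norm \<gamma> p \<infinity> T A <= ennreal \<omega>" and w: "0 <= \<omega>"
 shows "Lp p T A h <= ennreal (\<omega> * \<tau> powr \<gamma>)"
proof -
 have "Lp p T A h <= modulus p T A \<tau>" unfolding modulus_def using h by (intro SUP_upper) auto
 moreover have "ennreal (\<tau> powr - \<gamma>) * modulus p T A \<tau> <= ennreal \<omega>"
  using b h unfolding besov2_norm_eq lp_norm_def by (simp add: SUP_le_iff)
 then have "ennreal (\<tau> powr \<gamma>) * (ennreal (\<tau> powr - \<gamma>) * modulus p T A \<tau>) <= ennreal (\<tau> powr \<gamma>) * ennreal \<omega>"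
  by (rule mult_left_mono) simp
 moreover have "ennreal (\<tau> powr \<gamma>) * ennreal (\<tau> powr - \<gamma>) = 1"
  using h by (simp add: ennreal_mult[symmetric] powr_minus)
 ultimately show ?thesis using w
  by (simp add: mult.assoc[symmetric] ennreal_mult mult.commute[of \<omega>])
qed

section \<open>Pointwise bounds from vanishing partition sums\<close>

definition dyadic_partition :: "nat => nat => real" where
 "dyadic_partition k i = real i / 2 ^ k"

lemma unit_partition_dyadic: "unit_partition (2 ^ k) (dyadic_partition k)"
 by (simp add: unit_partition_def dyadic_partition_def divide_strict_right_mono)

lemma mesh_dyadic: "mesh (2 ^ k) (dyadic_partition k) = 1 / 2 ^ k"
proof -
 have "(%i. dyadic_partition k (Suc i) - dyadic_partition k i) ` {..<2 ^ k} = (%i. 1 / 2 ^ k) ` {..<(2::nat) ^ k}"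
  by (intro image_cong) (simp_all add: dyadic_partition_def field_simps)
 also have "\<dots> = {1 / 2 ^ k}" by (subst image_constant_conv) (simp add: lessThan_empty_iff)
 finally show ?thesis unfolding mesh_def by (simp only: Max_singleton)
qed

lemma sum_pairs:
 fixes g :: "nat => 'a::comm_monoid_add"
 shows "(\<Sum>j<2 * m. g j) = (\<Sum>i<m. g (2 * i) + g (Suc (2 * i)))"
 by (induction m) (simp_all add: add.assoc)

text \<open>A converse of sewing: the partition sums of \<open>\<Xi>\<close> vanish only in an
  averaged norm, and a bound on each dyadic cell is to be extracted. The defect is bounded on pairs
  of neighbouring cells because refinements starting at an arbitrary point cross grid
  points.\<close>

locale vanishing_partition_sums =
 fixes T :: real and \<Xi> :: "real => real => 'v::real_normed_vector" and a :: "nat => nat => real" and p :: ennreal and \<gamma> :: real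
 assumes T: "0 < T" and cont: "cont2 T \<Xi>" and p: "0 < p" and a: "tree_summable a"
  and defect: "\<And>m i j s u t. 1 <= m ==> i < 2 ^ m ==> j < 2 ^ m ==> j = i \<or> j = Suc i ==>
   dpt T m i <= s ==> s <= dpt T m (Suc i) ==> dpt T m j <= t ==> t <= dpt T m (Suc j) ==> s <= u ==> u <= t ==>
   norm (\<Xi> s t - \<Xi> s u - \<Xi> u t) <= a m i + a m j"
  and lim: "\<And>\<epsilon>. 0 < \<epsilon> ==> \<exists>\<eta>>0. \<forall>N \<tau>. unit_partition N \<tau> \<and> mesh N \<tau> < \<eta> -->
   besov2_norm \<gamma> p \<infinity> T (partition_sum \<Xi> N \<tau>) < ennreal \<epsilon>"
begin

lemma a_nonneg: "i < 2 ^ m ==> 0 <= a m i"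
 using a by (simp add: tree_summable_def)

context
 fixes n :: nat
 assumes n: "1 <= n"
begin

text \<open>The starting point \<open>s\<close> is kept free, since averaged information says
  nothing about a single starting point.\<close>

definition D :: "nat => real => 'v" where
 "D k s = (\<Sum>i<2 ^ k. \<Xi> (s + real i * (T / 2 ^ (n + k))) (s + real (Suc i) * (T / 2 ^ (n + k))))"

lemma D_eq: "D k s = partition_sum \<Xi> (2 ^ k) (dyadic_partition k) s (s + T / 2 ^ n)"
 by (simp add: D_def partition_sum_def dyadic_partition_def power_add mult.commute)

lemma h_bounds: "0 < T / 2 ^ n" "T / 2 ^ n < T"
proof -
 have "(2::real) <= 2 ^ n" using n power_increasing[of 1 n "2::real"] by simp
 then show "0 < T / 2 ^ n" "T / 2 ^ n < T" using T by (simp_all add: divide_less_eq)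
qed

lemma D_diff: "D k s - D (Suc k) s = (\<Sum>i<2 ^ k.
  \<Xi> (s + real i * (T / 2 ^ (n + k))) (s + real (Suc i) * (T / 2 ^ (n + k)))
  - \<Xi> (s + real i * (T / 2 ^ (n + k))) (s + real i * (T / 2 ^ (n + k)) + T / 2 ^ Suc (n + k))
  - \<Xi> (s + real i * (T / 2 ^ (n + k)) + T / 2 ^ Suc (n + k)) (s + real (Suc i) * (T / 2 ^ (n + k))))"
proof -
 define l where "l = T / 2 ^ Suc (n + k)"
 have l2: "T / 2 ^ (n + k) = 2 * l" by (simp add: l_def)
 have "D (Suc k) s = (\<Sum>i<2 ^ k. \<Xi> (s + real (2 * i) * l) (s + real (Suc (2 * i)) * l)
   + \<Xi> (s + real (Suc (2 * i)) * l) (s + real (Suc (Suc (2 * i))) * l))"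
  unfolding D_def power_Suc[of 2 k] sum_pairs by (simp only: l_def add_Suc_right)
 also have "\<dots> = (\<Sum>i<2 ^ k. \<Xi> (s + real i * (2 * l)) (s + real i * (2 * l) + l)
   + \<Xi> (s + real i * (2 * l) + l) (s + real (Suc i) * (2 * l)))"
  by (simp add: algebra_simps)
 finally show ?thesis unfolding D_def l2 l_def[symmetric]
  by (simp only: sum_subtractf[symmetric] diff_diff_eq)
qed

text \<open>Intervals started at \<open>s\<close> straddle grid points, so each defect is charged to
  two neighbouring cells; an interval confined to the last cell is charged to that cell twice. Hence
  the factor 2 + 1.\<close>

lemma D_diff_le:
 assumes s: "0 <= s" "s <= T - T / 2 ^ n"
 shows "norm (D k s - D (Suc k) s) <= 3 * level_sum a (n + k)"
proof -
 define m where "m = n + k"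
 define l where "l = T / 2 ^ m"
 have l0: "0 < l" using T by (simp add: l_def)
 have m1: "1 <= m" using n by (simp add: m_def)
 have sT: "s < T" using s h_bounds by linarith
 obtain j0 where j0: "j0 < 2 ^ m" "dpt T m j0 <= s" "s < dpt T m (Suc j0)"
  by (rule dyadic_floor[OF T s(1) sT, of m])
 define a' where "a' j = (if j < 2 ^ m then a m j else 0)" for j
 have a'0: "0 <= a' j" for j using a_nonneg by (simp add: a'_def)
 have kl: "2 ^ k * l = T / 2 ^ n" by (simp add: l_def m_def power_add)
 have dp: "dpt T m (j0 + i) = dpt T m j0 + real i * l" for i
  by (simp add: dpt_def l_def distrib_left add_divide_distrib)
 have tm: "norm (\<Xi> (s + real i * l) (s + real (Suc i) * l) - \<Xi> (s + real i * l) (s + real i * l + T / 2 ^ Suc m)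
   - \<Xi> (s + real i * l + T / 2 ^ Suc m) (s + real (Suc i) * l)) <= 2 * a' (j0 + i) + a' (j0 + Suc i)"
  if i: "i < 2 ^ k" for i
 proof -
  have "real (Suc i) <= 2 ^ k"
  proof -
   have "real (Suc i) <= real (2 ^ k)" using i by (simp only: of_nat_le_iff Suc_le_eq)
   then show ?thesis by simp
  qed
  then have "real (Suc i) * l <= 2 ^ k * l" using l0 by (intro mult_right_mono) auto
  then have le: "s + real (Suc i) * l <= T" unfolding kl using s by simp
  have half: "T / 2 ^ Suc m = l / 2" by (simp add: l_def)
  have bi: "dpt T m (j0 + i) <= s + real i * l" "s + real i * l < dpt T m (Suc (j0 + i))"
   "dpt T m (Suc (j0 + i)) <= s + real (Suc i) * l" "s + real (Suc i) * l <= dpt T m (Suc (Suc (j0 + i)))"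
   using j0 dp[of i] by (simp_all add: dpt_Suc l_def[symmetric] algebra_simps)
  have "s + real i * l < T" using le l0 by (simp add: algebra_simps)
  then have "dpt T m (j0 + i) < dpt T m (2 ^ m)" using bi(1) by simp
  then have ji: "j0 + i < 2 ^ m" by (simp only: dpt_less_iff[OF T])
  have ord: "s + real i * l <= s + real i * l + T / 2 ^ Suc m" "s + real i * l + T / 2 ^ Suc m <= s + real (Suc i) * l"
   unfolding half using l0 by (simp_all add: algebra_simps)
  show ?thesis
  proof (cases "Suc (j0 + i) < 2 ^ m")
   case True
   have "norm (\<Xi> (s + real i * l) (s + real (Suc i) * l) - \<Xi> (s + real i * l) (s + real i * l + T / 2 ^ Suc m)
    - \<Xi> (s + real i * l + T / 2 ^ Suc m) (s + real (Suc i) * l)) <= a m (j0 + i) + a m (Suc (j0 + i))"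
    by (rule defect[OF m1 ji True _ bi(1) less_imp_le[OF bi(2)] bi(3,4) ord]) simp
   then show ?thesis using True ji a_nonneg[OF ji] by (simp add: a'_def)
  next
   case False
   then have "Suc (j0 + i) = 2 ^ m" using ji by simp
   then have e: "s + real (Suc i) * l <= dpt T m (Suc (j0 + i))" "dpt T m (j0 + i) <= s + real (Suc i) * l"
    using le bi(1,3) dpt_mono[OF T, of "j0 + i" "Suc (j0 + i)" m] by auto
   have "norm (\<Xi> (s + real i * l) (s + real (Suc i) * l) - \<Xi> (s + real i * l) (s + real i * l + T / 2 ^ Suc m)
    - \<Xi> (s + real i * l + T / 2 ^ Suc m) (s + real (Suc i) * l)) <= a m (j0 + i) + a m (j0 + i)"
    by (rule defect[OF m1 ji ji _ bi(1) less_imp_le[OF bi(2)] e(2,1) ord]) simp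
   then show ?thesis using ji a'0[of "j0 + Suc i"] by (simp add: a'_def[of "j0 + i"])
  qed
 qed
 have shift: "(\<Sum>i<2 ^ k. a' (c + i)) <= level_sum a m" for c
 proof -
  have "(\<Sum>i<2 ^ k. a' (c + i)) = (\<Sum>j\<in>{c..<c + 2 ^ k}. a' j)"
   by (rule sum.reindex_bij_witness[of _ "%j. j - c" "%i. c + i"]) auto
  also have "\<dots> <= (\<Sum>j\<in>{c..<c + 2 ^ k} \<union> {..<2 ^ m}. a' j)" using a'0 by (intro sum_mono2) auto
  also have "\<dots> = (\<Sum>j<2 ^ m. a' j)" by (rule sum.mono_neutral_right) (auto simp: a'_def)
  also have "\<dots> = level_sum a m" by (simp add: a'_def level_sum_def)
  finally show ?thesis .
 qed
 have "norm (D k s - D (Suc k) s) <= (\<Sum>i<2 ^ k. 2 * a' (j0 + i) + a' (Suc j0 + i))"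
  unfolding D_diff m_def[symmetric] l_def[symmetric]
 proof (rule order_trans[OF norm_sum], rule sum_mono)
  fix i :: nat assume "i \<in> {..<2 ^ k}"
  then show "norm (\<Xi> (s + real i * l) (s + real (Suc i) * l) - \<Xi> (s + real i * l) (s + real i * l + T / 2 ^ Suc m)
   - \<Xi> (s + real i * l + T / 2 ^ Suc m) (s + real (Suc i) * l)) <= 2 * a' (j0 + i) + a' (Suc j0 + i)"
   using tm[of i] by simp
 qed
 also have "\<dots> = 2 * (\<Sum>i<2 ^ k. a' (j0 + i)) + (\<Sum>i<2 ^ k. a' (Suc j0 + i))"
  by (simp only: sum.distrib sum_distrib_left)
 also have "\<dots> <= 3 * level_sum a m" using shift[of j0] shift[of "Suc j0"] by linarith
 finally show ?thesis by (simp only: m_def)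
qed

text \<open>Started at a grid point, the intervals are cells, and only descendants of cell
  \<open>i\<close> are charged; this is where a tree sum arises.\<close>

lemma D_diff_le_dyadic:
 assumes i: "i < 2 ^ n"
 shows "norm (D k (dpt T n i) - D (Suc k) (dpt T n i)) <= 2 * (\<Sum>j\<in>{i * 2 ^ k..<Suc i * 2 ^ k}. a (n + k) j)"
proof -
 define m where "m = n + k"
 define l where "l = T / 2 ^ m"
 have l0: "0 < l" using T by (simp add: l_def)
 have m1: "1 <= m" using n by (simp add: m_def)
 have dp: "dpt T n i + real j * l = dpt T m (i * 2 ^ k + j)" for j
  using dpt_refine[of T n k i] by (simp add: dpt_def l_def m_def distrib_left add_divide_distrib)
 have "norm (D k (dpt T n i) - D (Suc k) (dpt T n i)) <= (\<Sum>j<2 ^ k. 2 * a m (i * 2 ^ k + j))"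
  unfolding D_diff m_def[symmetric] l_def[symmetric]
 proof (rule order_trans[OF norm_sum], rule sum_mono)
  fix j :: nat assume "j \<in> {..<2 ^ k}"
  then have "i * 2 ^ k + j < Suc i * 2 ^ k" by simp
  then have J: "i * 2 ^ k + j < 2 ^ m" unfolding m_def by (rule descendant_less[OF i])
  let ?J = "i * 2 ^ k + j"
  have e: "dpt T n i + real j * l = dpt T m ?J" "dpt T n i + real (Suc j) * l = dpt T m (Suc ?J)"
   using dp[of j] dp[of "Suc j"] by simp_all
  have half: "T / 2 ^ Suc m = l / 2" by (simp add: l_def)
  have b: "dpt T m (Suc ?J) = dpt T m ?J + l" by (simp add: dpt_Suc l_def)
  have "norm (\<Xi> (dpt T m ?J) (dpt T m (Suc ?J)) - \<Xi> (dpt T m ?J) (dpt T m ?J + T / 2 ^ Suc m)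
    - \<Xi> (dpt T m ?J + T / 2 ^ Suc m) (dpt T m (Suc ?J))) <= a m ?J + a m ?J"
   by (rule defect[OF m1 J J]) (use l0 half b in auto)
  then show "norm (\<Xi> (dpt T n i + real j * l) (dpt T n i + real (Suc j) * l)
    - \<Xi> (dpt T n i + real j * l) (dpt T n i + real j * l + T / 2 ^ Suc m)
    - \<Xi> (dpt T n i + real j * l + T / 2 ^ Suc m) (dpt T n i + real (Suc j) * l)) <= 2 * a m ?J"
   unfolding e by simp
 qed
 also have "\<dots> = 2 * (\<Sum>j\<in>{i * 2 ^ k..<Suc i * 2 ^ k}. a m j)"
 proof -
  have "Suc i * 2 ^ k = i * 2 ^ k + (2::nat) ^ k" by (simp only: mult_Suc add.commute)
  then have "(\<Sum>j<2 ^ k. a m (i * 2 ^ k + j)) = (\<Sum>j\<in>{i * 2 ^ k..<Suc i * 2 ^ k}. a m j)"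
   by (intro sum.reindex_bij_witness[of _ "%j. j - i * 2 ^ k" "%j. i * 2 ^ k + j"]) auto
  then show ?thesis by (simp only: sum_distrib_left[symmetric])
 qed
 finally show ?thesis by (simp only: m_def)
qed

definition tail :: "nat => real" where
 "tail K = (\<Sum>k. 3 * level_sum a (n + K + k))"

lemma tail_tendsto: "tail \<longlonglongrightarrow> 0"
proof -
 have "(%K. 3 * (\<Sum>k. level_sum a (K + n + k))) \<longlonglongrightarrow> 3 * 0"
  by (intro tendsto_mult_left LIMSEQ_ignore_initial_segment[OF level_tail_tendsto_0[OF a]])
 moreover have "tail K = 3 * (\<Sum>k. level_sum a (K + n + k))" for K
  unfolding tail_def using suminf_mult[OF summable_level_tail[OF a, of "n + K"], of 3] by (simp add: add_ac)
 ultimately show ?thesis by (simp add: tail_def[abs_def])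
qed

lemma D_close:
 assumes s: "0 <= s" "s <= T - T / 2 ^ n" and k: "K <= k"
 shows "norm (D K s - D k s) <= tail K"
proof -
 have nn: "0 <= 3 * level_sum a j" for j
  unfolding level_sum_def by (intro mult_nonneg_nonneg sum_nonneg a_nonneg) auto
 have sm: "summable (%j. 3 * level_sum a (n + K + j))" by (intro summable_mult summable_level_tail[OF a])
 have "norm (D K s - D (K + j) s) <= (\<Sum>i<j. 3 * level_sum a (n + K + i))" for j
 proof (induction j)
  case (Suc j)
  have "norm (D (K + j) s - D (Suc (K + j)) s) <= 3 * level_sum a (n + (K + j))" by (rule D_diff_le[OF s])
  with Suc norm_triangle_ineq[of "D K s - D (K + j) s" "D (K + j) s - D (Suc (K + j)) s"]
  show ?case by (simp add: add_ac)
 qed simp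
 from this[of "k - K"] have "norm (D K s - D k s) <= (\<Sum>i<k - K. 3 * level_sum a (n + K + i))" using k by simp
 also have "\<dots> <= tail K" unfolding tail_def using nn by (intro sum_le_suminf sm) auto
 finally show ?thesis .
qed

text \<open>Otherwise, by \<open>D_close\<close> and continuity, \<open>norm (D k s)\<close> would
  stay above a fixed \<open>e\<close> on a whole interval of starting points for every
  \<open>k >= K\<close>, contradicting the vanishing of the slice norms along dyadic
  partitions.\<close>

lemma D_le_tail:
 assumes s0: "0 <= s0" "s0 <= T - T / 2 ^ n"
 shows "norm (D K s0) <= tail K"
proof (rule ccontr)
 define h where "h = T / 2 ^ n"
 have h: "0 < h" "h < T" using h_bounds by (simp_all add: h_def)
 assume "\<not> norm (D K s0) <= tail K"
 define e where "e = (norm (D K s0) - tail K) / 2"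
 have e: "0 < e" "norm (D K s0) = tail K + 2 * e"
  using \<open>\<not> norm (D K s0) <= tail K\<close> by (auto simp: e_def field_simps)
 have cD: "continuous_on {0..T - h} (D k)" for k
  using cont2_slice[OF partition_sum_cont2[OF cont unit_partition_dyadic], of h k] h
  unfolding D_eq[abs_def] h_def by simp
 have s0h: "s0 \<in> {0..T - h}" using s0 by (simp add: h_def)
 obtain d where d: "0 < d" "\<And>s. s \<in> {0..T - h} ==> \<bar>s - s0\<bar> < d ==> dist (D K s) (D K s0) < e"
  using cD[of K, unfolded continuous_on_iff, rule_format, OF s0h e(1)] by (auto simp: dist_real_def)
 \<comment> \<open>An interval of starting points next to \<open>s0\<close>, on its left if
   \<open>s0\<close> is the right end of the range.\<close>
 obtain x y where xy: "x < y" "{x..y} \<subseteq> {0..T - h}" "\<And>s. s \<in> {x..y} ==> \<bar>s - s0\<bar> < d"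
 proof (cases "s0 < T - h")
  case True
  define y where "y = min (s0 + d / 2) (T - h)"
  have "s0 < y" "y <= T - h" "y <= s0 + d / 2" using True d by (auto simp: y_def)
  then show ?thesis using that[of s0 y] s0h d by auto
 next
  case False
  then have eq: "s0 = T - h" using s0h by simp
  define x where "x = max (s0 - d / 2) 0"
  have "x < s0" "0 <= x" "s0 - d / 2 <= x" using eq h d by (auto simp: x_def)
  then show ?thesis using that[of x s0] s0h d by auto
 qed
 have big: "e <= norm (D k s)" if k: "K <= k" and s: "s \<in> {x..y}" for k s
 proof -
  have sh: "s \<in> {0..T - h}" using s xy by blast
  have "dist (D K s) (D K s0) < e" by (rule d(2)[OF sh xy(3)[OF s]])
  then have "norm (D K s0) < norm (D K s) + e" unfolding dist_norm by norm
  moreover have "norm (D K s - D k s) <= tail K" using sh by (intro D_close k) (auto simp: h_def)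
  then have "norm (D K s) <= norm (D k s) + tail K" by norm
  ultimately show ?thesis using e by linarith
 qed
 \<comment> \<open>Small enough to contradict a lower bound \<open>e\<close> on
   \<open>{x..y}\<close>, both for the supremum and for the integral.\<close>
 define c where "c = e / 2 * min 1 ((y - x) powr inv_exp p)"
 have c: "0 < c" "c < e" "c <= e / 2 * (y - x) powr inv_exp p"
  using e(1) xy(1) by (auto simp: c_def min_def)
 define \<omega> where "\<omega> = c / T powr \<gamma>"
 have \<omega>: "0 < \<omega>" using c T by (simp add: \<omega>_def)
 obtain \<eta> where \<eta>: "0 < \<eta>" "\<And>N \<tau>. unit_partition N \<tau> ==> mesh N \<tau> < \<eta> ==> besov2_norm \<gamma> p \<infinity> T (partition_sum \<Xi> N \<tau>) < ennreal \<omega>"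
  using lim[OF \<omega>] by blast
 obtain k0 where k0: "(1 / 2) ^ k0 < \<eta>" using real_arch_pow_inv[of \<eta> "1 / 2"] \<eta>(1) by auto
 define k where "k = max k0 K"
 have "(1 / 2 :: real) ^ k <= (1 / 2) ^ k0" by (intro power_decreasing) (auto simp: k_def)
 then have "mesh (2 ^ k) (dyadic_partition k) < \<eta>" using k0 by (simp add: mesh_dyadic power_divide)
 then have "besov2_norm \<gamma> p \<infinity> T (partition_sum \<Xi> (2 ^ k) (dyadic_partition k)) <= ennreal \<omega>"
  by (intro less_imp_le \<eta>(2) unit_partition_dyadic)
 then have "Lp p T (partition_sum \<Xi> (2 ^ k) (dyadic_partition k)) h <= ennreal (\<omega> * T powr \<gamma>)"
  using h \<omega> by (intro Lp_le_besov2_norm_top[where \<tau> = T]) auto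
 also have "\<omega> * T powr \<gamma> = c" using T by (simp add: \<omega>_def)
 finally have L: "Lp p T (partition_sum \<Xi> (2 ^ k) (dyadic_partition k)) h <= ennreal c" .
 have Kk: "K <= k" by (simp add: k_def)
 note cont_k = partition_sum_cont2[OF cont unit_partition_dyadic[of k]]
 have Dk: "partition_sum \<Xi> (2 ^ k) (dyadic_partition k) s (s + h) = D k s" for s by (simp add: D_eq h_def)
 show False
 proof (cases "p = \<infinity>")
  case True
  then have "norm (D k x) <= c"
   using L Lp_le_iff[OF cont_k less_imp_le[OF h(1)] p less_imp_le[OF c(1)]] xy(1,2) by (auto simp: Dk)
  then show False using big[OF Kk, of x] c xy by simp
 next
  case False
  define P where "P = enn2real p"
  have P: "0 < P" unfolding P_def by (rule enn2real_pos[OF p False])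
  have ip: "inv_exp p = 1 / P" using False by (simp add: inv_exp_def P_def)
  have cP: "continuous_on {0..T - h} (%s. norm (D k s) powr P)"
   using continuous_norm_powr_slice[OF cont_k less_imp_le[OF h(1)] P] by (simp add: Dk)
  have "(y - x) * e powr P = integral {x..y} (%s. e powr P)" using xy(1) by simp
  also have "\<dots> <= integral {x..y} (%s. norm (D k s) powr P)"
   using big[OF Kk] e(1) P
   by (intro integral_le integrable_continuous_interval continuous_on_subset[OF cP xy(2)] powr_mono2) auto
  also have "\<dots> <= integral {0..T - h} (%s. norm (D k s) powr P)"
   using xy by (intro integral_subset_le integrable_continuous_interval cP continuous_on_subset[OF cP xy(2)]) auto
  also have "\<dots> <= c powr P"
   using L Lp_le_iff[OF cont_k less_imp_le[OF h(1)] p less_imp_le[OF c(1)]] False by (simp add: Dk P_def)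
  also have "\<dots> <= (e / 2 * (y - x) powr (1 / P)) powr P"
   using c P unfolding ip by (intro powr_mono2) auto
  also have "\<dots> = (e / 2) powr P * (y - x)" using xy(1) P by (simp only: powr_mult powr_powr) simp
  finally have "(y - x) * e powr P <= (y - x) * (e / 2) powr P" by (simp only: mult.commute)
  then have "e powr P <= (e / 2) powr P" using xy(1) by simp
  moreover have "(e / 2) powr P < e powr P" using e P by (intro powr_less_mono2) auto
  ultimately show False by simp
 qed
qed

text \<open>Telescope the refinements of the undivided cell; the sum left at the end is at most
  \<open>tail K\<close>, which tends to 0.\<close>

lemma norm_cell_le:
 assumes i: "i < 2 ^ n"
 shows "norm (\<Xi> (dpt T n i) (dpt T n (Suc i))) <= 2 * tree_sum a n i"
proof -
 let ?s = "dpt T n i"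
 let ?S = "%k. \<Sum>j\<in>{i * 2 ^ k..<Suc i * 2 ^ k}. a (n + k) j"
 have s: "0 <= ?s" "?s <= T - T / 2 ^ n" using dpt_cell_bounds[OF T i] by (auto simp: dpt_Suc)
 have D0: "D 0 ?s = \<Xi> ?s (dpt T n (Suc i))" by (simp add: D_def dpt_Suc)
 have part: "norm (D 0 ?s) <= 2 * (\<Sum>k<K. ?S k) + norm (D K ?s)" for K
 proof (induction K)
  case (Suc K)
  have "norm (D K ?s) <= 2 * ?S K + norm (D (Suc K) ?s)"
   using D_diff_le_dyadic[OF i, of K] norm_triangle_ineq[of "D K ?s - D (Suc K) ?s" "D (Suc K) ?s"] by simp
  with Suc show ?case by simp
 qed simp
 have sums: "(%K. \<Sum>k<K. ?S k) \<longlonglongrightarrow> tree_sum a n i" by (rule tree_sum_partial_tendsto[OF a i])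
 have "(%K. 2 * (\<Sum>k<K. ?S k) + tail K) \<longlonglongrightarrow> 2 * tree_sum a n i + 0"
  by (intro tendsto_add tendsto_mult_left sums tail_tendsto)
 then have "norm (D 0 ?s) <= 2 * tree_sum a n i + 0"
 proof (rule LIMSEQ_le_const)
  have "norm (D 0 ?s) <= 2 * (\<Sum>k<K. ?S k) + tail K" for K
   using part[of K] D_le_tail[OF s, of K] by linarith
  then show "\<exists>N. \<forall>K\<ge>N. norm (D 0 ?s) <= 2 * (\<Sum>k<K. ?S k) + tail K" by blast
 qed
 then show ?thesis unfolding D0 by simp
qed

end

end

section \<open>Continuity of the remainders and patching of cells\<close>

lemma norm_tensor_le: "norm (tensor a b) <= norm a * norm b"
proof -
 have "tensor a b $ i = a $ i *\<^sub>R b" for i by (simp add: tensor_def vec_eq_iff)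
 then have "norm (tensor a b $ i) = \<bar>a $ i\<bar> * norm b" for i by simp
 then have "norm (tensor a b) = L2_set (%i. \<bar>a $ i\<bar> * norm b) UNIV" by (simp only: norm_vec_def[of "tensor a b"])
 also have "\<dots> = L2_set (%i. \<bar>a $ i\<bar>) UNIV * norm b" by (simp add: L2_set_left_distrib)
 also have "L2_set (%i. \<bar>a $ i\<bar>) UNIV = norm a" by (simp add: norm_vec_def)
 finally show ?thesis by simp
qed

lemma bounded_linear_tensor_map: "bounded_linear (tensor_map :: real ^ 'n ^ 'm => _)"
proof (rule bounded_linear_intro[where K = 1])
 show "tensor_map (x + y) = tensor_map x + tensor_map y" for x y :: "real ^ 'n ^ 'm"
  by (rule blinfun_eqI) (simp add: tensor_map.rep_eq blinfun.add_left matrix_vector_mult_add_rdistrib)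
 show "tensor_map (r *\<^sub>R x) = r *\<^sub>R tensor_map x" for r and x :: "real ^ 'n ^ 'm"
  by (rule blinfun_eqI) (simp add: tensor_map.rep_eq blinfun.scaleR_left scaleR_matrix_vector_assoc)
 show "norm (tensor_map x) <= norm x * 1" for x :: "real ^ 'n ^ 'm" using norm_tensor_map_le[of x] by simp
qed

lemma continuous_on_contract:
 assumes W: "continuous_on S W" and B: "continuous_on S B"
 shows "continuous_on S (%x. contract (W x) (B x))"
proof -
 have "contract (W x) (B x) = (\<Sum>i\<in>UNIV. blinfun_apply (tensor_map (blinfun_apply (W x) (axis i 1))) (B x $ i))" for x
  by (simp add: contract_def tensor_map.rep_eq)
 moreover have "continuous_on S (%x. \<Sum>i\<in>UNIV. blinfun_apply (tensor_map (blinfun_apply (W x) (axis i 1))) (B x $ i))"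
  by (intro continuous_on_sum blinfun.continuous_on bounded_linear.continuous_on[OF bounded_linear_tensor_map]
    continuous_on_const W bounded_linear.continuous_on[OF bounded_linear_vec_nth] B)
 ultimately show ?thesis by (simp only:)
qed

lemma Cb2_continuous:
 assumes f: "Cb2 f" and Y: "continuous_on S Y"
 shows "continuous_on S (%t. f (Y t))" "continuous_on S (%t. fderiv f (Y t))"
proof -
 have "continuous_on UNIV f" "continuous_on UNIV (fderiv f)"
  using f unfolding Cb2_def Cb1_def Cb0_def by blast+
 then show "continuous_on S (%t. f (Y t))" "continuous_on S (%t. fderiv f (Y t))"
  by (auto intro: continuous_on_compose2[OF _ Y])
qed

lemma step_op_continuous:
 assumes f: "Cb2 f" and Y: "continuous_on S Y"
 shows "continuous_on S (%t. step_op f (Y t))"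
 unfolding step_op_def
 by (intro bounded_bilinear.continuous_on[OF bounded_bilinear_blinfun_compose] Cb2_continuous[OF f Y]
   bounded_linear.continuous_on[OF bounded_linear_tensor_map])

lemma continuous_on_simplex_fst_snd:
 assumes "continuous_on {0..T} g"
 shows "continuous_on (simplex2 T) (%z. g (fst z))" "continuous_on (simplex2 T) (%z. g (snd z))"
 by (rule continuous_on_compose2[OF assms]; force simp: simplex2_def intro: continuous_intros)+

lemma incr_cont2: "continuous_on {0..T} g ==> cont2 T (incr g)"
 by (auto simp: incr_def case_prod_beta intro!: continuous_intros continuous_on_simplex_fst_snd)

lemma remainder_cont2:
 assumes "continuous_on {0..T} X" "continuous_on {0..T} Y" "continuous_on {0..T} Y'"
 shows "cont2 T (remainder X Y Y')"
 unfolding remainder_def incr_def case_prod_beta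
 by (intro continuous_on_diff blinfun.continuous_on continuous_on_simplex_fst_snd assms)

lemma davie_remainder_cont2:
 assumes f: "Cb2 f" and "continuous_on {0..T} X" "cont2 T XX" "continuous_on {0..T} Y"
 shows "cont2 T (davie_remainder f X XX Y)"
proof -
 have eq: "f (Y s) *v (X t - X s) = blinfun_apply (tensor_map (f (Y s))) (X t - X s)" for s t
  by (simp add: tensor_map.rep_eq)
 show ?thesis unfolding davie_remainder_def eq case_prod_beta
  using assms(3)
  by (intro continuous_on_diff blinfun.continuous_on continuous_on_contract bounded_linear.continuous_on[OF bounded_linear_tensor_map]
    continuous_on_simplex_fst_snd Cb2_continuous[OF f] step_op_continuous[OF f] assms) (simp add: case_prod_beta)
qed

text \<open>Split at the common end point if the interval crosses it; otherwise one of the two cell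
  bounds already applies.\<close>

lemma two_cells_bound:
 fixes A :: "real => real => 'v::real_normed_vector"
 assumes ij: "j = i \<or> j = Suc i" and st: "dpt T n i <= s" "s <= t" "t <= dpt T n (Suc j)"
  and cell: "\<And>k s t. k = i \<or> k = j ==> dpt T n k <= s ==> s <= t ==> t <= dpt T n (Suc k) ==> norm (A s t) <= b k"
  and defect: "\<And>r. r = dpt T n (Suc i) ==> j = Suc i ==> s <= r ==> r <= t ==> norm (A s t - A s r - A r t) <= d"
  and nonneg: "0 <= b i" "0 <= b j" "0 <= d"
 shows "norm (A s t) <= b i + b j + d"
proof (cases "j = i \<or> t <= dpt T n (Suc i)")
 case True
 then have "norm (A s t) <= b i" using st by (intro cell) auto
 then show ?thesis using nonneg by simp
next
 case False
 then have j: "j = Suc i" and t: "dpt T n (Suc i) <= t" using ij by auto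
 show ?thesis
 proof (cases "dpt T n (Suc i) <= s")
  case True
  then have "norm (A s t) <= b j" using st j by (intro cell) auto
  then show ?thesis using nonneg by simp
 next
  case False
  then have "norm (A s (dpt T n (Suc i))) <= b i" "norm (A (dpt T n (Suc i)) t) <= b j"
   using st j t by (auto intro!: cell)
  moreover have "norm (A s t - A s (dpt T n (Suc i)) - A (dpt T n (Suc i)) t) <= d"
   using False j t by (intro defect) auto
  ultimately show ?thesis
   using norm_le_defect[of "A s t" "A s (dpt T n (Suc i))" "A (dpt T n (Suc i)) t"] by linarith
 qed
qed

text \<open>A crude bound by crossing at most \<open>2 ^ n\<close> cells, paying one cell bound and
  one defect each; it serves lags too long for the dyadic estimates.\<close>

lemma all_cells_bound:
 fixes A :: "real => real => 'v::real_normed_vector"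
 assumes T: "0 < T" and st: "0 <= s" "s <= t" "t <= T"
  and cell: "\<And>i s t. i < 2 ^ n ==> dpt T n i <= s ==> s <= t ==> t <= dpt T n (Suc i) ==> norm (A s t) <= b"
  and defect: "\<And>s r t. 0 <= s ==> s <= r ==> r <= t ==> t <= T ==> norm (A s t - A s r - A r t) <= d"
  and diag: "A 0 0 = 0" and nonneg: "0 <= b" "0 <= d"
 shows "norm (A s t) <= 2 ^ n * (b + d)"
proof -
 have "k <= 2 ^ n ==> 0 <= s ==> s <= t ==> t <= dpt T n k ==> norm (A s t) <= real k * (b + d)" for k s t
 proof (induction k arbitrary: s t)
  case 0
  then have "s = 0" "t = 0" by simp_all
  then show ?case using diag by simp
 next
  case (Suc k)
  have k: "k < 2 ^ n" using Suc.prems by simp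
  have tT: "t <= T" using Suc.prems dpt_bounds[OF T Suc.prems(1)] by simp
  have kb: "0 <= real k * (b + d)" using nonneg by simp
  have *: "real (Suc k) * (b + d) = real k * (b + d) + (b + d)" by (simp add: algebra_simps)
  consider "t <= dpt T n k" | "dpt T n k <= s" | "s <= dpt T n k" "dpt T n k <= t" by linarith
  then show ?case
  proof cases
   case 1
   then show ?thesis using Suc.IH[of s t] Suc.prems k nonneg unfolding * by simp
  next
   case 2
   then have "norm (A s t) <= b" using cell[OF k, of s t] Suc.prems by simp
   then show ?thesis using kb nonneg(2) unfolding * by linarith
  next
   case 3
   have "norm (A s (dpt T n k)) <= real k * (b + d)" using Suc.IH[of s "dpt T n k"] Suc.prems k 3 by simp
   moreover have "norm (A (dpt T n k) t) <= b" using cell[OF k, of "dpt T n k" t] Suc.prems 3 by simp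
   moreover have "norm (A s t - A s (dpt T n k) - A (dpt T n k) t) <= d" using defect Suc.prems 3 tT by simp
   ultimately show ?thesis unfolding *
    using norm_le_defect[of "A s t" "A s (dpt T n k)" "A (dpt T n k) t"] by linarith
  qed
 qed
 from this[of "2 ^ n" s t] show ?thesis using st by simp
qed

lemma besov2_norm_mono:
 assumes "\<And>s t. 0 <= s ==> s <= t ==> t <= T ==> norm (A s t) <= norm (B s t)"
 shows "besov2_norm \<gamma> p q T A <= besov2_norm \<gamma> p q T B"
 unfolding besov2_norm_def
proof (rule lp_norm_mono, rule mult_left_mono, rule SUP_mono)
 fix \<tau> h :: real assume "\<tau> \<in> space (density (restrict_space lborel {0<..T}) (%\<tau>. ennreal (1 / \<tau>)))" "h \<in> {0..\<tau>}"
 then show "\<exists>k\<in>{0..\<tau>}. lp_norm p (restrict_space lborel {0..T - h}) (%s. ennreal (norm (A s (s + h))))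
   <= lp_norm p (restrict_space lborel {0..T - k}) (%s. ennreal (norm (B s (s + k))))"
  using assms by (intro bexI[of _ h] lp_norm_mono ennreal_leI) (auto simp: space_restrict_space)
qed simp

lemma besov2_norm_cong:
 assumes "\<And>s t. 0 <= s ==> s <= t ==> t <= T ==> norm (A s t) = norm (B s t)"
 shows "besov2_norm \<gamma> p q T A = besov2_norm \<gamma> p q T B"
 using assms by (intro antisym besov2_norm_mono) auto

lemma in_besovI:
 fixes g :: "real => 'v::real_normed_vector"
 assumes T: "0 < T" and p: "0 < p" and g: "continuous_on {0..T} g" and b: "besov2_norm \<alpha> p q T (incr g) < \<infinity>"
 shows "in_besov \<alpha> p q T g"
proof -
 have c: "cont2 T (%s t. g s)" using continuous_on_simplex_fst_snd(1)[OF g] by (simp add: case_prod_beta)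
 obtain x where "0 <= x" "Lp p T (%s t. g s) 0 = ennreal x" by (rule Lp_finite[OF T c _ _ p, of 0]) (use T in auto)
 then have "lp_norm p (restrict_space lborel {0..T}) (%t. ennreal (norm (g t))) < \<infinity>" by (simp add: Lp_def)
 moreover have "measurable (restrict_space lborel {0..T}) borel = measurable (restrict_space borel {0..T}) (borel :: 'v measure)"
  by (rule measurable_cong_sets) (auto simp: sets_restrict_space)
 then have "g \<in> borel_measurable (restrict_space lborel {0..T})"
  using borel_measurable_continuous_on_restrict[OF g] by simp
 ultimately show ?thesis using b by (simp add: in_besov_def besov_seminorm_def)
qed

lemma in_besov2I: "cont2 T A ==> besov2_norm \<alpha> p q T A < \<infinity> ==> in_besov2 \<alpha> p q T A"
 by (simp add: in_besov2_def borel_measurable_continuous_on_restrict)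

lemma besov2_norm_lipschitz:
 fixes A :: "real => real => 'v::real_normed_vector" and B :: "real => real => 'w::real_normed_vector"
 assumes T: "0 < T" and B: "cont2 T B" and p: "0 < p" and q: "0 < q" and c: "0 <= c"
  and le: "\<And>s t. 0 <= s ==> s <= t ==> t <= T ==> norm (A s t) <= c * norm (B s t)"
 shows "besov2_norm \<gamma> p q T A
  <= ennreal ((c + 1) * 2 * 2 powr inv_exp p * 2 * 2 powr inv_exp q) * (besov2_norm \<gamma> p q T B + besov2_norm \<gamma> p q T B)"
proof (rule besov2_norm_quasi_triangle[OF T B B p q])
 show "0 < c + 1" using c by simp
 fix s t assume "0 <= s" "s <= t" "t <= T"
 then have "norm (A s t) <= c * norm (B s t)" by (rule le)
 also have "\<dots> <= (c + 1) * (norm (B s t) + norm (B s t))" using c by (intro mult_mono) auto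
 finally show "norm (A s t) <= (c + 1) * (norm (B s t) + norm (B s t))" .
qed

lemma inv_exp_divide:
 assumes "0 < a"
 shows "inv_exp (p / ennreal a) = a * inv_exp p"
proof (cases p)
 case (real P)
 then show ?thesis using assms by (simp add: inv_exp_def divide_ennreal ennreal_neq_top)
next
 case top
 then show ?thesis using assms by (simp add: inv_exp_def ennreal_top_divide)
qed

lemma inv_exp_third: "inv_exp (p / 3) = 3 * inv_exp p"
 using inv_exp_divide[of 3 p] by (simp flip: ennreal_numeral)

lemma third_divide:
 assumes "0 < a"
 shows "p / 3 / ennreal (a / 3) = p / ennreal a"
proof (cases p)
 case (real P)
 then show ?thesis using assms by (simp add: divide_ennreal flip: ennreal_numeral)
next
 case top
 then show ?thesis using assms by (simp add: ennreal_top_divide flip: ennreal_numeral)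
qed

lemma ennreal_divide_pos: "0 < p ==> 0 < p / ennreal a"
 by (simp add: ennreal_zero_less_divide)

lemma ennreal_less_inv_exp:
 assumes "0 < \<alpha>" "ennreal (1 / \<alpha>) < p"
 shows "0 < p" "inv_exp p < \<alpha>"
proof -
 show p: "0 < p" using assms(2) by (rule le_less_trans[rotated]) simp
 show "inv_exp p < \<alpha>"
 proof (cases p)
  case (real P)
  then have "1 / \<alpha> < P" using assms by (simp add: ennreal_less_iff)
  moreover have "0 < 1 / \<alpha>" using assms by simp
  ultimately have "0 < P" by linarith
  with \<open>1 / \<alpha> < P\<close> have "1 / P < \<alpha>" using assms(1) by (simp add: field_simps)
  then show ?thesis using real by (simp add: inv_exp_def ennreal_neq_top)
 qed (use assms in \<open>simp add: inv_exp_def\<close>)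
qed

section \<open>Cell arrays attached to Besov functions\<close>

locale besov_exponents =
 fixes T \<alpha> :: real and p q :: ennreal
 assumes T: "0 < T" and al: "1 / 3 <= \<alpha>" and p: "0 < p" "inv_exp p < \<alpha>"
  and q: "0 < q" "\<alpha> = 1 / 3 ==> q <= 3"
begin

text \<open>The profile \<open>v\<close> is hidden and only \<open>K\<close> is kept, because
  uniformity over all functions of bounded norm is expressed through \<open>K\<close>. Nonnegativity
  is demanded in generation 0 as well, on which \<open>cell_bound\<close> is silent.\<close>

definition cell_array :: "real => (nat => nat => real) => bool" where
 "cell_array K V \<longleftrightarrow> (\<exists>v. cell_bound p V v \<and> admissible \<alpha> K v) \<and> (\<forall>n. \<forall>i<2 ^ n. 0 <= V n i)"

definition add_const :: "real => real => real" where
 "add_const K L = (2 powr (1 + inv_exp p) + (2 powr (1 + inv_exp p)) ^ 3) * (8 * (K + L))"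

lemma cell_array_add:
 assumes "cell_array K V" "cell_array L W"
 shows "cell_array (add_const K L) (%n i. V n i + W n i)"
proof -
 obtain v w where v: "cell_bound p V v" "admissible \<alpha> K v" and w: "cell_bound p W w" "admissible \<alpha> L w"
  using assms unfolding cell_array_def by blast
 have "cell_bound p (%n i. V n i + W n i) (%n. 2 powr (1 + inv_exp p) * (v n + w n))"
  by (rule cell_bound_add[OF v(1) w(1) p(1)])
 moreover have "admissible \<alpha> (add_const K L) (%n. 2 powr (1 + inv_exp p) * (v n + w n))"
  unfolding add_const_def by (rule admissible_scale[OF admissible_add[OF v(2) w(2)]]) simp
 ultimately show ?thesis using assms unfolding cell_array_def by (metis add_nonneg_nonneg)
qed

lemma cell_array_scale:
 assumes "cell_array K V" "0 <= c"
 shows "cell_array ((c + c ^ 3) * K) (%n i. c * V n i)"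
proof -
 obtain v where v: "cell_bound p V v" "admissible \<alpha> K v" using assms(1) unfolding cell_array_def by blast
 have "cell_bound p (%n i. c * V n i) (%n. c * v n)"
  using cell_bound_nonneg[OF v(1)] assms(2) by (intro cell_bound_mono[OF v(1) p(1), where c = c]) auto
 then show ?thesis using admissible_scale[OF v(2) assms(2)] assms unfolding cell_array_def by (metis mult_nonneg_nonneg)
qed

text \<open>Increments are additive, so the chaining bound applies with zero defect.\<close>

lemma cell_array_path:
 assumes rho: "0 <= \<rho>"
 obtains K where "0 <= K" "\<And>g :: real => 'v::real_normed_vector. continuous_on {0..T} g ==>
  besov2_norm \<alpha> p q T (incr g) <= ennreal \<rho> ==> cell_array K (cellsup T (incr g))"
proof -
 have one: "x / ennreal 1 = x" for x :: ennreal by (simp add: divide_ennreal_def)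
 obtain K where K: "0 <= K" and *: "\<And>(A :: real => real => 'v) D dd.
  cont2 T A ==> (\<forall>s\<in>{0..T}. A s s = 0) ==> besov2_norm (1 * \<alpha>) (p / ennreal 1) (q / ennreal 1) T A <= ennreal \<rho> ==>
  cell_bound p D dd ==> admissible \<alpha> 0 dd ==>
  (\<forall>n i s u t. 1 <= n --> i < 2 ^ n --> dpt T n i <= s --> s <= u --> u <= t --> t <= dpt T n (Suc i) -->
   norm (A s t - A s u - A u t) <= D n i powr 1) ==>
  (\<exists>v. admissible \<alpha> K v \<and> cell_bound p (%n i. cellsup T A n i powr (1 / 1)) v)"
  using besov_cell_bound[where 'v = 'v, OF T al p q, of 1 \<rho> 0] rho by auto
 have z: "cell_bound p (%n i. 0) (%n. 0)" by (simp add: cell_bound_def)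
 have a0: "admissible \<alpha> 0 (%n. 0)" by (simp add: admissible_def)
 show ?thesis
 proof (rule that[OF K])
  fix g :: "real => 'v" assume g: "continuous_on {0..T} g" "besov2_norm \<alpha> p q T (incr g) <= ennreal \<rho>"
  obtain v where v: "admissible \<alpha> K v" "cell_bound p (%n i. cellsup T (incr g) n i powr (1 / 1)) v"
   using *[where A = "incr g", OF incr_cont2[OF g(1)] _ _ z a0] g(2) unfolding one mult_1
   by (auto simp: incr_def)
  have nn: "0 <= cellsup T (incr g) n i" if "i < 2 ^ n" for n i by (rule cellsup_nonneg[OF incr_cont2[OF g(1)] T that])
  have "cell_bound p (cellsup T (incr g)) v"
   using nn by (intro cell_bound_mono[OF v(2) p(1), where c = 1]) auto
  then show "cell_array K (cellsup T (incr g))" using v nn unfolding cell_array_def by blast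
 qed
qed

text \<open>The second level, \<open>\<beta> = 2\<close>: defects are bounded by squares, and the
  square root returns to the scale of a path.\<close>

lemma cell_array_two:
 assumes rho: "0 <= \<rho>" and L: "0 <= L"
 obtains K where "0 <= K" "\<And>(A :: real => real => 'v::real_normed_vector) D. cont2 T A ==> (\<And>s. 0 <= s ==> s <= T ==> A s s = 0) ==>
  besov2_norm (2 * \<alpha>) (p / 2) (q / 2) T A <= ennreal \<rho> ==> cell_array L D ==>
  (\<And>n i s u t. 1 <= n ==> i < 2 ^ n ==> dpt T n i <= s ==> s <= u ==> u <= t ==> t <= dpt T n (Suc i) ==>
   norm (A s t - A s u - A u t) <= (D n i)\<^sup>2) ==>
  cell_array K (%n i. sqrt (cellsup T A n i))"
proof -
 have e2: "ennreal 2 = 2" by simp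
 obtain K where K: "0 <= K" and *: "\<And>(A :: real => real => 'v) D dd.
  cont2 T A ==> (\<forall>s\<in>{0..T}. A s s = 0) ==> besov2_norm (2 * \<alpha>) (p / 2) (q / 2) T A <= ennreal \<rho> ==>
  cell_bound p D dd ==> admissible \<alpha> L dd ==>
  (\<forall>n i s u t. 1 <= n --> i < 2 ^ n --> dpt T n i <= s --> s <= u --> u <= t --> t <= dpt T n (Suc i) -->
   norm (A s t - A s u - A u t) <= D n i powr 2) ==>
  (\<exists>v. admissible \<alpha> K v \<and> cell_bound p (%n i. cellsup T A n i powr (1 / 2)) v)"
  using besov_cell_bound[where 'v = 'v, OF T al p q _ rho L, of 2, unfolded e2] by auto
 show ?thesis
 proof (rule that[OF K])
  fix A :: "real => real => 'v" and D
  assume A: "cont2 T A" "\<And>s. 0 <= s ==> s <= T ==> A s s = 0" "besov2_norm (2 * \<alpha>) (p / 2) (q / 2) T A <= ennreal \<rho>"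
   and D: "cell_array L D" and defect: "\<And>n i s u t. 1 <= n ==> i < 2 ^ n ==> dpt T n i <= s ==> s <= u ==> u <= t ==>
    t <= dpt T n (Suc i) ==> norm (A s t - A s u - A u t) <= (D n i)\<^sup>2"
  obtain dd where dd: "cell_bound p D dd" "admissible \<alpha> L dd" using D unfolding cell_array_def by blast
  have D0: "0 <= D n i" if "i < 2 ^ n" for n i using D that unfolding cell_array_def by blast
  have "\<forall>n i s u t. 1 <= n --> i < 2 ^ n --> dpt T n i <= s --> s <= u --> u <= t --> t <= dpt T n (Suc i) -->
   norm (A s t - A s u - A u t) <= D n i powr 2"
   using defect D0 by (simp add: powr_numeral)
  from *[OF A(1) _ A(3) dd this] obtain v where v: "admissible \<alpha> K v" "cell_bound p (%n i. cellsup T A n i powr (1 / 2)) v"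
   using A(2) by auto
  have nn: "0 <= cellsup T A n i" if "i < 2 ^ n" for n i by (rule cellsup_nonneg[OF A(1) T that])
  have "cell_bound p (%n i. sqrt (cellsup T A n i)) v"
   using nn by (intro cell_bound_mono[OF v(2) p(1), where c = 1]) (auto simp: powr_half_sqrt)
  then show "cell_array K (%n i. sqrt (cellsup T A n i))" using v nn unfolding cell_array_def by auto
 qed
qed

text \<open>By Chen's relation the defect of the second level is a product of two increments of
  \<open>X\<close>, so the array of \<open>X\<close> serves as defect array for \<open>XX\<close>.
  The sum of both arrays dominates the rough path.\<close>

lemma rough_path_array:
 assumes rho: "0 <= \<rho>"
 obtains K where "0 <= K" "\<And>(X :: real => real ^ 'n) XX. continuous_on {0..T} X ==> cont2 T XX ==> chen T X XX ==>
  besov2_norm \<alpha> p q T (incr X) <= ennreal \<rho> ==> besov2_norm (2 * \<alpha>) (p / 2) (q / 2) T XX <= ennreal (\<rho>\<^sup>2) ==>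
  \<exists>U. cell_array K U \<and> dominated T X XX U"
proof -
 obtain K1 where K1: "0 <= K1" "\<And>g :: real => real ^ 'n. continuous_on {0..T} g ==>
  besov2_norm \<alpha> p q T (incr g) <= ennreal \<rho> ==> cell_array K1 (cellsup T (incr g))"
  using cell_array_path[where 'v = "real ^ 'n", OF rho] by blast
 obtain K2 where K2: "0 <= K2" "\<And>(A :: real => real => real ^ 'n ^ 'n) D. cont2 T A ==> (\<And>s. 0 <= s ==> s <= T ==> A s s = 0) ==>
  besov2_norm (2 * \<alpha>) (p / 2) (q / 2) T A <= ennreal (\<rho>\<^sup>2) ==> cell_array K1 D ==>
  (\<And>n i s u t. 1 <= n ==> i < 2 ^ n ==> dpt T n i <= s ==> s <= u ==> u <= t ==> t <= dpt T n (Suc i) ==>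
   norm (A s t - A s u - A u t) <= (D n i)\<^sup>2) ==>
  cell_array K2 (%n i. sqrt (cellsup T A n i))"
  using cell_array_two[where 'v = "real ^ 'n ^ 'n", OF zero_le_power2[of \<rho>] K1(1)] by blast
 have "0 <= add_const K1 K2" using K1(1) K2(1) by (simp add: add_const_def)
 then show ?thesis
 proof (rule that)
  fix X :: "real => real ^ 'n" and XX
  assume X: "continuous_on {0..T} X" and XX: "cont2 T XX" and chen: "chen T X XX"
   and bX: "besov2_norm \<alpha> p q T (incr X) <= ennreal \<rho>" and bXX: "besov2_norm (2 * \<alpha>) (p / 2) (q / 2) T XX <= ennreal (\<rho>\<^sup>2)"
  note iX = incr_cont2[OF X]
  have uX: "norm (X t - X s) <= cellsup T (incr X) n i"
   if "i < 2 ^ n" "dpt T n i <= s" "s <= t" "t <= dpt T n (Suc i)" for n i s t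
   using cellsup_upper[where A = "incr X", OF iX T that] unfolding incr_def[of X s t] .
  have A1: "cell_array K1 (cellsup T (incr X))" by (rule K1(2)[OF X bX])
  have A2: "cell_array K2 (%n i. sqrt (cellsup T XX n i))"
  proof (rule K2(2)[OF XX chen_diag[OF chen] bXX A1])
   fix n i s u t assume h: "1 <= n" "i < 2 ^ n" "dpt T n i <= s" "s <= u" "u <= t" "t <= dpt T n (Suc i)"
   have "XX s t = XX s u + XX u t + tensor (X u - X s) (X t - X u)"
    using chen h dpt_cell_bounds[OF T h(2)] unfolding chen_def by auto
   then have "norm (XX s t - XX s u - XX u t) <= norm (X u - X s) * norm (X t - X u)"
    using norm_tensor_le[of "X u - X s" "X t - X u"] by simp
   also have "\<dots> <= cellsup T (incr X) n i * cellsup T (incr X) n i"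
    using h cellsup_nonneg[OF iX T h(2)] by (intro mult_mono uX) auto
   finally show "norm (XX s t - XX s u - XX u t) <= (cellsup T (incr X) n i)\<^sup>2" by (simp add: power2_eq_square)
  qed auto
  have "dominated T X XX (%n i. cellsup T (incr X) n i + sqrt (cellsup T XX n i))"
   unfolding dominated_def
  proof (intro allI impI conjI)
   fix n i s t assume n: "1 <= n" and i: "i < (2::nat) ^ n" and st: "dpt T n i <= s \<and> s <= t \<and> t <= dpt T n (Suc i)"
   have nn: "0 <= cellsup T (incr X) n i" "0 <= cellsup T XX n i"
    using cellsup_nonneg[OF iX T i] cellsup_nonneg[OF XX T i] by auto
   show "norm (X t - X s) <= cellsup T (incr X) n i + sqrt (cellsup T XX n i)"
    using uX[OF i, of s t] st nn by (simp add: add_increasing2)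
   have "norm (XX s t) <= cellsup T XX n i" using cellsup_upper[OF XX T i, of s t] st by simp
   also have "\<dots> = (sqrt (cellsup T XX n i))\<^sup>2" using nn by simp
   also have "\<dots> <= (cellsup T (incr X) n i + sqrt (cellsup T XX n i))\<^sup>2" using nn by (intro power_mono) auto
   finally show "norm (XX s t) <= (cellsup T (incr X) n i + sqrt (cellsup T XX n i))\<^sup>2" .
  qed
  then show "\<exists>U. cell_array (add_const K1 K2) U \<and> dominated T X XX U" using cell_array_add[OF A1 A2] by blast
 qed
qed

text \<open>Joins the regimes \<open>p >= 3\<close> and \<open>p < 3\<close>; in the latter \<alpha>
  > 1/3, and the last clause is void.\<close>

lemma cell_array_tree_sum:
 assumes "0 <= K"
 obtains K' where "0 <= K'" "\<And>U. cell_array K U ==> tree_summable (%n i. U n i ^ 3) \<and>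
  (\<exists>w. cell_bound (p / 3) (tree_sum (%n i. U n i ^ 3)) w \<and> (\<forall>n\<ge>1. w n <= K' * 2 powr (- 3 * \<alpha> * n)) \<and>
   (\<alpha> = 1 / 3 --> (%n. 2 ^ n * w n) \<longlonglongrightarrow> 0))"
proof -
 define K1 where "K1 = K + (if \<alpha> = 1 / 3 then 0 else K ^ 3 / (1 - 2 powr (1 - 3 * \<alpha>)))"
 define K2 where "K2 = (K powr enn2real p / (1 - 2 powr (1 - \<alpha> * enn2real p))) powr (3 / enn2real p)"
 have K1: "0 <= K1"
 proof (cases "\<alpha> = 1 / 3")
  case False
  then have "(2::real) powr (1 - 3 * \<alpha>) < 2 powr 0" using al by (intro powr_less_mono) auto
  then show ?thesis using False assms by (simp add: K1_def)
 qed (simp add: K1_def assms)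
 have K2: "0 <= K2" by (simp add: K2_def)
 show ?thesis
 proof (rule that[of "K1 + K2"])
  fix U assume U: "cell_array K U"
  then obtain u where u: "cell_bound p U u" "admissible \<alpha> K u" and U0: "\<And>n i. i < 2 ^ n ==> 0 <= U n i"
   unfolding cell_array_def by blast
  have "tree_summable (%n i. U n i powr 3)"
   by (rule tree_summable_cells[OF u p _ _ U0]) (use al in auto)
  then have ts: "tree_summable (%n i. U n i ^ 3)"
   using U0 by (simp add: tree_summable_def level_sum_def[abs_def] powr_numeral)
  have "\<exists>w. cell_bound (p / 3) (tree_sum (%n i. U n i ^ 3)) w \<and> (\<forall>n\<ge>1. w n <= (K1 + K2) * 2 powr (- 3 * \<alpha> * n)) \<and>
   (\<alpha> = 1 / 3 --> (%n. 2 ^ n * w n) \<longlonglongrightarrow> 0)"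
  proof (cases "inv_exp p <= 1 / 3")
   case True
   have "scale_tail u n / 2 ^ n <= (K1 + K2) * 2 powr (- 3 * \<alpha> * n)" if n: "1 <= n" for n
   proof -
    have "scale_tail u n <= K1 * 2 powr ((1 - 3 * \<alpha>) * n)"
     using admissible_scale_tail(2)[OF u(2) al n] by (simp only: K1_def)
    then have "scale_tail u n / 2 ^ n <= K1 * 2 powr ((1 - 3 * \<alpha>) * n) / 2 ^ n" by (simp add: divide_right_mono)
    also have "\<dots> = K1 * (2 powr ((1 - 3 * \<alpha>) * n) / 2 powr real n)" by (simp add: powr_realpow)
    also have "\<dots> = K1 * 2 powr (- 3 * \<alpha> * n)" by (simp only: powr_diff[symmetric]) (simp add: algebra_simps)
    also have "\<dots> <= (K1 + K2) * 2 powr (- 3 * \<alpha> * n)" using K2 by (intro mult_right_mono) auto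
    finally show ?thesis .
   qed
   moreover have "(%n. 2 ^ n * (scale_tail u n / 2 ^ n)) \<longlonglongrightarrow> 0" if "\<alpha> = 1 / 3"
    using admissible_scale_tail(3)[OF u(2) al _ that, of 1] by simp
   ultimately show ?thesis using cell_bound_tree_sum[OF u p al U0 True] by blast
  next
   case False
   then have "\<alpha> \<noteq> 1 / 3" using p(2) by auto
   moreover have "K2 * 2 powr (- 3 * \<alpha> * n) <= (K1 + K2) * 2 powr (- 3 * \<alpha> * n)" for n
    using K1 by (intro mult_right_mono) auto
   moreover have "cell_bound (p / 3) (tree_sum (%n i. U n i ^ 3)) (%n. K2 * 2 powr (- 3 * \<alpha> * n))"
    unfolding K2_def using False by (intro cell_bound_tree_sum_small[OF u p al U0]) auto
   ultimately show ?thesis by blast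
  qed
  with ts show "tree_summable (%n i. U n i ^ 3) \<and>
   (\<exists>w. cell_bound (p / 3) (tree_sum (%n i. U n i ^ 3)) w \<and> (\<forall>n\<ge>1. w n <= (K1 + K2) * 2 powr (- 3 * \<alpha> * n)) \<and>
   (\<alpha> = 1 / 3 --> (%n. 2 ^ n * w n) \<longlonglongrightarrow> 0))" by blast
 qed (use K1 K2 in simp)
qed

lemma cell_array_le:
 assumes "cell_array K U" "1 <= n" "i < 2 ^ n"
 shows "U n i <= K * 2 powr (- (\<alpha> - inv_exp p) * n)"
proof -
 obtain u where u: "cell_bound p U u" "admissible \<alpha> K u" using assms(1) unfolding cell_array_def by blast
 have "U n i <= 2 powr (n * inv_exp p) * u n" by (rule cell_bound_pointwise[OF u(1) p(1) assms(2,3)])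
 also have "\<dots> <= 2 powr (n * inv_exp p) * (K * 2 powr (- \<alpha> * n))"
  using u(2) assms(2) by (intro mult_left_mono) (auto simp: admissible_def)
 also have "\<dots> = K * (2 powr (n * inv_exp p) * 2 powr (- \<alpha> * n))" by simp
 also have "\<dots> = K * 2 powr (- (\<alpha> - inv_exp p) * n)" by (simp only: powr_add[symmetric]) (simp add: algebra_simps)
 finally show ?thesis .
qed

end

section \<open>Compensated sums and uniform constants\<close>

text \<open>Each compensated summand is an increment of \<open>Y\<close> minus its Davie remainder,
  and the increments telescope. Convergence of the rough sums therefore means that the partition
  sums of the remainder vanish.\<close>

lemma rough_sum_remainder:
 assumes \<tau>: "unit_partition N \<tau>" and st: "0 <= s" "s <= t" "t <= T"
  and Y': "\<And>t. t \<in> {0..T} ==> Y' t = tensor_map (f (Y t))" and Z: "\<And>t. t \<in> {0..T} ==> Y t = y + Z t"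
 shows "rough_sum X XX (%t. f (Y t)) (%t. fderiv f (Y t) o\<^sub>L Y' t) N \<tau> s t - incr Z s t
  = - partition_sum (davie_remainder f X XX Y) N \<tau> s t"
proof -
 define u where "u i = s + \<tau> i * (t - s)" for i
 have u_in: "u i \<in> {0..T}" if "i < N" for i
 proof -
  have "0 <= \<tau> i" "\<tau> i <= 1" using unit_partition_bounds[OF \<tau> that] by auto
  then have "0 <= \<tau> i * (t - s)" "\<tau> i * (t - s) <= 1 * (t - s)"
   using st by (simp, intro mult_right_mono, auto)
  then show ?thesis using st by (simp add: u_def)
 qed
 have Yu: "Y' (u i) = tensor_map (f (Y (u i)))" if "i < N" for i by (rule Y'[OF u_in[OF that]])
 have "u 0 = s" "u N = t" using \<tau> by (simp_all add: u_def unit_partition_def)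
 then have tele: "(\<Sum>i<N. Y (u (Suc i)) - Y (u i)) = Y t - Y s"
  using sum_lessThan_telescope[of "%i. Y (u i)" N] by simp
 have "rough_sum X XX (%t. f (Y t)) (%t. fderiv f (Y t) o\<^sub>L Y' t) N \<tau> s t
   = (\<Sum>i<N. (Y (u (Suc i)) - Y (u i)) - davie_remainder f X XX Y (u i) (u (Suc i)))"
  unfolding rough_sum_def Let_def u_def[symmetric]
  by (intro sum.cong refl) (simp add: davie_remainder_def step_op_def incr_def Yu)
 also have "\<dots> = (Y t - Y s) - partition_sum (davie_remainder f X XX Y) N \<tau> s t"
  unfolding partition_sum_def u_def[symmetric]
  by (simp only: sum_subtractf[of "%i. Y (u (Suc i)) - Y (u i)"] tele)
 finally show ?thesis using Z st by (simp add: incr_def)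
qed

text \<open>The constant of \<open>cell_power_Lp\<close>, named to make visible that it involves the
  path only through \<open>K\<close>, \<open>M\<close> and the generation \<open>n\<close>.\<close>

definition Lp_const :: "real => ennreal => real => real => real => nat => real" where
 "Lp_const T p K \<gamma> M n = 4 * (2 * T) powr inv_exp p * K * (2 / T) powr \<gamma> + M * T powr inv_exp p * (2 ^ n / T) powr \<gamma>"

lemma Lp_const_nonneg: "0 < T ==> 0 <= K ==> 0 <= M ==> 0 <= Lp_const T p K \<gamma> M n"
 by (simp add: Lp_const_def)

definition adjacent_const :: "real => real => real => real" where
 "adjacent_const d c B = B + davie_const d c * (1 + B)"

text \<open>A global bound for the first-order remainder: \<open>2 ^ n\<close> cells with increments
  of \<open>Y\<close> of at most \<open>c + d * c ^ 2 + 1\<close>, plus \<open>c\<close> times the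
  bound \<open>2 ^ n\<close> for the increments of \<open>X\<close>.\<close>

definition path_max :: "real => real => nat => real" where
 "path_max d c n = 2 ^ n * (c + d * c\<^sup>2 + 1) + c * 2 ^ n"

context besov_exponents
begin

text \<open>The Hoelder exponent of the Besov embedding. It is both the pointwise decay rate of the
  arrays and the surplus that closes the Besov estimates.\<close>

definition \<kappa> :: real where "\<kappa> = \<alpha> - inv_exp p"

lemma kappa_pos: "0 < \<kappa>"
 using p by (simp add: \<kappa>_def)

lemma cell_bound_third_le:
 assumes w: "cell_bound (p / 3) V w" "\<And>n. 1 <= n ==> w n <= K' * 2 powr (- 3 * \<alpha> * n)" and n: "1 <= n" and i: "i < 2 ^ n"
 shows "V n i <= K' * 2 powr (- 3 * \<kappa> * n)"
proof -
 have "V n i <= 2 powr (n * inv_exp (p / 3)) * w n"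
  using cell_bound_pointwise[OF w(1) _ n i] p(1) ennreal_divide_pos[of p 3] by simp
 also have "\<dots> <= 2 powr (n * inv_exp (p / 3)) * (K' * 2 powr (- 3 * \<alpha> * n))" by (intro mult_left_mono w(2)[OF n]) simp
 also have "\<dots> = K' * (2 powr (n * inv_exp (p / 3)) * 2 powr (- 3 * \<alpha> * n))" by simp
 also have "\<dots> = K' * 2 powr (- 3 * \<kappa> * n)"
  by (simp only: powr_add[symmetric]) (simp add: inv_exp_third \<kappa>_def algebra_simps)
 finally show ?thesis .
qed

text \<open>The summand with \<open>K\<close> squared comes from the second level, the one with
  \<open>K'\<close> from the Davie remainder.\<close>

definition remainder_const :: "real => real => real => real => real => nat => real" where
 "remainder_const d c K K' B n = Lp_const T p
   (2 powr (1 + inv_exp p) * (2 * d * c\<^sup>2 * K\<^sup>2 + adjacent_const d c B * K')) (\<alpha> + \<kappa>) (path_max d c n) n"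

definition davie_remainder_const :: "real => real => real => real => nat => real" where
 "davie_remainder_const d c K' B n = Lp_const T (p / 2) (adjacent_const d c B * K') (2 * \<alpha> + \<kappa>)
   (path_max d c n + d * c\<^sup>2 * (2 ^ n * (1 + 2 ^ n * 2 ^ n))) n"

end

section \<open>Regularity of a path that satisfies the Davie bound\<close>

text \<open>\<open>K\<close>, \<open>K'\<close>, \<open>B\<close> and \<open>n0\<close> are
  parameters, so that the bounds derived here are the same for all rough paths and vector fields to
  which these values apply.\<close>

locale davie_path = besov_exponents T \<alpha> p q for T \<alpha> :: real and p q :: ennreal +
 fixes K K' B c d :: real and n0 :: nat and X :: "real => real ^ 'n" and XX :: "real => real => real ^ 'n ^ 'n"
  and f :: "real ^ 'm => real ^ 'n ^ 'm" and Y :: "real => real ^ 'm" and U :: "nat => nat => real" and w :: "nat => real"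
 assumes d: "d = real CARD('n)" and K: "0 <= K" "0 <= K'" "0 <= B" and X: "continuous_on {0..T} X" and XX: "cont2 T XX" and chen: "chen T X XX"
  and f: "Cb2 f" "C2_norm f = c" and U: "cell_array K U" and dom: "dominated T X XX U"
  and ts: "tree_summable (%n i. U n i ^ 3)" and w: "cell_bound (p / 3) (tree_sum (%n i. U n i ^ 3)) w"
   "\<And>n. 1 <= n ==> w n <= K' * 2 powr (- 3 * \<alpha> * n)" "\<alpha> = 1 / 3 ==> (%n. 2 ^ n * w n) \<longlonglongrightarrow> 0"
  and n0: "1 <= n0" "\<And>n i. n0 <= n ==> i < 2 ^ n ==> U n i <= 1"
   "\<And>n i. n0 <= n ==> i < 2 ^ n ==> B * tree_sum (%n i. U n i ^ 3) n i <= 1"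
  and Y: "continuous_on {0..T} Y"
  and xi: "\<And>n i s t. n0 <= n ==> i < 2 ^ n ==> dpt T n i <= s ==> s <= t ==> t <= dpt T n (Suc i) ==>
   norm (davie_remainder f X XX Y s t) <= B * tree_sum (%n i. U n i ^ 3) n i"
begin

abbreviation W :: "nat => nat => real" where "W \<equiv> tree_sum (%n i. U n i ^ 3)"
abbreviation \<Xi> :: "real => real => real ^ 'm" where "\<Xi> \<equiv> davie_remainder f X XX Y"
abbreviation R :: "real => real => real ^ 'm" where "R \<equiv> remainder X Y (%t. tensor_map (f (Y t)))"


lemma c0: "0 <= c"
 using Cb2_norm_le(4)[OF f(1)] f(2) by simp

lemma const_nonneg: "0 <= davie_const d c" "0 <= adjacent_const d c B" "0 <= path_max d c n0"
 using davie_const_nonneg[of d c] c0 K d by (simp_all add: adjacent_const_def path_max_def)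

lemma U0: "i < 2 ^ n ==> 0 <= U n i"
 using U by (simp add: cell_array_def)

lemma W0: "i < 2 ^ n ==> 0 <= W n i"
 by (rule tree_sum_nonneg[OF ts])

lemma cube_le_W: "i < 2 ^ n ==> U n i ^ 3 <= W n i"
 by (rule tree_sum_ge[OF ts])

lemma cell_X:
 assumes "1 <= n" "i < 2 ^ n" "dpt T n i <= s" "s <= t" "t <= dpt T n (Suc i)"
 shows "norm (X t - X s) <= U n i" "norm (XX s t) <= (U n i)\<^sup>2"
 using dom assms unfolding dominated_def by auto

lemma davie_remainder_diag_0: "0 <= s ==> s <= T ==> \<Xi> s s = 0"
 by (rule davie_remainder_diag[OF chen])

lemma davie_remainder_cont: "cont2 T \<Xi>"
 by (rule davie_remainder_cont2[OF f(1) X XX Y])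

text \<open>Across a grid point the remainder is split there. The defect is estimated with the
  larger of the two cell values, whose cube is at most the sum of the two tree sums.\<close>

lemma davie_remainder_adjacent:
 assumes n: "n0 <= n"
 shows "cell_dominated T \<Xi> (%n i. adjacent_const d c B * W n i) n"
 unfolding cell_dominated_def
proof (intro allI impI)
 fix i j s t assume i: "i < 2 ^ n" and j: "j < (2::nat) ^ n" and ij: "j = i \<or> j = Suc i"
  and s: "dpt T n i <= s" "s <= dpt T n (Suc i)" and t: "dpt T n j <= t" "t <= dpt T n (Suc j)" and st: "s <= t"
 have n1: "1 <= n" using n n0(1) by simp
 have nn: "0 <= W n i" "0 <= W n j" using W0 i j by auto
 have "norm (\<Xi> s t) <= B * W n i + B * W n j + davie_const d c * ((1 + B) * (W n i + W n j))"
 proof (rule two_cells_bound[OF ij s(1) st t(2), where b = "%k. B * W n k"])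
  fix k s t assume "k = i \<or> k = j" "dpt T n k <= s" "s <= t" "t <= dpt T n (Suc k)"
  then show "norm (\<Xi> s t) <= B * W n k" using i j by (intro xi n) auto
 next
  fix r assume r: "r = dpt T n (Suc i)" and jS: "j = Suc i" and sr: "s <= r" and rt: "r <= t"
  define u where "u = max (U n i) (U n j)"
  have u: "0 <= u" "u <= 1" "U n i <= u" "U n j <= u"       using U0[OF i] U0[OF j] n0(2)[OF n i] n0(2)[OF n j] by (auto simp: u_def)
  have sq: "(U n i)\<^sup>2 <= u\<^sup>2" "(U n j)\<^sup>2 <= u\<^sup>2" using u U0 i j by (auto intro!: power_mono)
  have ch: "XX s t = XX s r + XX r t + tensor (X r - X s) (X t - X r)"
   using chen s t sr rt dpt_cell_bounds[OF T i] dpt_cell_bounds[OF T j] unfolding chen_def by auto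
  have X1: "norm (X r - X s) <= u" "norm (XX s r) <= u\<^sup>2"
   using cell_X[OF n1 i s(1) sr] r u(3) sq(1) by auto
  have X2: "norm (X t - X r) <= u" "norm (XX r t) <= u\<^sup>2"
   using cell_X[OF n1 j _ rt t(2)] r jS u(4) sq(2) by auto
  have x: "norm (\<Xi> s r) <= B * W n i" using xi[OF n i s(1) sr] r by simp
  then have x1: "norm (\<Xi> s r) <= 1" using n0(3)[OF n i] by linarith
  have "norm (\<Xi> s t - \<Xi> s r - \<Xi> r t) <= davie_const d c * (u ^ 3 + u * norm (\<Xi> s r))"
   using davie_remainder_step[OF f(1) ch u(1,2) X1(1) X2(1) X1(2) X2(2) x1 f(2)[symmetric] refl]
   unfolding davie_const_def Let_def d of_nat_mult of_nat_numeral .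
  also have "\<dots> <= davie_const d c * ((1 + B) * (W n i + W n j))"
  proof (intro mult_left_mono const_nonneg)
   have "u ^ 3 <= W n i + W n j"
    using cube_le_W[OF i] cube_le_W[OF j] nn by (auto simp: u_def max_def)
   moreover have "u * norm (\<Xi> s r) <= 1 * (B * W n i)" using u x by (intro mult_mono) auto
   moreover have "(1 + B) * (W n i + W n j) = W n i + W n j + B * W n i + B * W n j" by (simp add: algebra_simps)
   moreover have "0 <= B * W n j" using K nn by simp
   ultimately show "u ^ 3 + u * norm (\<Xi> s r) <= (1 + B) * (W n i + W n j)" by linarith
  qed
  finally show "norm (\<Xi> s t - \<Xi> s r - \<Xi> r t) <= davie_const d c * ((1 + B) * (W n i + W n j))" .
 qed (use nn K const_nonneg in simp_all)
 also have "\<dots> = adjacent_const d c B * W n i + adjacent_const d c B * W n j"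
  by (simp add: adjacent_const_def algebra_simps)
 finally show "norm (\<Xi> s t) <= adjacent_const d c B * W n i + adjacent_const d c B * W n j" .
qed

lemma second_level_adjacent:
 assumes n: "1 <= n"
 shows "cell_dominated T XX (%n i. 2 * (U n i)\<^sup>2) n"
 unfolding cell_dominated_def
proof (intro allI impI)
 fix i j s t assume i: "i < 2 ^ n" and j: "j < (2::nat) ^ n" and ij: "j = i \<or> j = Suc i"
  and s: "dpt T n i <= s" "s <= dpt T n (Suc i)" and t: "dpt T n j <= t" "t <= dpt T n (Suc j)" and st: "s <= t"
 have "norm (XX s t) <= (U n i)\<^sup>2 + (U n j)\<^sup>2 + U n i * U n j"
 proof (rule two_cells_bound[OF ij s(1) st t(2), where b = "%k. (U n k)\<^sup>2"])
  fix k s t assume "k = i \<or> k = j" "dpt T n k <= s" "s <= t" "t <= dpt T n (Suc k)"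
  then show "norm (XX s t) <= (U n k)\<^sup>2" using i j by (intro cell_X n) auto
 next
  fix r assume r: "r = dpt T n (Suc i)" and jS: "j = Suc i" and sr: "s <= r" and rt: "r <= t"
  have "XX s t = XX s r + XX r t + tensor (X r - X s) (X t - X r)"
   using chen s t sr rt dpt_cell_bounds[OF T i] dpt_cell_bounds[OF T j] unfolding chen_def by auto
  then have "norm (XX s t - XX s r - XX r t) <= norm (X r - X s) * norm (X t - X r)"
   using norm_tensor_le[of "X r - X s" "X t - X r"] by simp
  also have "\<dots> <= U n i * U n j"
   using cell_X(1)[OF n i s(1) sr] cell_X(1)[OF n j _ rt t(2)] r jS U0[OF i] by (intro mult_mono) auto
  finally show "norm (XX s t - XX s r - XX r t) <= U n i * U n j" .
 qed (use U0 i j in simp_all)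
 also have "\<dots> <= 2 * (U n i)\<^sup>2 + 2 * (U n j)\<^sup>2"
  using sum_squares_bound[of "U n i" "U n j"] U0[OF i] U0[OF j] mult_nonneg_nonneg[OF U0[OF i] U0[OF j]] by linarith
 finally show "norm (XX s t) <= 2 * (U n i)\<^sup>2 + 2 * (U n j)\<^sup>2" .
qed

lemma remainder_eq: "R s t = \<Xi> s t + contract (step_op f (Y s)) (XX s t)"
 by (simp add: remainder_def incr_def davie_remainder_def tensor_map.rep_eq)

lemma contract_step_op_le: "norm (contract (step_op f (Y s)) (XX s t)) <= d * c\<^sup>2 * norm (XX s t)"
proof -
 have "norm (contract (step_op f (Y s)) (XX s t)) <= d * norm (step_op f (Y s)) * norm (XX s t)"
  unfolding d by (rule norm_contract_le)
 also have "\<dots> <= d * c\<^sup>2 * norm (XX s t)"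
  using norm_step_op_le[OF f(1), of "Y s"] f(2) d by (intro mult_right_mono mult_left_mono) auto
 finally show ?thesis .
qed

lemma remainder_le: "norm (R s t) <= d * c\<^sup>2 * norm (XX s t) + norm (\<Xi> s t)"
 unfolding remainder_eq using contract_step_op_le[of s t] norm_triangle_ineq[of "\<Xi> s t" "contract (step_op f (Y s)) (XX s t)"] by linarith

lemma path_increment_le: "norm (Y t - Y s) <= c * norm (X t - X s) + norm (R s t)"
proof -
 have "Y t - Y s = f (Y s) *v (X t - X s) + R s t" by (simp add: remainder_def incr_def tensor_map.rep_eq)
 then have "norm (Y t - Y s) <= norm (f (Y s) *v (X t - X s)) + norm (R s t)" by (simp add: norm_triangle_ineq)
 moreover have "norm (f (Y s) *v (X t - X s)) <= c * norm (X t - X s)"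
  using Cb2_norm_le(1)[OF f(1), of "Y s"] f(2)
  by (intro order_trans[OF norm_matrix_vector_mult_le] mult_right_mono) auto
 ultimately show ?thesis by linarith
qed

lemma remainder_adjacent:
 assumes n: "n0 <= n"
 shows "cell_dominated T R (%n i. 2 * d * c\<^sup>2 * (U n i)\<^sup>2 + adjacent_const d c B * W n i) n"
 unfolding cell_dominated_def
proof (intro allI impI)
 fix i j s t assume h: "i < 2 ^ n" "j < (2::nat) ^ n" "j = i \<or> j = Suc i"
  "dpt T n i <= s" "s <= dpt T n (Suc i)" "dpt T n j <= t" "t <= dpt T n (Suc j)" "s <= t"
 have "1 <= n" using n n0(1) by simp
 have "d * c\<^sup>2 * norm (XX s t) <= d * c\<^sup>2 * (2 * (U n i)\<^sup>2 + 2 * (U n j)\<^sup>2)"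
  using d by (intro mult_left_mono cell_dominatedD[OF second_level_adjacent[OF \<open>1 <= n\<close>] h]) simp
 moreover have "norm (\<Xi> s t) <= adjacent_const d c B * W n i + adjacent_const d c B * W n j"
  by (rule cell_dominatedD[OF davie_remainder_adjacent[OF n] h])
 ultimately show "norm (R s t) <= 2 * d * c\<^sup>2 * (U n i)\<^sup>2 + adjacent_const d c B * W n i
   + (2 * d * c\<^sup>2 * (U n j)\<^sup>2 + adjacent_const d c B * W n j)"
  using remainder_le[of s t] by (simp add: algebra_simps)
qed

lemma global_bounds:
 assumes st: "0 <= s" "s <= t" "t <= T"
 shows "norm (R s t) <= path_max d c n0"
  "norm (\<Xi> s t) <= path_max d c n0 + d * c\<^sup>2 * (2 ^ n0 * (1 + 2 ^ n0 * 2 ^ n0))"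
proof -
 have Xg: "norm (X t - X s) <= 2 ^ n0 * (1 + 0)" if "0 <= s" "s <= t" "t <= T" for s t
 proof (rule all_cells_bound[where A = "%s t. X t - X s", OF T that])
  fix i s t assume h: "i < (2::nat) ^ n0" "dpt T n0 i <= s" "s <= t" "t <= dpt T n0 (Suc i)"
  show "norm (X t - X s) <= 1" using cell_X(1)[OF n0(1) h] n0(2)[OF order_refl h(1)] by linarith
 qed auto
 have XXg: "norm (XX s t) <= 2 ^ n0 * (1 + 2 ^ n0 * 2 ^ n0)"
 proof (rule all_cells_bound[OF T st])
  fix i s t assume h: "i < (2::nat) ^ n0" "dpt T n0 i <= s" "s <= t" "t <= dpt T n0 (Suc i)"
  have "norm (XX s t) <= (U n0 i)\<^sup>2" by (rule cell_X(2)[OF n0(1) h])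
  also have "\<dots> <= 1" using U0[OF h(1)] n0(2)[OF order_refl h(1)] by (simp add: power_le_one)
  finally show "norm (XX s t) <= 1" .
 next
  fix s r t assume h: "0 <= s" "s <= r" "r <= t" "t <= T"
  have "XX s t = XX s r + XX r t + tensor (X r - X s) (X t - X r)" using chen h unfolding chen_def by auto
  then have "norm (XX s t - XX s r - XX r t) <= norm (X r - X s) * norm (X t - X r)"
   using norm_tensor_le[of "X r - X s" "X t - X r"] by simp
  also have "\<dots> <= 2 ^ n0 * 2 ^ n0" using Xg[of s r] Xg[of r t] h by (intro mult_mono) auto
  finally show "norm (XX s t - XX s r - XX r t) <= 2 ^ n0 * 2 ^ n0" .
 qed (use chen_diag[OF chen, of 0] T in auto)
 have Yg: "norm (Y t - Y s) <= 2 ^ n0 * (c + d * c\<^sup>2 + 1 + 0)"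
 proof (rule all_cells_bound[where A = "%s t. Y t - Y s", OF T st])
  fix i s t assume h: "i < (2::nat) ^ n0" "dpt T n0 i <= s" "s <= t" "t <= dpt T n0 (Suc i)"
  note U1 = U0[OF h(1)] n0(2)[OF order_refl h(1)]
  have "norm (XX s t) <= (U n0 i)\<^sup>2" by (rule cell_X(2)[OF n0(1) h])
  also have "\<dots> <= 1" using U1 by (simp add: power_le_one)
  finally have "d * c\<^sup>2 * norm (XX s t) <= d * c\<^sup>2 * 1" using d by (intro mult_left_mono) auto
  moreover have "c * norm (X t - X s) <= c * 1" using cell_X(1)[OF n0(1) h] U1 c0 by (intro mult_left_mono) auto
  moreover have "norm (\<Xi> s t) <= 1" using xi[OF order_refl h] n0(3)[OF order_refl h(1)] by linarith
  ultimately show "norm (Y t - Y s) <= c + d * c\<^sup>2 + 1"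
   using increment_le_davie_remainder[OF f(1), of Y t s X XX] unfolding f(2) d[symmetric] by linarith
 qed (use c0 d in auto)
 have "R s t = (Y t - Y s) - f (Y s) *v (X t - X s)" by (simp add: remainder_def incr_def tensor_map.rep_eq)
 then have "norm (R s t) <= norm (Y t - Y s) + norm (f (Y s) *v (X t - X s))" by (simp only: norm_triangle_ineq4)
 moreover have "norm (f (Y s) *v (X t - X s)) <= c * 2 ^ n0"
  using Cb2_norm_le(1)[OF f(1), of "Y s"] f(2) Xg[OF st] c0
  by (intro order_trans[OF norm_matrix_vector_mult_le] mult_mono) auto
 ultimately show Rg: "norm (R s t) <= path_max d c n0" using Yg by (simp add: path_max_def)
 have "\<Xi> s t = R s t - contract (step_op f (Y s)) (XX s t)" by (simp add: remainder_eq)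
 then have "norm (\<Xi> s t) <= norm (R s t) + norm (contract (step_op f (Y s)) (XX s t))" by (simp only: norm_triangle_ineq4)
 moreover have "d * c\<^sup>2 * norm (XX s t) <= d * c\<^sup>2 * (2 ^ n0 * (1 + 2 ^ n0 * 2 ^ n0))" using d by (intro mult_left_mono XXg) simp
 ultimately show "norm (\<Xi> s t) <= path_max d c n0 + d * c\<^sup>2 * (2 ^ n0 * (1 + 2 ^ n0 * 2 ^ n0))"
  using Rg contract_step_op_le[of s t] by linarith
qed

lemma W_le: "1 <= n ==> i < 2 ^ n ==> W n i <= K' * 2 powr (- 3 * \<kappa> * n)"
 by (rule cell_bound_third_le[OF w(1,2)])

text \<open>Interpolation between the \<open>l^(p/3)\<close> bound and the pointwise bound on
  \<open>W\<close>: write \<open>W = W powr a * W powr (1 - a)\<close> and spend the pointwise decay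
  on the second factor. \<open>a = 1/3\<close> yields the exponent \<open>p\<close>, and
  \<open>a = 2/3\<close> yields \<open>p / 2\<close>.\<close>

lemma W_rescaled:
 assumes a: "0 < a" "a < 1" and C: "0 <= C"
 obtains v where "cell_bound (p / ennreal (3 * a)) (%n i. C * W n i) v"
  "\<And>n. 1 <= n ==> v n <= C * K' * 2 powr (- (3 * a * \<alpha> + 3 * (1 - a) * \<kappa>) * n)"
proof (rule that[of "%n. w n powr a * (C * (K' * 2 powr (- 3 * \<kappa> * n)) powr (1 - a))"])
 have q3: "p / ennreal (3 * a) = p / 3 / ennreal a" using third_divide[of "3 * a" p] a by simp
 have p3: "0 < p / 3" using ennreal_divide_pos[OF p(1), of 3] by simp
 show "cell_bound (p / ennreal (3 * a)) (%n i. C * W n i) (%n. w n powr a * (C * (K' * 2 powr (- 3 * \<kappa> * n)) powr (1 - a)))"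
 proof (rule cell_bound_rescale[OF w(1) a(1) p3 q3])
  fix n i assume n: "1 <= (n::nat)" "i < (2::nat) ^ n"
  have "W n i = W n i powr a * W n i powr (1 - a)"
   using W0[OF n(2)] by (cases "W n i = 0") (auto simp flip: powr_add)
  also have "\<dots> <= W n i powr a * (K' * 2 powr (- 3 * \<kappa> * n)) powr (1 - a)"
   using a W0[OF n(2)] by (intro mult_left_mono powr_mono2 W_le n) auto
  finally have "C * W n i <= C * (W n i powr a * (K' * 2 powr (- 3 * \<kappa> * n)) powr (1 - a))"
   using C by (rule mult_left_mono)
  then show "0 <= C * W n i \<and> C * W n i <= W n i powr a * (C * (K' * 2 powr (- 3 * \<kappa> * n)) powr (1 - a))"
   using C W0[OF n(2)] by (simp add: mult_ac)
 qed (use C in simp)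
 fix n :: nat assume n: "1 <= n"
 have "w n powr a <= (K' * 2 powr (- 3 * \<alpha> * n)) powr a"
  using a cell_bound_nonneg(1)[OF w(1) n] by (intro powr_mono2 w(2) n) auto
 then have "w n powr a * (C * (K' * 2 powr (- 3 * \<kappa> * n)) powr (1 - a))
   <= (K' * 2 powr (- 3 * \<alpha> * n)) powr a * (C * (K' * 2 powr (- 3 * \<kappa> * n)) powr (1 - a))"
  using C by (intro mult_right_mono) auto
 also have "\<dots> = C * (K' powr a * K' powr (1 - a)) * (2 powr (- 3 * \<alpha> * n * a) * 2 powr (- 3 * \<kappa> * n * (1 - a)))"
  using K(2) by (simp add: powr_mult powr_powr)
 also have "K' powr a * K' powr (1 - a) = K'" using K(2) by (cases "K' = 0") (auto simp flip: powr_add)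
 also have "2 powr (- 3 * \<alpha> * n * a) * 2 powr (- 3 * \<kappa> * n * (1 - a)) = 2 powr (- (3 * a * \<alpha> + 3 * (1 - a) * \<kappa>) * n)"
  by (simp only: powr_add[symmetric]) (simp add: algebra_simps)
 finally show "w n powr a * (C * (K' * 2 powr (- 3 * \<kappa> * n)) powr (1 - a))
  <= C * K' * 2 powr (- (3 * a * \<alpha> + 3 * (1 - a) * \<kappa>) * n)" .
qed

text \<open>In the square of \<open>U\<close> one factor is measured in \<open>l^p\<close> and the
  other pointwise. The first-order remainder thus has order \<open>\<alpha> + \<kappa>\<close> in
  \<open>L^p\<close>, better than a path of order \<alpha>, so \<open>Y\<close> inherits the Besov
  regularity of \<open>X\<close>.\<close>

lemma remainder_Lp:
 assumes h: "h \<in> {0..T}"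
 shows "Lp p T R h <= ennreal (remainder_const d c K K' B n0 * h powr (\<alpha> + \<kappa>))"
proof -
 obtain u where u: "cell_bound p U u" "admissible \<alpha> K u" using U unfolding cell_array_def by blast
 have one: "x = x / ennreal 1" for x :: ennreal by (simp add: divide_ennreal_def)
 have s: "cell_bound p (%n i. 2 * d * c\<^sup>2 * (U n i)\<^sup>2) (%n. u n powr 1 * (2 * d * c\<^sup>2 * (K * 2 powr (- \<kappa> * n))))"
 proof (rule cell_bound_rescale[OF u(1) _ p(1) one])
  fix n i assume n: "1 <= (n::nat)" "i < (2::nat) ^ n"
  have "U n i * U n i <= U n i * (K * 2 powr (- \<kappa> * n))"
   using cell_array_le[OF U n] U0[OF n(2)] by (intro mult_left_mono) (auto simp: \<kappa>_def)
  then have "2 * d * c\<^sup>2 * (U n i * U n i) <= 2 * d * c\<^sup>2 * (U n i * (K * 2 powr (- \<kappa> * n)))"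
   by (rule mult_left_mono) (simp add: d)
  moreover have "0 <= 2 * d * c\<^sup>2 * (U n i)\<^sup>2" using d by simp
  ultimately show "0 <= 2 * d * c\<^sup>2 * (U n i)\<^sup>2 \<and> 2 * d * c\<^sup>2 * (U n i)\<^sup>2 <= U n i powr 1 * (2 * d * c\<^sup>2 * (K * 2 powr (- \<kappa> * n)))"
   using U0[OF n(2)] by (simp add: power2_eq_square mult_ac)
 qed (use K d in simp_all)
 obtain v where "cell_bound (p / ennreal (3 * (1 / 3))) (%n i. adjacent_const d c B * W n i) v"
  and v: "\<And>n. 1 <= n ==> v n <= adjacent_const d c B * K' * 2 powr (- (3 * (1 / 3) * \<alpha> + 3 * (1 - 1 / 3) * \<kappa>) * n)"
  using W_rescaled[of "1 / 3" "adjacent_const d c B"] const_nonneg by auto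
 then have cv: "cell_bound p (%n i. adjacent_const d c B * W n i) v" by (simp add: one[symmetric, unfolded ennreal_1])
 let ?K = "2 powr (1 + inv_exp p) * (2 * d * c\<^sup>2 * K\<^sup>2 + adjacent_const d c B * K')"
 have le: "2 powr (1 + inv_exp p) * (u n powr 1 * (2 * d * c\<^sup>2 * (K * 2 powr (- \<kappa> * n))) + v n) <= ?K * 2 powr (- (\<alpha> + \<kappa>) * n)"
  if n: "n0 <= n" for n
 proof -
  have n1: "1 <= n" using n n0(1) by simp
  have un: "0 <= u n" "u n <= K * 2 powr (- \<alpha> * n)" using u(2) n1 by (auto simp: admissible_def)
  have "u n powr 1 * (2 * d * c\<^sup>2 * (K * 2 powr (- \<kappa> * n))) <= (K * 2 powr (- \<alpha> * n)) * (2 * d * c\<^sup>2 * (K * 2 powr (- \<kappa> * n)))"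
   using un K d by (intro mult_right_mono) auto
  also have "\<dots> = 2 * d * c\<^sup>2 * K\<^sup>2 * (2 powr (- \<alpha> * n) * 2 powr (- \<kappa> * n))" by (simp add: power2_eq_square mult_ac)
  also have "2 powr (- \<alpha> * n) * 2 powr (- \<kappa> * n) = 2 powr (- (\<alpha> + \<kappa>) * n)"
   by (simp only: powr_add[symmetric]) (simp add: algebra_simps)
  finally have 1: "u n powr 1 * (2 * d * c\<^sup>2 * (K * 2 powr (- \<kappa> * n))) <= 2 * d * c\<^sup>2 * K\<^sup>2 * 2 powr (- (\<alpha> + \<kappa>) * n)" .
  have "- (3 * (1 / 3) * \<alpha> + 3 * (1 - 1 / 3) * \<kappa>) * n <= - (\<alpha> + \<kappa>) * n"
   using kappa_pos by (intro mult_right_mono) auto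
  then have "v n <= adjacent_const d c B * K' * 2 powr (- (\<alpha> + \<kappa>) * n)"
   using const_nonneg K by (intro order_trans[OF v[OF n1]] mult_left_mono powr_mono) simp_all
  with 1 have "u n powr 1 * (2 * d * c\<^sup>2 * (K * 2 powr (- \<kappa> * n))) + v n
    <= (2 * d * c\<^sup>2 * K\<^sup>2 + adjacent_const d c B * K') * 2 powr (- (\<alpha> + \<kappa>) * n)" by (simp only: distrib_right)
  then show ?thesis unfolding mult.assoc by (intro mult_left_mono) (auto simp: mult.assoc)
 qed
 show ?thesis unfolding remainder_const_def Lp_const_def
 proof (rule cell_power_Lp[OF T _ p(1) cell_bound_add[OF s cv p(1)] n0(1) remainder_adjacent le _ _ _ const_nonneg(3) global_bounds(1) h])
  show "cont2 T R"
   by (intro remainder_cont2 X Y bounded_linear.continuous_on[OF bounded_linear_tensor_map] Cb2_continuous[OF f(1) Y])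
  show "R s s = 0" for s by (simp add: remainder_def incr_def)
  show "0 <= \<alpha> + \<kappa>" using al kappa_pos by simp
  show "0 <= ?K" using const_nonneg K d by simp
 qed auto
qed

text \<open>The order is strictly above \<open>2 * \<alpha>\<close>, so that the controlled
  remainder of \<open>Y\<close> is limited by the second level of the rough path alone.\<close>

lemma davie_remainder_Lp:
 assumes h: "h \<in> {0..T}"
 shows "Lp (p / 2) T \<Xi> h <= ennreal (davie_remainder_const d c K' B n0 * h powr (2 * \<alpha> + \<kappa>))"
proof -
 obtain v where "cell_bound (p / ennreal (3 * (2 / 3))) (%n i. adjacent_const d c B * W n i) v"
  and v: "\<And>n. 1 <= n ==> v n <= adjacent_const d c B * K' * 2 powr (- (3 * (2 / 3) * \<alpha> + 3 * (1 - 2 / 3) * \<kappa>) * n)"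
  using W_rescaled[of "2 / 3" "adjacent_const d c B"] const_nonneg by auto
 then have cv: "cell_bound (p / 2) (%n i. adjacent_const d c B * W n i) v" by simp
 show ?thesis unfolding davie_remainder_const_def Lp_const_def
 proof (rule cell_power_Lp[OF T davie_remainder_cont _ cv n0(1) davie_remainder_adjacent _ davie_remainder_diag_0 _ _ _ global_bounds(2) h])
  show "0 < p / 2" using ennreal_divide_pos[OF p(1), of 2] by simp
  show "v n <= adjacent_const d c B * K' * 2 powr (- (2 * \<alpha> + \<kappa>) * n)" if "n0 <= n" for n
   using v[of n] n0(1) that by simp
  show "0 <= 2 * \<alpha> + \<kappa>" using al kappa_pos by simp
 qed (use const_nonneg K d in auto)
qed

text \<open>The hypothesis of \<open>partition_sum_Lp\<close>, with an arbitrarily small constant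
  for fine partitions. For \<alpha> > 1/3 it follows from the surplus
  \<open>3 * \<alpha> - k > 0\<close>; at 1/3, where both exponents are 1, from the little-o
  estimate.\<close>

lemma davie_remainder_small:
 assumes e: "0 < (\<epsilon>::real)"
 obtains \<eta> where "0 < \<eta>" "\<And>\<theta> h. 0 <= \<theta> ==> \<theta> <= 1 ==> \<theta> < \<eta> ==> h \<in> {0..T} ==>
  Lp (p / 3) T \<Xi> (\<theta> * h) <= ennreal (\<theta> powr max 1 (inv_exp (p / 3)) * (\<epsilon> * h powr (3 * \<alpha>)))"
proof -
 have p3: "0 < p / 3" using ennreal_divide_pos[OF p(1), of 3] by simp
 have cw: "cell_bound (p / 3) (%n i. adjacent_const d c B * W n i) (%n. adjacent_const d c B * w n)"
  using W0 const_nonneg by (intro cell_bound_mono[OF w(1) p3, where c = "adjacent_const d c B"]) auto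
 show ?thesis
 proof (cases "\<alpha> = 1 / 3")
  case True
  have "(%n. 2 ^ n * (adjacent_const d c B * w n)) \<longlonglongrightarrow> 0"
   using tendsto_mult_left[OF w(3)[OF True], of "adjacent_const d c B"] by (simp add: mult_ac)
  from cell_little_o_Lp[OF T davie_remainder_cont p3 cw n0(1) davie_remainder_adjacent this davie_remainder_diag_0 e]
  obtain \<eta> where \<eta>: "0 < \<eta>" "\<And>h. 0 <= h ==> h <= \<eta> ==> Lp (p / 3) T \<Xi> h <= ennreal (\<epsilon> * h)" by blast
  show ?thesis
  proof (rule that[of "\<eta> / T"])
   fix \<theta> h assume \<theta>: "0 <= \<theta>" "\<theta> <= 1" "\<theta> < \<eta> / T" and h: "h \<in> {0..T}"
   have "\<theta> * h <= \<eta> / T * T" using \<theta> h by (intro mult_mono) auto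
   then have "Lp (p / 3) T \<Xi> (\<theta> * h) <= ennreal (\<epsilon> * (\<theta> * h))" using \<theta> h T by (intro \<eta>(2)) auto
   moreover have "max 1 (inv_exp (p / 3)) = 1" using p(2) True by (simp add: inv_exp_third)
   ultimately show "Lp (p / 3) T \<Xi> (\<theta> * h) <= ennreal (\<theta> powr max 1 (inv_exp (p / 3)) * (\<epsilon> * h powr (3 * \<alpha>)))"
    using True \<theta> h by (simp add: mult_ac)
  qed (use \<eta> T in simp)
 next
  case False
  define k where "k = max 1 (inv_exp (p / 3))"
  have k: "k < 3 * \<alpha>" using False al p(2) by (simp add: k_def inv_exp_third)
  obtain M where M: "0 <= M" "\<And>s t. 0 <= s ==> s <= t ==> t <= T ==> norm (\<Xi> s t) <= M"
   using cont2_bounded[OF davie_remainder_cont] by blast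
  define C where "C = Lp_const T (p / 3) (adjacent_const d c B * K') (3 * \<alpha>) M n0"
  have C0: "0 <= C" unfolding C_def using const_nonneg K M T by (intro Lp_const_nonneg) auto
  have L: "Lp (p / 3) T \<Xi> h <= ennreal (C * h powr (3 * \<alpha>))" if h: "h \<in> {0..T}" for h
   unfolding C_def Lp_const_def
  proof (rule cell_power_Lp[OF T davie_remainder_cont p3 cw n0(1) davie_remainder_adjacent _ davie_remainder_diag_0 _ _ M h])
   show "adjacent_const d c B * w n <= adjacent_const d c B * K' * 2 powr (- (3 * \<alpha>) * n)" if "n0 <= n" for n
    using mult_left_mono[OF w(2), of n "adjacent_const d c B"] const_nonneg that n0(1) by (simp add: mult.assoc)
  qed (use al const_nonneg K in auto)
  show ?thesis
  \<comment> \<open>The threshold solves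
    \<open>C * \<theta> powr (3 * \<alpha> - k) <= \<epsilon>\<close>; the added 1 covers
    \<open>C = 0\<close>.\<close>
  proof (rule that[of "(\<epsilon> / (C + 1)) powr (1 / (3 * \<alpha> - k))"])
   fix \<theta> h assume \<theta>: "0 <= \<theta>" "\<theta> <= 1" "\<theta> < (\<epsilon> / (C + 1)) powr (1 / (3 * \<alpha> - k))" and h: "h \<in> {0..T}"
   have "\<theta> powr (3 * \<alpha> - k) <= ((\<epsilon> / (C + 1)) powr (1 / (3 * \<alpha> - k))) powr (3 * \<alpha> - k)"
    using \<theta> k by (intro powr_mono2) auto
   also have "\<dots> = \<epsilon> / (C + 1)" using k e C0 by (simp add: powr_powr)
   finally have "C * \<theta> powr (3 * \<alpha> - k) <= C * (\<epsilon> / (C + 1))" using C0 by (rule mult_left_mono)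
   also have "\<dots> <= \<epsilon>" using C0 e by (simp add: field_simps)
   finally have small: "C * \<theta> powr (3 * \<alpha> - k) <= \<epsilon>" .
   have "\<theta> * h <= 1 * h" using \<theta> h by (intro mult_right_mono) auto
   moreover have "0 <= \<theta> * h" using \<theta> h by simp
   ultimately have "Lp (p / 3) T \<Xi> (\<theta> * h) <= ennreal (C * (\<theta> * h) powr (3 * \<alpha>))" using h by (intro L) auto
   also have "C * (\<theta> * h) powr (3 * \<alpha>) = \<theta> powr k * (C * \<theta> powr (3 * \<alpha> - k) * h powr (3 * \<alpha>))"
   proof -
    have "\<theta> powr (3 * \<alpha>) = \<theta> powr k * \<theta> powr (3 * \<alpha> - k)" by (simp flip: powr_add)
    then show ?thesis using \<theta> h by (simp add: powr_mult)
   qed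
   also have "ennreal \<dots> <= ennreal (\<theta> powr k * (\<epsilon> * h powr (3 * \<alpha>)))"
    using small by (intro ennreal_leI mult_left_mono mult_right_mono) auto
   finally show "Lp (p / 3) T \<Xi> (\<theta> * h) <= ennreal (\<theta> powr max 1 (inv_exp (p / 3)) * (\<epsilon> * h powr (3 * \<alpha>)))"
    by (simp only: k_def)
  qed (use e C0 in simp)
 qed
qed

lemma partition_sums_vanish:
 assumes e: "0 < (\<epsilon>::real)"
 shows "\<exists>\<eta>>0. \<forall>N \<tau>. unit_partition N \<tau> \<and> mesh N \<tau> < \<eta> -->
  besov2_norm (3 * \<alpha>) (p / 3) \<infinity> T (partition_sum \<Xi> N \<tau>) < ennreal \<epsilon>"
proof -
 have p3: "0 < p / 3" using ennreal_divide_pos[OF p(1), of 3] by simp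
 have e2: "0 < \<epsilon> / 2" using e by simp
 obtain \<eta> where \<eta>: "0 < \<eta>" "\<And>\<theta> h. 0 <= \<theta> ==> \<theta> <= 1 ==> \<theta> < \<eta> ==> h \<in> {0..T} ==>
  Lp (p / 3) T \<Xi> (\<theta> * h) <= ennreal (\<theta> powr max 1 (inv_exp (p / 3)) * (\<epsilon> / 2 * h powr (3 * \<alpha>)))"
  using davie_remainder_small[OF e2] by blast
 have "besov2_norm (3 * \<alpha>) (p / 3) \<infinity> T (partition_sum \<Xi> N \<tau>) < ennreal \<epsilon>"
  if \<tau>: "unit_partition N \<tau>" "mesh N \<tau> < \<eta>" for N \<tau>
 proof -
  have "besov2_norm (3 * \<alpha>) (p / 3) \<infinity> T (partition_sum \<Xi> N \<tau>) <= ennreal (\<epsilon> / 2)"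
  proof (rule besov2_norm_top_le)
   fix h assume h: "h \<in> {0..T}"
   show "Lp (p / 3) T (partition_sum \<Xi> N \<tau>) h <= ennreal (\<epsilon> / 2 * h powr (3 * \<alpha>))"
   proof (rule partition_sum_Lp[OF T davie_remainder_cont p3 \<tau>(1) h])
    fix i assume i: "i < N"
    have "\<tau> (Suc i) - \<tau> i <= mesh N \<tau>" unfolding mesh_def using i by (intro Max_ge) auto
    then show "Lp (p / 3) T \<Xi> ((\<tau> (Suc i) - \<tau> i) * h)
     <= ennreal ((\<tau> (Suc i) - \<tau> i) powr max 1 (inv_exp (p / 3)) * (\<epsilon> / 2 * h powr (3 * \<alpha>)))"
     using unit_partition_bounds[OF \<tau>(1) i] \<tau>(2) by (intro \<eta>(2) h) auto
   qed (use e in simp)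
  qed (use e al in auto)
  also have "\<dots> < ennreal \<epsilon>" using e by (simp add: ennreal_less_iff)
  finally show ?thesis .
 qed
 then show ?thesis using \<eta>(1) by blast
qed

end

section \<open>Existence with a uniform bound\<close>

text \<open>The constant of \<open>besov2_norm_quasi_triangle\<close>.\<close>

definition quasi :: "ennreal => ennreal => real => ennreal" where
 "quasi p q c = ennreal (c * 2 * 2 powr inv_exp p * 2 * 2 powr inv_exp q)"

lemma quasi_finite: "x < \<infinity> ==> y < \<infinity> ==> quasi p q c * (x + y) < \<infinity>"
 by (simp add: quasi_def ennreal_mult_less_top)

context besov_exponents
begin

lemma geometric_summable: "0 < k ==> summable (%n. C * 2 powr (- k * real n))"
 using sums_summable[OF powr_geometric_sums[of "- k" 0]] by (intro summable_mult) simp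

text \<open>All constants are chosen from \<open>c\<close> and \<open>\<rho>\<close> before the
  rough path is given: \<open>K\<close> bounds its arrays, \<open>K'\<close> their tree sums,
  \<open>B\<close> is the tree weight, and \<open>n0\<close> is a generation from which the
  geometric majorants \<open>u\<close> and \<open>B * v\<close> are at most 1.\<close>

lemma davie_path_exists:
 assumes c: "0 <= c" and rho: "0 <= \<rho>" and d: "d = real CARD('n)"
 obtains K K' B n0 where "\<And>(X :: real => real ^ 'n) XX (f :: real ^ 'm => real ^ 'n ^ 'm) y.
  continuous_on {0..T} X ==> cont2 T XX ==> chen T X XX ==>
  besov2_norm \<alpha> p q T (incr X) <= ennreal \<rho> ==> besov2_norm (2 * \<alpha>) (p / 2) (q / 2) T XX <= ennreal (\<rho>\<^sup>2) ==>
  Cb2 f ==> C2_norm f = c ==> \<exists>Y U w. Y 0 = y \<and> davie_path T \<alpha> p q K K' B c d n0 X XX f Y U w"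
proof -
 obtain K where K: "0 <= K" and arr: "\<And>(X :: real => real ^ 'n) XX. continuous_on {0..T} X ==> cont2 T XX ==> chen T X XX ==>
  besov2_norm \<alpha> p q T (incr X) <= ennreal \<rho> ==> besov2_norm (2 * \<alpha>) (p / 2) (q / 2) T XX <= ennreal (\<rho>\<^sup>2) ==>
  \<exists>U. cell_array K U \<and> dominated T X XX U"
  using rough_path_array[where 'n = 'n, OF rho] by blast
 obtain K' where K': "0 <= K'" and tree: "\<And>U. cell_array K U ==> tree_summable (%n i. U n i ^ 3) \<and>
  (\<exists>w. cell_bound (p / 3) (tree_sum (%n i. U n i ^ 3)) w \<and> (\<forall>n\<ge>1. w n <= K' * 2 powr (- 3 * \<alpha> * n)) \<and>
   (\<alpha> = 1 / 3 --> (%n. 2 ^ n * w n) \<longlonglongrightarrow> 0))"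
  using cell_array_tree_sum[OF K] by blast
 define u where "u n = K * 2 powr (- \<kappa> * real n)" for n :: nat
 define v where "v n = K' * 2 powr (- (3 * \<kappa>) * real n)" for n :: nat
 have u: "summable u" "\<And>n. 0 <= u n"
  unfolding u_def using geometric_summable[OF kappa_pos, of K] K by (simp_all only: mult_nonneg_nonneg powr_ge_zero)
 have v: "summable v" unfolding v_def using kappa_pos by (intro geometric_summable) simp
 define B where "B = tree_weight (davie_const d c) u 0"
 have B: "0 <= B" using davie_const_nonneg[of d c] c d by (simp add: B_def tree_weight_def)
 have "(%n. B * v n) \<longlonglongrightarrow> B * 0" by (intro tendsto_mult_left summable_LIMSEQ_zero v)
 then have "\<forall>\<^sub>F n in sequentially. B * v n < 1" by (intro order_tendstoD(2)) auto
 moreover have "\<forall>\<^sub>F n in sequentially. u n < 1" using summable_LIMSEQ_zero[OF u(1)] by (intro order_tendstoD(2)) auto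
 ultimately have "\<forall>\<^sub>F n in sequentially. B * v n < 1 \<and> u n < 1" by (rule eventually_conj)
 then obtain n1 where n1: "\<And>n. n1 <= n ==> B * v n < 1 \<and> u n < 1" by (auto simp: eventually_sequentially)
 define n0 where "n0 = max 1 n1"
 have n0: "1 <= n0" "\<And>n. n0 <= n ==> B * v n <= 1" "\<And>n. n0 <= n ==> u n <= 1"
  using n1 by (auto simp: n0_def intro: less_imp_le)
 show ?thesis
 proof (rule that)
  fix X :: "real => real ^ 'n" and XX and f :: "real ^ 'm => real ^ 'n ^ 'm" and y
  assume X: "continuous_on {0..T} X" and XX: "cont2 T XX" and chen: "chen T X XX"
   and b: "besov2_norm \<alpha> p q T (incr X) <= ennreal \<rho>" "besov2_norm (2 * \<alpha>) (p / 2) (q / 2) T XX <= ennreal (\<rho>\<^sup>2)"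
   and f: "Cb2 f" "C2_norm f = c"
  obtain U where U: "cell_array K U" and dom: "dominated T X XX U" using arr[OF X XX chen b] by blast
  obtain w where ts: "tree_summable (%n i. U n i ^ 3)" and w1: "cell_bound (p / 3) (tree_sum (%n i. U n i ^ 3)) w"
   and w2: "\<And>n. 1 <= n ==> w n <= K' * 2 powr (- 3 * \<alpha> * n)" and w3: "\<alpha> = 1 / 3 ==> (%n. 2 ^ n * w n) \<longlonglongrightarrow> 0"
   using tree[OF U] by blast
  have Uu: "U n i <= u n" if "1 <= n" "i < 2 ^ n" for n i
   using cell_array_le[OF U that] by (simp only: u_def \<kappa>_def)
  have Wv: "tree_sum (%n i. U n i ^ 3) n i <= v n" if "1 <= n" "i < 2 ^ n" for n i
   using cell_bound_third_le[OF w1 w2 that] by (simp add: v_def)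
  have cXX: "continuous_on {s..T} (XX s)" if "0 <= s" for s
   using that by (intro continuous_on_compose2[OF XX, of _ "%t. (s, t)", simplified])
    (auto simp: simplex2_def intro: continuous_intros)
  have n0': "tree_weight (davie_const CARD('n) (C2_norm f)) u 0 * v n <= 1" if "n0 <= n" for n
   using n0(2)[OF that] by (simp add: B_def f(2) d)
  obtain Y where Y: "continuous_on {0..T} Y" "Y 0 = y"
   "\<And>n i s t. n0 <= n ==> i < 2 ^ n ==> dpt T n i <= s ==> s <= t ==> t <= dpt T n (Suc i) ==>
    norm (davie_remainder f X XX Y s t)
    <= tree_weight (davie_const CARD('n) (C2_norm f)) u 0 * tree_sum (%n i. U n i ^ 3) n i"
   using davie_existence[OF T chen dom f(1) ts Uu u Wv summable_LIMSEQ_zero[OF v] X cXX n0(1,3) n0', of y] by blast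
  have "davie_path T \<alpha> p q K K' B c d n0 X XX f Y U w"
  proof (unfold_locales)
   show "norm (davie_remainder f X XX Y s t) <= B * tree_sum (%n i. U n i ^ 3) n i"
    if "n0 <= n" "i < 2 ^ n" "dpt T n i <= s" "s <= t" "t <= dpt T n (Suc i)" for n i s t
    using Y(3)[OF that] by (simp add: B_def f(2) d)
   fix n i assume n: "n0 <= n" and i: "i < (2::nat) ^ n"
   have m: "1 <= n" using n n0(1) by simp
   show "U n i <= 1" using Uu[OF m i] n0(3)[OF n] by linarith
   show "B * tree_sum (%n i. U n i ^ 3) n i <= 1"
    using mult_left_mono[OF Wv[OF m i] B] n0(2)[OF n] by linarith
  qed (fact d K K' B X XX chen f U dom ts w1 w2 w3 n0(1) Y(1))+
  then show "\<exists>Y U w. Y 0 = y \<and> davie_path T \<alpha> p q K K' B c d n0 X XX f Y U w" using Y(2) by blast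
 qed
qed

text \<open>Increments of \<open>Y\<close> inherit order \<alpha> from \<open>X\<close> and the
  better first-order remainder; the controlled remainder inherits order \<open>2 * \<alpha>\<close>
  from \<open>XX\<close> and the Davie remainder; the derivative is Lipschitz in \<open>Y\<close>.
  For the integrand, Taylor's formula bounds the remainder by the squared increment of
  \<open>Y\<close> plus the remainder of \<open>Y\<close>.\<close>

lemma rde_solution_exists:
 assumes c: "0 <= c" and rho: "0 <= \<rho>"
 obtains M where "M < \<infinity>" "\<And>(X :: real => real ^ 'n) XX (f :: real ^ 'm => real ^ 'n ^ 'm) y.
  continuous_on {0..T} X ==> cont2 T XX ==> chen T X XX ==>
  besov2_norm \<alpha> p q T (incr X) <= ennreal \<rho> ==> besov2_norm (2 * \<alpha>) (p / 2) (q / 2) T XX <= ennreal (\<rho>\<^sup>2) ==>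
  Cb2 f ==> C2_norm f = c ==>
  \<exists>Y Y'. rde_solution \<alpha> p q T X XX f y Y Y' \<and> controlled_seminorm \<alpha> p q T X Y Y' <= M"
proof -
 define d where "d = real CARD('n)"
 have p2: "0 < p / 2" and q2: "0 < q / 2"
  using ennreal_divide_pos[OF p(1), of 2] ennreal_divide_pos[OF q(1), of 2] by simp_all
 obtain K K' B n0 where ex: "\<And>(X :: real => real ^ 'n) XX (f :: real ^ 'm => real ^ 'n ^ 'm) y.
  continuous_on {0..T} X ==> cont2 T XX ==> chen T X XX ==>
  besov2_norm \<alpha> p q T (incr X) <= ennreal \<rho> ==> besov2_norm (2 * \<alpha>) (p / 2) (q / 2) T XX <= ennreal (\<rho>\<^sup>2) ==>
  Cb2 f ==> C2_norm f = c ==> \<exists>Y U w. Y 0 = y \<and> davie_path T \<alpha> p q K K' B c d n0 X XX f Y U w"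
  using davie_path_exists[where 'n = 'n and 'm = 'm, OF c rho d_def] by blast
 obtain K3 where K3: "0 <= K3" "\<And>C (E :: real => real => real ^ 'm). 0 <= C ==>
  (\<forall>h\<in>{0..T}. Lp p T E h <= ennreal (C * h powr (\<alpha> + \<kappa>))) ==> besov2_norm \<alpha> p q T E <= ennreal (C * K3)"
  using besov2_norm_power_bound[where 'v = "real ^ 'm", OF T q(1), of \<alpha> "\<alpha> + \<kappa>" p] kappa_pos al by auto
 obtain K4 where K4: "0 <= K4" "\<And>C (E :: real => real => real ^ 'm). 0 <= C ==>
  (\<forall>h\<in>{0..T}. Lp (p / 2) T E h <= ennreal (C * h powr (2 * \<alpha> + \<kappa>))) ==>
  besov2_norm (2 * \<alpha>) (p / 2) (q / 2) T E <= ennreal (C * K4)"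
  using besov2_norm_power_bound[where 'v = "real ^ 'm", OF T q2, of "2 * \<alpha>" "2 * \<alpha> + \<kappa>" "p / 2"] kappa_pos al by auto
 \<comment> \<open>\<open>MY\<close> will bound the increments of \<open>Y\<close> and
   \<open>MR\<close> its controlled remainder; both are fixed before the rough path.\<close>
 define MY where "MY = quasi p q (c + 1) * (ennreal \<rho> + ennreal (remainder_const d c K K' B n0 * K3))"
 define MR where "MR = quasi (p / 2) (q / 2) (d * c\<^sup>2 + 1) * (ennreal (\<rho>\<^sup>2) + ennreal (davie_remainder_const d c K' B n0 * K4))"
 have MY: "MY < \<infinity>" and MR: "MR < \<infinity>" unfolding MY_def MR_def by (intro quasi_finite; simp)+
 show ?thesis
 proof (rule that[of "quasi p q (c + 1) * (MY + MY) + MR"])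
  show "quasi p q (c + 1) * (MY + MY) + MR < \<infinity>" using quasi_finite[OF MY MY] MR by simp
  fix X :: "real => real ^ 'n" and XX and f :: "real ^ 'm => real ^ 'n ^ 'm" and y
  assume X: "continuous_on {0..T} X" "cont2 T XX" "chen T X XX"
   and b: "besov2_norm \<alpha> p q T (incr X) <= ennreal \<rho>" "besov2_norm (2 * \<alpha>) (p / 2) (q / 2) T XX <= ennreal (\<rho>\<^sup>2)"
   and f: "Cb2 f" "C2_norm f = c"
  obtain Y U w where Y0: "Y 0 = y" and "davie_path T \<alpha> p q K K' B c d n0 X XX f Y U w" using ex[OF X b f] by blast
  then interpret davie_path T \<alpha> p q K K' B c d n0 X XX f Y U w by simp
  let ?Y' = "%t. tensor_map (f (Y t))"
  have nonneg: "0 <= remainder_const d c K K' B n0" "0 <= davie_remainder_const d c K' B n0"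
   unfolding remainder_const_def davie_remainder_const_def using const_nonneg K T d by (intro Lp_const_nonneg; simp)+
  have cf: "continuous_on {0..T} (%t. f (Y t))" and cY': "continuous_on {0..T} ?Y'"
   and cG: "continuous_on {0..T} (%t. step_op f (Y t))"
   by (intro Cb2_continuous[OF f(1) Y] step_op_continuous[OF f(1) Y] bounded_linear.continuous_on[OF bounded_linear_tensor_map])+
  note cR = remainder_cont2[OF X(1) Y cY']
  have bR1: "besov2_norm \<alpha> p q T R <= ennreal (remainder_const d c K K' B n0 * K3)"
   using remainder_Lp by (intro K3 nonneg ballI)
  have bXi: "besov2_norm (2 * \<alpha>) (p / 2) (q / 2) T \<Xi> <= ennreal (davie_remainder_const d c K' B n0 * K4)"
   using davie_remainder_Lp by (intro K4 nonneg ballI)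
  have "besov2_norm \<alpha> p q T (incr Y) <= quasi p q (c + 1) * (besov2_norm \<alpha> p q T (incr X) + besov2_norm \<alpha> p q T R)"
   unfolding quasi_def
  proof (rule besov2_norm_quasi_triangle[OF T incr_cont2[OF X(1)] cR p(1) q(1)])
   fix s t
   have "norm (incr Y s t) <= c * norm (incr X s t) + norm (R s t)" using path_increment_le[of t s] by (simp add: incr_def)
   also have "\<dots> <= (c + 1) * norm (incr X s t) + (c + 1) * norm (R s t)"
    using c by (intro add_mono mult_right_mono) (auto simp: distrib_right)
   finally show "norm (incr Y s t) <= (c + 1) * (norm (incr X s t) + norm (R s t))" by (simp add: distrib_left)
  qed (use c in simp)
  also have "\<dots> <= MY" unfolding MY_def by (intro mult_left_mono add_mono b bR1) simp
  finally have bY: "besov2_norm \<alpha> p q T (incr Y) <= MY" .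
  have "besov2_norm (2 * \<alpha>) (p / 2) (q / 2) T R
   <= quasi (p / 2) (q / 2) (d * c\<^sup>2 + 1) * (besov2_norm (2 * \<alpha>) (p / 2) (q / 2) T XX + besov2_norm (2 * \<alpha>) (p / 2) (q / 2) T \<Xi>)"
   unfolding quasi_def
  proof (rule besov2_norm_quasi_triangle[OF T XX davie_remainder_cont p2 q2])
   fix s t
   have dc: "0 <= d * c\<^sup>2" using d by simp
   have "norm (R s t) <= d * c\<^sup>2 * norm (XX s t) + 1 * norm (\<Xi> s t)" using remainder_le[of s t] by simp
   also have "\<dots> <= (d * c\<^sup>2 + 1) * norm (XX s t) + (d * c\<^sup>2 + 1) * norm (\<Xi> s t)"
    using dc by (intro add_mono mult_right_mono) auto
   finally show "norm (R s t) <= (d * c\<^sup>2 + 1) * (norm (XX s t) + norm (\<Xi> s t))" by (simp only: distrib_left)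
  next
   have "0 <= d * c\<^sup>2" using d by simp
   then show "0 < d * c\<^sup>2 + 1" by linarith
  qed
  also have "\<dots> <= MR" unfolding MR_def by (intro mult_left_mono add_mono b bXi) simp
  finally have bR: "besov2_norm (2 * \<alpha>) (p / 2) (q / 2) T R <= MR" .
  have bY': "besov2_norm \<alpha> p q T (incr ?Y') <= quasi p q (c + 1) * (MY + MY)"
  proof -
   have "besov2_norm \<alpha> p q T (incr ?Y') <= quasi p q (c + 1) * (besov2_norm \<alpha> p q T (incr Y) + besov2_norm \<alpha> p q T (incr Y))"
    unfolding quasi_def
   proof (rule besov2_norm_lipschitz[OF T incr_cont2[OF Y] p(1) q(1) c])
    fix s t
    have "norm (incr ?Y' s t) <= norm (f (Y t) - f (Y s))"
     using norm_tensor_map_le[of "f (Y t) - f (Y s)"] by (simp add: incr_def tensor_map_diff)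
    also have "\<dots> <= c * norm (incr Y s t)" using Cb2_lipschitz(1)[OF f(1), of "Y t" "Y s"] f(2) by (simp add: incr_def)
    finally show "norm (incr ?Y' s t) <= c * norm (incr Y s t)" .
   qed
   also have "\<dots> <= quasi p q (c + 1) * (MY + MY)" by (intro mult_left_mono add_mono bY) simp
   finally show ?thesis .
  qed
  have bYf: "besov2_norm \<alpha> p q T (incr Y) < \<infinity>" using bY MY by (rule le_less_trans)
  have bRf: "besov2_norm (2 * \<alpha>) (p / 2) (q / 2) T R < \<infinity>" using bR MR by (rule le_less_trans)
  have bf: "besov2_norm \<alpha> p q T (incr (%t. f (Y t))) < \<infinity>"
  proof (rule le_less_trans[OF besov2_norm_lipschitz[OF T incr_cont2[OF Y] p(1) q(1) c] quasi_finite[OF bYf bYf, unfolded quasi_def]])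
   show "norm (incr (%t. f (Y t)) s t) <= c * norm (incr Y s t)" for s t
    using Cb2_lipschitz(1)[OF f(1), of "Y t" "Y s"] f(2) by (simp add: incr_def)
  qed
  have bG: "besov2_norm \<alpha> p q T (incr (%t. step_op f (Y t))) < \<infinity>"
  proof (rule le_less_trans[OF besov2_norm_lipschitz[OF T incr_cont2[OF Y] p(1) q(1), of "2 * c\<^sup>2"] quasi_finite[OF bYf bYf, unfolded quasi_def]])
   show "norm (incr (%t. step_op f (Y t)) s t) <= 2 * c\<^sup>2 * norm (incr Y s t)" for s t
    using step_op_lipschitz[OF f(1), of "Y t" "Y s"] f(2) by (simp add: incr_def)
  qed simp
  have bRG: "besov2_norm (2 * \<alpha>) (p / 2) (q / 2) T (remainder X (%t. f (Y t)) (%t. step_op f (Y t))) < \<infinity>"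
  proof -
   have sq: "besov2_norm (2 * \<alpha>) (p / 2) (q / 2) T (%s t. (norm (incr Y s t))\<^sup>2) < \<infinity>"
    using bYf by (intro le_less_trans[OF besov2_norm_square_le[OF p(1) q(1)]]) (simp add: power2_eq_square ennreal_mult_less_top)
   have csq: "cont2 T (%s t. (norm (incr Y s t))\<^sup>2)"
    using incr_cont2[OF Y] by (auto simp: case_prod_beta intro!: continuous_intros)
   show ?thesis
   proof (rule le_less_trans[OF besov2_norm_quasi_triangle[OF T csq cR p2 q2, of "c + 1"] quasi_finite[OF sq bRf, unfolded quasi_def]])
    fix s t
    have "remainder X (%t. f (Y t)) (%t. step_op f (Y t)) s t = taylor1 f (Y s) (Y t) + blinfun_apply (fderiv f (Y s)) (R s t)"
     by (simp add: remainder_def incr_def taylor1_def step_op_def blinfun.diff_right)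
    then have "norm (remainder X (%t. f (Y t)) (%t. step_op f (Y t)) s t)
      <= norm (taylor1 f (Y s) (Y t)) + norm (blinfun_apply (fderiv f (Y s)) (R s t))" by (simp only: norm_triangle_ineq)
    also have "\<dots> <= c * (norm (incr Y s t))\<^sup>2 + c * norm (R s t)"
     using taylor1_bound[OF f(1), of "Y s" "Y t"] norm_blinfun_le[OF Cb2_norm_le(2)[OF f(1)], of "Y s" "R s t"] f(2)
     by (intro add_mono) (auto simp: incr_def)
    also have "\<dots> <= (c + 1) * (norm (incr Y s t))\<^sup>2 + (c + 1) * norm (R s t)" by (intro add_mono mult_right_mono) auto
    finally show "norm (remainder X (%t. f (Y t)) (%t. step_op f (Y t)) s t)
      <= (c + 1) * (norm ((norm (incr Y s t))\<^sup>2) + norm (R s t))" by (simp add: distrib_left)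
   qed (use c in simp)
  qed
  have bY'f: "besov2_norm \<alpha> p q T (incr ?Y') < \<infinity>" using bY' quasi_finite[OF MY MY] by (rule le_less_trans)
  have con: "controlled \<alpha> p q T X Y ?Y'"
   unfolding controlled_def by (intro conjI Y cY' in_besovI[OF T p(1)] in_besov2I cR bYf bY'f bRf)
  have conf: "controlled \<alpha> p q T X (%t. f (Y t)) (%t. fderiv f (Y t) o\<^sub>L ?Y' t)"
   unfolding controlled_def step_op_def[symmetric]
   by (intro conjI cf cG in_besovI[OF T p(1)] in_besov2I remainder_cont2 X(1) bf bG bRG)
  have conv: "besov2_norm (3 * \<alpha>) (p / 3) \<infinity> T
    (%s t. rough_sum X XX (%t. f (Y t)) (%t. fderiv f (Y t) o\<^sub>L ?Y' t) N \<tau> s t - incr (%t. Y t - y) s t)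
    = besov2_norm (3 * \<alpha>) (p / 3) \<infinity> T (partition_sum \<Xi> N \<tau>)" if "unit_partition N \<tau>" for N \<tau>
   using rough_sum_remainder[OF that, where y = y and Z = "%t. Y t - y" and Y' = ?Y' and f = f and Y = Y and T = T and X = X and XX = XX]
   by (intro besov2_norm_cong) simp
  have "has_rough_integral \<alpha> p q T X XX (%t. f (Y t)) (%t. fderiv f (Y t) o\<^sub>L ?Y' t) (%t. Y t - y)"
   unfolding has_rough_integral_def
  proof (intro conjI allI impI)
   show "continuous_on {0..T} (%t. Y t - y)" by (intro continuous_intros Y)
   fix \<epsilon> :: real assume "0 < \<epsilon>"
   from partition_sums_vanish[OF this] show "\<exists>\<eta>>0. \<forall>N \<tau>. unit_partition N \<tau> \<and> mesh N \<tau> < \<eta> -->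
    besov2_norm (3 * \<alpha>) (p / 3) \<infinity> T
     (%s t. rough_sum X XX (%t. f (Y t)) (%t. fderiv f (Y t) o\<^sub>L ?Y' t) N \<tau> s t - incr (%t. Y t - y) s t) < ennreal \<epsilon>"
    using conv by simp
  qed (use conf Y0 in auto)
  then have "rde_solution \<alpha> p q T X XX f y Y ?Y'"
   unfolding rde_solution_def using con by auto
  moreover have "controlled_seminorm \<alpha> p q T X Y ?Y' <= quasi p q (c + 1) * (MY + MY) + MR"
   unfolding controlled_seminorm_def besov_seminorm_def by (intro add_mono bY' bR)
  ultimately show "\<exists>Y Y'. rde_solution \<alpha> p q T X XX f y Y Y' \<and>
   controlled_seminorm \<alpha> p q T X Y Y' <= quasi p q (c + 1) * (MY + MY) + MR" by blast
 qed
qed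

end

section \<open>Uniqueness among all solutions\<close>

lemma Cb3_fderiv2_holder:
 fixes f :: "'a::euclidean_space => 'b::real_normed_vector"
 assumes "Cb3 f"
 shows "fderiv2_holder (C2_norm (fderiv f)) 1 f"
proof -
 have g: "Cb2 (fderiv f)" and "Cb2 f" using assms unfolding Cb3_def Cb2_def Cb1_def by blast+
 then show ?thesis using Cb2_lipschitz(2)[OF g] Cb2_norm_le(4)[OF g] by (simp add: fderiv2_holder_def)
qed

lemma Cb2_holder_fderiv2_holder:
 assumes "Cb2_holder \<delta> f" "0 < \<delta>"
 obtains L where "fderiv2_holder L \<delta> f"
proof -
 obtain L where L: "\<And>x y. norm (fderiv (fderiv f) x - fderiv (fderiv f) y) <= L * norm (x - y) powr \<delta>"
  using assms(1) unfolding Cb2_holder_def by blast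
 have "L * norm (x - y) powr \<delta> <= \<bar>L\<bar> * norm (x - y) powr \<delta>" for x y :: 'a by (intro mult_right_mono) auto
 then have "fderiv2_holder \<bar>L\<bar> \<delta> f"
  using L order_trans assms unfolding fderiv2_holder_def Cb2_holder_def by (metis abs_ge_zero)
 then show ?thesis by (rule that)
qed

lemma tree_summable_scale:
 assumes "tree_summable a" "0 <= C"
 shows "tree_summable (%n i. C * a n i)"
proof -
 have "level_sum (%n i. C * a n i) = (%n. C * level_sum a n)" by (simp add: level_sum_def sum_distrib_left fun_eq_iff)
 then show ?thesis using assms unfolding tree_summable_def by (simp add: summable_mult)
qed

lemma dominated_mono:
 assumes "dominated T X XX U" "\<And>n i. i < 2 ^ n ==> 0 <= U n i \<and> U n i <= V n i"
 shows "dominated T X XX V"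
 unfolding dominated_def
proof (intro allI impI conjI)
 fix n i s t assume h: "1 <= n" "i < (2::nat) ^ n" "dpt T n i <= s \<and> s <= t \<and> t <= dpt T n (Suc i)"
 then have u: "norm (X t - X s) <= U n i" "norm (XX s t) <= (U n i)\<^sup>2" using assms(1) unfolding dominated_def by blast+
 show "norm (X t - X s) <= V n i" using u assms(2)[OF h(2)] by linarith
 show "norm (XX s t) <= (V n i)\<^sup>2" using u(2) assms(2)[OF h(2)] by (meson order_trans power_mono)
qed

context besov_exponents
begin

text \<open>An arbitrary solution comes with finite Besov norms but no explicit bound; it gets an
  array of its own, whose constant may depend on the solution. The defect of its remainder is
  \<open>(f (Y u) - f (Y s)) *v (X t - X u)\<close>, a product of two first-order terms.\<close>

lemma solution_array:
 fixes X :: "real => real ^ 'n" and f :: "real ^ 'm => real ^ 'n ^ 'm"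
 assumes X: "continuous_on {0..T} X" and U: "cell_array K U" and dom: "dominated T X XX U" and f: "Cb2 f"
  and sol: "rde_solution \<alpha> p q T X XX f y Y Y'"
 obtains L V where "cell_array L V"
  "\<And>n i s t. 1 <= n ==> i < 2 ^ n ==> dpt T n i <= s ==> s <= t ==> t <= dpt T n (Suc i) ==>
   norm (Y t - Y s) <= V n i \<and> norm (remainder X Y Y' s t) <= (V n i)\<^sup>2"
proof -
 define c where "c = C2_norm f"
 have c: "0 <= c" using Cb2_norm_le(4)[OF f] by (simp add: c_def)
 have Y: "continuous_on {0..T} Y" "continuous_on {0..T} Y'"
  and fin: "besov2_norm \<alpha> p q T (incr Y) < \<infinity>" "besov2_norm (2 * \<alpha>) (p / 2) (q / 2) T (remainder X Y Y') < \<infinity>"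
  and Y': "\<And>t. t \<in> {0..T} ==> Y' t = tensor_map (f (Y t))"
  using sol unfolding rde_solution_def controlled_def in_besov_def in_besov2_def besov_seminorm_def by auto
 note iY = incr_cont2[OF Y(1)] and cR = remainder_cont2[OF X Y]
 obtain r1 where r1: "0 <= r1" "besov2_norm \<alpha> p q T (incr Y) <= ennreal r1"
  by (rule that[of "enn2real (besov2_norm \<alpha> p q T (incr Y))"]) (use fin(1) in auto)
 obtain r2 where r2: "0 <= r2" "besov2_norm (2 * \<alpha>) (p / 2) (q / 2) T (remainder X Y Y') <= ennreal r2"
  by (rule that[of "enn2real (besov2_norm (2 * \<alpha>) (p / 2) (q / 2) T (remainder X Y Y'))"]) (use fin(2) in auto)
 obtain K1 where "\<And>g :: real => real ^ 'm. continuous_on {0..T} g ==>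
  besov2_norm \<alpha> p q T (incr g) <= ennreal r1 ==> cell_array K1 (cellsup T (incr g))"
  using cell_array_path[where 'v = "real ^ 'm", OF r1(1)] by blast
 then have V1: "cell_array K1 (cellsup T (incr Y))" using Y(1) r1(2) by blast
 have uY: "norm (Y t - Y s) <= cellsup T (incr Y) n i"
  if "i < 2 ^ n" "dpt T n i <= s" "s <= t" "t <= dpt T n (Suc i)" for n i s t
  using cellsup_upper[where A = "incr Y", OF iY T that] unfolding incr_def[of Y s t] .
 have Y0: "0 <= cellsup T (incr Y) n i" if "i < 2 ^ n" for n i by (rule cellsup_nonneg[OF iY T that])
 have U0: "0 <= U n i" if "i < 2 ^ n" for n i using U that by (simp add: cell_array_def)
 \<comment> \<open>The factor \<open>c + 1\<close> absorbs the Lipschitz constant of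
   \<open>f\<close> into a square.\<close>
 define D where "D n i = (c + 1) * (cellsup T (incr Y) n i + U n i)" for n i
 have "0 <= c + 1" using c by simp
 from cell_array_scale[OF cell_array_add[OF V1 U] this] obtain K2 where D: "cell_array K2 D"
  unfolding D_def[abs_def] by blast
 have K2: "0 <= K2" using D admissible_nonneg unfolding cell_array_def by blast
 obtain K3 where "0 <= K3" and K3': "\<And>(A :: real => real => real ^ 'm) D. cont2 T A ==> (\<And>s. 0 <= s ==> s <= T ==> A s s = 0) ==>
  besov2_norm (2 * \<alpha>) (p / 2) (q / 2) T A <= ennreal r2 ==> cell_array K2 D ==>
  (\<And>n i s u t. 1 <= n ==> i < 2 ^ n ==> dpt T n i <= s ==> s <= u ==> u <= t ==> t <= dpt T n (Suc i) ==>
   norm (A s t - A s u - A u t) <= (D n i)\<^sup>2) ==>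
  cell_array K3 (%n i. sqrt (cellsup T A n i))"
  using cell_array_two[where 'v = "real ^ 'm", OF r2(1) K2] by blast
 note K3 = K3'[OF cR _ r2(2) D]
 have V2: "cell_array K3 (%n i. sqrt (cellsup T (remainder X Y Y') n i))"
 proof (rule K3)
  show "remainder X Y Y' s s = 0" for s by (simp add: remainder_def incr_def)
  fix n i s u t assume h: "1 <= n" "i < (2::nat) ^ n" "dpt T n i <= s" "s <= u" "u <= t" "t <= dpt T n (Suc i)"
  have "s \<in> {0..T}" "u \<in> {0..T}" using h dpt_cell_bounds[OF T h(2)] by auto
  note su = this[THEN Y']
  have "remainder X Y Y' s t - remainder X Y Y' s u - remainder X Y Y' u t = (f (Y u) - f (Y s)) *v (X t - X u)"
   by (simp add: remainder_def incr_def su tensor_map.rep_eq matrix_vector_mult_diff_rdistrib matrix_vector_mult_diff_distrib)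
  then have "norm (remainder X Y Y' s t - remainder X Y Y' s u - remainder X Y Y' u t)
    <= norm (f (Y u) - f (Y s)) * norm (X t - X u)" by (simp only: norm_matrix_vector_mult_le)
  also have "\<dots> <= (c * cellsup T (incr Y) n i) * U n i"
  proof (rule mult_mono)
   show "norm (f (Y u) - f (Y s)) <= c * cellsup T (incr Y) n i"
    using Cb2_lipschitz(1)[OF f, of "Y u" "Y s"] mult_left_mono[OF uY[OF h(2,3,4)] c] h unfolding c_def by linarith
   show "norm (X t - X u) <= U n i" using dom h unfolding dominated_def by auto
  qed (use c Y0[OF h(2)] in auto)
  also have "\<dots> <= D n i * D n i"
   unfolding D_def using c Y0[OF h(2)] U0[OF h(2)]
   by (intro mult_mono) (auto simp: distrib_left distrib_right add_nonneg_nonneg)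
  finally show "norm (remainder X Y Y' s t - remainder X Y Y' s u - remainder X Y Y' u t) <= (D n i)\<^sup>2"
   by (simp only: power2_eq_square)
 qed
 show ?thesis
 proof (rule that[OF cell_array_add[OF V1 V2]])
  fix n i s t assume h: "1 <= n" "i < (2::nat) ^ n" "dpt T n i <= s" "s <= t" "t <= dpt T n (Suc i)"
  have R0: "0 <= cellsup T (remainder X Y Y') n i" by (rule cellsup_nonneg[OF cR T h(2)])
  have "norm (remainder X Y Y' s t) <= cellsup T (remainder X Y Y') n i" by (rule cellsup_upper[OF cR T h(2-)])
  also have "\<dots> = (sqrt (cellsup T (remainder X Y Y') n i))\<^sup>2" using R0 by simp
  also have "\<dots> <= (cellsup T (incr Y) n i + sqrt (cellsup T (remainder X Y Y') n i))\<^sup>2"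
   using R0 Y0[OF h(2)] by (intro power_mono) auto
  finally show "norm (Y t - Y s) <= cellsup T (incr Y) n i + sqrt (cellsup T (remainder X Y Y') n i) \<and>
    norm (remainder X Y Y' s t) <= (cellsup T (incr Y) n i + sqrt (cellsup T (remainder X Y Y') n i))\<^sup>2"
   using uY[OF h(2-)] real_sqrt_ge_zero[OF R0] by linarith
 qed
qed

text \<open>The sewing limit of a solution's integral: since the partition sums of its Davie remainder vanish,
 the remainder on a dyadic cell is controlled by the defects below that cell.\<close>

lemma solution_davie_remainder_le:
 fixes X :: "real => real ^ 'n" and f :: "real ^ 'm => real ^ 'n ^ 'm"
 assumes X: "continuous_on {0..T} X" and XX: "cont2 T XX" and chen: "chen T X XX" and f: "Cb2 f"
  and sol: "rde_solution \<alpha> p q T X XX f y Y Y'" and dom: "dominated T X XX U"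
  and V: "\<And>n i s t. 1 <= n ==> i < 2 ^ n ==> dpt T n i <= s ==> s <= t ==> t <= dpt T n (Suc i) ==>
   norm (Y t - Y s) <= U n i \<and> norm (remainder X Y Y' s t) <= (U n i)\<^sup>2"
  and ts: "tree_summable (%n i. U n i ^ 3)" and U0: "\<And>n i. i < 2 ^ n ==> 0 <= U n i"
  and C: "C = 4 * (C2_norm f * (2 + C2_norm f) + 2 * CARD('n) * (C2_norm f)\<^sup>2)" and n: "1 <= n" and i: "i < 2 ^ n"
 shows "norm (davie_remainder f X XX Y (dpt T n i) (dpt T n (Suc i))) <= 2 * tree_sum (%n i. C * U n i ^ 3) n i"
proof -
 define c where "c = C2_norm f"
 have c: "0 <= c" using Cb2_norm_le(4)[OF f] by (simp add: c_def)
 let ?R = "remainder X Y Y'"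
 let ?\<Xi> = "davie_remainder f X XX Y"
 have C0: "0 <= C" using c unfolding C c_def[symmetric] by simp
 have Y: "continuous_on {0..T} Y" and Y': "\<And>t. t \<in> {0..T} ==> Y' t = tensor_map (f (Y t))"
  using sol unfolding rde_solution_def controlled_def by auto
 obtain Z where Z: "has_rough_integral \<alpha> p q T X XX (%t. f (Y t)) (%t. fderiv f (Y t) o\<^sub>L Y' t) Z"
  and YZ: "\<And>t. t \<in> {0..T} ==> Y t = y + Z t"
  using sol unfolding rde_solution_def by blast
 interpret vanishing_partition_sums T ?\<Xi> "%n i. C * U n i ^ 3" "p / 3" "3 * \<alpha>"
 proof
  show "0 < T" by (rule T)
  show "cont2 T ?\<Xi>" by (rule davie_remainder_cont2[OF f X XX Y])
  show "0 < p / 3" using ennreal_divide_pos[OF p(1), of 3] by simp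
  show "tree_summable (%n i. C * U n i ^ 3)" by (rule tree_summable_scale[OF ts C0])
  have eq: "besov2_norm (3 * \<alpha>) (p / 3) \<infinity> T
    (%s t. rough_sum X XX (%t. f (Y t)) (%t. fderiv f (Y t) o\<^sub>L Y' t) N \<tau> s t - incr Z s t)
    = besov2_norm (3 * \<alpha>) (p / 3) \<infinity> T (partition_sum ?\<Xi> N \<tau>)" if "unit_partition N \<tau>" for N \<tau>
  proof (rule besov2_norm_cong)
   fix s t assume "0 <= s" "s <= t" "t <= T"
   note st = this
   have "rough_sum X XX (%t. f (Y t)) (%t. fderiv f (Y t) o\<^sub>L Y' t) N \<tau> s t - incr Z s t = - partition_sum ?\<Xi> N \<tau> s t"
    by (rule rough_sum_remainder[OF that st]) (fact Y' YZ)+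
   then show "norm (rough_sum X XX (%t. f (Y t)) (%t. fderiv f (Y t) o\<^sub>L Y' t) N \<tau> s t - incr Z s t)
    = norm (partition_sum ?\<Xi> N \<tau> s t)" by simp
  qed
  show "\<exists>\<eta>>0. \<forall>N \<tau>. unit_partition N \<tau> \<and> mesh N \<tau> < \<eta> -->
   besov2_norm (3 * \<alpha>) (p / 3) \<infinity> T (partition_sum ?\<Xi> N \<tau>) < ennreal \<epsilon>" if "0 < \<epsilon>" for \<epsilon> :: real
  proof -
   from Z that obtain \<eta> where \<eta>: "0 < \<eta>" "\<forall>N \<tau>. unit_partition N \<tau> \<and> mesh N \<tau> < \<eta> --> besov2_norm (3 * \<alpha>) (p / 3) \<infinity> T
     (%s t. rough_sum X XX (%t. f (Y t)) (%t. fderiv f (Y t) o\<^sub>L Y' t) N \<tau> s t - incr Z s t) < ennreal \<epsilon>"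
    unfolding has_rough_integral_def by blast
   then show ?thesis using eq by (intro exI[of _ \<eta>]) simp
  qed
 next
  fix m i j s u t assume m: "1 <= m" and i: "i < (2::nat) ^ m" and j: "j < (2::nat) ^ m" and ij: "j = i \<or> j = Suc i"
   and s: "dpt T m i <= s" "s <= dpt T m (Suc i)" and t: "dpt T m j <= t" "t <= dpt T m (Suc j)"
   and su: "s <= u" and ut: "u <= t"
  define S where "S = U m i + U m j"
  have Ui: "0 <= U m i" and Uj: "0 <= U m j" using U0 i j by auto
  then have S: "0 <= S" by (simp add: S_def)
  have S2: "S\<^sup>2 = (U m i)\<^sup>2 + (U m j)\<^sup>2 + 2 * (U m i * U m j)" by (simp add: S_def power2_sum)
  have UU: "0 <= U m i * U m j" using Ui Uj by simp
  have in0T: "0 <= s" "t <= T" using s t dpt_cell_bounds[OF T i] dpt_cell_bounds[OF T j] by auto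
  have cell: "norm (X b - X a) <= U m k" "norm (XX a b) <= (U m k)\<^sup>2" "norm (Y b - Y a) <= U m k" "norm (?R a b) <= (U m k)\<^sup>2"
   if "k = i \<or> k = j" "dpt T m k <= a" "a <= b" "b <= dpt T m (Suc k)" for k a b
   using that i j m dom V[of m k a b] unfolding dominated_def by auto
  have Xab: "norm (X b - X a) <= S" and Yab: "norm (Y b - Y a) <= S"
   if ab: "dpt T m i <= a" "a <= b" "b <= dpt T m (Suc j)" for a b
   using two_cells_bound[where A = "%a b. X b - X a" and b = "U m" and d = 0, OF ij ab cell(1)]
    two_cells_bound[where A = "%a b. Y b - Y a" and b = "U m" and d = 0, OF ij ab cell(3)] Ui Uj
   by (auto simp: S_def)
  have XXu: "norm (XX u t) <= S\<^sup>2"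
  proof -
   have "norm (XX u t) <= (U m i)\<^sup>2 + (U m j)\<^sup>2 + U m i * U m j"
   proof (rule two_cells_bound[where b = "%k. (U m k)\<^sup>2", OF ij _ ut t(2) cell(2)])
    fix r assume r: "r = dpt T m (Suc i)" "j = Suc i" "u <= r" "r <= t"
    have "XX u t = XX u r + XX r t + tensor (X r - X u) (X t - X r)"
     using chen r in0T su ut unfolding chen_def by auto
    then have "norm (XX u t - XX u r - XX r t) <= norm (X r - X u) * norm (X t - X r)"
     using norm_tensor_le[of "X r - X u" "X t - X r"] by simp
    also have "\<dots> <= U m i * U m j"
     using cell(1)[of i u r] cell(1)[of j r t] r s su t Ui by (intro mult_mono) auto
    finally show "norm (XX u t - XX u r - XX r t) <= U m i * U m j" .
   qed (use s su UU in auto)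
   then show ?thesis using S2 UU by linarith
  qed
  \<comment> \<open>The remainder of \<open>Y\<close> is not additive: at a grid point it has a
    defect bounded by \<open>c * U m i * U m j\<close>, whence the factor
    \<open>1 + c\<close>.\<close>
  have Rs: "norm (?R s u) <= (1 + c) * S\<^sup>2"
  proof -
   have u2: "u <= dpt T m (Suc j)" using ut t by simp
   have "norm (?R s u) <= (U m i)\<^sup>2 + (U m j)\<^sup>2 + c * (U m i * U m j)"
   proof (rule two_cells_bound[where b = "%k. (U m k)\<^sup>2", OF ij s(1) su u2 cell(4)])
    fix r assume r: "r = dpt T m (Suc i)" "j = Suc i" "s <= r" "r <= u"
    have "s \<in> {0..T}" "r \<in> {0..T}" using r in0T ut by auto
    note sr = this[THEN Y']
    have "?R s u - ?R s r - ?R r u = (f (Y r) - f (Y s)) *v (X u - X r)"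
     by (simp add: remainder_def incr_def sr tensor_map.rep_eq matrix_vector_mult_diff_rdistrib matrix_vector_mult_diff_distrib)
    then have "norm (?R s u - ?R s r - ?R r u) <= norm (f (Y r) - f (Y s)) * norm (X u - X r)"
     by (simp only: norm_matrix_vector_mult_le)
    also have "\<dots> <= (c * U m i) * U m j"
    proof (rule mult_mono)
     have "norm (Y r - Y s) <= U m i" using cell(3)[of i s r] r s by simp
     then show "norm (f (Y r) - f (Y s)) <= c * U m i"
      using Cb2_lipschitz(1)[OF f, of "Y r" "Y s"] c unfolding c_def[symmetric]
      by (meson mult_left_mono order_trans)
     show "norm (X u - X r) <= U m j" using cell(1)[of j r u] r u2 by simp
    qed (use c Ui in auto)
    finally show "norm (?R s u - ?R s r - ?R r u) <= c * (U m i * U m j)" by (simp only: mult.assoc)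
   qed (use UU c in auto)
   moreover have "c * (U m i * U m j) <= c * S\<^sup>2" using c S2 UU by (intro mult_left_mono) auto
   ultimately show ?thesis using S2 UU by (simp only: distrib_right mult_1)
  qed
  have chn: "XX s t = XX s u + XX u t + tensor (X u - X s) (X t - X u)"
   using chen in0T su ut unfolding chen_def by auto
  have ss: "Y' s = tensor_map (f (Y s))" using in0T su ut by (intro Y') auto
  have split: "f (Y u) - f (Y s) - blinfun_apply (step_op f (Y s)) (X u - X s) = taylor1 f (Y s) (Y u) + blinfun_apply (fderiv f (Y s)) (?R s u)"
   by (simp add: taylor1_def step_op_def remainder_def incr_def ss blinfun.diff_right)
  have Xu: "norm (X t - X u) <= S" using Xab[of u t] s su ut t by simp
  have Yu: "norm (Y u - Y s) <= S" using Yab[of s u] s su ut t by simp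
  have A: "norm (f (Y u) - f (Y s) - blinfun_apply (step_op f (Y s)) (X u - X s)) <= c * (2 + c) * S\<^sup>2"
  proof -
   have "norm (taylor1 f (Y s) (Y u)) <= c * S\<^sup>2"
    using taylor1_bound[OF f, of "Y s" "Y u"] Yu c unfolding c_def[symmetric]
    by (meson mult_left_mono norm_ge_zero order_trans power_mono)
   moreover have "norm (blinfun_apply (fderiv f (Y s)) (?R s u)) <= c * ((1 + c) * S\<^sup>2)"
    using norm_blinfun_le[OF Cb2_norm_le(2)[OF f], of "Y s" "?R s u"] Rs c unfolding c_def[symmetric]
    by (meson mult_left_mono order_trans)
   moreover have "c * (2 + c) * S\<^sup>2 = c * S\<^sup>2 + c * ((1 + c) * S\<^sup>2)" by (simp add: algebra_simps)
   ultimately show ?thesis unfolding split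
    using norm_triangle_ineq[of "taylor1 f (Y s) (Y u)" "blinfun_apply (fderiv f (Y s)) (?R s u)"] by linarith
  qed
  have B: "norm (contract (step_op f (Y u) - step_op f (Y s)) (XX u t)) <= CARD('n) * (2 * c\<^sup>2 * S) * S\<^sup>2"
  proof (rule order_trans[OF norm_contract_le], rule mult_mono[OF mult_left_mono XXu])
   have "2 * c\<^sup>2 * norm (Y u - Y s) <= 2 * c\<^sup>2 * S" using Yu by (intro mult_left_mono) auto
   then show "norm (step_op f (Y u) - step_op f (Y s)) <= 2 * c\<^sup>2 * S"
    using step_op_lipschitz[OF f, of "Y u" "Y s"] unfolding c_def[symmetric] by linarith
  qed (use S in auto)
  have "norm ((f (Y u) - f (Y s) - blinfun_apply (step_op f (Y s)) (X u - X s)) *v (X t - X u)) <= (c * (2 + c) * S\<^sup>2) * S"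
   using A Xu S c by (intro order_trans[OF norm_matrix_vector_mult_le] mult_mono) auto
  then have "norm (?\<Xi> s t - ?\<Xi> s u - ?\<Xi> u t) <= (c * (2 + c) * S\<^sup>2) * S + CARD('n) * (2 * c\<^sup>2 * S) * S\<^sup>2"
   unfolding davie_remainder_defect[OF chn]
   using B norm_triangle_ineq[of "(f (Y u) - f (Y s) - blinfun_apply (step_op f (Y s)) (X u - X s)) *v (X t - X u)"
    "contract (step_op f (Y u) - step_op f (Y s)) (XX u t)"] by simp
  also have "\<dots> = (c * (2 + c) + 2 * CARD('n) * c\<^sup>2) * S ^ 3"
   by (simp add: power2_eq_square power3_eq_cube algebra_simps)
  also have "\<dots> <= (c * (2 + c) + 2 * CARD('n) * c\<^sup>2) * (4 * (U m i ^ 3 + U m j ^ 3))"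
  proof (rule mult_left_mono)
   \<comment> \<open>Convexity of the cube, written as an identity with a square; this is the factor
     4 in \<open>C\<close>.\<close>
   have "4 * (U m i ^ 3 + U m j ^ 3) - S ^ 3 = 3 * ((U m i + U m j) * (U m i - U m j)\<^sup>2)"
    by (simp add: S_def power2_eq_square power3_eq_cube algebra_simps)
   moreover have "0 <= (U m i + U m j) * (U m i - U m j)\<^sup>2" using Ui Uj by simp
   ultimately show "S ^ 3 <= 4 * (U m i ^ 3 + U m j ^ 3)" by linarith
  qed (use c in simp)
  also have "\<dots> = C * U m i ^ 3 + C * U m j ^ 3" unfolding C c_def[symmetric] by (simp add: algebra_simps)
  finally show "norm (?\<Xi> s t - ?\<Xi> s u - ?\<Xi> u t) <= C * U m i ^ 3 + C * U m j ^ 3" .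
 qed
 show ?thesis by (rule norm_cell_le[OF n i])
qed

text \<open>One array \<open>U\<close> dominates the rough path and both solutions, so that both
  live on a single tree. It also bounds their Davie remainders on cells by tree sums, whose totals
  over a generation are tails of a convergent series.\<close>

lemma rde_solution_unique:
 fixes X :: "real => real ^ 'n" and f :: "real ^ 'm => real ^ 'n ^ 'm"
 assumes X: "continuous_on {0..T} X" "cont2 T XX" "chen T X XX" and rho: "0 <= \<rho>"
  and b: "besov2_norm \<alpha> p q T (incr X) <= ennreal \<rho>" "besov2_norm (2 * \<alpha>) (p / 2) (q / 2) T XX <= ennreal (\<rho>\<^sup>2)"
  and f: "fderiv2_holder L \<delta> f" "\<delta> <= 1" and dl: "(2 + \<delta>) * \<alpha> > 1 \<or> \<alpha> = 1 / 3 \<and> 2 + \<delta> = 3"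
  and Y: "rde_solution \<alpha> p q T X XX f y Y Y'" and Z: "rde_solution \<alpha> p q T X XX f y Z Z'" and t: "t \<in> {0..T}"
 shows "Y t = Z t \<and> Y' t = Z' t"
proof -
 have f2: "Cb2 f" and dpos: "0 < \<delta>" using f(1) by (auto simp: fderiv2_holder_def)
 obtain K1 where "\<And>(X :: real => real ^ 'n) XX. continuous_on {0..T} X ==> cont2 T XX ==> chen T X XX ==>
  besov2_norm \<alpha> p q T (incr X) <= ennreal \<rho> ==> besov2_norm (2 * \<alpha>) (p / 2) (q / 2) T XX <= ennreal (\<rho>\<^sup>2) ==>
  \<exists>U. cell_array K1 U \<and> dominated T X XX U"
  using rough_path_array[where 'n = 'n, OF rho] by blast
 then obtain U1 where U1: "cell_array K1 U1" "dominated T X XX U1" using X b by blast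
 obtain KY VY where VY: "cell_array KY VY"
  "\<And>n i s t. 1 <= n ==> i < 2 ^ n ==> dpt T n i <= s ==> s <= t ==> t <= dpt T n (Suc i) ==>
   norm (Y t - Y s) <= VY n i \<and> norm (remainder X Y Y' s t) <= (VY n i)\<^sup>2"
  using solution_array[OF X(1) U1 f2 Y] by blast
 obtain KZ VZ where VZ: "cell_array KZ VZ"
  "\<And>n i s t. 1 <= n ==> i < 2 ^ n ==> dpt T n i <= s ==> s <= t ==> t <= dpt T n (Suc i) ==>
   norm (Z t - Z s) <= VZ n i \<and> norm (remainder X Z Z' s t) <= (VZ n i)\<^sup>2"
  using solution_array[OF X(1) U1 f2 Z] by blast
 define U where "U n i = U1 n i + (VY n i + VZ n i)" for n i
 obtain K where U: "cell_array K U"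
  using cell_array_add[OF U1(1) cell_array_add[OF VY(1) VZ(1)]] unfolding U_def[abs_def] by blast
 have nn: "0 <= U1 n i" "0 <= VY n i" "0 <= VZ n i" if "i < 2 ^ n" for n i
  using U1(1) VY(1) VZ(1) that by (simp_all add: cell_array_def)
 have U0: "0 <= U n i" and le: "U1 n i <= U n i" "VY n i <= U n i" "VZ n i <= U n i" if "i < 2 ^ n" for n i
  using nn[OF that] by (simp_all add: U_def)
 have dom: "dominated T X XX U" using le nn by (intro dominated_mono[OF U1(2)]) auto
 have incY: "norm (Y t - Y s) <= U n i \<and> norm (remainder X Y Y' s t) <= (U n i)\<^sup>2"
  if "1 <= n" "i < 2 ^ n" "dpt T n i <= s" "s <= t" "t <= dpt T n (Suc i)" for n i s t
  using VY(2)[OF that] le(2)[OF that(2)] power_mono[OF le(2)[OF that(2)] nn(2)[OF that(2)], of 2] by linarith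
 have incZ: "norm (Z t - Z s) <= U n i \<and> norm (remainder X Z Z' s t) <= (U n i)\<^sup>2"
  if "1 <= n" "i < 2 ^ n" "dpt T n i <= s" "s <= t" "t <= dpt T n (Suc i)" for n i s t
  using VZ(2)[OF that] le(3)[OF that(2)] power_mono[OF le(3)[OF that(2)] nn(3)[OF that(2)], of 2] by linarith
 obtain u' where u': "cell_bound p U u'" "admissible \<alpha> K u'" using U unfolding cell_array_def by blast
 have K: "0 <= K" by (rule admissible_nonneg[OF u'(2)])
 have ts3: "tree_summable (%n i. U n i ^ 3)" using cell_array_tree_sum[OF K] U by metis
 have tsd: "tree_summable (%n i. U n i powr (2 + \<delta>))"
  using dpos dl by (intro tree_summable_cells[OF u' p _ _ U0]) auto
 define u where "u n = K * 2 powr (- \<kappa> * real n)" for n :: nat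
 have us: "summable u" unfolding u_def by (rule geometric_summable[OF kappa_pos])
 have u0: "0 <= u n" for n using K by (simp add: u_def)
 have Uu: "U n i <= u n" if "1 <= n" "i < 2 ^ n" for n i
  using cell_array_le[OF U that] by (simp only: u_def \<kappa>_def)
 define C where "C = 4 * (C2_norm f * (2 + C2_norm f) + 2 * CARD('n) * (C2_norm f)\<^sup>2)"
 have C0: "0 <= C" using Cb2_norm_le(4)[OF f2] by (simp add: C_def)
 define e where "e n i = 2 * tree_sum (%n i. C * U n i ^ 3) n i" for n i
 note tsC = tree_summable_scale[OF ts3 C0]
 have "(%n. 2 * (\<Sum>k. level_sum (%n i. C * U n i ^ 3) (n + k))) \<longlonglongrightarrow> 2 * 0"
  by (intro tendsto_mult_left level_tail_tendsto_0[OF tsC])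
 then have e0: "(%n. \<Sum>i<2 ^ n. e n i) \<longlonglongrightarrow> 0"
  by (simp add: e_def sum_distrib_left[symmetric] level_sum_tree_sum[OF tsC])
 have solY: "continuous_on {0..T} Y" "\<And>t. t \<in> {0..T} ==> Y' t = tensor_map (f (Y t))" "Y 0 = y"
  and solZ: "continuous_on {0..T} Z" "\<And>t. t \<in> {0..T} ==> Z' t = tensor_map (f (Z t))" "Z 0 = y"
  using Y Z T unfolding rde_solution_def controlled_def has_rough_integral_def by auto
 have "Y t = Z t"
 proof (rule davie_uniqueness[OF T X(3) dom f tsd Uu us u0 _ _ _ e0 solY(1) solZ(1) _ t])
  show "norm (davie_remainder f X XX Y (dpt T n i) (dpt T n (Suc i))) <= e n i" if "1 <= n" "i < 2 ^ n" for n i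
   unfolding e_def by (rule solution_davie_remainder_le[OF X f2 Y dom incY ts3 U0 C_def that])
  show "norm (davie_remainder f X XX Z (dpt T n i) (dpt T n (Suc i))) <= e n i" if "1 <= n" "i < 2 ^ n" for n i
   unfolding e_def by (rule solution_davie_remainder_le[OF X f2 Z dom incZ ts3 U0 C_def that])
  show "Y 0 = Z 0" using solY solZ by simp
  fix n i s t assume h: "1 <= n" "i < (2::nat) ^ n" "dpt T n i <= s" "s <= t" "t <= dpt T n (Suc i)"
  have "s \<in> {0..T}" using h dpt_cell_bounds[OF T h(2)] by auto
  then have "remainder X Y Y' s t = Y t - Y s - f (Y s) *v (X t - X s)"
   by (simp add: remainder_def incr_def solY(2) tensor_map.rep_eq)
  then show "norm (Y t - Y s) <= U n i \<and> norm (Z t - Z s) <= U n i \<and> norm (Y t - Y s - f (Y s) *v (X t - X s)) <= (U n i)\<^sup>2"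
   using incY[OF h] incZ[OF h] by simp
 qed
 then show ?thesis using solY(2)[OF t] solZ(2)[OF t] by simp
qed

end

theorem theorem5p6:
 fixes \<alpha> T :: real and p q :: ennreal
 assumes "0 < T"
  and "1 / 3 <= \<alpha>" and "\<alpha> < 1"
  and "ennreal (1 / \<alpha>) < p"
  and "0 < q" and "\<alpha> = 1 / 3 ==> q <= 3"
 shows "\<exists>M :: real => ennreal => real.
  \<forall>(X :: real => real ^ 'n) (XX :: real => real => real ^ 'n ^ 'n)
   (f :: real ^ 'm => real ^ 'n ^ 'm).
   rough_path \<alpha> p q T X XX -->
   (\<alpha> > 1 / 3 -->
    (\<exists>\<delta>. 0 < \<delta> \<and> \<delta> <= 1 \<and> (2 + \<delta>) * \<alpha> > 1 \<and> ennreal (\<delta> * \<alpha>) > 1 / p \<and> Cb2_holder \<delta> f)) -->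
   (\<alpha> = 1 / 3 --> Cb3 f) -->
   (\<forall>y :: real ^ 'm. \<exists>Y Y'.
     rde_solution \<alpha> p q T X XX f y Y Y' \<and>
     (\<forall>Z Z'. rde_solution \<alpha> p q T X XX f y Z Z' -->
      (\<forall>t\<in>{0..T}. Z t = Y t \<and> Z' t = Y' t)) \<and>
     controlled_seminorm \<alpha> p q T X Y Y' <= ennreal (M (C2_norm f) (rough_norm \<alpha> p q T X XX)))"
proof -
 have "0 < \<alpha>" using assms(2) by simp
 note pp = ennreal_less_inv_exp[OF this assms(4)]
 interpret besov_exponents T \<alpha> p q using assms pp by unfold_locales auto
 \<comment> \<open>The second level enters the rough norm under a square root, so its own norm is
   bounded by the square of \<open>\<rho>\<close>.\<close>
 have path: "continuous_on {0..T} X \<and> cont2 T XX \<and> chen T X XX \<and>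
   besov2_norm \<alpha> p q T (incr X) <= ennreal \<rho> \<and> besov2_norm (2 * \<alpha>) (p / 2) (q / 2) T XX <= ennreal (\<rho>\<^sup>2) \<and> 0 <= \<rho>"
  if rp: "rough_path \<alpha> p q T X XX" and \<rho>: "\<rho> = enn2real (rough_norm \<alpha> p q T X XX)"
  for X :: "real => real ^ 'n" and XX \<rho>
 proof -
  have "rough_norm \<alpha> p q T X XX = ennreal \<rho>" using rp by (simp add: rough_path_def \<rho>)
  then have le: "besov2_norm \<alpha> p q T (incr X) <= ennreal \<rho>" "epowr (besov2_norm (2 * \<alpha>) (p / 2) (q / 2) T XX) (1 / 2) <= ennreal \<rho>"
   unfolding rough_norm_def by (metis le_iff_add, metis add.commute le_iff_add)
  have r0: "0 <= \<rho>" by (simp add: \<rho>)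
  have "besov2_norm (2 * \<alpha>) (p / 2) (q / 2) T XX <= ennreal (\<rho> powr 2)"
   using le(2) epowr_le_iff[OF r0, of 2] by simp
  moreover have "chen T X XX" using rp unfolding rough_path_def chen_def incr_def by blast
  ultimately show ?thesis using rp le(1) r0 by (simp add: rough_path_def powr_numeral)
 qed
 have uniq: "Z t = Y t \<and> Z' t = Y' t"
  if rp: "rough_path \<alpha> p q T X XX"
   and fa: "\<alpha> > 1 / 3 --> (\<exists>\<delta>. 0 < \<delta> \<and> \<delta> <= 1 \<and> (2 + \<delta>) * \<alpha> > 1 \<and> ennreal (\<delta> * \<alpha>) > 1 / p \<and> Cb2_holder \<delta> f)"
   and fb: "\<alpha> = 1 / 3 --> Cb3 f"
   and Y: "rde_solution \<alpha> p q T X XX f y Y Y'" and Z: "rde_solution \<alpha> p q T X XX f y Z Z'" and t: "t \<in> {0..T}"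
  for X :: "real => real ^ 'n" and XX and f :: "real ^ 'm => real ^ 'n ^ 'm" and y Y Y' Z Z' t
 proof -
  \<comment> \<open>Both regularity regimes are brought into one form; at \<alpha> = 1/3 the pair
    \<open>\<delta> = 1\<close> and \<open>2 + \<delta> = 3\<close> is the critical
    alternative.\<close>
  obtain L \<delta> where f: "fderiv2_holder L \<delta> f" "\<delta> <= 1" and dl: "(2 + \<delta>) * \<alpha> > 1 \<or> \<alpha> = 1 / 3 \<and> 2 + \<delta> = 3"
  proof (cases "\<alpha> = 1 / 3")
   case True
   with fb show ?thesis using that[OF Cb3_fderiv2_holder] by auto
  next
   case False
   then obtain \<delta> where d: "0 < \<delta>" "\<delta> <= 1" "(2 + \<delta>) * \<alpha> > 1" "Cb2_holder \<delta> f" using fa assms(2) by auto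
   obtain L where "fderiv2_holder L \<delta> f" by (rule Cb2_holder_fderiv2_holder[OF d(4,1)])
   then show ?thesis using d by (intro that) auto
  qed
  define \<rho> where "\<rho> = enn2real (rough_norm \<alpha> p q T X XX)"
  note h = path[OF rp \<rho>_def]
  show ?thesis by (rule rde_solution_unique[where \<rho> = \<rho>, OF _ _ _ _ _ _ f dl Z Y t]) (use h in blast)+
 qed
 \<comment> \<open>A bound for every fixed pair of norm values; choosing \<open>M\<close> as a
   function of the pair then excludes any dependence on the rough path, the vector field or the
   initial value beyond it.\<close>
 have "\<exists>M::real. 0 <= c --> (\<forall>(X :: real => real ^ 'n) XX (f :: real ^ 'm => real ^ 'n ^ 'm) y.
   rough_path \<alpha> p q T X XX \<and> rough_norm \<alpha> p q T X XX = r \<and> Cb2 f \<and> C2_norm f = c -->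
   (\<exists>Y Y'. rde_solution \<alpha> p q T X XX f y Y Y' \<and> controlled_seminorm \<alpha> p q T X Y Y' <= ennreal M))" for c r
 proof (cases "0 <= c")
  case True
  obtain M where M: "M < \<infinity>" "\<And>(X :: real => real ^ 'n) XX (f :: real ^ 'm => real ^ 'n ^ 'm) y.
   continuous_on {0..T} X ==> cont2 T XX ==> chen T X XX ==>
   besov2_norm \<alpha> p q T (incr X) <= ennreal (enn2real r) ==>
   besov2_norm (2 * \<alpha>) (p / 2) (q / 2) T XX <= ennreal ((enn2real r)\<^sup>2) ==> Cb2 f ==> C2_norm f = c ==>
   \<exists>Y Y'. rde_solution \<alpha> p q T X XX f y Y Y' \<and> controlled_seminorm \<alpha> p q T X Y Y' <= M"
   using rde_solution_exists[where 'n = 'n and 'm = 'm, OF True enn2real_nonneg[of r]] by blast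
  have "M = ennreal (enn2real M)" using M(1) by simp
  then show ?thesis using M(2) path by (intro exI[of _ "enn2real M"]) metis
 qed simp
 then obtain M :: "real => ennreal => real" where M: "\<And>c r (X :: real => real ^ 'n) XX (f :: real ^ 'm => real ^ 'n ^ 'm) y.
   0 <= c ==> rough_path \<alpha> p q T X XX \<and> rough_norm \<alpha> p q T X XX = r \<and> Cb2 f \<and> C2_norm f = c ==>
   \<exists>Y Y'. rde_solution \<alpha> p q T X XX f y Y Y' \<and> controlled_seminorm \<alpha> p q T X Y Y' <= ennreal (M c r)"
  by metis
 show ?thesis
 proof (intro exI[of _ M] allI impI)
  fix X :: "real => real ^ 'n" and XX and f :: "real ^ 'm => real ^ 'n ^ 'm" and y
  assume rp: "rough_path \<alpha> p q T X XX"
   and fa: "\<alpha> > 1 / 3 --> (\<exists>\<delta>. 0 < \<delta> \<and> \<delta> <= 1 \<and> (2 + \<delta>) * \<alpha> > 1 \<and> ennreal (\<delta> * \<alpha>) > 1 / p \<and> Cb2_holder \<delta> f)"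
   and fb: "\<alpha> = 1 / 3 --> Cb3 f"
  have f2: "Cb2 f"
  proof (cases "\<alpha> = 1 / 3")
   case True
   with fb have "fderiv2_holder (C2_norm (fderiv f)) 1 f" by (intro Cb3_fderiv2_holder) simp
   then show ?thesis by (simp add: fderiv2_holder_def)
  next
   case False
   then show ?thesis using fa assms(2) by (auto simp: Cb2_holder_def)
  qed
  obtain Y Y' where Y: "rde_solution \<alpha> p q T X XX f y Y Y'"
   "controlled_seminorm \<alpha> p q T X Y Y' <= ennreal (M (C2_norm f) (rough_norm \<alpha> p q T X XX))"
   using M[OF Cb2_norm_le(4)[OF f2], of X XX _ f y] rp f2 by blast
  have "\<forall>Z Z'. rde_solution \<alpha> p q T X XX f y Z Z' --> (\<forall>t\<in>{0..T}. Z t = Y t \<and> Z' t = Y' t)"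
   using uniq[OF rp fa fb Y(1)] by blast
  with Y show "\<exists>Y Y'. rde_solution \<alpha> p q T X XX f y Y Y' \<and>
     (\<forall>Z Z'. rde_solution \<alpha> p q T X XX f y Z Z' --> (\<forall>t\<in>{0..T}. Z t = Y t \<and> Z' t = Y' t)) \<and>
     controlled_seminorm \<alpha> p q T X Y Y' <= ennreal (M (C2_norm f) (rough_norm \<alpha> p q T X XX))" by blast
 qed
qed

end
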